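(* Let $d\ge2$, $0<p<\infty$, $0<q\le\infty$, $s\in\mathbb{R}$, and let $A\in\{B,F\}$. (i) Suppose $(s,p,q)\in U(A)$ and $s<\frac dp$. Then there exists a constant $c$ such that $$|x|^{\frac dp-s}|f(x)|\le c\,\|f|RA^s_{p,q}(\mathbb{R}^d)\|$$ holds for all $0<|x|\le1$ and all $f\in RA^s_{p,q}(\mathbb{R}^d)$. (ii) Let $\sigma_p(d)<s<d/p$. There exists a constant $c>0$ such that for all $x\in\mathbb{R}^d$ with $0<|x|<1$ there exists a smooth radial function $f\in RA^s_{p,q}(\mathbb{R}^d)$ with $\|f|RA^s_{p,q}(\mathbb{R}^d)\|=1$ and $$|x|^{\frac dp-s}|f(x)|\ge c.$$
   Context: For $0<p<\infty$, $0<q\le\infty$: $(s,p,q)\in U(B)$ means that either $s>1/p$, or $s=1/p$ and $q\le1$; $(s,p,q)\in U(F)$ means that either $s>1/p$, or $s=1/p$ and $p\le1$. $\sigma_p(d)=d\max(0,\frac1p-1)$. Besov and Lizorkin-Triebel spaces on $\mathbb{R}^n$: let $\varphi_0\in C_0^\infty(\mathbb{R}^n)$ with $\varphi_0(\xi)=1$ for $|\xi|\le1$ and $\varphi_0(\xi)=0$ for $|\xi|\ge 3/2$, and $\varphi_j(\xi)=\varphi_0(2^{-j}\xi)-\varphi_0(2^{-j+1}\xi)$, $j\ge1$. Then $B^s_{p,q}(\mathbb{R}^n)$ consists of all $f\in\mathcal{S}'(\mathbb{R}^n)$ with $\big(\sum_{j\ge0}2^{jsq}\|\mathcal{F}^{-1}[\varphi_j\mathcal{F}f]\|_{L_p}^q\big)^{1/q}<\infty$,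 and, for $p<\infty$, $F^s_{p,q}(\mathbb{R}^n)$ of all $f\in\mathcal{S}'(\mathbb{R}^n)$ with $\big\|\big(\sum_{j\ge0}2^{jsq}|\mathcal{F}^{-1}[\varphi_j\mathcal{F}f](\cdot)|^q\big)^{1/q}\big\|_{L_p}<\infty$ (usual modification for $q=\infty$); these expressions are the quasi-norms. $A^s_{p,q}$ stands for $B^s_{p,q}$ or $F^s_{p,q}$. $RE$ denotes the subset of radial elements of $E$ (invariant under all orthogonal transformations), with the quasi-norm of $E$. If $(s,p,q)\in U(A)$, every $f\in RA^s_{p,q}(\mathbb{R}^d)$ agrees on $\mathbb{R}^d\setminus\{0\}$ with a continuous function, and $f(x)$, $x\ne0$, denotes the value of this continuous representative. *)

theory Defs
  imports "HOL-Analysis.Analysis"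
begin

definition partial_deriv :: "'a::euclidean_space \<Rightarrow> ('a \<Rightarrow> complex) \<Rightarrow> 'a \<Rightarrow> complex" where
  "partial_deriv b f x = frechet_derivative f (at x) b"

text \<open>Multi-indices are represented by lists of basis vectors.\<close>

abbreviation multi_indices :: "'a::euclidean_space list set" where
  "multi_indices \<equiv> lists Basis"

definition iter_deriv :: "'a::euclidean_space list \<Rightarrow> ('a \<Rightarrow> complex) \<Rightarrow> 'a \<Rightarrow> complex" where
  "iter_deriv bs f = foldr partial_deriv bs f"

definition smooth_fun :: "('a::euclidean_space \<Rightarrow> complex) \<Rightarrow> bool" where
  "smooth_fun f \<longleftrightarrow> (\<forall>bs\<in>multi_indices. \<forall>x. iter_deriv bs f differentiable (at x))"

definition test_funs :: "'a::euclidean_space set \<Rightarrow> ('a \<Rightarrow> complex) set" where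
  "test_funs U = {\<phi>. smooth_fun \<phi> \<and> (\<exists>K. compact K \<and> K \<subseteq> U \<and> (\<forall>x. x \<notin> K \<longrightarrow> \<phi> x = 0))}"

definition schwartz :: "('a::euclidean_space \<Rightarrow> complex) set" where
  "schwartz = {\<phi>. smooth_fun \<phi> \<and>
     (\<forall>k. \<forall>bs\<in>multi_indices. bdd_above (range (\<lambda>x. (1 + norm x) ^ k * norm (iter_deriv bs \<phi> x))))}"

definition schwartz_seminorm :: "nat \<Rightarrow> 'a::euclidean_space list \<Rightarrow> ('a \<Rightarrow> complex) \<Rightarrow> real" where
  "schwartz_seminorm k bs \<phi> = (SUP x. (1 + norm x) ^ k * norm (iter_deriv bs \<phi> x))"

text \<open>
  Complex-linear functionals on the Schwartz space that are continuous for the topology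
  generated by the seminorms above. Functionals are made extensional, so that two tempered
  distributions are equal iff they agree on all Schwartz functions.
\<close>

definition tempered_dists :: "(('a::euclidean_space \<Rightarrow> complex) \<Rightarrow> complex) set" where
  "tempered_dists = {T. T \<in> extensional schwartz \<and>
     (\<forall>\<phi>\<in>schwartz. \<forall>\<psi>\<in>schwartz. T (\<lambda>x. \<phi> x + \<psi> x) = T \<phi> + T \<psi>) \<and>
     (\<forall>c. \<forall>\<phi>\<in>schwartz. T (\<lambda>x. c * \<phi> x) = c * T \<phi>) \<and>
     (\<exists>C N. \<forall>\<phi>\<in>schwartz. norm (T \<phi>) \<le>
        C * (\<Sum>bs | bs \<in> multi_indices \<and> length bs \<le> N. schwartz_seminorm N bs \<phi>))}"

definition fourier :: "('a::euclidean_space \<Rightarrow> complex) \<Rightarrow> 'a \<Rightarrow> complex" where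
  "fourier \<phi> \<xi> = of_real ((2 * pi) powr (- real DIM('a) / 2)) *
     (LINT x|lborel. exp (- \<i> * of_real (x \<bullet> \<xi>)) * \<phi> x)"

definition inv_fourier :: "('a::euclidean_space \<Rightarrow> complex) \<Rightarrow> 'a \<Rightarrow> complex" where
  "inv_fourier \<phi> x = of_real ((2 * pi) powr (- real DIM('a) / 2)) *
     (LINT \<xi>|lborel. exp (\<i> * of_real (x \<bullet> \<xi>)) * \<phi> \<xi>)"

definition dist_fourier ::
  "(('a::euclidean_space \<Rightarrow> complex) \<Rightarrow> complex) \<Rightarrow> (('a \<Rightarrow> complex) \<Rightarrow> complex)" where
  "dist_fourier T = (\<lambda>\<phi>\<in>schwartz. T (fourier \<phi>))"

definition dist_inv_fourier ::
  "(('a::euclidean_space \<Rightarrow> complex) \<Rightarrow> complex) \<Rightarrow> (('a \<Rightarrow> complex) \<Rightarrow> complex)" where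
  "dist_inv_fourier T = (\<lambda>\<phi>\<in>schwartz. T (inv_fourier \<phi>))"

definition dist_mult ::
  "('a::euclidean_space \<Rightarrow> complex) \<Rightarrow> (('a \<Rightarrow> complex) \<Rightarrow> complex) \<Rightarrow> (('a \<Rightarrow> complex) \<Rightarrow> complex)" where
  "dist_mult m T = (\<lambda>\<phi>\<in>schwartz. T (\<lambda>x. m x * \<phi> x))"

definition agrees_on ::
  "'a::euclidean_space set \<Rightarrow> (('a \<Rightarrow> complex) \<Rightarrow> complex) \<Rightarrow> ('a \<Rightarrow> complex) \<Rightarrow> bool" where
  "agrees_on U T g \<longleftrightarrow> (\<forall>\<phi>\<in>test_funs U.
     integrable lborel (\<lambda>x. g x * \<phi> x) \<and> T \<phi> = (LINT x|lborel. g x * \<phi> x))"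

text \<open>
  The continuous representative of \<open>T\<close> on the open set \<open>U\<close>. If there is one, its values on \<open>U\<close>
  are unique; its values outside \<open>U\<close> are irrelevant.
\<close>

definition cont_rep ::
  "'a::euclidean_space set \<Rightarrow> (('a \<Rightarrow> complex) \<Rightarrow> complex) \<Rightarrow> 'a \<Rightarrow> complex" where
  "cont_rep U T = (SOME g. continuous_on U g \<and> agrees_on U T g)"

definition radial_fun :: "('a::euclidean_space \<Rightarrow> complex) \<Rightarrow> bool" where
  "radial_fun g \<longleftrightarrow> (\<forall>h. orthogonal_transformation h \<longrightarrow> g \<circ> h = g)"

definition radial_dist :: "(('a::euclidean_space \<Rightarrow> complex) \<Rightarrow> complex) \<Rightarrow> bool" where
  "radial_dist T \<longleftrightarrow> (\<forall>h. orthogonal_transformation h \<longrightarrow> (\<forall>\<phi>\<in>schwartz. T (\<phi> \<circ> h) = T \<phi>))"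

definition ennpow :: "ennreal \<Rightarrow> real \<Rightarrow> ennreal" where
  "ennpow t r = (if t = \<infinity> then \<infinity> else ennreal (enn2real t powr r))" \<comment> \<open>only used for \<open>r > 0\<close>\<close>

definition lq_norm :: "ennreal \<Rightarrow> (nat \<Rightarrow> ennreal) \<Rightarrow> ennreal" where
  "lq_norm q a =
     (if q = \<infinity> then (SUP j. a j)
      else ennpow (\<Sum>j. ennpow (a j) (enn2real q)) (1 / enn2real q))"

definition Lp_norm :: "real \<Rightarrow> ('a::euclidean_space \<Rightarrow> ennreal) \<Rightarrow> ennreal" where
  "Lp_norm p u = ennpow (\<integral>\<^sup>+x. ennpow (u x) p \<partial>lborel) (1 / p)"

definition lp_generator :: "('a::euclidean_space \<Rightarrow> complex) \<Rightarrow> bool" where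
  "lp_generator \<phi>0 \<longleftrightarrow> \<phi>0 \<in> test_funs UNIV \<and>
     (\<forall>\<xi>. norm \<xi> \<le> 1 \<longrightarrow> \<phi>0 \<xi> = 1) \<and> (\<forall>\<xi>. norm \<xi> \<ge> 3/2 \<longrightarrow> \<phi>0 \<xi> = 0)"

definition dyadic :: "('a::euclidean_space \<Rightarrow> complex) \<Rightarrow> nat \<Rightarrow> 'a \<Rightarrow> complex" where
  "dyadic \<phi>0 j \<xi> =
     (if j = 0 then \<phi>0 \<xi>
      else \<phi>0 ((2 powr (- real j)) *\<^sub>R \<xi>) - \<phi>0 ((2 powr (- real j + 1)) *\<^sub>R \<xi>))"

text \<open>
  The frequency block is a tempered distribution with compactly supported Fourier transform, hence
  a smooth function by Paley-Wiener-Schwartz; \<open>cont_rep UNIV\<close> passes to that function.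
\<close>

definition freq_block ::
  "('a::euclidean_space \<Rightarrow> complex) \<Rightarrow> nat \<Rightarrow> (('a \<Rightarrow> complex) \<Rightarrow> complex) \<Rightarrow> 'a \<Rightarrow> complex" where
  "freq_block \<phi>0 j f = cont_rep UNIV (dist_inv_fourier (dist_mult (dyadic \<phi>0 j) (dist_fourier f)))"

datatype space_scale = Besov | Triebel

fun A_enorm :: "('a::euclidean_space \<Rightarrow> complex) \<Rightarrow> space_scale \<Rightarrow> real \<Rightarrow> real \<Rightarrow> ennreal
    \<Rightarrow> (('a \<Rightarrow> complex) \<Rightarrow> complex) \<Rightarrow> ennreal" where
  "A_enorm \<phi>0 Besov s p q f =
     lq_norm q (\<lambda>j. ennreal (2 powr (real j * s)) * Lp_norm p (\<lambda>x. ennreal (norm (freq_block \<phi>0 j f x))))"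
| "A_enorm \<phi>0 Triebel s p q f =
     Lp_norm p (\<lambda>x. lq_norm q (\<lambda>j. ennreal (2 powr (real j * s)) * ennreal (norm (freq_block \<phi>0 j f x))))"

definition A_space :: "('a::euclidean_space \<Rightarrow> complex) \<Rightarrow> space_scale \<Rightarrow> real \<Rightarrow> real \<Rightarrow> ennreal
    \<Rightarrow> (('a \<Rightarrow> complex) \<Rightarrow> complex) set" where
  "A_space \<phi>0 A s p q = {f \<in> tempered_dists. A_enorm \<phi>0 A s p q f < \<infinity>}"

definition A_norm :: "('a::euclidean_space \<Rightarrow> complex) \<Rightarrow> space_scale \<Rightarrow> real \<Rightarrow> real \<Rightarrow> ennreal
    \<Rightarrow> (('a \<Rightarrow> complex) \<Rightarrow> complex) \<Rightarrow> real" where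
  "A_norm \<phi>0 A s p q f = enn2real (A_enorm \<phi>0 A s p q f)"

definition RA_space :: "('a::euclidean_space \<Rightarrow> complex) \<Rightarrow> space_scale \<Rightarrow> real \<Rightarrow> real \<Rightarrow> ennreal
    \<Rightarrow> (('a \<Rightarrow> complex) \<Rightarrow> complex) set" where
  "RA_space \<phi>0 A s p q = {f \<in> A_space \<phi>0 A s p q. radial_dist f}"

fun U_cond :: "space_scale \<Rightarrow> real \<Rightarrow> real \<Rightarrow> ennreal \<Rightarrow> bool" where
  "U_cond Besov s p q \<longleftrightarrow> s > 1 / p \<or> (s = 1 / p \<and> q \<le> 1)"
| "U_cond Triebel s p q \<longleftrightarrow> s > 1 / p \<or> (s = 1 / p \<and> p \<le> 1)"

definition sigma_p :: "real \<Rightarrow> nat \<Rightarrow> real" where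
  "sigma_p p d = real d * max 0 (1 / p - 1)"

end

theory Submission
  imports Defs "HOL-Probability.Probability"
begin

text \<open>
  Upper bound. Write \<open>f\<^sub>j\<close> for the frequency blocks of a radial \<open>f\<close>. By radiality, \<open>f\<^sub>j(x)\<close> is a
  pairing with kernels centred at any point \<open>z\<close> of the sphere \<open>|z| = |x|\<close>, so Peetre's maximal
  inequality bounds \<open>|f\<^sub>j(x)|\<^bsup>u\<^esup>\<close> by averages of \<open>|f\<^sub>i|\<^bsup>u\<^esup>\<close>, \<open>|i - j| \<le> 1\<close>, at scale \<open>2\<^bsup>-j\<^esup>\<close> around \<open>z\<close>.
  Averaging over \<open>2\<^bsup>-j\<^esup>\<close>-separated points \<open>z\<close> gives a kernel whose density is at most that of a
  shell of width \<open>2\<^bsup>-j\<^esup>\<close>. Hoelder's inequality then bounds \<open>f\<^sub>j(x)\<close> by the \<open>L\<^sub>p\<close> norms of the \<open>f\<^sub>i\<close>, and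
  the bounds are summed over \<open>j\<close>. In the Triebel case with \<open>s = 1/p\<close> and \<open>p \<le> 1\<close> one takes
  \<open>u = p/2\<close>, puts \<open>H = sup\<^sub>i 2\<^bsup>i/2\<^esup> |f\<^sub>i|\<^bsup>p/2\<^esup>\<close>, so that \<open>H\<close> is in \<open>L\<^sub>2\<close>, and sums the squares of the pairings of
  \<open>H\<close> with the kernels by almost orthogonality.

  Lower bound. The extremal functions are normalised Gaussians of width \<open>|x|\<close>. Each of their
  blocks is controlled by a Fourier decay estimate that is uniform in the width.
\<close>
subsection \<open>Schwartz functions\<close>

text \<open>Averaging over about \<open>(2^j r)^(d-1)\<close> points of the sphere of radius
  \<open>r\<close> improves the bound for a block from \<open>2^(jd/p)\<close> to
  \<open>(2^j r^(1-d))^(1/p)\<close> as soon as \<open>2^j r >= 1\<close>. Against the factor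
  \<open>2^(-js)\<close> low frequencies are summable because \<open>s < d/p\<close>, high ones
  because \<open>s > 1/p\<close>, and both sums are of size \<open>r^(s-d/p)\<close>. At
  \<open>s = 1/p\<close> the high frequencies no longer decay, and summability must come from the
  quasi-norm. Obstacles: for \<open>p < 1\<close> the blocks can only be compared through powers
  \<open>u <= p\<close>; Peetre's absorption divides by a supremum that must first be shown finite;
  the generator need not be radial, so rotations mix neighbouring blocks. Bounds for the series
  concern the continuous representative only after uniform convergence away from the origin; at the
  Triebel endpoint no numerical majorant is at hand, and a truncation of \<open>H\<close> takes its
  place. For a Gaussian of width \<open>1/r\<close> the weighted block norms with
  \<open>2^j < r\<close> behave like \<open>(2^j/r)^(s+d-d/p)\<close>; \<open>sigma_p\<close> makes
  this exponent positive.\<close>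

lemma one_plus_norm_le:
  fixes x y :: "'a::real_normed_vector"
  shows "1 + norm x \<le> (1 + norm y) * (1 + norm (x - y))"
proof -
  have "norm x \<le> norm y + norm (x - y)" by (metis norm_triangle_sub add.commute)
  moreover have "0 \<le> norm y * norm (x - y)" by simp
  ultimately show ?thesis unfolding distrib_left distrib_right by linarith
qed

lemma one_plus_norm_power_le:
  fixes x y :: "'a::real_normed_vector"
  shows "(1 + norm x) ^ k \<le> (1 + norm y) ^ k * (1 + norm (x - y)) ^ k"
  by (metis one_plus_norm_le power_mono power_mult_distrib add_nonneg_nonneg norm_ge_zero zero_le_one)

lemma partial_derivI: "(f has_derivative f') (at x) \<Longrightarrow> partial_deriv b f x = f' b"
  unfolding partial_deriv_def using frechet_derivative_at by metis

lemma iter_deriv_simps [simp]: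
  "iter_deriv [] f = f"
  "iter_deriv (b # bs) f = partial_deriv b (iter_deriv bs f)"
  "iter_deriv (bs @ [b]) f = iter_deriv bs (partial_deriv b f)"
  by (auto simp: iter_deriv_def)

section \<open>Rapid decay and a coinduction principle for Schwartz functions\<close>

definition rapid :: "('a::euclidean_space \<Rightarrow> complex) \<Rightarrow> bool" where
  "rapid f \<longleftrightarrow> (\<forall>k. \<exists>C. \<forall>x. (1 + norm x) ^ k * norm (f x) \<le> C)"

lemma rapidI: "(\<And>k. \<exists>C. \<forall>x. (1 + norm x) ^ k * norm (f x) \<le> C) \<Longrightarrow> rapid f"
  by (simp add: rapid_def)

lemma rapidE:
  assumes "rapid f"
  obtains C where "C > 0" "\<And>x. (1 + norm x) ^ k * norm (f x) \<le> C"
proof -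
  obtain C where "\<And>x. (1 + norm x) ^ k * norm (f x) \<le> C"
    using assms unfolding rapid_def by blast
  then show ?thesis
    by (intro that[of "max C 1"]) (auto simp: le_max_iff_disj)
qed

lemma rapid_add:
  assumes "rapid f" "rapid g" shows "rapid (\<lambda>x. f x + g x)"
proof (rule rapidI)
  fix k
  obtain C D where C: "\<And>x. (1 + norm x) ^ k * norm (f x) \<le> C"
    and D: "\<And>x. (1 + norm x) ^ k * norm (g x) \<le> D"
    using rapidE[OF assms(1)] rapidE[OF assms(2)] by metis
  have "(1 + norm x) ^ k * norm (f x + g x) \<le> C + D" for x
  proof -
    have "(1 + norm x) ^ k * norm (f x + g x) \<le> (1 + norm x) ^ k * (norm (f x) + norm (g x))"
      by (intro mult_left_mono norm_triangle_ineq) auto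
    also have "\<dots> \<le> C + D" using C[of x] D[of x] by (simp add: algebra_simps)
    finally show ?thesis .
  qed
  then show "\<exists>C. \<forall>x. (1 + norm x) ^ k * norm (f x + g x) \<le> C" by blast
qed

lemma rapid_mult:
  assumes "rapid f" "rapid g" shows "rapid (\<lambda>x. f x * g x)"
proof (rule rapidI)
  fix k
  obtain C D where CD: "D > 0" "C > 0" "\<And>x. (1 + norm x) ^ k * norm (f x) \<le> C"
    "\<And>x. (1 + norm x) ^ 0 * norm (g x) \<le> D"
    using rapidE[OF assms(1)] rapidE[OF assms(2)] by metis
  have "(1 + norm x) ^ k * norm (f x * g x) \<le> C * D" for x
    using mult_mono[OF CD(3)[of x] CD(4)[of x]] CD by (simp add: norm_mult)
  then show "\<exists>C. \<forall>x. (1 + norm x) ^ k * norm (f x * g x) \<le> C" by blast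
qed

lemma rapid_bounded_mult:
  assumes "rapid f" "\<And>x. norm (g x) \<le> B * (1 + norm x) ^ N"
  shows "rapid (\<lambda>x. g x * f x)"
proof (rule rapidI)
  fix k
  obtain C where C: "C > 0" "\<And>x. (1 + norm x) ^ (k + N) * norm (f x) \<le> C"
    using rapidE[OF assms(1)] by metis
  have B: "B \<ge> 0" using assms(2)[of 0] norm_ge_zero[of "g 0"] by (simp del: norm_ge_zero)
  have "(1 + norm x) ^ k * norm (g x * f x) \<le> B * C" for x
  proof -
    have "(1 + norm x) ^ k * norm (g x * f x) \<le> (1 + norm x) ^ k * (B * (1 + norm x) ^ N * norm (f x))"
      unfolding norm_mult by (intro mult_left_mono mult_right_mono assms) auto
    also have "\<dots> = B * ((1 + norm x) ^ (k + N) * norm (f x))" by (simp add: power_add)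
    also have "\<dots> \<le> B * C" by (intro mult_left_mono C B)
    finally show ?thesis .
  qed
  then show "\<exists>C. \<forall>x. (1 + norm x) ^ k * norm (g x * f x) \<le> C" by blast
qed

inductive_set sum_closure :: "('a \<Rightarrow> complex) set \<Rightarrow> ('a \<Rightarrow> complex) set" for X where
  base: "f \<in> X \<Longrightarrow> f \<in> sum_closure X"
| add: "f \<in> sum_closure X \<Longrightarrow> g \<in> sum_closure X \<Longrightarrow> (\<lambda>x. f x + g x) \<in> sum_closure X"

text \<open>By induction on the multi-index every iterated derivative of a member stays in the sum
  closure, and differentiability and decay pass to sums. Closure properties of the Schwartz space
  then need only first derivatives; no Leibniz formula or chain rule of higher order
  appears.\<close>

lemma schwartz_coinduct:
  fixes X :: "('a::euclidean_space \<Rightarrow> complex) set"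
  assumes diff: "\<And>f x. f \<in> X \<Longrightarrow> f differentiable at x"
    and deriv: "\<And>f b. f \<in> X \<Longrightarrow> b \<in> Basis \<Longrightarrow> partial_deriv b f \<in> sum_closure X"
    and rapid: "\<And>f. f \<in> X \<Longrightarrow> rapid f"
  shows "X \<subseteq> schwartz"
proof
  fix f assume f: "f \<in> X"
  have 1: "g differentiable at x" if "g \<in> sum_closure X" for g x
    using that by induction (auto intro: diff)
  have 2: "partial_deriv b g \<in> sum_closure X" if "g \<in> sum_closure X" "b \<in> Basis" for g b
    using that
  proof induction
    case (add f g)
    have "partial_deriv b (\<lambda>x. f x + g x) = (\<lambda>x. partial_deriv b f x + partial_deriv b g x)"
    proof
      fix x
      have "(f has_derivative frechet_derivative f (at x)) (at x)"
        "(g has_derivative frechet_derivative g (at x)) (at x)"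
        using 1 add frechet_derivative_works by blast+
      then have "((\<lambda>x. f x + g x) has_derivative
          (\<lambda>h. frechet_derivative f (at x) h + frechet_derivative g (at x) h)) (at x)"
        by (rule has_derivative_add)
      from partial_derivI[OF this]
      show "partial_deriv b (\<lambda>x. f x + g x) x = partial_deriv b f x + partial_deriv b g x"
        by (simp add: partial_deriv_def)
    qed
    then show ?case using add by (auto intro: sum_closure.add)
  qed (use deriv in auto)
  have 3: "rapid g" if "g \<in> sum_closure X" for g
    using that by induction (auto intro: rapid rapid_add)
  have 4: "iter_deriv bs f \<in> sum_closure X" if "bs \<in> multi_indices" for bs
    using that by (induction bs) (auto intro: f sum_closure.base 2)
  have "bdd_above (range (\<lambda>x. (1 + norm x) ^ k * norm (iter_deriv bs f x)))" if "bs \<in> multi_indices" for k bs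
    using 3[OF 4[OF that]] unfolding rapid_def bdd_above_def by blast
  then show "f \<in> schwartz"
    using 1[OF 4] by (auto simp: schwartz_def smooth_fun_def)
qed

lemma schwartz_differentiable: "f \<in> schwartz \<Longrightarrow> f differentiable at x"
  unfolding schwartz_def smooth_fun_def by (force dest: bspec[where x = "[]"])

lemma schwartz_rapid: "f \<in> schwartz \<Longrightarrow> rapid f"
  unfolding schwartz_def rapid_def by (force simp: bdd_above_def dest: bspec[where x = "[]"])

lemma schwartz_partial_deriv:
  fixes f :: "'a::euclidean_space \<Rightarrow> complex"
  assumes "f \<in> schwartz" "b \<in> Basis"
  shows "partial_deriv b f \<in> schwartz"
proof -
  have *: "bs @ [b] \<in> multi_indices" if "bs \<in> multi_indices" for bs using that assms by auto
  show ?thesis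
    unfolding schwartz_def smooth_fun_def mem_Collect_eq
  proof (intro conjI ballI allI)
    fix bs assume "bs \<in> (multi_indices :: 'a list set)"
    note bs = *[OF this]
    show "iter_deriv bs (partial_deriv b f) differentiable at x" for x
      using assms(1) bs unfolding schwartz_def smooth_fun_def by (auto dest!: bspec[where x = "bs @ [b]"])
    show "bdd_above (range (\<lambda>x. (1 + norm x) ^ k * cmod (iter_deriv bs (partial_deriv b f) x)))" for k
      using assms(1) bs unfolding schwartz_def by (auto dest!: spec[where x = k] bspec[where x = "bs @ [b]"])
  qed
qed

lemma schwartz_iter_deriv:
  assumes "f \<in> schwartz" "bs \<in> multi_indices"
  shows "iter_deriv bs f \<in> schwartz"
  using assms(2,1) by (induction bs) (auto intro: schwartz_partial_deriv)

lemma has_derivative_partials: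
  fixes f :: "'a::euclidean_space \<Rightarrow> complex"
  assumes "f differentiable at x"
  shows "(f has_derivative (\<lambda>h. \<Sum>b\<in>Basis. (h \<bullet> b) *\<^sub>R partial_deriv b f x)) (at x)"
proof -
  let ?D = "frechet_derivative f (at x)"
  have D: "(f has_derivative ?D) (at x)" using assms frechet_derivative_works by blast
  then have lin: "linear ?D" using has_derivative_linear by blast
  have "?D h = (\<Sum>b\<in>Basis. (h \<bullet> b) *\<^sub>R partial_deriv b f x)" for h
  proof -
    have "?D h = ?D (\<Sum>b\<in>Basis. (h \<bullet> b) *\<^sub>R b)" by (simp add: euclidean_representation)
    also have "\<dots> = (\<Sum>b\<in>Basis. (h \<bullet> b) *\<^sub>R ?D b)"
      using lin by (simp add: linear_sum linear_scale)
    finally show ?thesis by (simp add: partial_deriv_def)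
  qed
  then have "?D = (\<lambda>h. \<Sum>b\<in>Basis. (h \<bullet> b) *\<^sub>R partial_deriv b f x)" by (rule ext)
  with D show ?thesis by simp
qed

lemmas schwartz_has_derivative = has_derivative_partials[OF schwartz_differentiable]

lemma schwartz_continuous: "f \<in> schwartz \<Longrightarrow> continuous_on A f"
  by (meson schwartz_differentiable continuous_at_imp_continuous_on differentiable_imp_continuous_within)

lemma schwartz_measurable [measurable_dest]: "f \<in> schwartz \<Longrightarrow> f \<in> borel_measurable borel"
  by (intro borel_measurable_continuous_onI schwartz_continuous)

section \<open>Closure properties of the Schwartz space\<close>

lemma schwartz_add:
  fixes f g :: "'a::euclidean_space \<Rightarrow> complex"
  assumes "f \<in> schwartz" "g \<in> schwartz"
  shows "(\<lambda>x. f x + g x) \<in> schwartz"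
    and "b \<in> Basis \<Longrightarrow> partial_deriv b (\<lambda>x. f x + g x) = (\<lambda>x. partial_deriv b f x + partial_deriv b g x)"
proof -
  have P: "partial_deriv b (\<lambda>x. f x + g x) = (\<lambda>x. partial_deriv b f x + partial_deriv b g x)"
    if "f \<in> schwartz" "g \<in> schwartz" "b \<in> Basis" for b and f g :: "'a \<Rightarrow> complex"
  proof
    fix x
    show "partial_deriv b (\<lambda>x. f x + g x) x = partial_deriv b f x + partial_deriv b g x"
      using partial_derivI[OF has_derivative_add[OF schwartz_has_derivative schwartz_has_derivative], OF that(1,2), of b x] that(3)
      by (simp add: inner_Basis if_distrib[of "\<lambda>x. x *\<^sub>R _"] cong: if_cong)
  qed
  then show "b \<in> Basis \<Longrightarrow> partial_deriv b (\<lambda>x. f x + g x) = (\<lambda>x. partial_deriv b f x + partial_deriv b g x)"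
    using assms by blast
  have "{(\<lambda>x. f x + g x :: complex) | f g :: 'a \<Rightarrow> complex. f \<in> schwartz \<and> g \<in> schwartz} \<subseteq> schwartz" (is "?X \<subseteq> _")
  proof (rule schwartz_coinduct)
    fix h b assume h: "h \<in> ?X" and b: "b \<in> (Basis :: 'a set)"
    then obtain f g :: "'a \<Rightarrow> complex" where fg: "f \<in> schwartz" "g \<in> schwartz" "h = (\<lambda>x. f x + g x)"
      by blast
    show "partial_deriv b h \<in> sum_closure ?X"
      unfolding fg(3) P[OF fg(1,2) b]
      using schwartz_partial_deriv[OF fg(1) b] schwartz_partial_deriv[OF fg(2) b]
      by (intro sum_closure.base) blast
  qed (auto intro!: differentiable_add intro: schwartz_differentiable rapid_add schwartz_rapid)
  then show "(\<lambda>x. f x + g x) \<in> schwartz" using assms by blast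
qed

lemma schwartz_mult_partial:
  fixes f g :: "'a::euclidean_space \<Rightarrow> complex"
  assumes "f differentiable at x" "g differentiable at x" "b \<in> Basis"
  shows "partial_deriv b (\<lambda>x. f x * g x) x = f x * partial_deriv b g x + partial_deriv b f x * g x"
  using partial_derivI[OF has_derivative_mult[OF has_derivative_partials has_derivative_partials],
      OF assms(1,2), of b] assms(3)
  by (simp add: inner_Basis if_distrib[of "\<lambda>x. x *\<^sub>R _"] cong: if_cong)

lemma schwartz_mult:
  fixes f g :: "'a::euclidean_space \<Rightarrow> complex"
  assumes "f \<in> schwartz" "g \<in> schwartz"
  shows "(\<lambda>x. f x * g x) \<in> schwartz"
proof -
  have "{(\<lambda>x. f x * g x :: complex) | f g :: 'a \<Rightarrow> complex. f \<in> schwartz \<and> g \<in> schwartz} \<subseteq> schwartz" (is "?X \<subseteq> _")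
  proof (rule schwartz_coinduct)
    fix h b assume h: "h \<in> ?X" and b: "b \<in> (Basis :: 'a set)"
    then obtain f g :: "'a \<Rightarrow> complex" where fg: "f \<in> schwartz" "g \<in> schwartz" "h = (\<lambda>x. f x * g x)"
      by blast
    have "partial_deriv b h = (\<lambda>x. f x * partial_deriv b g x + partial_deriv b f x * g x)"
      using fg b schwartz_mult_partial schwartz_differentiable by blast
    moreover have "(\<lambda>x. f x * partial_deriv b g x) \<in> ?X" "(\<lambda>x. partial_deriv b f x * g x) \<in> ?X"
      using fg schwartz_partial_deriv b by blast+
    ultimately show "partial_deriv b h \<in> sum_closure ?X"
      by (simp only: sum_closure.base sum_closure.add)
  qed (auto intro: schwartz_differentiable rapid_mult schwartz_rapid differentiable_mult)
  then show ?thesis using assms by blast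
qed

lemma schwartz_cmult:
  fixes f :: "'a::euclidean_space \<Rightarrow> complex"
  assumes "f \<in> schwartz"
  shows "(\<lambda>x. c * f x) \<in> schwartz"
    and "b \<in> Basis \<Longrightarrow> partial_deriv b (\<lambda>x. c * f x) = (\<lambda>x. c * partial_deriv b f x)"
proof -
  have P: "partial_deriv b (\<lambda>x. c * f x) = (\<lambda>x. c * partial_deriv b f x)"
    if "f \<in> schwartz" "b \<in> Basis" for b and f :: "'a \<Rightarrow> complex"
  proof
    fix x
    show "partial_deriv b (\<lambda>x. c * f x) x = c * partial_deriv b f x"
      using partial_derivI[OF has_derivative_mult[OF has_derivative_const[of c] schwartz_has_derivative[OF that(1)]], of b x] that(2)
      by (simp add: inner_Basis if_distrib[of "\<lambda>x. x *\<^sub>R _"] cong: if_cong)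
  qed
  then show "b \<in> Basis \<Longrightarrow> partial_deriv b (\<lambda>x. c * f x) = (\<lambda>x. c * partial_deriv b f x)"
    using assms by blast
  have "{(\<lambda>x. c * f x) | f :: 'a \<Rightarrow> complex. f \<in> schwartz} \<subseteq> schwartz" (is "?X \<subseteq> _")
  proof (rule schwartz_coinduct)
    fix h b assume h: "h \<in> ?X" and b: "b \<in> (Basis :: 'a set)"
    then obtain f :: "'a \<Rightarrow> complex" where fg: "f \<in> schwartz" "h = (\<lambda>x. c * f x)"
      by blast
    show "partial_deriv b h \<in> sum_closure ?X"
      unfolding fg(2) P[OF fg(1) b] using schwartz_partial_deriv[OF fg(1) b]
      by (intro sum_closure.base) blast
  next
    fix h assume "h \<in> ?X"
    then obtain f :: "'a \<Rightarrow> complex" where fg: "f \<in> schwartz" "h = (\<lambda>x. c * f x)"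
      by blast
    show "rapid h" unfolding fg(2)
      by (rule rapid_bounded_mult[OF schwartz_rapid[OF fg(1)], of _ "norm c" 0]) auto
  qed (auto intro: schwartz_differentiable)
  then show "(\<lambda>x. c * f x) \<in> schwartz" using assms by blast
qed

lemma schwartz_zero: "(\<lambda>x::'a::euclidean_space. 0) \<in> schwartz"
proof -
  have "{(\<lambda>x::'a. 0::complex)} \<subseteq> schwartz"
    by (rule schwartz_coinduct)
      (auto simp: rapid_def intro!: sum_closure.base ext partial_derivI[OF has_derivative_const])
  then show ?thesis by blast
qed

lemma schwartz_diff:
  assumes "f \<in> schwartz" "g \<in> schwartz"
  shows "(\<lambda>x. f x - g x) \<in> schwartz"
  using schwartz_add(1)[OF assms(1) schwartz_cmult(1)[OF assms(2), of "-1"]] by simp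

lemma schwartz_sum:
  "(\<And>i. i \<in> I \<Longrightarrow> f i \<in> schwartz) \<Longrightarrow> (\<lambda>x. \<Sum>i\<in>I. f i x) \<in> schwartz"
  by (induction I rule: infinite_finite_induct) (auto intro: schwartz_zero schwartz_add)

lemma schwartz_iter_deriv_add:
  assumes "bs \<in> multi_indices" "f \<in> schwartz" "g \<in> schwartz"
  shows "iter_deriv bs (\<lambda>x. f x + g x) = (\<lambda>x. iter_deriv bs f x + iter_deriv bs g x)"
  using assms(1) by (induction bs) (auto simp: schwartz_add(2) schwartz_iter_deriv assms)

lemma schwartz_iter_deriv_cmult:
  assumes "bs \<in> multi_indices" "f \<in> schwartz"
  shows "iter_deriv bs (\<lambda>x. c * f x) = (\<lambda>x. c * iter_deriv bs f x)"
  using assms(1) by (induction bs) (auto simp: schwartz_cmult(2) schwartz_iter_deriv assms)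

lemma schwartz_iter_deriv_diff:
  assumes "bs \<in> multi_indices" "f \<in> schwartz" "g \<in> schwartz"
  shows "iter_deriv bs (\<lambda>x. f x - g x) = (\<lambda>x. iter_deriv bs f x - iter_deriv bs g x)"
  using schwartz_iter_deriv_add[OF assms(1,2) schwartz_cmult(1)[OF assms(3), of "-1"]]
    schwartz_iter_deriv_cmult[OF assms(1,3), of "-1"] by simp

lemma schwartz_coord_mult:
  fixes f :: "'a::euclidean_space \<Rightarrow> complex"
  assumes "f \<in> schwartz"
  shows "(\<lambda>x. of_real (x \<bullet> v) * f x) \<in> schwartz"
proof -
  have P: "partial_deriv b (\<lambda>x. of_real (x \<bullet> v) * f x) = (\<lambda>x. of_real (x \<bullet> v) * partial_deriv b f x + of_real (b \<bullet> v) * f x)"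
    if f: "f \<in> schwartz" and b: "b \<in> Basis" for f :: "'a \<Rightarrow> complex" and b
  proof
    fix x
    have "((\<lambda>x. complex_of_real (x \<bullet> v)) has_derivative (\<lambda>x. of_real (x \<bullet> v))) (at x)"
      by (auto intro!: derivative_eq_intros)
    from partial_derivI[OF has_derivative_mult[OF this schwartz_has_derivative[OF f]], of b] b
    show "partial_deriv b (\<lambda>x. of_real (x \<bullet> v) * f x) x = of_real (x \<bullet> v) * partial_deriv b f x + of_real (b \<bullet> v) * f x"
      by (simp add: inner_Basis if_distrib[of "\<lambda>x. x *\<^sub>R _"] cong: if_cong)
  qed
  \<comment> \<open>The Schwartz functions are adjoined to the family because differentiating the
    coordinate leaves a multiple of \<open>f\<close> without the coordinate factor.\<close>
  have "{(\<lambda>x. of_real (x \<bullet> v) * f x) | f :: 'a \<Rightarrow> complex. f \<in> schwartz} \<union> schwartz \<subseteq> schwartz" (is "?X \<union> _ \<subseteq> _")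
  proof (rule schwartz_coinduct)
    fix h b assume h: "h \<in> ?X \<union> schwartz" and b: "b \<in> (Basis :: 'a set)"
    show "partial_deriv b h \<in> sum_closure (?X \<union> schwartz)"
    proof (cases "h \<in> schwartz")
      case False
      with h obtain f :: "'a \<Rightarrow> complex" where f: "f \<in> schwartz" "h = (\<lambda>x. of_real (x \<bullet> v) * f x)"
        by blast
      have "(\<lambda>x. of_real (x \<bullet> v) * partial_deriv b f x) \<in> ?X" "(\<lambda>x. of_real (b \<bullet> v) * f x) \<in> schwartz"
        using schwartz_partial_deriv[OF f(1) b] schwartz_cmult[OF f(1)] by blast+
      then show ?thesis unfolding f(2) P[OF f(1) b] by (intro sum_closure.add sum_closure.base UnI1 UnI2)
    qed (auto intro: sum_closure.base schwartz_partial_deriv b)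
  next
    fix h assume h: "h \<in> ?X \<union> schwartz"
    show "rapid h"
    proof (cases "h \<in> schwartz")
      case False
      with h obtain f :: "'a \<Rightarrow> complex" where f: "f \<in> schwartz" "h = (\<lambda>x. of_real (x \<bullet> v) * f x)"
        by blast
      have "\<bar>x \<bullet> v\<bar> \<le> norm v * (1 + norm x) ^ 1" for x
        using Cauchy_Schwarz_ineq2[of x v] by (simp add: algebra_simps)
          (metis add.commute add_increasing2 norm_ge_zero)
      then show ?thesis unfolding f(2)
        by (intro rapid_bounded_mult[OF schwartz_rapid[OF f(1)], of _ "norm v" 1]) simp
    qed (auto intro: schwartz_rapid)
  next
    fix h x assume "h \<in> ?X \<union> schwartz"
    then show "h differentiable at x"
      by (auto intro: schwartz_differentiable intro!: differentiable_mult[OF bounded_linear_imp_differentiable]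
          bounded_linear_compose[OF bounded_linear_of_real bounded_linear_inner_left])
  qed
  then show ?thesis using assms by blast
qed

text \<open>The lower bound on \<open>norm (L x)\<close> carries decay of \<open>f\<close> over to
  the composition. Reflections, dilations and orthogonal maps are all instances.\<close>

lemma schwartz_linear_image:
  fixes L :: "'a::euclidean_space \<Rightarrow> 'a"
  assumes L: "bounded_linear L" and c: "c > 0" "\<And>x. c * norm x \<le> norm (L x)" and f: "f \<in> schwartz"
  shows "(\<lambda>x. f (L x)) \<in> schwartz"
proof -
  have "{(\<lambda>x. f (L x)) | f :: 'a \<Rightarrow> complex. f \<in> schwartz} \<subseteq> schwartz" (is "?X \<subseteq> _")
  proof (rule schwartz_coinduct)
    fix h b assume h: "h \<in> ?X" and b: "b \<in> (Basis :: 'a set)"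
    then obtain f :: "'a \<Rightarrow> complex" where f: "f \<in> schwartz" "h = (\<lambda>x. f (L x))"
      by blast
    have "partial_deriv b h = (\<lambda>x. (\<lambda>y. \<Sum>b'\<in>Basis. of_real (L b \<bullet> b') * partial_deriv b' f y) (L x))"
    proof
      fix x
      have "(L has_derivative L) (at x)" using L bounded_linear_imp_has_derivative by blast
      from partial_derivI[OF has_derivative_compose[OF this schwartz_has_derivative[OF f(1)]], of b]
      show "partial_deriv b h x = (\<lambda>y. \<Sum>b'\<in>Basis. of_real (L b \<bullet> b') * partial_deriv b' f y) (L x)"
        unfolding f(2) by (simp add: scaleR_conv_of_real)
    qed
    moreover have "(\<lambda>y. \<Sum>b'\<in>Basis. of_real (L b \<bullet> b') * partial_deriv b' f y) \<in> schwartz"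
      by (intro schwartz_sum schwartz_cmult schwartz_partial_deriv f)
    ultimately have "\<exists>g\<in>schwartz. partial_deriv b h = (\<lambda>x. g (L x))" by (rule rev_bexI[rotated])
    then have "partial_deriv b h \<in> ?X" by blast
    then show "partial_deriv b h \<in> sum_closure ?X" by (rule sum_closure.base)
  next
    fix h assume "h \<in> ?X"
    then obtain f :: "'a \<Rightarrow> complex" where f: "f \<in> schwartz" "h = (\<lambda>x. f (L x))"
      by blast
    show "rapid h"
    proof (rule rapidI)
      fix k
      obtain C where C: "C > 0" "\<And>x. (1 + norm x) ^ k * norm (f x) \<le> C"
        using rapidE[OF schwartz_rapid[OF f(1)]] by metis
      have "(1 + norm x) ^ k * norm (h x) \<le> (1 + 1 / c) ^ k * C" for x
      proof -
        have "1 + norm x \<le> (1 + 1 / c) * (1 + norm (L x))"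
        proof -
          have "norm x \<le> norm (L x) / c" using c by (simp add: field_simps)
          then have "1 + norm x \<le> 1 + norm (L x) / c" by simp
          also have "\<dots> \<le> (1 + 1 / c) * (1 + norm (L x))" using c by (simp add: field_simps)
          finally show ?thesis .
        qed
        then have "(1 + norm x) ^ k \<le> (1 + 1 / c) ^ k * (1 + norm (L x)) ^ k"
          by (metis add_nonneg_nonneg norm_ge_zero power_mono power_mult_distrib zero_le_one)
        then have "(1 + norm x) ^ k * norm (h x) \<le> ((1 + 1 / c) ^ k * (1 + norm (L x)) ^ k) * norm (f (L x))"
          unfolding f(2) by (intro mult_right_mono) auto
        also have "\<dots> = (1 + 1 / c) ^ k * ((1 + norm (L x)) ^ k * norm (f (L x)))" by simp
        also have "\<dots> \<le> (1 + 1 / c) ^ k * C" using c by (intro mult_left_mono C) auto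
        finally show ?thesis .
      qed
      then show "\<exists>C. \<forall>x. (1 + norm x) ^ k * norm (h x) \<le> C" by blast
    qed
  next
    fix h x assume "h \<in> ?X"
    then obtain f :: "'a \<Rightarrow> complex" where f: "f \<in> schwartz" "h = (\<lambda>x. f (L x))"
      by blast
    show "h differentiable at x" unfolding f(2)
      using differentiable_chain_at[OF bounded_linear_imp_differentiable[OF L] schwartz_differentiable[OF f(1)]]
      by (simp add: o_def)
  qed
  then show ?thesis using assms by blast
qed

lemma schwartz_translate:
  fixes f :: "'a::euclidean_space \<Rightarrow> complex"
  assumes "f \<in> schwartz"
  shows "(\<lambda>x. f (x - v)) \<in> schwartz"
    and "b \<in> Basis \<Longrightarrow> partial_deriv b (\<lambda>x. f (x - v)) = (\<lambda>x. partial_deriv b f (x - v))"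
proof -
  have P: "partial_deriv b (\<lambda>x. f (x - v)) = (\<lambda>x. partial_deriv b f (x - v))"
    if "f \<in> schwartz" "b \<in> Basis" for b and f :: "'a \<Rightarrow> complex"
  proof
    fix x
    have "((\<lambda>x. x - v) has_derivative (\<lambda>h. h)) (at x)" by (auto intro!: derivative_eq_intros)
    from partial_derivI[OF has_derivative_compose[OF this schwartz_has_derivative[OF that(1)]], of b] that(2)
    show "partial_deriv b (\<lambda>x. f (x - v)) x = partial_deriv b f (x - v)"
      by (simp add: inner_Basis if_distrib[of "\<lambda>x. x *\<^sub>R _"] cong: if_cong)
  qed
  then show "b \<in> Basis \<Longrightarrow> partial_deriv b (\<lambda>x. f (x - v)) = (\<lambda>x. partial_deriv b f (x - v))"
    using assms by blast
  have "{(\<lambda>x. f (x - v)) | f :: 'a \<Rightarrow> complex. f \<in> schwartz} \<subseteq> schwartz" (is "?X \<subseteq> _")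
  proof (rule schwartz_coinduct)
    fix h b assume h: "h \<in> ?X" and b: "b \<in> (Basis :: 'a set)"
    then obtain f :: "'a \<Rightarrow> complex" where fg: "f \<in> schwartz" "h = (\<lambda>x. f (x - v))"
      by blast
    show "partial_deriv b h \<in> sum_closure ?X"
      unfolding fg(2) P[OF fg(1) b] using schwartz_partial_deriv[OF fg(1) b]
      by (intro sum_closure.base) blast
  next
    fix h assume "h \<in> ?X"
    then obtain f :: "'a \<Rightarrow> complex" where fg: "f \<in> schwartz" "h = (\<lambda>x. f (x - v))"
      by blast
    show "rapid h"
    proof (rule rapidI)
      fix k
      obtain C where C: "C > 0" "\<And>x. (1 + norm x) ^ k * norm (f x) \<le> C"
        using rapidE[OF schwartz_rapid[OF fg(1)]] by metis
      have "(1 + norm x) ^ k * norm (h x) \<le> (1 + norm v) ^ k * C" for x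
      proof -
        have "(1 + norm x) ^ k * norm (f (x - v)) \<le> ((1 + norm v) ^ k * (1 + norm (x - v)) ^ k) * norm (f (x - v))"
          by (intro mult_right_mono one_plus_norm_power_le) auto
        also have "\<dots> = (1 + norm v) ^ k * ((1 + norm (x - v)) ^ k * norm (f (x - v)))" by simp
        also have "\<dots> \<le> (1 + norm v) ^ k * C" by (intro mult_left_mono C) auto
        finally show ?thesis using fg by simp
      qed
      then show "\<exists>C. \<forall>x. (1 + norm x) ^ k * norm (h x) \<le> C" by blast
    qed
  next
    fix h x assume "h \<in> ?X"
    then obtain f :: "'a \<Rightarrow> complex" where f: "f \<in> schwartz" "h = (\<lambda>x. f (x - v))"
      by blast
    have "(\<lambda>x. x - v) differentiable at x" by simp
    from differentiable_chain_at[OF this schwartz_differentiable[OF f(1)]]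
    show "h differentiable at x" unfolding f(2) by (simp add: o_def)
  qed
  then show "(\<lambda>x. f (x - v)) \<in> schwartz" using assms by blast
qed

lemma schwartz_iter_deriv_translate:
  assumes "bs \<in> multi_indices" "f \<in> schwartz"
  shows "iter_deriv bs (\<lambda>x. f (x - v)) = (\<lambda>x. iter_deriv bs f (x - v))"
  using assms(1) by (induction bs) (auto simp: schwartz_translate(2) schwartz_iter_deriv assms)

section \<open>Test functions and a weighted mean value estimate\<close>

lemma test_funs_partial_deriv:
  fixes f :: "'a::euclidean_space \<Rightarrow> complex"
  assumes "f \<in> test_funs UNIV" "b \<in> Basis"
  shows "partial_deriv b f \<in> test_funs UNIV"
proof -
  obtain K where K: "compact K" "\<And>x. x \<notin> K \<Longrightarrow> f x = 0" and sm: "smooth_fun f"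
    using assms unfolding test_funs_def by blast
  have "partial_deriv b f x = 0" if "x \<notin> K" for x
  proof -
    have "(f has_derivative (\<lambda>h. 0)) (at x)"
      by (rule has_derivative_transform_within_open[where s = "- K" and f = "\<lambda>_. 0"])
        (use K that in \<open>auto simp: compact_imp_closed open_Compl\<close>)
    from partial_derivI[OF this] show ?thesis .
  qed
  moreover have "smooth_fun (partial_deriv b f)"
    unfolding smooth_fun_def
  proof (intro ballI allI)
    fix bs x assume "bs \<in> (multi_indices :: 'a list set)"
    then have "bs @ [b] \<in> multi_indices" using assms(2) by auto
    then show "iter_deriv bs (partial_deriv b f) differentiable at x"
      using sm unfolding smooth_fun_def by (metis iter_deriv_simps(3))
  qed
  ultimately show ?thesis using K(1) unfolding test_funs_def by blast
qed

lemma test_funs_subset_schwartz: "test_funs (U :: 'a::euclidean_space set) \<subseteq> schwartz"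
proof -
  have "test_funs UNIV \<subseteq> (schwartz :: ('a \<Rightarrow> complex) set)"
  proof (rule schwartz_coinduct)
    show D: "f differentiable at x" if "f \<in> test_funs UNIV" for f :: "'a \<Rightarrow> complex" and x
      using that unfolding test_funs_def smooth_fun_def by (force dest: bspec[where x = "[]"])
    fix f :: "'a \<Rightarrow> complex" assume f: "f \<in> test_funs UNIV"
    show "partial_deriv b f \<in> sum_closure (test_funs UNIV)" if "b \<in> Basis" for b
      using test_funs_partial_deriv[OF f that] by (rule sum_closure.base)
    obtain K where K: "compact K" "\<And>x. x \<notin> K \<Longrightarrow> f x = 0"
      using f unfolding test_funs_def by blast
    show "rapid f"
    proof (rule rapidI)
      fix k
      have "continuous_on K f" using D[OF f] 
        by (meson continuous_at_imp_continuous_on differentiable_imp_continuous_within)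
      then have "continuous_on K (\<lambda>x. (1 + norm x) ^ k * norm (f x))" by (intro continuous_intros)
      then have "bounded ((\<lambda>x. (1 + norm x) ^ k * norm (f x)) ` K)"
        using K(1) compact_continuous_image compact_imp_bounded by blast
      then obtain C where C: "\<And>x. x \<in> K \<Longrightarrow> norm ((1 + norm x) ^ k * norm (f x)) \<le> C"
        unfolding bounded_iff by blast
      have "(1 + norm x) ^ k * norm (f x) \<le> max C 0" for x
        using C[of x] K(2)[of x] by (cases "x \<in> K") (auto simp: le_max_iff_disj)
      then show "\<exists>C. \<forall>x. (1 + norm x) ^ k * norm (f x) \<le> C" by blast
    qed
  qed
  then show ?thesis unfolding test_funs_def by blast
qed

text \<open>A mean value inequality that keeps the decay weight. It dominates difference quotients
  by an integrable function and later controls translations in all Schwartz seminorms.\<close>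

lemma rapid_has_derivative_diff_bound:
  fixes f :: "'a::euclidean_space \<Rightarrow> complex"
  assumes "f \<in> schwartz"
  obtains C where "C > 0" "\<And>x v. (1 + norm x) ^ k * norm (f (x + v) - f x) \<le> C * norm v * (1 + norm v) ^ k"
proof -
  have "\<exists>C. \<forall>b\<in>Basis. C b > 0 \<and> (\<forall>x. (1 + norm x) ^ k * norm (partial_deriv b f x) \<le> C b)"
    by (rule bchoice) (metis rapidE[OF schwartz_rapid[OF schwartz_partial_deriv[OF assms]]])
  then obtain C where C: "\<And>b. b \<in> Basis \<Longrightarrow> C b > 0"
    "\<And>b x. b \<in> Basis \<Longrightarrow> (1 + norm x) ^ k * norm (partial_deriv b f x) \<le> C b" by metis
  show ?thesis
  proof (rule that[of "sum C Basis"])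
    show "sum C Basis > 0" using C by (intro sum_pos) auto
    fix x v :: 'a
    \<comment> \<open>Lipschitz constant on the ball of radius \<open>norm v\<close> around
      \<open>x\<close>: moving the decay weight from an intermediate point to \<open>x\<close> costs
      the factor \<open>(1 + norm v) ^ k\<close>.\<close>
    define B where "B = sum C Basis * (1 + norm v) ^ k / (1 + norm x) ^ k"
    have "norm (f (x + v) - f x) \<le> B * norm ((x + v) - x)"
    proof (rule differentiable_bound[of "cball x (norm v)"])
      fix y assume y: "y \<in> cball x (norm v)"
      show "(f has_derivative (\<lambda>h. \<Sum>b\<in>Basis. (h \<bullet> b) *\<^sub>R partial_deriv b f y)) (at y within cball x (norm v))"
        using schwartz_has_derivative[OF assms] has_derivative_at_withinI by blast
      show "onorm (\<lambda>h. \<Sum>b\<in>Basis. (h \<bullet> b) *\<^sub>R partial_deriv b f y) \<le> B"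
      proof (rule onorm_le)
        fix h
        have *: "norm (partial_deriv b f y) \<le> C b * (1 + norm v) ^ k / (1 + norm x) ^ k" if b: "b \<in> Basis" for b
        proof -
          have "norm (x - y) \<le> norm v" using y by (simp add: dist_norm)
          then have "(1 + norm (x - y)) ^ k \<le> (1 + norm v) ^ k" by (intro power_mono) auto
          then have "(1 + norm x) ^ k \<le> (1 + norm y) ^ k * (1 + norm v) ^ k"
            using one_plus_norm_power_le[of x k y]
            by (smt (verit) mult_left_mono norm_ge_zero zero_le_power)
          then have "(1 + norm x) ^ k * norm (partial_deriv b f y) \<le> (1 + norm y) ^ k * (1 + norm v) ^ k * norm (partial_deriv b f y)"
            by (intro mult_right_mono) auto
          also have "\<dots> = (1 + norm v) ^ k * ((1 + norm y) ^ k * norm (partial_deriv b f y))" by simp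
          also have "\<dots> \<le> (1 + norm v) ^ k * C b" by (intro mult_left_mono C b) auto
          finally show ?thesis by (simp add: field_simps zero_less_power add_pos_nonneg)
        qed
        have "norm (\<Sum>b\<in>Basis. (h \<bullet> b) *\<^sub>R partial_deriv b f y) \<le> (\<Sum>b\<in>Basis. norm h * (C b * (1 + norm v) ^ k / (1 + norm x) ^ k))"
          by (intro sum_norm_le) (unfold norm_scaleR real_norm_def, intro mult_mono * Basis_le_norm, auto)
        also have "\<dots> = B * norm h" unfolding B_def by (simp add: sum_distrib_left sum_distrib_right sum_divide_distrib mult_ac)
        finally show "norm (\<Sum>b\<in>Basis. (h \<bullet> b) *\<^sub>R partial_deriv b f y) \<le> B * norm h" .
      qed
    qed (auto simp: dist_norm)
    then show "(1 + norm x) ^ k * norm (f (x + v) - f x) \<le> sum C Basis * norm v * (1 + norm v) ^ k"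
      unfolding B_def by (simp add: field_simps zero_less_power add_pos_nonneg)
  qed
qed

subsection \<open>The Fourier transform\<close>

lemma nn_integral_lborel_affine:
  fixes f :: "'a::euclidean_space \<Rightarrow> ennreal"
  assumes [measurable]: "f \<in> borel_measurable borel" and c: "c \<noteq> 0"
  shows "(\<integral>\<^sup>+x. f x \<partial>lborel) = ennreal (\<bar>c\<bar> ^ DIM('a)) * (\<integral>\<^sup>+x. f (t + c *\<^sub>R x) \<partial>lborel)"
  by (subst lborel_affine[OF c, of t])
     (simp add: nn_integral_density nn_integral_distr nn_integral_cmult)

lemma integrable_lborel_affine:
  fixes f :: "'a::euclidean_space \<Rightarrow> 'b::{banach, second_countable_topology}"
  assumes f: "integrable lborel f" and c: "c \<noteq> 0"
  shows "integrable lborel (\<lambda>x. f (t + c *\<^sub>R x))"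
proof -
  have [measurable]: "f \<in> borel_measurable borel" using f by auto
  have "(\<integral>\<^sup>+x. norm (f x) \<partial>lborel) < \<infinity>" using f unfolding integrable_iff_bounded by auto
  then have "ennreal (\<bar>c\<bar> ^ DIM('a)) * (\<integral>\<^sup>+x. norm (f (t + c *\<^sub>R x)) \<partial>lborel) < \<infinity>"
    by (subst (asm) nn_integral_lborel_affine[OF _ c, of _ t]) auto
  then have "(\<integral>\<^sup>+x. norm (f (t + c *\<^sub>R x)) \<partial>lborel) < \<infinity>"
    using c by (auto simp: ennreal_mult_less_top)
  then show ?thesis by (intro integrableI_bounded) auto
qed

lemma integral_lborel_affine:
  fixes f :: "'a::euclidean_space \<Rightarrow> complex"
  assumes [measurable]: "f \<in> borel_measurable borel" and c: "c \<noteq> 0"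
  shows "(LINT x|lborel. f x) = of_real (\<bar>c\<bar> ^ DIM('a)) * (LINT x|lborel. f (t + c *\<^sub>R x))"
  by (subst lborel_affine[OF c, of t])
     (simp add: integral_density integral_distr scaleR_conv_of_real)

lemma integral_lborel_translate:
  fixes f :: "'a::euclidean_space \<Rightarrow> complex"
  assumes [measurable]: "f \<in> borel_measurable borel"
  shows "(LINT x|lborel. f (x + v)) = (LINT x|lborel. f x)"
  using integral_lborel_affine[of f 1 v] assms by (simp add: add.commute)

text \<open>One fixed integrable radial majorant serves throughout, as dominating function for
  rapidly decaying integrands and, dilated by \<open>2^j\<close>, as averaging kernel in the maximal
  inequality.\<close>

definition weight :: "'a::euclidean_space \<Rightarrow> real" where
  "weight x = 1 / (1 + norm x) ^ (2 * DIM('a))"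

lemma weight_pos: "weight x > 0" and weight_nonneg [simp]: "weight x \<ge> 0"
  by (auto simp: weight_def add_pos_nonneg)

lemma weight_measurable [measurable]: "weight \<in> borel_measurable borel"
  unfolding weight_def[abs_def] by measurable

text \<open>The exponent \<open>2 * DIM('a)\<close> provides one factor
  \<open>(1 + norm x)^2\<close> for each coordinate. Each of these dominates
  \<open>1 + (x \<bullet> b)^2\<close>, so that the weight lies below a product of integrable
  functions of one variable.\<close>

lemma integrable_weight: "integrable lborel (weight :: 'a::euclidean_space \<Rightarrow> real)"
proof -
  have "integrable lborel (\<lambda>x::real. inverse (1 + x\<^sup>2))"
    using integrable_inverse_1_plus_square by (simp add: set_integrable_def)
  then have "nn_integral lborel (\<lambda>x::real. ennreal (norm (inverse (1 + x\<^sup>2)))) < \<infinity>"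
    unfolding integrable_iff_bounded by blast
  moreover have "0 \<le> 1 + x\<^sup>2" for x :: real by (simp add: add_nonneg_nonneg)
  ultimately have 1: "nn_integral lborel (\<lambda>x::real. ennreal (inverse (1 + x\<^sup>2))) < \<infinity>"
    by simp
  have le: "weight x \<le> (\<Prod>b\<in>Basis. inverse (1 + (x \<bullet> b)\<^sup>2))" for x :: 'a
  proof -
    have "(\<Prod>b\<in>Basis. 1 + (x \<bullet> b)\<^sup>2) \<le> (\<Prod>b\<in>(Basis::'a set). (1 + norm x)\<^sup>2)"
    proof (intro prod_mono conjI)
      fix b :: 'a assume b: "b \<in> Basis"
      have "(x \<bullet> b)\<^sup>2 \<le> (norm x)\<^sup>2" using Basis_le_norm[OF b, of x] by (metis abs_norm_cancel abs_le_square_iff)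
      then show "1 + (x \<bullet> b)\<^sup>2 \<le> (1 + norm x)\<^sup>2" by (simp add: power2_sum add_increasing2)
    qed (simp add: add_nonneg_nonneg)
    also have "\<dots> = (1 + norm x) ^ (2 * DIM('a))" by (simp add: power_mult)
    finally have "inverse ((1 + norm x) ^ (2 * DIM('a))) \<le> inverse (\<Prod>b\<in>Basis. 1 + (x \<bullet> b)\<^sup>2)"
      by (intro le_imp_inverse_le prod_pos) (auto intro: add_pos_nonneg)
    then show ?thesis by (simp add: weight_def inverse_eq_divide prod_dividef)
  qed
  have "(\<integral>\<^sup>+x. ennreal (norm (weight x)) \<partial>(lborel :: 'a measure)) \<le> (\<integral>\<^sup>+x. (\<Prod>b\<in>Basis. ennreal (inverse (1 + (x \<bullet> b)\<^sup>2))) \<partial>(lborel :: 'a measure))"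
    using le by (intro nn_integral_mono) (auto simp: prod_ennreal intro!: ennreal_leI add_nonneg_nonneg)
  also have "\<dots> = (\<Prod>b\<in>(Basis::'a set). (\<integral>\<^sup>+x. ennreal (inverse (1 + x\<^sup>2)) \<partial>lborel))"
    by (intro nn_integral_lborel_prod) auto
  also have "\<dots> < \<infinity>" using 1 by (simp add: power_less_top_ennreal)
  finally show ?thesis by (intro integrableI_bounded) auto
qed

lemma rapid_le_weight:
  assumes "rapid (f :: 'a::euclidean_space \<Rightarrow> complex)"
  obtains C where "C > 0" "\<And>x. (1 + norm x) ^ N * norm (f x) \<le> C * weight x"
proof -
  obtain C where C: "C > 0" "\<And>x. (1 + norm x) ^ (2 * DIM('a) + N) * norm (f x) \<le> C"
    using rapidE[OF assms] by metis
  then show ?thesis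
    by (intro that[of C]) (auto simp: weight_def field_simps power_add add_pos_nonneg zero_less_power)
qed

lemma integrable_rapid_weighted:
  fixes f :: "'a::euclidean_space \<Rightarrow> complex"
  assumes "rapid f" and [measurable]: "f \<in> borel_measurable borel"
  shows "integrable lborel (\<lambda>x. (1 + norm x) ^ N * norm (f x))"
proof -
  obtain C where C: "C > 0" "\<And>x. (1 + norm x) ^ N * norm (f x) \<le> C * weight x"
    using rapid_le_weight[OF assms(1)] by metis
  show ?thesis
    by (rule Bochner_Integration.integrable_bound[of _ "\<lambda>x. C * weight x"])
      (use C integrable_weight in \<open>auto simp: abs_mult\<close>)
qed

lemma integrable_rapid:
  fixes f :: "'a::euclidean_space \<Rightarrow> complex"
  assumes "rapid f" "f \<in> borel_measurable borel"
  shows "integrable lborel f"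
  using integrable_rapid_weighted[OF assms, of 0] assms(2) by (simp add: integrable_norm_iff)

lemma schwartz_integrable: "f \<in> schwartz \<Longrightarrow> integrable lborel f"
  by (intro integrable_rapid schwartz_rapid schwartz_measurable)

section \<open>Derivatives and coordinate factors under the Fourier transform\<close>

definition fourier_const :: "'a::euclidean_space itself \<Rightarrow> real" where
  "fourier_const _ = (2 * pi) powr (- real DIM('a) / 2)"

lemma fourier_const_pos: "fourier_const a > 0"
  by (simp add: fourier_const_def)

lemma fourier_altdef:
  "fourier \<phi> \<xi> = of_real (fourier_const TYPE('a)) * (LINT x|lborel. exp (- \<i> * of_real (x \<bullet> \<xi>)) * \<phi> x)"
  for \<phi> :: "'a::euclidean_space \<Rightarrow> complex"
  by (simp add: fourier_def fourier_const_def)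

lemma inv_fourier_eq: "inv_fourier \<phi> \<xi> = fourier \<phi> (- \<xi>)"
  by (simp add: fourier_def inv_fourier_def inner_commute)

lemma integrable_exp_mult:
  fixes f :: "'a::euclidean_space \<Rightarrow> complex"
  assumes "integrable lborel f"
  shows "integrable lborel (\<lambda>x. exp (- \<i> * of_real (x \<bullet> \<xi>)) * f x)"
  by (rule Bochner_Integration.integrable_bound[OF assms]) (use assms in \<open>auto simp: norm_mult\<close>)

lemma fourier_add:
  "integrable lborel f \<Longrightarrow> integrable lborel g \<Longrightarrow> fourier (\<lambda>x. f x + g x) \<xi> = fourier f \<xi> + fourier g \<xi>"
  unfolding fourier_altdef by (simp add: distrib_left integrable_exp_mult[simplified])

lemma fourier_cmult: "fourier (\<lambda>x. c * f x) \<xi> = c * fourier f \<xi>"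
  unfolding fourier_altdef by (simp add: mult.left_commute[of _ c])

lemma fourier_diff:
  "integrable lborel f \<Longrightarrow> integrable lborel g \<Longrightarrow> fourier (\<lambda>x. f x - g x) \<xi> = fourier f \<xi> - fourier g \<xi>"
  unfolding fourier_altdef by (simp add: right_diff_distrib integrable_exp_mult[simplified])

lemma norm_fourier_le:
  fixes f :: "'a::euclidean_space \<Rightarrow> complex"
  shows "norm (fourier f \<xi>) \<le> fourier_const TYPE('a) * (LINT x|lborel. norm (f x))"
proof -
  have "norm (LINT x|lborel. exp (- \<i> * of_real (x \<bullet> \<xi>)) * f x) \<le> (LINT x|lborel. norm (exp (- \<i> * of_real (x \<bullet> \<xi>)) * f x))"
    by (rule integral_norm_bound)
  then show ?thesis unfolding fourier_altdef norm_mult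
    using fourier_const_pos[of "TYPE('a)"] by (simp add: mult_left_mono)
qed

lemma fourier_translate:
  fixes f :: "'a::euclidean_space \<Rightarrow> complex"
  assumes [measurable]: "f \<in> borel_measurable borel"
  shows "fourier (\<lambda>x. f (x + v)) \<xi> = exp (\<i> * of_real (v \<bullet> \<xi>)) * fourier f \<xi>"
proof -
  have "(LINT x|lborel. exp (- \<i> * of_real (x \<bullet> \<xi>)) * f (x + v))
      = (LINT x|lborel. exp (\<i> * of_real (v \<bullet> \<xi>)) * (exp (- \<i> * of_real ((x + v) \<bullet> \<xi>)) * f (x + v)))"
    by (intro Bochner_Integration.integral_cong) (auto simp: inner_add_left distrib_left mult.assoc[symmetric] simp flip: exp_add)
  also have "\<dots> = exp (\<i> * of_real (v \<bullet> \<xi>)) * (LINT x|lborel. exp (- \<i> * of_real (x \<bullet> \<xi>)) * f x)"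
    using integral_lborel_translate[of "\<lambda>x. exp (- \<i> * of_real (x \<bullet> \<xi>)) * f x" v] by simp
  finally show ?thesis unfolding fourier_altdef by simp
qed

lemma fourier_scale:
  fixes f :: "'a::euclidean_space \<Rightarrow> complex"
  assumes [measurable]: "f \<in> borel_measurable borel" and a: "a > 0"
  shows "fourier f \<xi> = of_real (a ^ DIM('a)) * fourier (\<lambda>x. f (a *\<^sub>R x)) (a *\<^sub>R \<xi>)"
  using integral_lborel_affine[of "\<lambda>x. exp (- \<i> * of_real (x \<bullet> \<xi>)) * f x" a 0] a
  unfolding fourier_altdef by simp

lemma has_derivative_quadratic:
  fixes f :: "'a::real_normed_vector \<Rightarrow> 'b::real_normed_vector"
  assumes L: "bounded_linear L" and b: "\<And>h. norm (f (x + h) - f x - L h) \<le> C * (norm h)\<^sup>2"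
  shows "(f has_derivative L) (at x)"
  unfolding has_derivative_at
proof
  have "((\<lambda>h. norm (f (x + h) - f x - L h) / norm h) \<longlongrightarrow> 0) (at 0)"
  proof (rule Lim_null_comparison)
    show "((\<lambda>h::'a. C * norm h) \<longlongrightarrow> 0) (at 0)" by (auto intro!: tendsto_eq_intros)
    show "\<forall>\<^sub>F h in at 0. norm (norm (f (x + h) - f x - L h) / norm h) \<le> C * norm h"
      using b by (auto simp: divide_simps power2_eq_square mult_ac intro!: always_eventually)
  qed
  then show "(\<lambda>h. norm (f (x + h) - f x - L h) / norm h) \<midarrow>0\<rightarrow> 0" .
qed (fact L)

lemma exp_ii_second_order:
  "norm (exp (- \<i> * of_real (t + s)) - exp (- \<i> * of_real t) - (- \<i> * of_real s) * exp (- \<i> * of_real t)) \<le> s\<^sup>2"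
proof -
  have "norm (exp (\<i> * of_real (- s)) - (\<Sum>k\<le>1. (\<i> * of_real (- s)) ^ k / fact k)) \<le> \<bar>- s\<bar> ^ Suc 1 / fact (Suc 1)"
    by (rule iexp_approx1)
  then have *: "norm (exp (- \<i> * of_real s) - 1 - (- \<i> * of_real s)) \<le> s\<^sup>2"
  proof -
    assume a: "norm (exp (\<i> * of_real (- s)) - (\<Sum>k\<le>1. (\<i> * of_real (- s)) ^ k / fact k)) \<le> \<bar>- s\<bar> ^ Suc 1 / fact (Suc 1)"
    have "(\<Sum>k\<le>1. (\<i> * complex_of_real (- s)) ^ k / fact k) = 1 + - \<i> * of_real s" by simp
    moreover have "\<bar>- s\<bar> ^ Suc 1 / fact (Suc 1) = s\<^sup>2 / 2" by (simp add: power2_eq_square)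
    moreover have "exp (- \<i> * of_real s) - 1 - (- \<i> * of_real s) = exp (\<i> * of_real (- s)) - (1 + - \<i> * of_real s)" by simp
    moreover have "s\<^sup>2 / 2 \<le> s\<^sup>2" by simp
    ultimately show ?thesis using a by (smt (verit))
  qed
  have "exp (- \<i> * of_real (t + s)) - exp (- \<i> * of_real t) - (- \<i> * of_real s) * exp (- \<i> * of_real t)
     = exp (- \<i> * of_real t) * (exp (- \<i> * of_real s) - 1 - (- \<i> * of_real s))"
    by (simp add: algebra_simps exp_add exp_diff) (simp add: exp_minus divide_inverse)
  with * show ?thesis by (simp add: norm_mult)
qed

text \<open>The second-order remainder of the exponential is at most
  \<open>(x \<bullet> h)^2\<close>, which is integrable against the rapidly decaying
  \<open>g\<close>. This yields a quadratic remainder for the integral directly, and no limit has to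
  be moved under the integral sign.\<close>

lemma fourier_has_derivative:
  fixes g :: "'a::euclidean_space \<Rightarrow> complex"
  assumes g: "rapid g" and [measurable]: "g \<in> borel_measurable borel"
  shows "(fourier g has_derivative (\<lambda>h. \<Sum>b\<in>Basis. (h \<bullet> b) *\<^sub>R fourier (\<lambda>x. - \<i> * of_real (x \<bullet> b) * g x) \<xi>)) (at \<xi>)"
proof (rule has_derivative_quadratic)
  show "bounded_linear (\<lambda>h. \<Sum>b\<in>Basis. (h \<bullet> b) *\<^sub>R fourier (\<lambda>x. - \<i> * of_real (x \<bullet> b) * g x) \<xi>)"
    by (intro bounded_linear_sum bounded_linear_compose[OF bounded_linear_scaleR_left bounded_linear_inner_left])
  fix h :: 'a
  have intb: "integrable lborel (\<lambda>x. - \<i> * of_real (x \<bullet> b) * g x)" for b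
  proof (rule integrable_rapid[OF rapid_bounded_mult[OF g, of _ "norm b" 1]])
    fix x :: 'a
    show "norm (- \<i> * complex_of_real (x \<bullet> b)) \<le> norm b * (1 + norm x) ^ 1"
      using Cauchy_Schwarz_ineq2[of x b] by (simp add: norm_mult algebra_simps) (smt (verit) norm_ge_zero)
  qed measurable
  let ?E = "\<lambda>x \<xi>. exp (- \<i> * of_real (x \<bullet> \<xi>))"
  let ?c = "fourier_const TYPE('a)"
  have "(\<Sum>b\<in>Basis. (h \<bullet> b) *\<^sub>R fourier (\<lambda>x. - \<i> * of_real (x \<bullet> b) * g x) \<xi>)
      = of_real ?c * (LINT x|lborel. (\<Sum>b\<in>Basis. of_real (h \<bullet> b) * (?E x \<xi> * (- \<i> * of_real (x \<bullet> b) * g x))))"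
    unfolding fourier_altdef scaleR_conv_of_real
    by (subst Bochner_Integration.integral_sum[OF integrable_mult_right[OF integrable_exp_mult[OF intb]]])
      (simp only: integral_mult_right_zero sum_distrib_left mult.left_commute)
  also have "(\<lambda>x. (\<Sum>b\<in>Basis. of_real (h \<bullet> b) * (?E x \<xi> * (- \<i> * of_real (x \<bullet> b) * g x))))
      = (\<lambda>x. (- \<i> * of_real (x \<bullet> h)) * ?E x \<xi> * g x)"
    by (simp add: euclidean_inner[of _ h] sum_distrib_left sum_distrib_right mult_ac)
  finally have L: "(\<Sum>b\<in>Basis. (h \<bullet> b) *\<^sub>R fourier (\<lambda>x. - \<i> * of_real (x \<bullet> b) * g x) \<xi>)
      = of_real ?c * (LINT x|lborel. (- \<i> * of_real (x \<bullet> h)) * ?E x \<xi> * g x)" .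
  have ig: "integrable lborel g" by (intro integrable_rapid) (use g in auto)
  have i3: "integrable lborel (\<lambda>x. (- \<i> * of_real (x \<bullet> h)) * ?E x \<xi> * g x)"
    using integrable_exp_mult[OF intb[of h], of \<xi>] by (simp add: mult_ac)
  have "fourier g (\<xi> + h) - fourier g \<xi> - (\<Sum>b\<in>Basis. (h \<bullet> b) *\<^sub>R fourier (\<lambda>x. - \<i> * of_real (x \<bullet> b) * g x) \<xi>)
     = of_real ?c * (LINT x|lborel. ?E x (\<xi> + h) * g x - ?E x \<xi> * g x - (- \<i> * of_real (x \<bullet> h)) * ?E x \<xi> * g x)"
    unfolding fourier_altdef L[unfolded fourier_altdef]
      Bochner_Integration.integral_diff[OF Bochner_Integration.integrable_diff[OF integrable_exp_mult[OF ig] integrable_exp_mult[OF ig]] i3]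
      Bochner_Integration.integral_diff[OF integrable_exp_mult[OF ig] integrable_exp_mult[OF ig]] right_diff_distrib ..
  also have "norm \<dots> \<le> ?c * (LINT x|lborel. (norm h)\<^sup>2 * ((1 + norm x)^2 * norm (g x)))"
    unfolding norm_mult norm_of_real
  proof (intro mult_mono abs_le_iff[THEN iffD2] integral_norm_bound[THEN order_trans] integral_mono)
    show "norm (?E x (\<xi> + h) * g x - ?E x \<xi> * g x - (- \<i> * of_real (x \<bullet> h)) * ?E x \<xi> * g x) \<le> (norm h)\<^sup>2 * ((1 + norm x)^2 * norm (g x))" for x
    proof -
      have "norm (?E x (\<xi> + h) * g x - ?E x \<xi> * g x - (- \<i> * of_real (x \<bullet> h)) * ?E x \<xi> * g x)
        = norm (?E x (\<xi> + h) - ?E x \<xi> - (- \<i> * of_real (x \<bullet> h)) * ?E x \<xi>) * norm (g x)"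
        by (simp add: norm_mult[symmetric] algebra_simps)
      also have "\<dots> \<le> (x \<bullet> h)\<^sup>2 * norm (g x)"
        using exp_ii_second_order[of "x \<bullet> \<xi>" "x \<bullet> h"] by (intro mult_right_mono) (auto simp: inner_add_right)
      also have "(x \<bullet> h)\<^sup>2 \<le> (norm x * norm h)\<^sup>2"
        using Cauchy_Schwarz_ineq2[of x h] by (metis abs_le_square_iff abs_mult abs_norm_cancel)
      also have "\<dots> \<le> ((1 + norm x) * norm h)\<^sup>2" by (intro power_mono mult_right_mono) auto
      finally show ?thesis by (simp add: mult_ac power_mult_distrib mult_right_mono)
    qed
    show "integrable lborel (\<lambda>x. (norm h)\<^sup>2 * ((1 + norm x)^2 * norm (g x)))"
      by (intro integrable_mult_right integrable_rapid_weighted g) auto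
    show "integrable lborel (\<lambda>x. norm (?E x (\<xi> + h) * g x - ?E x \<xi> * g x - (- \<i> * of_real (x \<bullet> h)) * ?E x \<xi> * g x))"
      using integrable_exp_mult[OF ig] i3 by (intro integrable_norm Bochner_Integration.integrable_diff) auto
  qed (use fourier_const_pos[of "TYPE('a)"] in auto)
  finally show "norm (fourier g (\<xi> + h) - fourier g \<xi> - (\<Sum>b\<in>Basis. (h \<bullet> b) *\<^sub>R fourier (\<lambda>x. - \<i> * of_real (x \<bullet> b) * g x) \<xi>))
    \<le> ?c * (LINT x|lborel. (1 + norm x)^2 * norm (g x)) * (norm h)\<^sup>2"
    unfolding integral_mult_right_zero by (simp only: mult_ac)
qed

lemma fourier_partial_deriv:
  assumes "rapid g" "g \<in> borel_measurable borel" "b \<in> Basis"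
  shows "partial_deriv b (fourier g) \<xi> = fourier (\<lambda>x. - \<i> * of_real (x \<bullet> b) * g x) \<xi>"
  using partial_derivI[OF fourier_has_derivative[OF assms(1,2)], of b \<xi>] assms(3)
  by (simp add: inner_Basis if_distrib[of "\<lambda>x. x *\<^sub>R _"] cong: if_cong)

text \<open>Difference quotients replace integration by parts: their Fourier transforms are explicit
  by the translation rule, and the quotients converge under an integrable majorant. The two
  evaluations of the same limit give the formula.\<close>

lemma fourier_of_partial_deriv:
  fixes g :: "'a::euclidean_space \<Rightarrow> complex"
  assumes g: "g \<in> schwartz" and b: "b \<in> Basis"
  shows "fourier (partial_deriv b g) \<xi> = \<i> * of_real (b \<bullet> \<xi>) * fourier g \<xi>"
proof -
  define t where "t n = 1 / real (Suc n)" for n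
  have t: "0 < t n" "t n \<le> 1" for n by (auto simp: t_def field_simps)
  have t0: "t \<longlonglongrightarrow> 0" unfolding t_def by (rule lim_inverse_n'[THEN LIMSEQ_Suc])
  have [measurable]: "g \<in> borel_measurable borel" "partial_deriv b g \<in> borel_measurable borel"
    using schwartz_measurable g schwartz_partial_deriv[OF g b] by auto
  define q where "q n x = of_real (1 / t n) * (g (x + t n *\<^sub>R b) - g x)" for n x
  let ?K = "2 * DIM('a)"
  obtain C where C: "C > 0" "\<And>x v. (1 + norm x) ^ ?K * norm (g (x + v) - g x) \<le> C * norm v * (1 + norm v) ^ ?K"
    using rapid_has_derivative_diff_bound[OF g] by metis
  \<comment> \<open>As the step sizes are at most 1, the weight of the mean value estimate costs at
    most \<open>2 ^ ?K\<close>, uniformly in \<open>n\<close>.\<close>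
  have qb: "norm (q n x) \<le> C * 2 ^ ?K * weight x" for n x
  proof -
    have "(1 + norm x) ^ ?K * norm (g (x + t n *\<^sub>R b) - g x) \<le> C * t n * (1 + t n) ^ ?K"
      using C(2)[of x "t n *\<^sub>R b"] t[of n] b by simp
    also have "\<dots> \<le> C * t n * 2 ^ ?K" using C t[of n] by (intro mult_left_mono power_mono) auto
    finally show ?thesis using t[of n] unfolding q_def weight_def
      by (simp add: field_simps norm_mult norm_divide zero_less_power add_pos_nonneg)
  qed
  have ql: "(\<lambda>n. q n x) \<longlonglongrightarrow> partial_deriv b g x" for x
  proof -
    let ?D = "\<lambda>h. \<Sum>b\<in>Basis. (h \<bullet> b) *\<^sub>R partial_deriv b g x"
    have D: "(g has_derivative ?D) (at x)" by (rule schwartz_has_derivative[OF g])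
    have Db: "?D (s *\<^sub>R b) = of_real s * partial_deriv b g x" for s
    proof -
      have "?D (s *\<^sub>R b) = (\<Sum>b'\<in>Basis. if b = b' then of_real s * partial_deriv b' g x else 0)"
        using b by (intro sum.cong) (auto simp: inner_Basis scaleR_conv_of_real)
      then show ?thesis using b by simp
    qed
    have lim: "(\<lambda>h. norm (g (x + h) - g x - ?D h) / norm h) \<midarrow>0\<rightarrow> 0"
      using D unfolding has_derivative_at by blast
    have "filterlim (\<lambda>n. t n *\<^sub>R b) (at 0) sequentially"
      unfolding filterlim_at using t b nonzero_Basis[OF b] 
      by (auto intro!: tendsto_eq_intros t0 always_eventually simp: less_imp_neq[THEN not_sym])
    from filterlim_compose[OF lim this]
    have "(\<lambda>n. norm (g (x + t n *\<^sub>R b) - g x - ?D (t n *\<^sub>R b)) / norm (t n *\<^sub>R b)) \<longlonglongrightarrow> 0" .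
    moreover have "norm (g (x + t n *\<^sub>R b) - g x - ?D (t n *\<^sub>R b)) / norm (t n *\<^sub>R b) = norm (q n x - partial_deriv b g x)" for n
    proof -
      have "q n x - partial_deriv b g x = of_real (1 / t n) * (g (x + t n *\<^sub>R b) - g x - of_real (t n) * partial_deriv b g x)"
        using t[of n] by (simp add: q_def field_simps)
      then have "norm (q n x - partial_deriv b g x) = 1 / t n * norm (g (x + t n *\<^sub>R b) - g x - of_real (t n) * partial_deriv b g x)"
        using t[of n] by (simp only: norm_mult norm_of_real) simp
      then show ?thesis unfolding Db using t[of n] b by simp
    qed
    ultimately show ?thesis by (simp add: LIM_zero_iff tendsto_norm_zero_iff)
  qed
  have [measurable]: "q n \<in> borel_measurable borel" for n unfolding q_def[abs_def] by measurable
  have "(\<lambda>n. LINT x|lborel. exp (- \<i> * of_real (x \<bullet> \<xi>)) * q n x) \<longlonglongrightarrow> (LINT x|lborel. exp (- \<i> * of_real (x \<bullet> \<xi>)) * partial_deriv b g x)"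
  proof (rule integral_dominated_convergence[where w = "\<lambda>x. C * 2 ^ ?K * weight x"])
    show "integrable lborel (\<lambda>x::'a. C * 2 ^ ?K * weight x)" by (intro integrable_mult_right integrable_weight)
    show "AE x in lborel. (\<lambda>n. exp (- \<i> * of_real (x \<bullet> \<xi>)) * q n x) \<longlonglongrightarrow> exp (- \<i> * of_real (x \<bullet> \<xi>)) * partial_deriv b g x"
      by (intro always_eventually allI tendsto_intros ql)
  qed (use qb in \<open>auto simp: norm_mult\<close>)
  then have 1: "(\<lambda>n. fourier (q n) \<xi>) \<longlonglongrightarrow> fourier (partial_deriv b g) \<xi>"
    unfolding fourier_altdef by (intro tendsto_intros)
  have ig: "integrable lborel g" by (rule schwartz_integrable[OF g])
  have ig': "integrable lborel (\<lambda>x. g (x + v))" for v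
    using integrable_lborel_affine[OF ig, of 1 v] by (simp add: add.commute)
  have "fourier (q n) \<xi> = (exp ((\<i> * of_real (b \<bullet> \<xi>)) * of_real (t n)) - 1) / of_real (t n) * fourier g \<xi>" for n
    unfolding q_def fourier_cmult fourier_diff[OF ig' ig]
    by (subst fourier_translate) (auto simp: field_simps)
  moreover have "(\<lambda>n. (exp ((\<i> * of_real (b \<bullet> \<xi>)) * of_real (t n)) - 1) / of_real (t n)) \<longlonglongrightarrow> \<i> * of_real (b \<bullet> \<xi>)"
  proof -
    let ?z = "\<i> * complex_of_real (b \<bullet> \<xi>)"
    have "((\<lambda>w. exp (?z * w)) has_field_derivative ?z) (at 0)"
      by (auto intro!: derivative_eq_intros)
    then have lim: "((\<lambda>w. (exp (?z * w) - 1) / w) \<longlongrightarrow> ?z) (at 0)"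
      by (simp add: has_field_derivative_iff)
    have "filterlim (\<lambda>n. complex_of_real (t n)) (at 0) sequentially"
      unfolding filterlim_at using t t0 by (auto intro!: tendsto_eq_intros always_eventually simp: less_imp_neq[THEN not_sym])
    from filterlim_compose[OF lim this] show ?thesis .
  qed
  ultimately have "(\<lambda>n. fourier (q n) \<xi>) \<longlonglongrightarrow> \<i> * of_real (b \<bullet> \<xi>) * fourier g \<xi>"
    by (simp only: tendsto_mult_right)
  with 1 show ?thesis using LIMSEQ_unique by blast
qed

text \<open>Reduces decay in the norm to decay along the coordinates. Powers of a single coordinate
  correspond to repeated derivatives in one direction, so mixed derivatives never have to be
  estimated.\<close>

lemma one_plus_norm_power_le_sum:
  fixes \<xi> :: "'a::euclidean_space"
  shows "(1 + norm \<xi>) ^ k \<le> (1 + real DIM('a)) ^ k * (1 + (\<Sum>b\<in>Basis. \<bar>\<xi> \<bullet> b\<bar> ^ k))"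
proof -
  define m where "m = Max ((\<lambda>b. \<bar>\<xi> \<bullet> b\<bar>) ` Basis)"
  have m: "\<bar>\<xi> \<bullet> b\<bar> \<le> m" if "b \<in> Basis" for b unfolding m_def using that by (intro Max_ge) auto
  have "m \<in> (\<lambda>b. \<bar>\<xi> \<bullet> b\<bar>) ` Basis" unfolding m_def by (intro Max_in) auto
  then obtain b0 where b0: "b0 \<in> Basis" "m = \<bar>\<xi> \<bullet> b0\<bar>" by blast
  have "norm \<xi> \<le> (\<Sum>b\<in>Basis. \<bar>\<xi> \<bullet> b\<bar>)" by (rule norm_le_l1)
  also have "\<dots> \<le> (\<Sum>b\<in>(Basis::'a set). m)" by (intro sum_mono m)
  finally have "1 + norm \<xi> \<le> (1 + real DIM('a)) * max 1 m"
    by (simp add: distrib_right) (smt (verit) max.cobounded1 max.cobounded2 mult_left_mono of_nat_0_le_iff)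
  then have "(1 + norm \<xi>) ^ k \<le> ((1 + real DIM('a)) * max 1 m) ^ k" by (intro power_mono) auto
  also have "\<dots> = (1 + real DIM('a)) ^ k * max 1 m ^ k" by (simp add: power_mult_distrib)
  also have "max 1 m ^ k \<le> 1 + m ^ k" using b0 by (cases "m \<le> 1") (auto simp: max_def)
  also have "m ^ k \<le> (\<Sum>b\<in>Basis. \<bar>\<xi> \<bullet> b\<bar> ^ k)"
    unfolding b0(2) using b0(1) by (intro member_le_sum) auto
  finally show ?thesis by (simp add: mult_left_mono)
qed

lemma rapid_coords:
  fixes f :: "'a::euclidean_space \<Rightarrow> complex"
  assumes "\<And>k b. b \<in> Basis \<Longrightarrow> \<exists>C. \<forall>x. \<bar>x \<bullet> b\<bar> ^ k * norm (f x) \<le> C"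
  shows "rapid f"
proof (rule rapidI)
  fix k
  from assms have "\<forall>b\<in>Basis. \<exists>C. \<forall>x. \<bar>x \<bullet> b\<bar> ^ k * norm (f x) \<le> C" by blast
  then obtain C where C: "\<And>b x. b \<in> Basis \<Longrightarrow> \<bar>x \<bullet> b\<bar> ^ k * norm (f x) \<le> C b" by metis
  obtain b0 :: 'a where "b0 \<in> Basis" using nonempty_Basis by blast
  then obtain C0 where C0: "\<And>x. \<bar>x \<bullet> b0\<bar> ^ 0 * norm (f x) \<le> C0" using assms by meson
  have "(1 + norm x) ^ k * norm (f x) \<le> (1 + real DIM('a)) ^ k * (C0 + sum C Basis)" for x
  proof -
    have "(1 + norm x) ^ k * norm (f x) \<le> (1 + real DIM('a)) ^ k * (1 + (\<Sum>b\<in>Basis. \<bar>x \<bullet> b\<bar> ^ k)) * norm (f x)"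
      by (intro mult_right_mono one_plus_norm_power_le_sum) auto
    also have "\<dots> = (1 + real DIM('a)) ^ k * (norm (f x) + (\<Sum>b\<in>Basis. \<bar>x \<bullet> b\<bar> ^ k * norm (f x)))"
      by (simp add: algebra_simps sum_distrib_left sum_distrib_right)
    also have "\<dots> \<le> (1 + real DIM('a)) ^ k * (C0 + sum C Basis)"
      using C0[of x] C by (intro mult_left_mono add_mono sum_mono) auto
    finally show ?thesis .
  qed
  then show "\<exists>C. \<forall>x. (1 + norm x) ^ k * norm (f x) \<le> C" by blast
qed

text \<open>Each power of a coordinate is traded for one partial derivative of \<open>g\<close>,
  which is again a Schwartz function; the remaining transform is bounded by an integral
  norm.\<close>

lemma rapid_fourier:
  fixes g :: "'a::euclidean_space \<Rightarrow> complex"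
  assumes "g \<in> schwartz" shows "rapid (fourier g)"
proof (rule rapid_coords)
  fix k and b :: 'a assume b: "b \<in> Basis"
  show "\<exists>C. \<forall>\<xi>. \<bar>\<xi> \<bullet> b\<bar> ^ k * norm (fourier g \<xi>) \<le> C"
    using assms
  proof (induction k arbitrary: g)
    case 0
    then show ?case using norm_fourier_le by auto
  next
    case (Suc k)
    then obtain C where C: "\<And>\<xi>. \<bar>\<xi> \<bullet> b\<bar> ^ k * norm (fourier (partial_deriv b g) \<xi>) \<le> C"
      using schwartz_partial_deriv[OF _ b] by blast
    have "\<bar>\<xi> \<bullet> b\<bar> ^ Suc k * norm (fourier g \<xi>) \<le> C" for \<xi>
      using C[of \<xi>] unfolding fourier_of_partial_deriv[OF Suc.prems b]
      by (simp add: norm_mult inner_commute mult_ac)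
    then show ?case by blast
  qed
qed

lemma schwartz_fourier:
  assumes "g \<in> schwartz" shows "fourier g \<in> schwartz"
proof -
  have "fourier ` schwartz \<subseteq> (schwartz :: ('a \<Rightarrow> complex) set)"
  proof (rule schwartz_coinduct)
    fix f :: "'a \<Rightarrow> complex" assume "f \<in> fourier ` schwartz"
    then obtain g where g: "g \<in> schwartz" "f = fourier g" by blast
    show "rapid f" using rapid_fourier g by blast
    show "f differentiable at x" for x
      using fourier_has_derivative[OF schwartz_rapid[OF g(1)] schwartz_measurable[OF g(1)]]
      unfolding g(2) differentiable_def by blast
    show "partial_deriv b f \<in> sum_closure (fourier ` schwartz)" if b: "b \<in> Basis" for b
    proof -
      have "partial_deriv b f = fourier (\<lambda>x. - \<i> * (of_real (x \<bullet> b) * g x))"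
        unfolding g(2) using fourier_partial_deriv[OF schwartz_rapid[OF g(1)] schwartz_measurable[OF g(1)] b]
        by (auto simp: mult.assoc)
      then show ?thesis
        by (intro sum_closure.base) (use schwartz_cmult(1)[OF schwartz_coord_mult[OF g(1)]] in blast)
    qed
  qed
  then show ?thesis using assms by blast
qed

lemma schwartz_reflect: "f \<in> schwartz \<Longrightarrow> (\<lambda>x. f (- x)) \<in> schwartz"
  by (rule schwartz_linear_image[of uminus 1]) (auto intro: bounded_linear_minus bounded_linear_ident)

lemma schwartz_inv_fourier: "g \<in> schwartz \<Longrightarrow> inv_fourier g \<in> schwartz"
  using schwartz_reflect[OF schwartz_fourier, of g] by (simp add: inv_fourier_eq[abs_def])

text \<open>The factor that arises inside the integral when a Fourier transform is differentiated
  along \<open>bs\<close>, hence the factors \<open>- \<i>\<close>.\<close>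

definition monom :: "'a::euclidean_space list \<Rightarrow> 'a \<Rightarrow> complex" where
  "monom bs x = (\<Prod>b\<leftarrow>bs. - \<i> * of_real (x \<bullet> b))"

lemma schwartz_monom_mult: "g \<in> schwartz \<Longrightarrow> (\<lambda>x. monom bs x * g x) \<in> schwartz"
proof (induction bs)
  case (Cons b bs)
  from schwartz_cmult(1)[OF schwartz_coord_mult[OF Cons.IH[OF Cons.prems]], of "- \<i>" b]
  show ?case by (simp add: monom_def mult_ac)
qed (auto simp: monom_def)

lemma iter_deriv_fourier:
  assumes "bs \<in> multi_indices" "g \<in> schwartz"
  shows "iter_deriv bs (fourier g) = fourier (\<lambda>x. monom bs x * g x)"
  using assms(1)
proof (induction bs)
  case (Cons b bs)
  have *: "(\<lambda>x. monom bs x * g x) \<in> schwartz" by (rule schwartz_monom_mult[OF assms(2)])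
  show ?case
    using Cons fourier_partial_deriv[OF schwartz_rapid[OF *] schwartz_measurable[OF *], of b]
    by (auto simp: monom_def mult_ac)
qed (simp add: monom_def)

subsection \<open>Gaussians and Fourier inversion\<close>

definition gauss :: "'a::euclidean_space \<Rightarrow> complex" where
  "gauss x = of_real (exp (- (norm x)\<^sup>2 / 2))"

lemma gauss_measurable [measurable]: "gauss \<in> borel_measurable borel"
  unfolding gauss_def[abs_def] by measurable

lemma gauss_partial_deriv: "partial_deriv b gauss x = - of_real (x \<bullet> b) * gauss x"
  and gauss_differentiable: "gauss differentiable at x"
proof -
  have "((\<lambda>x. exp (- (x \<bullet> x) / 2)) has_derivative (\<lambda>h. - (x \<bullet> h) * exp (- (x \<bullet> x) / 2))) (at x)"
    by (auto intro!: derivative_eq_intros simp: inner_commute fun_eq_iff)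
  then have "((\<lambda>x. exp (- (norm x)\<^sup>2 / 2)) has_derivative (\<lambda>h. - (x \<bullet> h) * exp (- (norm x)\<^sup>2 / 2))) (at x)"
    by (simp only: power2_norm_eq_inner)
  from has_derivative_of_real[OF this]
  have D: "(gauss has_derivative (\<lambda>h. of_real (- (x \<bullet> h) * exp (- (norm x)\<^sup>2 / 2)))) (at x)"
    unfolding gauss_def[abs_def] .
  show "partial_deriv b gauss x = - of_real (x \<bullet> b) * gauss x"
    unfolding partial_derivI[OF D] by (simp add: gauss_def)
  show "gauss differentiable at x" using D unfolding differentiable_def by blast
qed

lemma rapid_gauss: "rapid gauss"
proof (rule rapidI)
  fix k
  have "(1 + norm x) ^ k * norm (gauss x) \<le> exp ((real k)\<^sup>2 / 2)" for x :: 'a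
  proof -
    have "(1 + norm x) ^ k \<le> exp (norm x) ^ k" by (intro power_mono) (auto simp: exp_ge_add_one_self)
    also have "\<dots> = exp (real k * norm x)" by (simp add: exp_of_nat_mult)
    finally have "(1 + norm x) ^ k * norm (gauss x) \<le> exp (real k * norm x) * exp (- (norm x)\<^sup>2 / 2)"
      by (auto simp: gauss_def intro!: mult_right_mono)
    also have "\<dots> = exp (real k * norm x - (norm x)\<^sup>2 / 2)" by (simp add: exp_add[symmetric])
    also have "real k * norm x - (norm x)\<^sup>2 / 2 \<le> (real k)\<^sup>2 / 2"
      using zero_le_power2[of "real k - norm x"] by (simp add: power2_eq_square algebra_simps)
    finally show ?thesis by simp
  qed
  then show "\<exists>C. \<forall>x::'a. (1 + norm x) ^ k * norm (gauss x) \<le> C" by blast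
qed

text \<open>Polynomial multiples of the Gaussian, introduced because this family is closed under
  differentiation, as the coinduction principle demands.\<close>

inductive_set gauss_polys :: "('a::euclidean_space \<Rightarrow> complex) set" where
  base: "gauss \<in> gauss_polys"
| coord: "f \<in> gauss_polys \<Longrightarrow> (\<lambda>x. of_real (x \<bullet> b) * f x) \<in> gauss_polys"
| cmult: "f \<in> gauss_polys \<Longrightarrow> (\<lambda>x. c * f x) \<in> gauss_polys"
| add: "f \<in> gauss_polys \<Longrightarrow> g \<in> gauss_polys \<Longrightarrow> (\<lambda>x. f x + g x) \<in> gauss_polys"

lemma gauss_polys_deriv:
  assumes "f \<in> gauss_polys" "b \<in> Basis"
  shows "(\<forall>x. f differentiable at x) \<and> partial_deriv b f \<in> gauss_polys"
  using assms(1)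
proof induction
  case base
  have "partial_deriv b gauss = (\<lambda>x::'a. (- 1) * (of_real (x \<bullet> b) * gauss x))"
    using gauss_partial_deriv by auto
  moreover have "(\<lambda>x::'a. (- 1) * (of_real (x \<bullet> b) * gauss x)) \<in> gauss_polys" by (intro gauss_polys.intros)
  ultimately show ?case using gauss_differentiable by metis
next
  case (coord f b')
  have lin: "(\<lambda>x::'a. complex_of_real (x \<bullet> b')) differentiable at x" for x
    by (intro bounded_linear_imp_differentiable bounded_linear_compose[OF bounded_linear_of_real bounded_linear_inner_left])
  have "partial_deriv b (\<lambda>x::'a. complex_of_real (x \<bullet> b')) x = of_real (b \<bullet> b')" for x
    by (rule partial_derivI[OF bounded_linear_imp_has_derivative])
      (intro bounded_linear_compose[OF bounded_linear_of_real bounded_linear_inner_left])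
  then have "partial_deriv b (\<lambda>x. of_real (x \<bullet> b') * f x) = (\<lambda>x. of_real (x \<bullet> b') * partial_deriv b f x + of_real (b \<bullet> b') * f x)"
    using schwartz_mult_partial[OF lin _ assms(2)] coord by auto
  then show ?case using coord lin by (auto intro!: gauss_polys.intros)
next
  case (cmult f c)
  have "partial_deriv b (\<lambda>x::'a. c) x = 0" for x by (rule partial_derivI) auto
  then have "partial_deriv b (\<lambda>x. c * f x) = (\<lambda>x. c * partial_deriv b f x)"
    using schwartz_mult_partial[of "\<lambda>x. c" _ f b] cmult assms(2) by auto
  then show ?case using cmult by (auto intro!: gauss_polys.intros)
next
  case (add f g)
  have "partial_deriv b (\<lambda>x. f x + g x) = (\<lambda>x. partial_deriv b f x + partial_deriv b g x)"
  proof
    fix x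
    show "partial_deriv b (\<lambda>x. f x + g x) x = partial_deriv b f x + partial_deriv b g x"
      using partial_derivI[OF has_derivative_add[OF has_derivative_partials has_derivative_partials], of f x g b] add assms(2)
      by (simp add: inner_Basis if_distrib[of "\<lambda>x. x *\<^sub>R _"] cong: if_cong)
  qed
  then show ?case using add by (auto intro!: gauss_polys.intros differentiable_add)
qed

lemma rapid_gauss_polys: "f \<in> gauss_polys \<Longrightarrow> rapid f"
proof (induction rule: gauss_polys.induct)
  case (coord f b)
  then show ?case
  proof (intro rapid_bounded_mult[of f _ "norm b" 1])
    show "norm (complex_of_real (x \<bullet> b)) \<le> norm b * (1 + norm x) ^ 1" for x
      using Cauchy_Schwarz_ineq2[of x b] by (simp add: algebra_simps) (smt (verit) norm_ge_zero)
  qed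
next
  case (cmult f c)
  then show ?case by (intro rapid_bounded_mult[of f _ "norm c" 0]) auto
qed (auto intro: rapid_gauss rapid_add)

lemma schwartz_gauss: "gauss \<in> (schwartz :: ('a::euclidean_space \<Rightarrow> complex) set)"
proof -
  obtain b0 :: 'a where b0: "b0 \<in> Basis" using nonempty_Basis by blast
  have "gauss_polys \<subseteq> (schwartz :: ('a \<Rightarrow> complex) set)"
    by (rule schwartz_coinduct)
      (use gauss_polys_deriv b0 rapid_gauss_polys in \<open>blast intro: sum_closure.base\<close>)+
  then show ?thesis using gauss_polys.base by blast
qed

lemma integral_gauss: "(LINT x|lborel. gauss (x :: 'a::euclidean_space)) = 1 / of_real (fourier_const TYPE('a))"
proof -
  have "(\<integral>\<^sup>+x. ennreal (exp (- x\<^sup>2 / 2)) \<partial>lborel) = ennreal (sqrt (2 * pi))"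
  proof -
    have "(\<integral>\<^sup>+x. ennreal (exp (- x\<^sup>2 / 2)) \<partial>lborel) = (\<integral>\<^sup>+x. ennreal (sqrt (2 * pi)) * ennreal (normal_density 0 1 x) \<partial>lborel)"
      by (intro nn_integral_cong) (simp add: normal_density_def ennreal_mult'[symmetric])
    also have "\<dots> = ennreal (sqrt (2 * pi)) * (\<integral>\<^sup>+x. ennreal (normal_density 0 1 x) \<partial>lborel)"
      by (intro nn_integral_cmult) auto
    also have "(\<integral>\<^sup>+x. ennreal (normal_density 0 1 x) \<partial>lborel) = 1"
      using prob_space.emeasure_space_1[OF prob_space_normal_density[of 1 0]] by (simp add: emeasure_density)
    finally show ?thesis by simp
  qed
  note 1 = this
  have "(\<integral>\<^sup>+x. ennreal (exp (- (norm x)\<^sup>2 / 2)) \<partial>(lborel :: 'a measure)) = (\<integral>\<^sup>+x. (\<Prod>b\<in>Basis. ennreal (exp (- (x \<bullet> b)\<^sup>2 / 2))) \<partial>(lborel :: 'a measure))"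
  proof (intro nn_integral_cong)
    fix x :: 'a
    have "(norm x)\<^sup>2 = (\<Sum>b\<in>Basis. (x \<bullet> b)\<^sup>2)"
      unfolding power2_norm_eq_inner by (subst euclidean_inner) (simp only: power2_eq_square)
    then have "exp (- (norm x)\<^sup>2 / 2) = (\<Prod>b\<in>Basis. exp (- (x \<bullet> b)\<^sup>2 / 2))"
      by (simp add: exp_sum[symmetric] sum_negf sum_divide_distrib)
    then show "ennreal (exp (- (norm x)\<^sup>2 / 2)) = (\<Prod>b\<in>Basis. ennreal (exp (- (x \<bullet> b)\<^sup>2 / 2)))"
      by (simp add: prod_ennreal)
  qed
  also have "\<dots> = (\<Prod>b\<in>(Basis::'a set). (\<integral>\<^sup>+x. ennreal (exp (- x\<^sup>2 / 2)) \<partial>lborel))"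
    by (intro nn_integral_lborel_prod) auto
  also have "\<dots> = ennreal (sqrt (2 * pi) ^ DIM('a))" unfolding 1 by (simp add: ennreal_power)
  also have "sqrt (2 * pi) ^ DIM('a) = 1 / fourier_const TYPE('a)"
    by (simp add: fourier_const_def powr_minus powr_half_sqrt[symmetric] powr_powr[symmetric] powr_realpow[symmetric] inverse_eq_divide)
      (simp add: powr_powr)
  finally have "(LINT x|lborel. exp (- (norm (x::'a))\<^sup>2 / 2)) = 1 / fourier_const TYPE('a)"
    using fourier_const_pos[of "TYPE('a)"] by (simp add: integral_eq_nn_integral)
  then have "complex_of_real (LINT x|lborel. exp (- (norm (x::'a))\<^sup>2 / 2)) = 1 / of_real (fourier_const TYPE('a))" by simp
  then show ?thesis unfolding gauss_def by (simp only: integral_complex_of_real)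
qed

text \<open>Both functions solve the same first-order equation, gradient equal to
  \<open>- \<xi>\<close> times the function. Their quotient \<open>H\<close> is therefore constant,
  and its value at the origin is the normalised Gaussian integral.\<close>

lemma fourier_gauss: "fourier gauss = (gauss :: 'a::euclidean_space \<Rightarrow> complex)"
proof
  fix \<xi> :: 'a
  define H where "H = (\<lambda>\<xi>::'a. fourier gauss \<xi> * of_real (exp ((\<xi> \<bullet> \<xi>) / 2)))"
  have D: "(H has_derivative (\<lambda>h. 0)) (at \<xi>)" for \<xi>
  proof -
    have pd: "partial_deriv b (fourier gauss) \<xi> = - of_real (\<xi> \<bullet> b) * fourier gauss \<xi>" if b: "b \<in> Basis" for b
    proof -
      have "(\<lambda>x. - \<i> * complex_of_real (x \<bullet> b) * gauss x) = (\<lambda>x. \<i> * partial_deriv b gauss x)"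
        by (simp add: gauss_partial_deriv mult.assoc)
      then show ?thesis
        using fourier_partial_deriv[OF rapid_gauss gauss_measurable b, of \<xi>]
          fourier_of_partial_deriv[OF schwartz_gauss b, of \<xi>]
        by (simp add: fourier_cmult inner_commute mult.assoc[symmetric])
    qed
    have 1: "(fourier gauss has_derivative (\<lambda>h. - of_real (\<xi> \<bullet> h) * fourier gauss \<xi>)) (at \<xi>)"
    proof -
      have "(\<lambda>h. \<Sum>b\<in>Basis. (h \<bullet> b) *\<^sub>R partial_deriv b (fourier gauss) \<xi>) = (\<lambda>h. - of_real (\<xi> \<bullet> h) * fourier gauss \<xi>)"
      proof
        fix h
        have "(\<Sum>b\<in>Basis. (h \<bullet> b) *\<^sub>R partial_deriv b (fourier gauss) \<xi>) = (\<Sum>b\<in>Basis. of_real (- ((\<xi> \<bullet> b) * (h \<bullet> b))) * fourier gauss \<xi>)"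
          by (intro sum.cong refl) (simp add: pd scaleR_conv_of_real)
        also have "\<dots> = of_real (- (\<xi> \<bullet> h)) * fourier gauss \<xi>"
          by (subst euclidean_inner) (simp only: sum_distrib_right of_real_sum sum_negf[symmetric])
        finally show "(\<Sum>b\<in>Basis. (h \<bullet> b) *\<^sub>R partial_deriv b (fourier gauss) \<xi>) = - of_real (\<xi> \<bullet> h) * fourier gauss \<xi>" by simp
      qed
      then show ?thesis using schwartz_has_derivative[OF schwartz_fourier[OF schwartz_gauss], of \<xi>] by simp
    qed
    have 2: "((\<lambda>\<xi>::'a. complex_of_real (exp ((\<xi> \<bullet> \<xi>) / 2))) has_derivative (\<lambda>h. of_real ((\<xi> \<bullet> h) * exp ((\<xi> \<bullet> \<xi>) / 2)))) (at \<xi>)"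
      by (rule has_derivative_of_real) (auto intro!: derivative_eq_intros simp: inner_commute fun_eq_iff)
    show ?thesis unfolding H_def
      using has_derivative_mult[OF 1 2] by (simp add: mult_ac)
  qed
  have "H \<xi> = H 0"
    using has_derivative_zero_unique[of UNIV H \<xi> 0] D by (auto intro: has_derivative_at_withinI)
  also have "H 0 = 1"
    unfolding H_def fourier_altdef using fourier_const_pos[of "TYPE('a)"] by (simp add: integral_gauss)
  finally show "fourier gauss \<xi> = gauss \<xi>"
    by (simp add: H_def gauss_def power2_norm_eq_inner exp_minus field_simps)
qed

section \<open>Fubini, the multiplication formula and inversion\<close>

lemma integral_swap:
  fixes f g :: "'a::euclidean_space \<Rightarrow> complex" and K :: "'a \<Rightarrow> 'a \<Rightarrow> complex"
  assumes f: "integrable lborel f" and g: "integrable lborel g"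
    and K[measurable]: "(\<lambda>(x, y). K x y) \<in> borel_measurable (borel \<Otimes>\<^sub>M borel)" and K1: "\<And>x y. norm (K x y) \<le> 1"
  shows "(LINT x|lborel. f x * (LINT y|lborel. K x y * g y)) = (LINT y|lborel. g y * (LINT x|lborel. K x y * f x))"
proof -
  have [measurable]: "f \<in> borel_measurable borel" "g \<in> borel_measurable borel" using f g by auto
  have ig: "integrable lborel (\<lambda>y. K x y * g y)" for x
    by (rule Bochner_Integration.integrable_bound[OF g]) (use K1 in \<open>auto simp: norm_mult mult_left_le_one_le\<close>)
  have "integrable (lborel \<Otimes>\<^sub>M lborel) (\<lambda>(x, y). K x y * f x * g y)"
  proof (rule lborel_pair.Fubini_integrable)
    show "integrable lborel (\<lambda>x. LINT y|lborel. norm (case (x, y) of (x, y) \<Rightarrow> K x y * f x * g y))"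
    proof (rule Bochner_Integration.integrable_bound)
      show "integrable lborel (\<lambda>x. norm (f x) * (LINT y|lborel. norm (g y)))" using f g by simp
      show "AE x in lborel. norm (LINT y|lborel. norm (case (x, y) of (x, y) \<Rightarrow> K x y * f x * g y)) \<le> norm (norm (f x) * (LINT y|lborel. norm (g y)))"
      proof (intro always_eventually allI)
        fix x
        have "(LINT y|lborel. norm (K x y * f x * g y)) \<le> (LINT y|lborel. norm (f x) * norm (g y))"
        proof (rule integral_mono)
          show "integrable lborel (\<lambda>y. norm (K x y * f x * g y))"
            using integrable_mult_right[OF ig[of x], of "f x"] by (intro integrable_norm) (simp add: mult_ac)
          show "norm (K x y * f x * g y) \<le> norm (f x) * norm (g y)" for y
            using K1[of x y] by (simp add: norm_mult mult.assoc mult_left_le_one_le)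
        qed (use g in simp)
        then show "norm (LINT y|lborel. norm (case (x, y) of (x, y) \<Rightarrow> K x y * f x * g y)) \<le> norm (norm (f x) * (LINT y|lborel. norm (g y)))"
          by (simp add: integral_nonneg_AE)
      qed
    qed measurable
    show "AE x in lborel. integrable lborel (\<lambda>y. case (x, y) of (x, y) \<Rightarrow> K x y * f x * g y)"
      using integrable_mult_right[OF ig] by (simp add: mult_ac)
  qed measurable
  from lborel_pair.Fubini_integral[OF this]
  have "(LINT y|lborel. LINT x|lborel. K x y * f x * g y) = (LINT x|lborel. LINT y|lborel. K x y * f x * g y)" .
  then show ?thesis by (simp add: mult_ac flip: integral_mult_right_zero)
qed

lemma fourier_measurable [measurable]:
  fixes f :: "'a::euclidean_space \<Rightarrow> complex"
  assumes [measurable]: "f \<in> borel_measurable borel"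
  shows "fourier f \<in> borel_measurable borel"
  unfolding fourier_altdef[abs_def] by measurable

lemma fourier_multiplication:
  fixes f g :: "'a::euclidean_space \<Rightarrow> complex"
  assumes "integrable lborel f" "integrable lborel g"
  shows "(LINT x|lborel. f x * fourier g x) = (LINT x|lborel. fourier f x * g x)"
proof -
  have "(LINT x|lborel. f x * (LINT y|lborel. exp (- \<i> * complex_of_real (x \<bullet> y)) * g y)) = (LINT y|lborel. g y * (LINT x|lborel. exp (- \<i> * complex_of_real (x \<bullet> y)) * f x))"
    by (rule integral_swap[OF assms]) auto
  then have "of_real (fourier_const TYPE('a)) * (LINT x|lborel. f x * (LINT y|lborel. exp (- \<i> * complex_of_real (y \<bullet> x)) * g y)) = of_real (fourier_const TYPE('a)) * (LINT y|lborel. g y * (LINT x|lborel. exp (- \<i> * complex_of_real (x \<bullet> y)) * f x))"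
    by (simp only: inner_commute)
  then show ?thesis unfolding fourier_altdef
    by (simp only: mult.left_commute[of _ "complex_of_real (fourier_const TYPE('a))"] integral_mult_right_zero mult.assoc mult.commute[of _ "g _"])
qed

lemma inv_fourier_multiplication:
  fixes f g :: "'a::euclidean_space \<Rightarrow> complex"
  assumes f: "integrable lborel f" and g: "integrable lborel g"
  shows "(LINT x|lborel. f x * inv_fourier g x) = (LINT x|lborel. inv_fourier f x * g x)"
proof -
  have [measurable]: "f \<in> borel_measurable borel" "g \<in> borel_measurable borel" using f g by auto
  have "(LINT x|lborel. f x * inv_fourier g x) = (LINT x|lborel. f (- x) * fourier g x)"
    using integral_lborel_affine[of "\<lambda>x. f x * inv_fourier g x" "-1" 0] by (simp add: inv_fourier_eq[abs_def])
  also have "\<dots> = (LINT x|lborel. fourier (\<lambda>x. f (- x)) x * g x)"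
    using integrable_lborel_affine[OF f, of "-1" 0] by (intro fourier_multiplication g) auto
  also have "fourier (\<lambda>x. f (- x)) = inv_fourier f"
  proof
    fix \<xi>
    show "fourier (\<lambda>x. f (- x)) \<xi> = inv_fourier f \<xi>"
      using integral_lborel_affine[of "\<lambda>x. exp (\<i> * of_real (x \<bullet> \<xi>)) * f x" "-1" 0]
      by (simp add: fourier_altdef inv_fourier_eq)
  qed
  finally show ?thesis .
qed

text \<open>The convolution theorem in the form used below: multiplication by \<open>\<phi>\<close>
  on the Fourier side is convolution with \<open>fourier \<phi>\<close>. It follows from the
  multiplication formula applied to a modulated \<open>\<phi>\<close>.\<close>

lemma fourier_modulated_mult:
  fixes \<phi> \<psi> :: "'a::euclidean_space \<Rightarrow> complex"
  assumes "integrable lborel \<phi>" "integrable lborel \<psi>"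
  shows "fourier (\<lambda>\<xi>. \<phi> \<xi> * inv_fourier \<psi> \<xi>) w = of_real (fourier_const TYPE('a)) * (LINT y|lborel. \<psi> y * fourier \<phi> (w - y))"
proof -
  have "fourier (\<lambda>\<xi>. \<phi> \<xi> * inv_fourier \<psi> \<xi>) w = of_real (fourier_const TYPE('a)) * (LINT \<xi>|lborel. (exp (- \<i> * of_real (\<xi> \<bullet> w)) * \<phi> \<xi>) * inv_fourier \<psi> \<xi>)"
    unfolding fourier_altdef by (simp add: mult.assoc)
  also have "(LINT \<xi>|lborel. (exp (- \<i> * of_real (\<xi> \<bullet> w)) * \<phi> \<xi>) * inv_fourier \<psi> \<xi>) = (LINT y|lborel. inv_fourier (\<lambda>\<xi>. exp (- \<i> * of_real (\<xi> \<bullet> w)) * \<phi> \<xi>) y * \<psi> y)"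
    by (intro inv_fourier_multiplication integrable_exp_mult assms)
  also have "(\<lambda>y. inv_fourier (\<lambda>\<xi>. exp (- \<i> * of_real (\<xi> \<bullet> w)) * \<phi> \<xi>) y) = (\<lambda>y. fourier \<phi> (w - y))"
  proof
    fix y
    have "exp (- \<i> * complex_of_real (\<xi> \<bullet> - y)) * exp (- \<i> * of_real (\<xi> \<bullet> w)) = exp (- \<i> * of_real (\<xi> \<bullet> (w - y)))" for \<xi>
      unfolding exp_add[symmetric] by (rule arg_cong[of _ _ exp]) (simp add: inner_diff_right algebra_simps)
    then show "inv_fourier (\<lambda>\<xi>. exp (- \<i> * of_real (\<xi> \<bullet> w)) * \<phi> \<xi>) y = fourier \<phi> (w - y)"
      unfolding inv_fourier_eq fourier_altdef mult.assoc[symmetric] by simp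
  qed
  finally show ?thesis by (simp add: mult.commute)
qed

lemma fourier_inversion:
  fixes \<phi> :: "'a::euclidean_space \<Rightarrow> complex"
  assumes "\<phi> \<in> schwartz"
  shows "fourier (inv_fourier \<phi>) = \<phi>"
proof
  fix w
  define e where "e n = 1 / real (Suc n)" for n
  have e: "0 < e n" "e n \<le> 1" for n by (auto simp: e_def field_simps)
  have e0: "e \<longlonglongrightarrow> 0" unfolding e_def by (rule lim_inverse_n'[THEN LIMSEQ_Suc])
  note F = schwartz_inv_fourier[OF assms]
  have [measurable]: "inv_fourier \<phi> \<in> borel_measurable borel" "\<phi> \<in> borel_measurable borel"
    using schwartz_measurable F assms by auto
  let ?c = "complex_of_real (fourier_const TYPE('a))"
  have cont: "isCont f x" if "f \<in> schwartz" for f :: "'a \<Rightarrow> complex" and x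
    using schwartz_continuous[OF that, of UNIV] continuous_on_eq_continuous_at by blast
  have gl: "(\<lambda>n. gauss (e n *\<^sub>R x)) \<longlonglongrightarrow> gauss (0::'a)" for x :: 'a
  proof -
    have "(\<lambda>n. e n *\<^sub>R x) \<longlonglongrightarrow> 0" by (auto intro!: tendsto_eq_intros e0)
    from isCont_tendsto_compose[OF cont[OF schwartz_gauss] this] show ?thesis .
  qed
  have pl: "(\<lambda>n. \<phi> (w - e n *\<^sub>R x)) \<longlonglongrightarrow> \<phi> w" for x
  proof -
    have "(\<lambda>n. w - e n *\<^sub>R x) \<longlonglongrightarrow> w" by (auto intro!: tendsto_eq_intros e0)
    from isCont_tendsto_compose[OF cont[OF assms] this] show ?thesis .
  qed
  \<comment> \<open>Gaussian regularisation of the inversion integral, evaluated in two ways: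
    dominated convergence removes the regularisation, while the convolution theorem turns
    \<open>J n\<close> into a Gaussian average of \<open>\<phi>\<close> around \<open>w\<close> at
    scale \<open>e n\<close>.\<close>
  define J where "J n = fourier (\<lambda>\<xi>. gauss (e n *\<^sub>R \<xi>) * inv_fourier \<phi> \<xi>) w" for n
  have "(\<lambda>n. LINT \<xi>|lborel. exp (- \<i> * of_real (\<xi> \<bullet> w)) * (gauss (e n *\<^sub>R \<xi>) * inv_fourier \<phi> \<xi>)) \<longlonglongrightarrow> (LINT \<xi>|lborel. exp (- \<i> * of_real (\<xi> \<bullet> w)) * (gauss (0::'a) * inv_fourier \<phi> \<xi>))"
  proof (rule integral_dominated_convergence[where w = "\<lambda>x. norm (inv_fourier \<phi> x)"])
    show "AE x in lborel. (\<lambda>n. exp (- \<i> * of_real (x \<bullet> w)) * (gauss (e n *\<^sub>R x) * inv_fourier \<phi> x)) \<longlonglongrightarrow> exp (- \<i> * of_real (x \<bullet> w)) * (gauss (0::'a) * inv_fourier \<phi> x)"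
      by (intro always_eventually allI tendsto_mult tendsto_const gl)
  qed (use schwartz_integrable[OF F] in \<open>auto simp: norm_mult gauss_def intro!: mult_left_le_one_le\<close>)
  then have J1: "J \<longlonglongrightarrow> fourier (inv_fourier \<phi>) w"
    unfolding J_def[abs_def] fourier_altdef by (intro tendsto_intros) (simp add: gauss_def)
  have J2: "J n = ?c * (LINT v|lborel. \<phi> (w - e n *\<^sub>R v) * gauss v)" for n
  proof -
    have [measurable]: "(\<lambda>x. gauss (e n *\<^sub>R x)) \<in> borel_measurable (borel :: 'a measure)" by measurable
    have ig: "integrable lborel (\<lambda>x::'a. gauss (e n *\<^sub>R x))"
      using integrable_lborel_affine[OF schwartz_integrable[OF schwartz_gauss], of "e n" 0] e[of n] by simp
    have sc: "fourier (\<lambda>x::'a. gauss (e n *\<^sub>R x)) y = of_real (inverse (e n) ^ DIM('a)) * gauss (inverse (e n) *\<^sub>R y)" for y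
      using fourier_scale[of "\<lambda>x::'a. gauss (e n *\<^sub>R x)" "inverse (e n)" y] e[of n]
      by (simp add: fourier_gauss)
    have "J n = ?c * (LINT y|lborel. \<phi> y * (of_real (inverse (e n) ^ DIM('a)) * gauss (inverse (e n) *\<^sub>R (w - y))))"
      unfolding J_def fourier_modulated_mult[OF ig schwartz_integrable[OF assms]] sc ..
    also have "(LINT y|lborel. \<phi> y * (of_real (inverse (e n) ^ DIM('a)) * gauss (inverse (e n) *\<^sub>R (w - y))))
       = (LINT v|lborel. \<phi> (w - e n *\<^sub>R v) * gauss v)"
      using e[of n] by (subst integral_lborel_affine[of _ "- e n" w])
        (auto simp: field_simps simp flip: integral_mult_right_zero)
    finally show ?thesis .
  qed
  obtain B where B: "\<And>x. norm (\<phi> x) \<le> B"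
    using rapidE[OF schwartz_rapid[OF assms], of 0] by (metis power_0 mult_1)
  have "(\<lambda>n. LINT v|lborel. \<phi> (w - e n *\<^sub>R v) * gauss v) \<longlonglongrightarrow> (LINT v|lborel. \<phi> w * gauss (v::'a))"
  proof (rule integral_dominated_convergence[where w = "\<lambda>x. B * norm (gauss x)"])
    show "AE x in lborel. (\<lambda>n. \<phi> (w - e n *\<^sub>R x) * gauss x) \<longlonglongrightarrow> \<phi> w * gauss x"
      by (intro always_eventually allI tendsto_mult tendsto_const pl)
    show "integrable lborel (\<lambda>x::'a. B * norm (gauss x))"
      by (intro integrable_mult_right integrable_norm schwartz_integrable schwartz_gauss)
  qed (use B in \<open>auto simp: norm_mult intro!: mult_right_mono\<close>)
  then have "(\<lambda>n. ?c * (LINT v|lborel. \<phi> (w - e n *\<^sub>R v) * gauss v)) \<longlonglongrightarrow> ?c * (LINT v|lborel. \<phi> w * gauss (v::'a))"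
    by (intro tendsto_intros)
  also have "?c * (LINT v|lborel. \<phi> w * gauss (v::'a)) = \<phi> w"
    using fourier_const_pos[of "TYPE('a)"] by (simp add: integral_gauss)
  finally show "fourier (inv_fourier \<phi>) w = \<phi> w"
    using J1 unfolding J2[abs_def] using LIMSEQ_unique by blast
qed

lemma inv_fourier_fourier:
  fixes \<phi> :: "'a::euclidean_space \<Rightarrow> complex"
  assumes "\<phi> \<in> schwartz"
  shows "inv_fourier (fourier \<phi>) = \<phi>"
proof
  fix w
  have *: "(\<lambda>x. fourier \<phi> x) = (\<lambda>x. inv_fourier \<phi> (- x))" by (simp add: inv_fourier_eq)
  have m: "inv_fourier \<phi> \<in> borel_measurable borel"
    by (rule schwartz_measurable[OF schwartz_inv_fourier[OF assms]])
  have "inv_fourier (fourier \<phi>) w = fourier (inv_fourier \<phi>) w"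
    using fourier_scale[of "inv_fourier \<phi>" 1 w] m
      integral_lborel_affine[of "\<lambda>x. exp (- \<i> * of_real (x \<bullet> w)) * inv_fourier \<phi> x" "-1" 0]
    unfolding * by (simp add: inv_fourier_eq[of "\<lambda>x. inv_fourier \<phi> (- x)"] fourier_altdef)
  then show "inv_fourier (fourier \<phi>) w = \<phi> w" by (simp add: fourier_inversion[OF assms])
qed

subsection \<open>Tempered distributions\<close>

definition schwartz_norm :: "nat \<Rightarrow> ('a::euclidean_space \<Rightarrow> complex) \<Rightarrow> real" where
  "schwartz_norm N \<phi> = (\<Sum>bs | bs \<in> multi_indices \<and> length bs \<le> N. schwartz_seminorm N bs \<phi>)"

lemma schwartz_seminorm_le:
  assumes "\<And>x. (1 + norm x) ^ k * norm (iter_deriv bs \<phi> x) \<le> C"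
  shows "schwartz_seminorm k bs \<phi> \<le> C"
  unfolding schwartz_seminorm_def by (rule cSUP_least) (use assms in auto)

lemma schwartz_norm_le:
  fixes \<phi> :: "'a::euclidean_space \<Rightarrow> complex"
  assumes "\<And>bs x. bs \<in> multi_indices \<Longrightarrow> length bs \<le> N \<Longrightarrow> (1 + norm x) ^ N * norm (iter_deriv bs \<phi> x) \<le> C bs * t"
  shows "schwartz_norm N \<phi> \<le> (\<Sum>bs | bs \<in> (multi_indices :: 'a list set) \<and> length bs \<le> N. C bs) * t"
  unfolding schwartz_norm_def sum_distrib_right by (intro sum_mono schwartz_seminorm_le assms) auto

text \<open>Modulus of continuity of translations in the Schwartz seminorms, with polynomial
  dependence on the base point \<open>u\<close>. It yields continuity and polynomial growth of
  \<open>T\<close> applied to translates, and the convergence of finite sums of translates to an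
  integral.\<close>

lemma schwartz_norm_translate_diff:
  fixes \<phi> :: "'a::euclidean_space \<Rightarrow> complex"
  assumes "\<phi> \<in> schwartz"
  obtains C where "\<And>bs. C bs > 0" "\<And>bs w u v. bs \<in> multi_indices \<Longrightarrow>
    (1 + norm w) ^ N * norm (iter_deriv bs \<phi> (w - v) - iter_deriv bs \<phi> (w - u))
      \<le> C bs * (norm (u - v) * (1 + norm (u - v)) ^ N * (1 + norm u) ^ N)"
proof -
  have "\<exists>C. C > 0 \<and> (\<forall>w u v. (1 + norm w) ^ N * norm (iter_deriv bs \<phi> (w - v) - iter_deriv bs \<phi> (w - u))
      \<le> C * (norm (u - v) * (1 + norm (u - v)) ^ N * (1 + norm u) ^ N))" if bs: "bs \<in> multi_indices" for bs
  proof -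
    obtain C where C: "C > 0" "\<And>x v. (1 + norm x) ^ N * norm (iter_deriv bs \<phi> (x + v) - iter_deriv bs \<phi> x) \<le> C * norm v * (1 + norm v) ^ N"
      using rapid_has_derivative_diff_bound[OF schwartz_iter_deriv[OF assms bs]] by metis
    have "(1 + norm w) ^ N * norm (iter_deriv bs \<phi> (w - v) - iter_deriv bs \<phi> (w - u))
      \<le> C * (norm (u - v) * (1 + norm (u - v)) ^ N * (1 + norm u) ^ N)" for w u v
    proof -
      have "(1 + norm w) ^ N * norm (iter_deriv bs \<phi> (w - v) - iter_deriv bs \<phi> (w - u))
        \<le> ((1 + norm u) ^ N * (1 + norm (w - u)) ^ N) * norm (iter_deriv bs \<phi> (w - v) - iter_deriv bs \<phi> (w - u))"
        by (intro mult_right_mono one_plus_norm_power_le) auto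
      also have "\<dots> = (1 + norm u) ^ N * ((1 + norm (w - u)) ^ N * norm (iter_deriv bs \<phi> ((w - u) + (u - v)) - iter_deriv bs \<phi> (w - u)))"
        by simp
      also have "\<dots> \<le> (1 + norm u) ^ N * (C * norm (u - v) * (1 + norm (u - v)) ^ N)"
        by (intro mult_left_mono C(2)) auto
      finally show ?thesis by (simp add: mult_ac)
    qed
    then show ?thesis using C(1) by blast
  qed
  then obtain C where "\<And>bs. bs \<in> multi_indices \<Longrightarrow> C bs > 0 \<and> (\<forall>w u v. (1 + norm w) ^ N * norm (iter_deriv bs \<phi> (w - v) - iter_deriv bs \<phi> (w - u))
      \<le> C bs * (norm (u - v) * (1 + norm (u - v)) ^ N * (1 + norm u) ^ N))" by metis
  \<comment> \<open>The default value 1 makes the constant positive also for lists that are not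
    multi-indices.\<close>
  then show ?thesis by (intro that[of "\<lambda>bs. if bs \<in> multi_indices then C bs else 1"]) auto
qed

lemma tempered_add: "T \<in> tempered_dists \<Longrightarrow> \<phi> \<in> schwartz \<Longrightarrow> \<psi> \<in> schwartz \<Longrightarrow> T (\<lambda>x. \<phi> x + \<psi> x) = T \<phi> + T \<psi>"
  and tempered_cmult: "T \<in> tempered_dists \<Longrightarrow> \<phi> \<in> schwartz \<Longrightarrow> T (\<lambda>x. c * \<phi> x) = c * T \<phi>"
  by (auto simp: tempered_dists_def)

lemma tempered_diff:
  "T \<in> tempered_dists \<Longrightarrow> \<phi> \<in> schwartz \<Longrightarrow> \<psi> \<in> schwartz \<Longrightarrow> T (\<lambda>x. \<phi> x - \<psi> x) = T \<phi> - T \<psi>"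
  using tempered_add[of T \<phi> "\<lambda>x. (-1) * \<psi> x"] tempered_cmult[of T \<psi> "-1"] schwartz_cmult(1)[of \<psi> "-1"] by simp

lemma tempered_sum:
  "T \<in> tempered_dists \<Longrightarrow> (\<And>i. i \<in> I \<Longrightarrow> f i \<in> schwartz) \<Longrightarrow> T (\<lambda>x. \<Sum>i\<in>I. f i x) = (\<Sum>i\<in>I. T (f i))"
proof (induction I rule: infinite_finite_induct)
  case empty
  then show ?case using tempered_cmult[of T "\<lambda>x. 0" 0] schwartz_zero by simp
next
  case (infinite A)
  then show ?case using tempered_cmult[of T "\<lambda>x. 0" 0] schwartz_zero by simp
next
  case (insert i I)
  then show ?case using tempered_add[of T "f i" "\<lambda>x. \<Sum>i\<in>I. f i x"] schwartz_sum[of I f] by simp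
qed

lemma tempered_bound:
  fixes T :: "('a::euclidean_space \<Rightarrow> complex) \<Rightarrow> complex"
  assumes "T \<in> tempered_dists"
  obtains C N where "C \<ge> 0" "\<And>\<phi>. \<phi> \<in> schwartz \<Longrightarrow> norm (T \<phi>) \<le> C * schwartz_norm N \<phi>"
proof -
  obtain C N where C: "\<And>\<phi>. \<phi> \<in> schwartz \<Longrightarrow> norm (T \<phi>) \<le> C * schwartz_norm N \<phi>"
    using assms unfolding tempered_dists_def schwartz_norm_def by blast
  have "norm (T \<phi>) \<le> \<bar>C\<bar> * schwartz_norm N \<phi>" if \<phi>: "\<phi> \<in> schwartz" for \<phi>
  proof -
    have "schwartz_norm N \<phi> \<ge> 0"
      unfolding schwartz_norm_def
    proof (intro sum_nonneg)
      fix bs :: "'a list" assume "bs \<in> {bs. bs \<in> multi_indices \<and> length bs \<le> N}"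
      then have "bdd_above (range (\<lambda>x. (1 + norm x) ^ N * norm (iter_deriv bs \<phi> x)))"
        using \<phi> unfolding schwartz_def by auto
      from cSUP_upper[OF _ this, of 0] show "0 \<le> schwartz_seminorm N bs \<phi>"
        unfolding schwartz_seminorm_def by (auto intro: order_trans[OF norm_ge_zero])
    qed
    then show ?thesis using C[OF \<phi>] by (smt (verit) mult_right_mono)
  qed
  then show ?thesis by (intro that[of "\<bar>C\<bar>" N]) auto
qed

lemma tempered_translate_diff:
  fixes T :: "('a::euclidean_space \<Rightarrow> complex) \<Rightarrow> complex"
  assumes T: "T \<in> tempered_dists" and K: "K \<in> schwartz"
  obtains C N where "C \<ge> 0" "\<And>u v. norm (T (\<lambda>w. K (w - v)) - T (\<lambda>w. K (w - u))) \<le> C * (norm (u - v) * (1 + norm (u - v)) ^ N * (1 + norm u) ^ N)"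
proof -
  obtain C N where C: "C \<ge> 0" "\<And>\<phi>. \<phi> \<in> schwartz \<Longrightarrow> norm (T \<phi>) \<le> C * schwartz_norm N \<phi>"
    using tempered_bound[OF T] by metis
  obtain D where D: "\<And>bs. D bs > 0" "\<And>bs w u v. bs \<in> multi_indices \<Longrightarrow>
    (1 + norm w) ^ N * norm (iter_deriv bs K (w - v) - iter_deriv bs K (w - u))
      \<le> D bs * (norm (u - v) * (1 + norm (u - v)) ^ N * (1 + norm u) ^ N)"
    using schwartz_norm_translate_diff[OF K, of N] by metis
  let ?D = "\<Sum>bs | bs \<in> (multi_indices :: 'a list set) \<and> length bs \<le> N. D bs"
  show ?thesis
  proof (rule that[of "C * ?D" N])
    show "C * ?D \<ge> 0" using C(1) D(1) by (intro mult_nonneg_nonneg sum_nonneg) (auto intro: less_imp_le)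
    fix u v
    have *: "(\<lambda>w. K (w - v)) \<in> schwartz" "(\<lambda>w. K (w - u)) \<in> schwartz" by (intro schwartz_translate K)+
    have "norm (T (\<lambda>w. K (w - v)) - T (\<lambda>w. K (w - u))) \<le> C * schwartz_norm N (\<lambda>w. K (w - v) - K (w - u))"
      using C(2)[OF schwartz_diff[OF *]] by (simp add: tempered_diff[OF T *])
    also have "\<dots> \<le> C * (?D * (norm (u - v) * (1 + norm (u - v)) ^ N * (1 + norm u) ^ N))"
      by (intro mult_left_mono schwartz_norm_le C(1))
        (simp add: schwartz_iter_deriv_diff[OF _ *] schwartz_iter_deriv_translate[OF _ K] D(2))
    finally show "norm (T (\<lambda>w. K (w - v)) - T (\<lambda>w. K (w - u))) \<le> C * ?D * (norm (u - v) * (1 + norm (u - v)) ^ N * (1 + norm u) ^ N)"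
      by (simp add: mult_ac)
  qed
qed

lemma tempered_translate_growth:
  fixes T :: "('a::euclidean_space \<Rightarrow> complex) \<Rightarrow> complex"
  assumes T: "T \<in> tempered_dists" and K: "K \<in> schwartz"
  obtains C N where "C > 0" "\<And>v. norm (T (\<lambda>w. K (w - v))) \<le> C * (1 + norm v) ^ N"
proof -
  obtain C N where C: "C \<ge> 0" "\<And>u v. norm (T (\<lambda>w. K (w - v)) - T (\<lambda>w. K (w - u))) \<le> C * (norm (u - v) * (1 + norm (u - v)) ^ N * (1 + norm u) ^ N)"
    using tempered_translate_diff[OF T K] by metis
  have "norm (T (\<lambda>w. K (w - v))) \<le> (C + norm (T K) + 1) * (1 + norm v) ^ Suc N" for v
  proof -
    define X where "X = (1 + norm v) ^ Suc N"
    have "norm (T (\<lambda>w. K (w - v))) \<le> norm (T K) + norm (T (\<lambda>w. K (w - v)) - T K)"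
      by (metis norm_triangle_sub)
    moreover have "norm (T (\<lambda>w. K (w - v)) - T K) \<le> C * (norm v * (1 + norm v) ^ N)" using C(2)[of v 0] by simp
    moreover have "\<dots> \<le> C * X" unfolding X_def using C(1) by (intro mult_left_mono) (auto intro!: mult_right_mono)
    moreover have "norm (T K) * 1 \<le> (norm (T K) + 1) * X" unfolding X_def by (intro mult_mono one_le_power) auto
    ultimately have "norm (T (\<lambda>w. K (w - v))) \<le> (C + norm (T K) + 1) * X" by (simp add: distrib_right)
    then show ?thesis unfolding X_def .
  qed
  then show ?thesis using C(1) by (intro that[of "C + norm (T K) + 1" "Suc N"]) (auto intro: add_nonneg_pos)
qed

lemma tempered_translate_continuous:
  fixes T :: "('a::euclidean_space \<Rightarrow> complex) \<Rightarrow> complex"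
  assumes T: "T \<in> tempered_dists" and K: "K \<in> schwartz"
  shows "isCont (\<lambda>v. T (\<lambda>w. K (w - v))) u"
proof -
  obtain C N where C: "C \<ge> 0" "\<And>u v. norm (T (\<lambda>w. K (w - v)) - T (\<lambda>w. K (w - u))) \<le> C * (norm (u - v) * (1 + norm (u - v)) ^ N * (1 + norm u) ^ N)"
    using tempered_translate_diff[OF T K] by metis
  have "((\<lambda>v. T (\<lambda>w. K (w - v)) - T (\<lambda>w. K (w - u))) \<longlongrightarrow> 0) (at u)"
  proof (rule Lim_null_comparison)
    show "\<forall>\<^sub>F v in at u. norm (T (\<lambda>w. K (w - v)) - T (\<lambda>w. K (w - u))) \<le> C * (norm (u - v) * (1 + norm (u - v)) ^ N * (1 + norm u) ^ N)"
      using C(2) by (intro always_eventually allI)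
    have "((\<lambda>v. C * (norm (u - v) * (1 + norm (u - v)) ^ N * (1 + norm u) ^ N)) \<longlongrightarrow> C * (norm (u - u) * (1 + norm (u - u)) ^ N * (1 + norm u) ^ N)) (at u)"
      by (intro tendsto_intros)
    then show "((\<lambda>v. C * (norm (u - v) * (1 + norm (u - v)) ^ N * (1 + norm u) ^ N)) \<longlongrightarrow> 0) (at u)" by simp
  qed
  then show ?thesis unfolding isCont_def by (simp add: LIM_zero_iff)
qed

section \<open>Exchanging a distribution with an integral\<close>

lemma integrable_mult_bounded:
  fixes f g :: "'a \<Rightarrow> complex"
  assumes f: "integrable M f" and [measurable]: "g \<in> borel_measurable M" and B: "\<And>x. norm (g x) \<le> B"
  shows "integrable M (\<lambda>x. f x * g x)"
proof (rule Bochner_Integration.integrable_bound)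
  show "integrable M (\<lambda>x. norm (f x) * B)" using f by simp
  show "AE x in M. norm (f x * g x) \<le> norm (norm (f x) * B)"
    using B order_trans[OF norm_ge_zero B] by (auto simp: norm_mult abs_mult intro!: mult_left_mono)
qed (use f in measurable)

text \<open>For a simple \<open>F\<close> the integral is a finite linear combination of values of
  \<open>h\<close>. With translates of a kernel in place of \<open>h\<close>, a merely linear
  functional can be pulled through it.\<close>

lemma integral_simple_compose:
  fixes \<psi> :: "'a::euclidean_space \<Rightarrow> complex" and F :: "'a \<Rightarrow> 'a"
  assumes \<psi>: "integrable lborel \<psi>" and F: "simple_function lborel F"
  shows "(LINT y|lborel. \<psi> y * h (F y)) = (\<Sum>m\<in>range F. (LINT y|lborel. indicator (F -` {m}) y * \<psi> y) * h m)"
    and "integrable lborel (\<lambda>y. \<psi> y * h (F y))"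
proof -
  have fin: "finite (range F)" using F by (simp add: simple_function_def)
  have meas: "F -` {m} \<in> sets lborel" for m
    using simple_functionD(2)[OF F, of "{m}"] by simp
  have int: "integrable lborel (\<lambda>y. indicator (F -` {m}) y * \<psi> y * h m)" for m
  proof (intro integrable_mult_left)
    have "(\<lambda>y. indicator (F -` {m}) y *\<^sub>R \<psi> y) = (\<lambda>y. indicator (F -` {m}) y * \<psi> y)"
      by (auto simp: indicator_def)
    with integrable_mult_indicator[OF meas \<psi>, of m]
    show "integrable lborel (\<lambda>y. indicator (F -` {m}) y * \<psi> y)" by simp
  qed
  have eq: "\<psi> y * h (F y) = (\<Sum>m\<in>range F. indicator (F -` {m}) y * \<psi> y * h m)" for y
  proof -
    have "(\<Sum>m\<in>range F. indicator (F -` {m}) y * \<psi> y * h m) = (\<Sum>m\<in>range F. if m = F y then \<psi> y * h m else 0)"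
      by (intro sum.cong) (auto simp: indicator_def)
    then show ?thesis using fin by simp
  qed
  show "integrable lborel (\<lambda>y. \<psi> y * h (F y))"
    unfolding eq by (intro Bochner_Integration.integrable_sum int)
  show "(LINT y|lborel. \<psi> y * h (F y)) = (\<Sum>m\<in>range F. (LINT y|lborel. indicator (F -` {m}) y * \<psi> y) * h m)"
    unfolding eq by (subst Bochner_Integration.integral_sum[OF int]) simp
qed

lemma schwartz_iter_deriv_sum:
  assumes "bs \<in> multi_indices" "\<And>i. i \<in> I \<Longrightarrow> f i \<in> schwartz"
  shows "iter_deriv bs (\<lambda>x. \<Sum>i\<in>I. f i x) = (\<lambda>x. \<Sum>i\<in>I. iter_deriv bs (f i) x)"
  using assms(2)
proof (induction I rule: infinite_finite_induct)
  case (insert i I)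
  then show ?case using schwartz_iter_deriv_add[OF assms(1), of "f i" "\<lambda>x. \<Sum>i\<in>I. f i x"] schwartz_sum[of I f] by simp
qed (use schwartz_iter_deriv_cmult[OF assms(1) schwartz_zero, of 0] in auto)

text \<open>Simple approximations of the identity map take the place of Riemann sums:
  \<open>R i\<close> is a finite combination of translates of \<open>K\<close> and converges to the
  convolution \<open>\<Psi>\<close> in the seminorms that control \<open>T\<close>. The hypothesis
  on derivatives says that they fall on the kernel, so the integral itself is never differentiated
  here.\<close>

lemma tempered_integral_exchange:
  fixes T :: "('a::euclidean_space \<Rightarrow> complex) \<Rightarrow> complex"
  assumes T: "T \<in> tempered_dists" and K: "K \<in> schwartz" and \<psi>: "\<psi> \<in> schwartz" and \<Psi>: "\<Psi> \<in> schwartz"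
    and deriv: "\<And>bs w. bs \<in> multi_indices \<Longrightarrow> iter_deriv bs \<Psi> w = (LINT y|lborel. \<psi> y * iter_deriv bs K (w - y))"
  shows "integrable lborel (\<lambda>y. \<psi> y * T (\<lambda>w. K (w - y)))"
    and "T \<Psi> = (LINT y|lborel. \<psi> y * T (\<lambda>w. K (w - y)))"
proof -
  have i\<psi>: "integrable lborel \<psi>" by (rule schwartz_integrable[OF \<psi>])
  have [measurable]: "\<psi> \<in> borel_measurable borel" by (rule schwartz_measurable[OF \<psi>])
  have bw: "integrable lborel (\<lambda>y. (1 + norm y) ^ k * norm (\<psi> y))" for k
    by (intro integrable_rapid_weighted schwartz_rapid \<psi>) measurable
  \<comment> \<open>The bound \<open>2 * norm x\<close> keeps the polynomial growth of translates
    dominated by a polynomial in \<open>norm y\<close>, uniformly in \<open>i\<close>.\<close>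
  obtain F :: "nat \<Rightarrow> 'a \<Rightarrow> 'a" where F: "\<And>i. simple_function lborel (F i)" "\<And>x. (\<lambda>i. F i x) \<longlonglongrightarrow> x"
      "\<And>i x. norm (F i x) \<le> 2 * norm x"
    using borel_measurable_implies_sequence_metric[of "\<lambda>x. x" "lborel :: 'a measure" 0] by auto
  have [measurable]: "F i \<in> borel_measurable borel" for i using borel_measurable_simple_function[OF F(1)] by simp
  define H where "H v = T (\<lambda>w. K (w - v))" for v
  have Hc: "isCont H u" for u unfolding H_def by (rule tempered_translate_continuous[OF T K])
  have [measurable]: "H \<in> borel_measurable borel"
    using Hc by (intro borel_measurable_continuous_onI continuous_at_imp_continuous_on) auto
  obtain A M where A: "A > 0" "\<And>v. norm (H v) \<le> A * (1 + norm v) ^ M"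
    using tempered_translate_growth[OF T K] unfolding H_def by metis
  have dom: "norm (\<psi> y * H v) \<le> A * 2 ^ M * ((1 + norm y) ^ M * norm (\<psi> y))" if "norm v \<le> 2 * norm y" for v y
  proof -
    have "norm (H v) \<le> A * (1 + norm v) ^ M" by (rule A)
    also have "\<dots> \<le> A * (2 * (1 + norm y)) ^ M" using A that by (intro mult_left_mono power_mono) auto
    finally have "norm (H v) \<le> A * 2 ^ M * (1 + norm y) ^ M" by (simp only: power_mult_distrib mult_ac)
    from mult_left_mono[OF this norm_ge_zero[of "\<psi> y"]] show ?thesis by (simp only: norm_mult mult_ac)
  qed
  have conv: "(\<lambda>i. LINT y|lborel. \<psi> y * H (F i y)) \<longlonglongrightarrow> (LINT y|lborel. \<psi> y * H y)"
    by (rule integral_dominated_convergence[where w = "\<lambda>y. A * 2 ^ M * ((1 + norm y) ^ M * norm (\<psi> y))"])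
      (use bw dom F in \<open>auto intro!: tendsto_intros isCont_tendsto_compose[OF Hc]\<close>)
  have "integrable lborel (\<lambda>y. \<psi> y * H y)"
    by (rule Bochner_Integration.integrable_bound[of _ "\<lambda>y. A * 2 ^ M * ((1 + norm y) ^ M * norm (\<psi> y))"])
      (use bw dom A in \<open>auto simp: abs_mult intro!: order_trans[OF dom]\<close>)
  then show "integrable lborel (\<lambda>y. \<psi> y * T (\<lambda>w. K (w - y)))" unfolding H_def .
  define a where "a i m = (LINT y|lborel. indicator (F i -` {m}) y * \<psi> y)" for i m
  define R where "R i w = (\<Sum>m\<in>range (F i). a i m * K (w - m))" for i w
  have Ks: "(\<lambda>w. a i m * K (w - m)) \<in> schwartz" for i m by (intro schwartz_cmult schwartz_translate K)
  have R: "R i \<in> schwartz" for i unfolding R_def[abs_def] by (intro schwartz_sum Ks)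
  have TR: "T (R i) = (LINT y|lborel. \<psi> y * H (F i y))" for i
  proof -
    have "T (R i) = (\<Sum>m\<in>range (F i). T (\<lambda>w. a i m * K (w - m)))"
      unfolding R_def[abs_def] by (rule tempered_sum[OF T Ks])
    also have "\<dots> = (\<Sum>m\<in>range (F i). a i m * H m)"
      unfolding H_def by (intro sum.cong refl tempered_cmult[OF T] schwartz_translate K)
    also have "\<dots> = (LINT y|lborel. \<psi> y * H (F i y))"
      using integral_simple_compose(1)[OF i\<psi> F(1), of H i] by (simp add: a_def)
    finally show ?thesis .
  qed
  have dR: "iter_deriv bs (R i) w = (LINT y|lborel. \<psi> y * iter_deriv bs K (w - F i y))" if "bs \<in> multi_indices" for bs i w
  proof -
    have "iter_deriv bs (R i) = (\<lambda>w. \<Sum>m\<in>range (F i). iter_deriv bs (\<lambda>w. a i m * K (w - m)) w)"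
      unfolding R_def[abs_def] by (rule schwartz_iter_deriv_sum[OF that Ks])
    then show ?thesis
      using integral_simple_compose(1)[OF i\<psi> F(1), of "\<lambda>v. iter_deriv bs K (w - v)" i]
      by (simp add: a_def schwartz_iter_deriv_cmult[OF that schwartz_translate(1)[OF K]] schwartz_iter_deriv_translate[OF that K])
  qed
  obtain C N where C: "C \<ge> 0" "\<And>\<phi>. \<phi> \<in> schwartz \<Longrightarrow> norm (T \<phi>) \<le> C * schwartz_norm N \<phi>"
    using tempered_bound[OF T] by metis
  obtain D where D: "\<And>bs. D bs > 0" "\<And>bs w u v. bs \<in> multi_indices \<Longrightarrow>
    (1 + norm w) ^ N * norm (iter_deriv bs K (w - v) - iter_deriv bs K (w - u))
      \<le> D bs * (norm (u - v) * (1 + norm (u - v)) ^ N * (1 + norm u) ^ N)"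
    using schwartz_norm_translate_diff[OF K, of N] by metis
  \<comment> \<open>Pointwise factor in the seminorm error of \<open>R i\<close>; its integral
    against \<open>norm (\<psi> y)\<close> is \<open>E i\<close>, which tends to 0 by dominated
    convergence.\<close>
  define G where "G i y = norm (y - F i y) * (1 + norm (y - F i y)) ^ N * (1 + norm y) ^ N" for i y
  have [measurable]: "G i \<in> borel_measurable borel" for i unfolding G_def[abs_def] by measurable
  have Gb: "G i y \<le> 3 ^ Suc N * (1 + norm y) ^ (Suc N + N)" for i y
  proof -
    have 1: "norm (y - F i y) \<le> 3 * norm y" using F(3)[of i y] norm_triangle_ineq4[of y "F i y"] by simp
    have "G i y \<le> (3 * (1 + norm y)) * (3 * (1 + norm y)) ^ N * (1 + norm y) ^ N"
      unfolding G_def using 1 by (intro mult_mono power_mono) auto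
    also have "\<dots> = 3 ^ Suc N * (1 + norm y) ^ (Suc N + N)" by (simp only: power_mult_distrib power_add power_Suc mult_ac)
    finally show ?thesis .
  qed
  have Gn: "G i y \<ge> 0" for i y unfolding G_def by auto
  define E where "E i = (LINT y|lborel. norm (\<psi> y) * G i y)" for i
  have domG: "norm (norm (\<psi> y) * G i y) \<le> 3 ^ Suc N * ((1 + norm y) ^ (Suc N + N) * norm (\<psi> y))" for i y
    using mult_left_mono[OF Gb[of i y] norm_ge_zero[of "\<psi> y"]] Gn by (simp only: real_norm_def abs_mult abs_norm_cancel abs_of_nonneg mult_ac)
  have iG: "integrable lborel (\<lambda>y. norm (\<psi> y) * G i y)" for i
    by (rule Bochner_Integration.integrable_bound[of _ "\<lambda>y. 3 ^ Suc N * ((1 + norm y) ^ (Suc N + N) * norm (\<psi> y))"])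
      (use domG bw in \<open>auto intro!: always_eventually order_trans[OF domG] simp del: power_Suc add_Suc\<close>)
  have E0: "E \<longlonglongrightarrow> 0"
  proof -
    have "(\<lambda>i. LINT y|lborel. norm (\<psi> y) * G i y) \<longlonglongrightarrow> (LINT y|lborel. norm (\<psi> y) * 0)"
    proof (rule integral_dominated_convergence[where w = "\<lambda>y. 3 ^ Suc N * ((1 + norm y) ^ (Suc N + N) * norm (\<psi> y))"])
      show "AE y in lborel. (\<lambda>i. norm (\<psi> y) * G i y) \<longlonglongrightarrow> norm (\<psi> y) * 0"
      proof (intro always_eventually allI tendsto_mult tendsto_const)
        fix y
        have "(\<lambda>i. norm (y - F i y) * (1 + norm (y - F i y)) ^ N * (1 + norm y) ^ N) \<longlonglongrightarrow> norm (y - y) * (1 + norm (y - y)) ^ N * (1 + norm y) ^ N"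
          by (intro tendsto_intros F)
        then show "(\<lambda>i. G i y) \<longlonglongrightarrow> 0" by (simp add: G_def)
      qed
      show "integrable lborel (\<lambda>y. 3 ^ Suc N * ((1 + norm y) ^ (Suc N + N) * norm (\<psi> y)))" by (intro integrable_mult_right bw)
    qed (use domG in \<open>auto intro!: always_eventually simp del: power_Suc add_Suc\<close>)
    then show ?thesis by (simp add: E_def[abs_def])
  qed
  let ?D = "\<Sum>bs | bs \<in> (multi_indices :: 'a list set) \<and> length bs \<le> N. D bs"
  have diff: "norm (T \<Psi> - T (R i)) \<le> C * (?D * E i)" for i
  proof -
    have "norm (T \<Psi> - T (R i)) \<le> C * schwartz_norm N (\<lambda>w. \<Psi> w - R i w)"
      using C(2)[OF schwartz_diff[OF \<Psi> R]] by (simp add: tempered_diff[OF T \<Psi> R])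
    also have "\<dots> \<le> C * (?D * E i)"
    proof (intro mult_left_mono schwartz_norm_le C(1))
      fix bs :: "'a list" and w assume bs: "bs \<in> multi_indices"
      have dK: "iter_deriv bs K \<in> schwartz" by (rule schwartz_iter_deriv[OF K bs])
      have [measurable]: "iter_deriv bs K \<in> borel_measurable borel" by (rule schwartz_measurable[OF dK])
      obtain B where B: "\<And>x. norm (iter_deriv bs K x) \<le> B"
        using rapidE[OF schwartz_rapid[OF dK], of 0] by (metis power_0 mult_1)
      have i1: "integrable lborel (\<lambda>y. \<psi> y * iter_deriv bs K (w - y))"
        by (rule integrable_mult_bounded[OF i\<psi> _ B]) measurable
      have i2: "integrable lborel (\<lambda>y. \<psi> y * iter_deriv bs K (w - F i y))"
        using integral_simple_compose(2)[OF i\<psi> F(1), of "\<lambda>v. iter_deriv bs K (w - v)"] .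
      have "(1 + norm w) ^ N * norm (iter_deriv bs (\<lambda>w. \<Psi> w - R i w) w)
          = (1 + norm w) ^ N * norm (LINT y|lborel. \<psi> y * iter_deriv bs K (w - y) - \<psi> y * iter_deriv bs K (w - F i y))"
        unfolding schwartz_iter_deriv_diff[OF bs \<Psi> R] deriv[OF bs] dR[OF bs] Bochner_Integration.integral_diff[OF i1 i2] ..
      also have "\<dots> \<le> (1 + norm w) ^ N * (LINT y|lborel. norm (\<psi> y * iter_deriv bs K (w - y) - \<psi> y * iter_deriv bs K (w - F i y)))"
        by (intro mult_left_mono integral_norm_bound) auto
      also have "\<dots> = (LINT y|lborel. (1 + norm w) ^ N * norm (\<psi> y * iter_deriv bs K (w - y) - \<psi> y * iter_deriv bs K (w - F i y)))"
        by simp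
      also have "\<dots> \<le> (LINT y|lborel. D bs * (norm (\<psi> y) * G i y))"
      proof (rule integral_mono)
        show "integrable lborel (\<lambda>y. (1 + norm w) ^ N * norm (\<psi> y * iter_deriv bs K (w - y) - \<psi> y * iter_deriv bs K (w - F i y)))"
          by (intro integrable_mult_right integrable_norm Bochner_Integration.integrable_diff i1 i2)
        show "integrable lborel (\<lambda>y. D bs * (norm (\<psi> y) * G i y))" by (intro integrable_mult_right iG)
        fix y
        have "(1 + norm w) ^ N * norm (iter_deriv bs K (w - y) - iter_deriv bs K (w - F i y)) \<le> D bs * G i y"
          using D(2)[OF bs, of w "F i y" y] by (simp add: G_def norm_minus_commute)
        from mult_left_mono[OF this norm_ge_zero[of "\<psi> y"]]
        show "(1 + norm w) ^ N * norm (\<psi> y * iter_deriv bs K (w - y) - \<psi> y * iter_deriv bs K (w - F i y)) \<le> D bs * (norm (\<psi> y) * G i y)"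
          by (simp only: right_diff_distrib[symmetric] norm_mult mult_ac)
      qed
      also have "\<dots> = D bs * E i" by (simp add: E_def)
      finally show "(1 + norm w) ^ N * norm (iter_deriv bs (\<lambda>w. \<Psi> w - R i w) w) \<le> D bs * E i" .
    qed
    finally show ?thesis .
  qed
  have "(\<lambda>i. T \<Psi> - T (R i)) \<longlonglongrightarrow> 0"
    by (rule Lim_null_comparison[of _ "\<lambda>i. C * (?D * E i)"])
      (use diff in \<open>auto intro!: always_eventually tendsto_eq_intros E0\<close>)
  then have "(\<lambda>i. T (R i)) \<longlonglongrightarrow> T \<Psi>"
    using tendsto_diff[OF tendsto_const[of "T \<Psi>"]] by fastforce
  with conv show "T \<Psi> = (LINT y|lborel. \<psi> y * T (\<lambda>w. K (w - y)))"
    unfolding TR H_def using LIMSEQ_unique by blast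
qed

subsection \<open>Littlewood-Paley blocks\<close>

lemma schwartz_cnj:
  fixes f :: "'a::euclidean_space \<Rightarrow> complex"
  assumes "f \<in> schwartz"
  shows "(\<lambda>x. cnj (f x)) \<in> schwartz"
proof -
  have "{(\<lambda>x. cnj (f x)) | f :: 'a \<Rightarrow> complex. f \<in> schwartz} \<subseteq> schwartz" (is "?X \<subseteq> _")
  proof (rule schwartz_coinduct)
    fix h assume h: "h \<in> ?X"
    then obtain f :: "'a \<Rightarrow> complex" where f: "f \<in> schwartz" "h = (\<lambda>x. cnj (f x))" by blast
    have D: "(h has_derivative (\<lambda>v. cnj (\<Sum>b\<in>Basis. (v \<bullet> b) *\<^sub>R partial_deriv b f x))) (at x)" for x
      unfolding f(2) by (rule has_derivative_cnj[OF schwartz_has_derivative[OF f(1)]])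
    then show "h differentiable at x" for x unfolding differentiable_def by blast
    show "rapid h" using schwartz_rapid[OF f(1)] unfolding rapid_def f(2) by simp
    show "partial_deriv b h \<in> sum_closure ?X" if b: "b \<in> Basis" for b
    proof -
      have "partial_deriv b h = (\<lambda>x. cnj (partial_deriv b f x))"
        using partial_derivI[OF D, of b] b
        by (auto simp: inner_Basis if_distrib[of "\<lambda>x. x *\<^sub>R _"] cong: if_cong)
      then show ?thesis using schwartz_partial_deriv[OF f(1) b] by (intro sum_closure.base) blast
    qed
  qed
  then show ?thesis using assms by blast
qed

lemma schwartz_dilate:
  fixes f :: "'a::euclidean_space \<Rightarrow> complex"
  assumes "f \<in> schwartz" "a > 0"
  shows "(\<lambda>x. f (a *\<^sub>R x)) \<in> schwartz"
  by (rule schwartz_linear_image[of _ a]) (use assms in \<open>auto intro: bounded_linear_intros\<close>)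

section \<open>Bump functions and uniqueness of continuous representatives\<close>

lemma schwartz_imp_test_fun:
  assumes "f \<in> schwartz" "compact K" "K \<subseteq> U" "\<And>x. x \<notin> K \<Longrightarrow> f x = 0"
  shows "f \<in> test_funs U"
  using assms unfolding test_funs_def schwartz_def by blast

lemma lp_generator_schwartz: "lp_generator \<phi>0 \<Longrightarrow> \<phi>0 \<in> schwartz"
  unfolding lp_generator_def using test_funs_subset_schwartz by blast

text \<open>The generator may take complex values, so its squared modulus is used; it is smooth as
  the product of the generator with its conjugate.\<close>

lemma exists_bump:
  fixes \<phi>0 :: "'a::euclidean_space \<Rightarrow> complex"
  assumes gen: "lp_generator \<phi>0" and r: "r > 0" "cball x r \<subseteq> U"
  obtains \<eta> :: "'a \<Rightarrow> real" where "(\<lambda>y. complex_of_real (\<eta> y)) \<in> test_funs U" "\<And>y. \<eta> y \<ge> 0"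
    "\<And>y. y \<notin> cball x r \<Longrightarrow> \<eta> y = 0" "(LINT y|lborel. \<eta> y) > 0" "integrable lborel \<eta>"
proof -
  \<comment> \<open>Under this dilation the ball of radius \<open>r / 2\<close> goes to the unit
    ball, where the generator is 1, and points outside the ball of radius \<open>r\<close> go beyond
    \<open>3/2\<close>, where it vanishes.\<close>
  define a where "a = 2 / r"
  define \<eta> where "\<eta> y = (norm (\<phi>0 (a *\<^sub>R (y - x))))\<^sup>2" for y
  have a: "a > 0" using r by (simp add: a_def)
  have norm_a: "norm (a *\<^sub>R (y - x)) = a * dist x y" for y
    using a by (simp add: dist_norm norm_minus_commute)
  have p: "(\<lambda>y. \<phi>0 (a *\<^sub>R (y - x))) \<in> schwartz"
    by (rule schwartz_translate(1)[OF schwartz_dilate[OF lp_generator_schwartz[OF gen] a]])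
  have e: "complex_of_real (\<eta> y) = \<phi>0 (a *\<^sub>R (y - x)) * cnj (\<phi>0 (a *\<^sub>R (y - x)))" for y
    unfolding \<eta>_def complex_norm_square ..
  have S: "(\<lambda>y. complex_of_real (\<eta> y)) \<in> schwartz"
    unfolding e by (intro schwartz_mult schwartz_cnj p)
  have z: "\<eta> y = 0" if "y \<notin> cball x r" for y
  proof -
    have "a * r < a * dist x y" using that a by simp
    then have "norm (a *\<^sub>R (y - x)) \<ge> 3/2"
      using r unfolding norm_a by (simp add: a_def)
    then show ?thesis using gen by (simp add: \<eta>_def lp_generator_def)
  qed
  have int: "integrable lborel \<eta>" using schwartz_integrable[OF S] complex_of_real_integrable_eq by blast
  have "(LINT y|lborel. \<eta> y) \<ge> (LINT y|lborel. indicator (cball x (r/2)) y)"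
  proof (rule integral_mono[OF _ int])
    show "integrable lborel (indicator (cball x (r/2)) :: 'a \<Rightarrow> real)"
      using emeasure_bounded_finite[OF bounded_cball] by (intro integrable_real_indicator) auto
    fix y
    show "indicator (cball x (r/2)) y \<le> \<eta> y"
    proof (cases "y \<in> cball x (r/2)")
      case True
      then have "a * dist x y \<le> a * (r / 2)" using a by (intro mult_left_mono) auto
      then have "norm (a *\<^sub>R (y - x)) \<le> 1" using r unfolding norm_a by (simp add: a_def)
      then show ?thesis using gen True by (simp add: \<eta>_def lp_generator_def)
    qed (simp add: \<eta>_def)
  qed
  moreover have "(LINT y|lborel. indicator (cball x (r/2)) y :: real) > 0"
  proof -
    have "measure lborel (cball x (r/2)) > 0"
      using content_cball_pos[of "r/2" x] r by (simp add: measure_completion)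
    then show ?thesis by simp
  qed
  ultimately have pos: "(LINT y|lborel. \<eta> y) > 0" by (rule less_le_trans[rotated])
  have "\<eta> y \<ge> 0" for y by (simp add: \<eta>_def)
  with pos show ?thesis
    by (intro that[of \<eta>] schwartz_imp_test_fun[OF S compact_cball r(2)] z int) (auto simp: z)
qed

text \<open>The fundamental lemma of the calculus of variations. Near \<open>x\<close> the
  difference \<open>k\<close> stays within half of its modulus at \<open>x\<close>, so its integral
  against a nonnegative bump cannot vanish. The generator supplies the bump.\<close>

lemma agrees_on_unique:
  fixes g h :: "'a::euclidean_space \<Rightarrow> complex"
  assumes gen: "lp_generator (\<phi>0 :: 'a \<Rightarrow> complex)" and U: "open U"
    and g: "continuous_on U g" "agrees_on U T g" and h: "continuous_on U h" "agrees_on U T h" and x: "x \<in> U"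
  shows "g x = h x"
proof (rule ccontr)
  assume ne: "g x \<noteq> h x"
  define k where "k y = g y - h y" for y
  have k: "continuous_on U k" "k x \<noteq> 0" unfolding k_def using ne by (auto intro!: continuous_intros g h)
  then have "\<exists>d>0. \<forall>y\<in>U. dist y x < d \<longrightarrow> dist (k y) (k x) < norm (k x) / 2"
    using x unfolding continuous_on_iff by (metis half_gt_zero zero_less_norm_iff)
  then obtain d where d: "d > 0" "\<And>y. y \<in> U \<Longrightarrow> dist y x < d \<Longrightarrow> dist (k y) (k x) < norm (k x) / 2" by blast
  obtain e where e: "e > 0" "cball x e \<subseteq> U" using U x open_contains_cball by blast
  define r where "r = min e (d/2)"
  have r: "r > 0" "cball x r \<subseteq> U" "\<And>y. y \<in> cball x r \<Longrightarrow> dist y x < d"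
    using e d by (auto simp: r_def dist_commute intro: subset_trans[OF subset_cball])
  obtain \<eta> :: "'a \<Rightarrow> real" where \<eta>: "(\<lambda>y. complex_of_real (\<eta> y)) \<in> test_funs U" "\<And>y. \<eta> y \<ge> 0"
    "\<And>y. y \<notin> cball x r \<Longrightarrow> \<eta> y = 0" "(LINT y|lborel. \<eta> y) > 0" "integrable lborel \<eta>"
    using exists_bump[OF gen r(1,2)] by metis
  have i: "integrable lborel (\<lambda>y. g y * of_real (\<eta> y))" "integrable lborel (\<lambda>y. h y * of_real (\<eta> y))"
    and "(LINT y|lborel. g y * of_real (\<eta> y)) = (LINT y|lborel. h y * of_real (\<eta> y))"
    using g(2) h(2) \<eta>(1) unfolding agrees_on_def by auto
  then have 0: "(LINT y|lborel. k y * of_real (\<eta> y)) = 0"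
    unfolding k_def left_diff_distrib by (subst Bochner_Integration.integral_diff[OF i]) simp
  have ik: "integrable lborel (\<lambda>y. k y * of_real (\<eta> y))"
    unfolding k_def left_diff_distrib by (intro Bochner_Integration.integrable_diff i)
  have ic: "integrable lborel (\<lambda>y. k x * of_real (\<eta> y))" using \<eta>(5) by simp
  have "norm (LINT y|lborel. k y * of_real (\<eta> y) - k x * of_real (\<eta> y)) \<le> (LINT y|lborel. norm (k x) / 2 * \<eta> y)"
  proof (intro order_trans[OF integral_norm_bound] integral_mono)
    show "integrable lborel (\<lambda>y. norm (k x) / 2 * \<eta> y)" using \<eta>(5) by simp
    show "integrable lborel (\<lambda>y. norm (k y * of_real (\<eta> y) - k x * of_real (\<eta> y)))"
      by (intro integrable_norm Bochner_Integration.integrable_diff ik ic)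
    fix y
    show "norm (k y * of_real (\<eta> y) - k x * of_real (\<eta> y)) \<le> norm (k x) / 2 * \<eta> y"
    proof (cases "y \<in> cball x r")
      case True
      then have "norm (k y - k x) \<le> norm (k x) / 2" using d(2)[of y] r by (force simp: dist_norm)
      then have "norm (k y - k x) * \<eta> y \<le> norm (k x) / 2 * \<eta> y" using \<eta>(2) by (intro mult_right_mono) auto
      then show ?thesis using \<eta>(2)[of y] by (simp add: left_diff_distrib[symmetric] norm_mult)
    qed (simp add: \<eta>(3))
  qed
  moreover have "(LINT y|lborel. k y * of_real (\<eta> y) - k x * of_real (\<eta> y)) = - (k x * of_real (LINT y|lborel. \<eta> y))"
    by (subst Bochner_Integration.integral_diff[OF ik ic]) (simp add: 0)
  ultimately have "norm (k x) * (LINT y|lborel. \<eta> y) \<le> norm (k x) / 2 * (LINT y|lborel. \<eta> y)"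
    using \<eta>(4) by (simp add: norm_mult)
  then show False using \<eta>(4) k(2) by simp
qed

lemma cont_rep_eq:
  fixes g :: "'a::euclidean_space \<Rightarrow> complex"
  assumes gen: "lp_generator (\<phi>0 :: 'a \<Rightarrow> complex)" and U: "open U"
    and g: "continuous_on U g" "agrees_on U T g" and x: "x \<in> U"
  shows "cont_rep U T x = g x"
proof -
  have "continuous_on U (cont_rep U T) \<and> agrees_on U T (cont_rep U T)"
    unfolding cont_rep_def by (rule someI[of _ g]) (use g in auto)
  then show ?thesis using agrees_on_unique[OF gen U _ _ g x] by blast
qed

text \<open>The telescoped partial sum of the dyadic functions. It has a second use as a reproducing
  multiplier, since \<open>cutoff \<phi>0 (Suc j)\<close> equals 1 wherever
  \<open>dyadic \<phi>0 j\<close> is nonzero.\<close>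

definition cutoff :: "('a::euclidean_space \<Rightarrow> complex) \<Rightarrow> nat \<Rightarrow> 'a \<Rightarrow> complex" where
  "cutoff \<phi>0 J \<xi> = \<phi>0 ((2 powr (- real J)) *\<^sub>R \<xi>)"

lemma dyadic_0: "dyadic \<phi>0 0 = cutoff \<phi>0 0"
  by (simp add: dyadic_def cutoff_def fun_eq_iff)

lemma dyadic_Suc: "dyadic \<phi>0 (Suc j) = (\<lambda>\<xi>. cutoff \<phi>0 (Suc j) \<xi> - cutoff \<phi>0 j \<xi>)"
proof -
  have "- real (Suc j) + 1 = - real j" by simp
  then show ?thesis unfolding dyadic_def cutoff_def fun_eq_iff by simp
qed

lemma sum_dyadic: "(\<Sum>j\<le>J. dyadic \<phi>0 j \<xi>) = cutoff \<phi>0 J \<xi>"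
  by (induction J) (auto simp: dyadic_0 dyadic_Suc)

lemma schwartz_cutoff: "lp_generator \<phi>0 \<Longrightarrow> cutoff \<phi>0 J \<in> schwartz"
  unfolding cutoff_def[abs_def] by (intro schwartz_dilate lp_generator_schwartz) auto

lemma schwartz_dyadic: "lp_generator \<phi>0 \<Longrightarrow> dyadic \<phi>0 j \<in> schwartz"
  by (cases j) (auto simp: dyadic_0 dyadic_Suc intro!: schwartz_diff schwartz_cutoff)

lemma cutoff_eq_1: "lp_generator \<phi>0 \<Longrightarrow> norm \<xi> \<le> 2 ^ J \<Longrightarrow> cutoff \<phi>0 J \<xi> = 1"
  unfolding lp_generator_def cutoff_def by (simp add: powr_minus powr_realpow field_simps)

lemma cutoff_eq_0: "lp_generator \<phi>0 \<Longrightarrow> norm \<xi> \<ge> 3/2 * 2 ^ J \<Longrightarrow> cutoff \<phi>0 J \<xi> = 0"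
  unfolding lp_generator_def cutoff_def by (simp add: powr_minus powr_realpow field_simps)

lemma dyadic_support:
  assumes "lp_generator \<phi>0" "dyadic \<phi>0 j \<xi> \<noteq> 0"
  shows "norm \<xi> < 3/2 * 2 ^ j" and "j > 0 \<Longrightarrow> norm \<xi> > 2 ^ (j - 1)"
proof -
  show "norm \<xi> < 3/2 * 2 ^ j"
  proof (rule ccontr)
    assume a: "\<not> ?thesis"
    then have "cutoff \<phi>0 j \<xi> = 0" using cutoff_eq_0[OF assms(1)] by simp
    moreover have "cutoff \<phi>0 i \<xi> = 0" if "j = Suc i" for i
      using a that zero_le_power[of "2::real" i, OF zero_le_numeral] by (intro cutoff_eq_0[OF assms(1)]) (simp only: that power_Suc; linarith)
    ultimately show False using assms(2) by (cases j) (auto simp: dyadic_0 dyadic_Suc)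
  qed
  show "norm \<xi> > 2 ^ (j - 1)" if "j > 0"
  proof (rule ccontr)
    assume a: "\<not> ?thesis"
    obtain i where i: "j = Suc i" using \<open>j > 0\<close> by (cases j) auto
    have "norm \<xi> \<le> 2 ^ i" using a i by simp
    moreover from this have "norm \<xi> \<le> 2 ^ Suc i"
      using zero_le_power[of "2::real" i] by (simp only: power_Suc) linarith
    ultimately show False using assms cutoff_eq_1[OF assms(1)] by (simp add: i dyadic_Suc del: power_Suc)
  qed
qed

lemma cutoff_mult_dyadic:
  assumes "lp_generator \<phi>0"
  shows "dyadic \<phi>0 j \<xi> * cutoff \<phi>0 (Suc j) \<xi> = dyadic \<phi>0 j \<xi>"
proof (cases "dyadic \<phi>0 j \<xi> = 0")
  case False
  have "norm \<xi> \<le> 2 ^ Suc j" using dyadic_support(1)[OF assms False] by (simp only: power_Suc) (use zero_le_power[of "2::real" j] in linarith)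
  then show ?thesis using cutoff_eq_1[OF assms] by simp
qed simp

text \<open>On the annulus of index \<open>j\<close> the partial sum up to \<open>j + 1\<close> is
  already 1, while the partial sum up to \<open>j - 2\<close> still vanishes. For
  \<open>j < 2\<close> truncated subtraction makes the range start at 0, and the whole partial sum
  is taken.\<close>

lemma sum_dyadic_neighbours:
  assumes gen: "lp_generator \<phi>0" and u: "norm \<xi> < 3/2 * 2 ^ j" and l: "j > 0 \<Longrightarrow> norm \<xi> > 2 ^ (j - 1)"
  shows "(\<Sum>i\<in>{j - 1..j + 1}. dyadic \<phi>0 i \<xi>) = 1"
proof -
  have 1: "cutoff \<phi>0 (Suc j) \<xi> = 1"
    using u zero_le_power[of "2::real" j, OF zero_le_numeral] by (intro cutoff_eq_1[OF gen]) (simp only: power_Suc; linarith)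
  show ?thesis
  proof (cases "j \<ge> 2")
    case False
    then have "{j - 1..j + 1} = {..Suc j}" by auto
    then show ?thesis using 1 by (simp only: sum_dyadic)
  next
    case True
    then obtain i where i: "j = Suc (Suc i)" by (metis add_2_eq_Suc le_Suc_ex)
    have "norm \<xi> > 2 ^ Suc i" using l i by simp
    then have 0: "cutoff \<phi>0 i \<xi> = 0"
      using zero_le_power[of "2::real" i, OF zero_le_numeral] by (intro cutoff_eq_0[OF gen]) (simp only: power_Suc; linarith)
    have "{..Suc j} = {..i} \<union> {j - 1..j + 1}" "{..i} \<inter> {j - 1..j + 1} = {}" using i by auto
    then have "(\<Sum>i\<le>Suc j. dyadic \<phi>0 i \<xi>) = (\<Sum>i\<le>i. dyadic \<phi>0 i \<xi>) + (\<Sum>i\<in>{j - 1..j + 1}. dyadic \<phi>0 i \<xi>)"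
      by (metis finite_atMost finite_atLeastAtMost sum.union_disjoint)
    then show ?thesis unfolding sum_dyadic 0 1 by simp
  qed
qed

text \<open>The function \<open>\<phi>(D) T\<close>, that is, the convolution of \<open>T\<close> with a multiple of \<open>inv_fourier \<phi>\<close>.\<close>

definition block :: "('a::euclidean_space \<Rightarrow> complex) \<Rightarrow> (('a \<Rightarrow> complex) \<Rightarrow> complex) \<Rightarrow> 'a \<Rightarrow> complex" where
  "block \<phi> T y = of_real (fourier_const TYPE('a)) * T (\<lambda>w. fourier \<phi> (w - y))"

text \<open>Identifies the pointwise definition of \<open>block\<close> with the distribution
  obtained by multiplying with \<open>\<phi>\<close> on the Fourier side. The derivatives required
  by the exchange lemma come for free: differentiating a Fourier transform multiplies
  \<open>\<phi>\<close> by \<open>monom bs\<close>, and the convolution theorem applies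
  again.\<close>

lemma block_pairing:
  fixes T :: "('a::euclidean_space \<Rightarrow> complex) \<Rightarrow> complex"
  assumes T: "T \<in> tempered_dists" and \<phi>: "\<phi> \<in> schwartz" and \<psi>: "\<psi> \<in> schwartz"
  shows "integrable lborel (\<lambda>y. block \<phi> T y * \<psi> y)"
    and "T (fourier (\<lambda>\<xi>. \<phi> \<xi> * inv_fourier \<psi> \<xi>)) = (LINT y|lborel. block \<phi> T y * \<psi> y)"
proof -
  let ?c = "complex_of_real (fourier_const TYPE('a))"
  have c: "?c \<noteq> 0" using fourier_const_pos[of "TYPE('a)"] by simp
  \<comment> \<open>Division by the Fourier constant makes \<open>\<Psi>\<close> exactly the
    convolution of \<open>\<psi>\<close> with \<open>fourier \<phi>\<close>.\<close>
  define \<Psi> where "\<Psi> w = (1 / ?c) * fourier (\<lambda>\<xi>. \<phi> \<xi> * inv_fourier \<psi> \<xi>) w" for w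
  have P: "(\<lambda>\<xi>. \<phi> \<xi> * inv_fourier \<psi> \<xi>) \<in> schwartz" by (intro schwartz_mult \<phi> schwartz_inv_fourier \<psi>)
  have F: "fourier (\<lambda>\<xi>. \<phi> \<xi> * inv_fourier \<psi> \<xi>) \<in> schwartz" by (rule schwartz_fourier[OF P])
  have \<Psi>: "\<Psi> \<in> schwartz" unfolding \<Psi>_def[abs_def] by (rule schwartz_cmult[OF F])
  have d: "iter_deriv bs \<Psi> w = (LINT y|lborel. \<psi> y * iter_deriv bs (fourier \<phi>) (w - y))" if bs: "bs \<in> multi_indices" for bs w
  proof -
    have M: "(\<lambda>\<xi>. monom bs \<xi> * \<phi> \<xi>) \<in> schwartz" by (rule schwartz_monom_mult[OF \<phi>])
    have "iter_deriv bs \<Psi> w = (1 / ?c) * fourier (\<lambda>\<xi>. (monom bs \<xi> * \<phi> \<xi>) * inv_fourier \<psi> \<xi>) w"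
      unfolding \<Psi>_def[abs_def] schwartz_iter_deriv_cmult[OF bs F] iter_deriv_fourier[OF bs P] by (simp only: mult.assoc)
    also have "\<dots> = (LINT y|lborel. \<psi> y * fourier (\<lambda>\<xi>. monom bs \<xi> * \<phi> \<xi>) (w - y))"
      unfolding fourier_modulated_mult[OF schwartz_integrable[OF M] schwartz_integrable[OF \<psi>]] using c by simp
    finally show ?thesis unfolding iter_deriv_fourier[OF bs \<phi>] .
  qed
  note E = tempered_integral_exchange[OF T schwartz_fourier[OF \<phi>] \<psi> \<Psi> d]
  have "integrable lborel (\<lambda>y. ?c * (\<psi> y * T (\<lambda>w. fourier \<phi> (w - y))))" by (intro integrable_mult_right E)
  then show "integrable lborel (\<lambda>y. block \<phi> T y * \<psi> y)" unfolding block_def by (simp add: mult_ac)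
  have "T (fourier (\<lambda>\<xi>. \<phi> \<xi> * inv_fourier \<psi> \<xi>)) = ?c * T \<Psi>"
    unfolding \<Psi>_def[abs_def] tempered_cmult[OF T F] using c by simp
  also have "\<dots> = (LINT y|lborel. ?c * (\<psi> y * T (\<lambda>w. fourier \<phi> (w - y))))" using E(2) by simp
  also have "\<dots> = (LINT y|lborel. block \<phi> T y * \<psi> y)" unfolding block_def by (simp only: mult_ac)
  finally show "T (fourier (\<lambda>\<xi>. \<phi> \<xi> * inv_fourier \<psi> \<xi>)) = (LINT y|lborel. block \<phi> T y * \<psi> y)" .
qed

lemma block_continuous:
  assumes "T \<in> tempered_dists" "\<phi> \<in> schwartz"
  shows "continuous_on A (block \<phi> T)"
  unfolding block_def[abs_def]
  by (intro continuous_at_imp_continuous_on ballI continuous_intros tempered_translate_continuous assms schwartz_fourier)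

lemma block_growth:
  fixes T :: "('a::euclidean_space \<Rightarrow> complex) \<Rightarrow> complex"
  assumes "T \<in> tempered_dists" "\<phi> \<in> schwartz"
  obtains C N where "C > 0" "\<And>y. norm (block \<phi> T y) \<le> C * (1 + norm y) ^ N"
proof -
  obtain C N where "C > 0" "\<And>v. norm (T (\<lambda>w. fourier \<phi> (w - v))) \<le> C * (1 + norm v) ^ N"
    using tempered_translate_growth[OF assms(1) schwartz_fourier[OF assms(2)]] by metis
  then show ?thesis using fourier_const_pos[of "TYPE('a)"]
    by (intro that[of "fourier_const TYPE('a) * C" N]) (auto simp: block_def norm_mult mult.assoc intro!: mult_left_mono)
qed

lemma dist_block_apply:
  assumes "lp_generator \<phi>0" "\<psi> \<in> schwartz"
  shows "dist_inv_fourier (dist_mult (dyadic \<phi>0 j) (dist_fourier f)) \<psi> = f (fourier (\<lambda>\<xi>. dyadic \<phi>0 j \<xi> * inv_fourier \<psi> \<xi>))"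
  using schwartz_inv_fourier[OF assms(2)] schwartz_mult[OF schwartz_dyadic[OF assms(1), of j] schwartz_inv_fourier[OF assms(2)]] assms(2)
  by (simp add: dist_inv_fourier_def dist_mult_def dist_fourier_def)

lemma freq_block_eqI:
  fixes \<phi>0 :: "'a::euclidean_space \<Rightarrow> complex"
  assumes gen: "lp_generator \<phi>0" and "continuous_on UNIV g"
    and "\<And>\<psi>. \<psi> \<in> schwartz \<Longrightarrow> integrable lborel (\<lambda>y. g y * \<psi> y)"
    and "\<And>\<psi>. \<psi> \<in> schwartz \<Longrightarrow> f (fourier (\<lambda>\<xi>. dyadic \<phi>0 j \<xi> * inv_fourier \<psi> \<xi>)) = (LINT y|lborel. g y * \<psi> y)"
  shows "freq_block \<phi>0 j f = g"
proof
  fix x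
  have "agrees_on UNIV (dist_inv_fourier (dist_mult (dyadic \<phi>0 j) (dist_fourier f))) g"
    unfolding agrees_on_def
  proof
    fix \<psi> :: "'a \<Rightarrow> complex" assume "\<psi> \<in> test_funs UNIV"
    then have \<psi>: "\<psi> \<in> schwartz" using test_funs_subset_schwartz by blast
    show "integrable lborel (\<lambda>x. g x * \<psi> x) \<and> dist_inv_fourier (dist_mult (dyadic \<phi>0 j) (dist_fourier f)) \<psi> = (LINT x|lborel. g x * \<psi> x)"
      using assms(3,4)[OF \<psi>] dist_block_apply[OF gen \<psi>] by simp
  qed
  then show "freq_block \<phi>0 j f x = g x"
    unfolding freq_block_def using cont_rep_eq[OF gen open_UNIV assms(2)] by blast
qed

lemma freq_block_eq:
  fixes \<phi>0 :: "'a::euclidean_space \<Rightarrow> complex"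
  assumes gen: "lp_generator \<phi>0" and T: "T \<in> tempered_dists"
  shows "freq_block \<phi>0 j T = block (dyadic \<phi>0 j) T"
  by (intro freq_block_eqI[OF gen] block_continuous[OF T] block_pairing[OF T] schwartz_dyadic[OF gen])

section \<open>Convergence of the dyadic expansion\<close>

lemma fourier_cutoff:
  fixes \<phi>0 :: "'a::euclidean_space \<Rightarrow> complex"
  assumes gen: "lp_generator \<phi>0"
  shows "fourier (cutoff \<phi>0 J) v = of_real ((2 ^ J) ^ DIM('a)) * fourier \<phi>0 (2 ^ J *\<^sub>R v)"
  using fourier_scale[OF schwartz_measurable[OF schwartz_cutoff[OF gen, of J]], of "2 ^ J" v]
  by (simp add: cutoff_def powr_minus powr_realpow)

lemma integral_fourier_generator:
  fixes \<phi>0 :: "'a::euclidean_space \<Rightarrow> complex"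
  assumes gen: "lp_generator \<phi>0"
  shows "of_real (fourier_const TYPE('a)) * (LINT z|lborel. fourier \<phi>0 z) = 1"
proof -
  have "inv_fourier (fourier \<phi>0) 0 = \<phi>0 0" by (simp add: inv_fourier_fourier[OF lp_generator_schwartz[OF gen]])
  then show ?thesis using gen by (simp add: inv_fourier_eq fourier_altdef lp_generator_def)
qed

lemma monom_inv_fourier:
  assumes "bs \<in> multi_indices" "\<psi> \<in> schwartz"
  shows "(\<lambda>\<xi>. monom bs \<xi> * inv_fourier \<psi> \<xi>) = inv_fourier (iter_deriv bs \<psi>)"
proof -
  have S: "(\<lambda>\<xi>. monom bs \<xi> * inv_fourier \<psi> \<xi>) \<in> schwartz" by (intro schwartz_monom_mult schwartz_inv_fourier assms)
  have "iter_deriv bs \<psi> = fourier (\<lambda>\<xi>. monom bs \<xi> * inv_fourier \<psi> \<xi>)"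
    using iter_deriv_fourier[OF assms(1) schwartz_inv_fourier[OF assms(2)]] by (simp add: fourier_inversion[OF assms(2)])
  then show ?thesis by (simp add: inv_fourier_fourier[OF S])
qed

text \<open>The cutoffs act on \<open>\<psi>\<close> as averages against dilates of
  \<open>fourier \<phi>0\<close>. By inversion at the origin and \<open>\<phi>0 0 = 1\<close> the
  normalised kernel has total integral 1, so only differences of translates of \<open>\<psi>\<close>
  remain. In each seminorm they are of order \<open>2^(-J)\<close>, and continuity of
  \<open>T\<close> finishes.\<close>

lemma cutoff_approximation:
  fixes T :: "('a::euclidean_space \<Rightarrow> complex) \<Rightarrow> complex"
  assumes gen: "lp_generator \<phi>0" and T: "T \<in> tempered_dists" and \<psi>: "\<psi> \<in> schwartz"
  shows "(\<lambda>J. T (fourier (\<lambda>\<xi>. cutoff \<phi>0 J \<xi> * inv_fourier \<psi> \<xi>))) \<longlonglongrightarrow> T \<psi>"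
proof -
  let ?c = "complex_of_real (fourier_const TYPE('a))"
  let ?\<Phi> = "fourier \<phi>0"
  have S0: "?\<Phi> \<in> schwartz" by (rule schwartz_fourier[OF lp_generator_schwartz[OF gen]])
  have [measurable]: "?\<Phi> \<in> borel_measurable borel" by (rule schwartz_measurable[OF S0])
  define P where "P J = (\<lambda>\<xi>. cutoff \<phi>0 J \<xi> * inv_fourier \<psi> \<xi>)" for J
  have PS: "P J \<in> schwartz" for J unfolding P_def by (intro schwartz_mult schwartz_cutoff[OF gen] schwartz_inv_fourier \<psi>)
  have conv: "fourier (\<lambda>\<xi>. cutoff \<phi>0 J \<xi> * inv_fourier \<psi> \<xi>) w = ?c * (LINT z|lborel. \<psi> (w - (1 / 2 ^ J) *\<^sub>R z) * ?\<Phi> z)"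
    if \<psi>: "\<psi> \<in> schwartz" for J w \<psi>
  proof -
    have [measurable]: "\<psi> \<in> borel_measurable borel" by (rule schwartz_measurable[OF \<psi>])
    have "fourier (\<lambda>\<xi>. cutoff \<phi>0 J \<xi> * inv_fourier \<psi> \<xi>) w = ?c * (LINT y|lborel. \<psi> y * (of_real ((2 ^ J) ^ DIM('a)) * ?\<Phi> (2 ^ J *\<^sub>R (w - y))))"
      unfolding fourier_modulated_mult[OF schwartz_integrable[OF schwartz_cutoff[OF gen]] schwartz_integrable[OF \<psi>]] fourier_cutoff[OF gen] ..
    also have "(LINT y|lborel. \<psi> y * (of_real ((2 ^ J) ^ DIM('a)) * ?\<Phi> (2 ^ J *\<^sub>R (w - y))))
       = (LINT z|lborel. \<psi> (w - (1 / 2 ^ J) *\<^sub>R z) * ?\<Phi> z)"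
      by (subst integral_lborel_affine[of _ "- 1 / 2 ^ J" w])
        (auto simp: field_simps power_divide simp flip: integral_mult_right_zero)
    finally show ?thesis .
  qed
  obtain C N where C: "C \<ge> 0" "\<And>\<phi>. \<phi> \<in> schwartz \<Longrightarrow> norm (T \<phi>) \<le> C * schwartz_norm N \<phi>"
    using tempered_bound[OF T] by metis
  obtain D where D: "\<And>bs. D bs > 0" "\<And>bs w u v. bs \<in> multi_indices \<Longrightarrow>
    (1 + norm w) ^ N * norm (iter_deriv bs \<psi> (w - v) - iter_deriv bs \<psi> (w - u))
      \<le> D bs * (norm (u - v) * (1 + norm (u - v)) ^ N * (1 + norm u) ^ N)"
    using schwartz_norm_translate_diff[OF \<psi>, of N] by metis
  let ?D = "\<Sum>bs | bs \<in> (multi_indices :: 'a list set) \<and> length bs \<le> N. D bs"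
  \<comment> \<open>Moment of the kernel: \<open>N\<close> powers come from the seminorm and one
    more from the first-order difference, whose factor \<open>1 / 2 ^ J\<close> gives the
    rate.\<close>
  define E where "E = fourier_const TYPE('a) * (LINT z|lborel. (1 + norm z) ^ Suc N * norm (?\<Phi> z))"
  have iE: "integrable lborel (\<lambda>z. (1 + norm z) ^ k * norm (?\<Phi> z))" for k
    by (intro integrable_rapid_weighted schwartz_rapid S0) measurable
  have dn: "norm (T (fourier (P J)) - T \<psi>) \<le> C * (?D * (E * (1 / 2 ^ J)))" for J
  proof -
    note FS = schwartz_fourier[OF PS]
    have "norm (T (fourier (P J)) - T \<psi>) \<le> C * schwartz_norm N (\<lambda>w. fourier (P J) w - \<psi> w)"
      using C(2)[OF schwartz_diff[OF FS \<psi>]] by (simp add: tempered_diff[OF T FS \<psi>])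
    also have "\<dots> \<le> C * (?D * (E * (1 / 2 ^ J)))"
    proof (intro mult_left_mono schwartz_norm_le C(1))
      fix bs :: "'a list" and w assume bs: "bs \<in> multi_indices"
      let ?d = "iter_deriv bs \<psi>"
      have dS: "?d \<in> schwartz" by (rule schwartz_iter_deriv[OF \<psi> bs])
      have [measurable]: "?d \<in> borel_measurable borel" by (rule schwartz_measurable[OF dS])
      obtain B where B: "\<And>x. norm (?d x) \<le> B"
        using rapidE[OF schwartz_rapid[OF dS], of 0] by (metis power_0 mult_1)
      have i1: "integrable lborel (\<lambda>z. ?d (w - (1 / 2 ^ J) *\<^sub>R z) * ?\<Phi> z)"
        unfolding mult.commute[of _ "?\<Phi> _"] by (rule integrable_mult_bounded[OF schwartz_integrable[OF S0] _ B]) measurable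
      have i2: "integrable lborel (\<lambda>z. ?d w * ?\<Phi> z)" using schwartz_integrable[OF S0] by simp
      have "iter_deriv bs (fourier (P J)) w = fourier (\<lambda>\<xi>. cutoff \<phi>0 J \<xi> * inv_fourier ?d \<xi>) w"
        unfolding iter_deriv_fourier[OF bs PS] monom_inv_fourier[OF bs \<psi>, symmetric] by (simp only: P_def mult_ac)
      also have "\<dots> = ?c * (LINT z|lborel. ?d (w - (1 / 2 ^ J) *\<^sub>R z) * ?\<Phi> z)" by (rule conv[OF dS])
      finally have "iter_deriv bs (\<lambda>w. fourier (P J) w - \<psi> w) w = ?c * (LINT z|lborel. ?d (w - (1 / 2 ^ J) *\<^sub>R z) * ?\<Phi> z) - ?d w * (?c * (LINT z|lborel. ?\<Phi> z))"
        unfolding schwartz_iter_deriv_diff[OF bs FS \<psi>] integral_fourier_generator[OF gen] by simp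
      also have "\<dots> = ?c * (LINT z|lborel. ?d (w - (1 / 2 ^ J) *\<^sub>R z) * ?\<Phi> z - ?d w * ?\<Phi> z)"
        unfolding Bochner_Integration.integral_diff[OF i1 i2] by (simp add: algebra_simps)
      finally have "(1 + norm w) ^ N * norm (iter_deriv bs (\<lambda>w. fourier (P J) w - \<psi> w) w)
        = fourier_const TYPE('a) * ((1 + norm w) ^ N * norm (LINT z|lborel. ?d (w - (1 / 2 ^ J) *\<^sub>R z) * ?\<Phi> z - ?d w * ?\<Phi> z))"
        using fourier_const_pos[of "TYPE('a)"] by (simp add: norm_mult)
      also have "\<dots> \<le> fourier_const TYPE('a) * ((1 + norm w) ^ N * (LINT z|lborel. norm (?d (w - (1 / 2 ^ J) *\<^sub>R z) * ?\<Phi> z - ?d w * ?\<Phi> z)))"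
        using fourier_const_pos[of "TYPE('a)"] by (intro mult_left_mono integral_norm_bound) auto
      also have "\<dots> = fourier_const TYPE('a) * (LINT z|lborel. (1 + norm w) ^ N * norm (?d (w - (1 / 2 ^ J) *\<^sub>R z) * ?\<Phi> z - ?d w * ?\<Phi> z))"
        by simp
      also have "\<dots> \<le> fourier_const TYPE('a) * (LINT z|lborel. D bs * (1 / 2 ^ J) * ((1 + norm z) ^ Suc N * norm (?\<Phi> z)))"
      proof (intro mult_left_mono integral_mono)
        show "integrable lborel (\<lambda>z. (1 + norm w) ^ N * norm (?d (w - (1 / 2 ^ J) *\<^sub>R z) * ?\<Phi> z - ?d w * ?\<Phi> z))"
          by (intro integrable_mult_right integrable_norm Bochner_Integration.integrable_diff i1 i2)
        show "integrable lborel (\<lambda>z. D bs * (1 / 2 ^ J) * ((1 + norm z) ^ Suc N * norm (?\<Phi> z)))"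
          by (intro integrable_mult_right iE)
        fix z :: 'a
        let ?v = "(1 / 2 ^ J) *\<^sub>R z"
        have v: "norm ?v = (1 / 2 ^ J) * norm z" by simp
        have v1: "norm ?v \<le> norm z" unfolding v by (intro mult_left_le_one_le) (auto simp: divide_le_eq)
        have "(1 + norm w) ^ N * norm (?d (w - ?v) - ?d w) \<le> D bs * (norm ?v * (1 + norm ?v) ^ N)"
          using D(2)[OF bs, of w ?v 0] by simp
        also have "\<dots> \<le> D bs * ((1 / 2 ^ J * (1 + norm z)) * (1 + norm z) ^ N)"
          using D(1)[of bs] v1 by (intro mult_left_mono mult_mono power_mono) (auto simp: v divide_right_mono)
        also have "\<dots> = D bs * (1 / 2 ^ J) * (1 + norm z) ^ Suc N" by simp
        finally have "(1 + norm w) ^ N * norm (?d (w - ?v) - ?d w) \<le> D bs * (1 / 2 ^ J) * (1 + norm z) ^ Suc N" .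
        from mult_right_mono[OF this norm_ge_zero[of "?\<Phi> z"]]
        show "(1 + norm w) ^ N * norm (?d (w - ?v) * ?\<Phi> z - ?d w * ?\<Phi> z) \<le> D bs * (1 / 2 ^ J) * ((1 + norm z) ^ Suc N * norm (?\<Phi> z))"
          by (simp only: left_diff_distrib[symmetric] norm_mult mult.assoc)
      qed (use fourier_const_pos[of "TYPE('a)"] in auto)
      also have "\<dots> = D bs * (E * (1 / 2 ^ J))" unfolding integral_mult_right_zero E_def by simp
      finally show "(1 + norm w) ^ N * norm (iter_deriv bs (\<lambda>w. fourier (P J) w - \<psi> w) w) \<le> D bs * (E * (1 / 2 ^ J))" .
    qed
    finally show ?thesis .
  qed
  have "(\<lambda>J. 1 / 2 ^ J) \<longlonglongrightarrow> (0::real)" using LIMSEQ_power_zero[of "1/2::real"] by (simp add: power_divide)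
  then have "(\<lambda>J. C * (?D * (E * (1 / 2 ^ J)))) \<longlonglongrightarrow> C * (?D * (E * 0))"
    by (intro tendsto_mult tendsto_const)
  then have lim: "(\<lambda>J. C * (?D * (E * (1 / 2 ^ J)))) \<longlonglongrightarrow> 0" by simp
  have "(\<lambda>J. T (fourier (P J)) - T \<psi>) \<longlonglongrightarrow> 0"
    by (rule Lim_null_comparison[OF _ lim]) (intro always_eventually allI dn)
  then show ?thesis unfolding P_def by (simp add: LIM_zero_iff)
qed

lemma block_sum_tendsto:
  fixes T :: "('a::euclidean_space \<Rightarrow> complex) \<Rightarrow> complex"
  assumes gen: "lp_generator \<phi>0" and T: "T \<in> tempered_dists" and \<psi>: "\<psi> \<in> schwartz"
  shows "(\<lambda>J. \<Sum>j\<le>J. LINT y|lborel. block (dyadic \<phi>0 j) T y * \<psi> y) \<longlonglongrightarrow> T \<psi>"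
proof -
  have "(\<Sum>j\<le>J. LINT y|lborel. block (dyadic \<phi>0 j) T y * \<psi> y) = T (fourier (\<lambda>\<xi>. cutoff \<phi>0 J \<xi> * inv_fourier \<psi> \<xi>))" for J
  proof -
    have S: "(\<lambda>\<xi>. dyadic \<phi>0 j \<xi> * inv_fourier \<psi> \<xi>) \<in> schwartz" for j
      by (intro schwartz_mult schwartz_dyadic[OF gen] schwartz_inv_fourier \<psi>)
    have "fourier (\<lambda>\<xi>. \<Sum>j\<le>J. dyadic \<phi>0 j \<xi> * inv_fourier \<psi> \<xi>) = (\<lambda>w. \<Sum>j\<le>J. fourier (\<lambda>\<xi>. dyadic \<phi>0 j \<xi> * inv_fourier \<psi> \<xi>) w)"
    proof (induction J)
      case (Suc J)
      have "(\<lambda>\<xi>. \<Sum>j\<le>J. dyadic \<phi>0 j \<xi> * inv_fourier \<psi> \<xi>) \<in> schwartz" by (intro schwartz_sum S)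
      then show ?case using Suc fourier_add[OF schwartz_integrable schwartz_integrable[OF S]] by (auto simp: fun_eq_iff)
    qed simp
    moreover have "(\<lambda>\<xi>. cutoff \<phi>0 J \<xi> * inv_fourier \<psi> \<xi>) = (\<lambda>\<xi>. \<Sum>j\<le>J. dyadic \<phi>0 j \<xi> * inv_fourier \<psi> \<xi>)"
      by (simp add: sum_dyadic flip: sum_distrib_right)
    ultimately show ?thesis
      by (simp add: tempered_sum[OF T schwartz_fourier[OF S]] block_pairing(2)[OF T schwartz_dyadic[OF gen] \<psi>])
  qed
  then show ?thesis using cutoff_approximation[OF assms] by simp
qed

subsection \<open>Peetre maximal inequality\<close>

lemma fourier_modulate:
  fixes \<phi> :: "'a::euclidean_space \<Rightarrow> complex"
  shows "fourier (\<lambda>\<xi>. exp (\<i> * of_real (x \<bullet> \<xi>)) * \<phi> \<xi>) w = fourier \<phi> (w - x)"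
proof -
  have "exp (- \<i> * complex_of_real (\<xi> \<bullet> w)) * exp (\<i> * of_real (x \<bullet> \<xi>)) = exp (- \<i> * of_real (\<xi> \<bullet> (w - x)))" for \<xi>
    unfolding exp_add[symmetric] by (rule arg_cong[of _ _ exp]) (simp add: inner_diff_right inner_commute[of x] algebra_simps)
  then show ?thesis unfolding fourier_altdef mult.assoc[symmetric] by simp
qed

lemma inv_fourier_translate:
  fixes f :: "'a::euclidean_space \<Rightarrow> complex"
  assumes "f \<in> borel_measurable borel"
  shows "inv_fourier (\<lambda>y. f (y - x)) \<xi> = exp (\<i> * of_real (x \<bullet> \<xi>)) * inv_fourier f \<xi>"
  using fourier_translate[OF assms, of "- x" "- \<xi>"] by (simp add: inv_fourier_eq)

lemma inv_fourier_cmult: "inv_fourier (\<lambda>x. c * f x) \<xi> = c * inv_fourier f \<xi>"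
  by (simp add: inv_fourier_eq fourier_cmult)

text \<open>A frequency-localised function is unchanged by a multiplier that is 1 on its spectrum.
  Expressing a block through itself is what the absorption argument of Peetre starts from.\<close>

lemma reproducing:
  fixes \<phi>0 :: "'a::euclidean_space \<Rightarrow> complex"
  assumes gen: "lp_generator \<phi>0" and T: "T \<in> tempered_dists"
  shows "block (dyadic \<phi>0 j) T x = (LINT y|lborel. block (dyadic \<phi>0 j) T y *
    (of_real (fourier_const TYPE('a)) * fourier (cutoff \<phi>0 (Suc j)) (y - x)))"
proof -
  let ?c = "complex_of_real (fourier_const TYPE('a))"
  note D = schwartz_dyadic[OF gen, of j] and Q = schwartz_cutoff[OF gen, of "Suc j"]
  define \<psi> where "\<psi> y = ?c * fourier (cutoff \<phi>0 (Suc j)) (y - x)" for y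
  have \<psi>: "\<psi> \<in> schwartz" unfolding \<psi>_def[abs_def] by (intro schwartz_cmult schwartz_translate schwartz_fourier Q)
  have "inv_fourier \<psi> \<xi> = ?c * (exp (\<i> * of_real (x \<bullet> \<xi>)) * cutoff \<phi>0 (Suc j) \<xi>)" for \<xi>
    unfolding \<psi>_def[abs_def] inv_fourier_cmult inv_fourier_translate[OF schwartz_measurable[OF schwartz_fourier[OF Q]]]
      inv_fourier_fourier[OF Q] ..
  then have eq: "(\<lambda>\<xi>. dyadic \<phi>0 j \<xi> * inv_fourier \<psi> \<xi>) = (\<lambda>\<xi>. ?c * (exp (\<i> * of_real (x \<bullet> \<xi>)) * (dyadic \<phi>0 j \<xi> * cutoff \<phi>0 (Suc j) \<xi>)))"
    by (simp add: fun_eq_iff)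
  then have "fourier (\<lambda>\<xi>. dyadic \<phi>0 j \<xi> * inv_fourier \<psi> \<xi>) = (\<lambda>w. ?c * fourier (dyadic \<phi>0 j) (w - x))"
    by (intro ext) (simp only: eq cutoff_mult_dyadic[OF gen] fourier_cmult fourier_modulate)
  then have "T (fourier (\<lambda>\<xi>. dyadic \<phi>0 j \<xi> * inv_fourier \<psi> \<xi>)) = block (dyadic \<phi>0 j) T x"
    unfolding block_def using tempered_cmult[OF T schwartz_translate(1)[OF schwartz_fourier[OF D]]] by simp
  then show ?thesis using block_pairing(2)[OF T D \<psi>] unfolding \<psi>_def by simp
qed

text \<open>Both kernels are needed at the same scale \<open>2^j\<close>: the first reproduces a
  block, the second enters after rotations. Passing between neighbouring scales costs the factors
  \<open>2 ^ DIM('a)\<close> and \<open>2 ^ M\<close>.\<close>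

lemma kernel_bound:
  fixes \<phi>0 :: "'a::euclidean_space \<Rightarrow> complex"
  assumes gen: "lp_generator \<phi>0"
  obtains C where "C > 0"
    "\<And>j v. norm (fourier (cutoff \<phi>0 (Suc j)) v) \<le> C * (2 ^ j) ^ DIM('a) / (1 + 2 ^ j * norm v) ^ M"
    "\<And>j v. norm (fourier (dyadic \<phi>0 j) v) \<le> C * (2 ^ j) ^ DIM('a) / (1 + 2 ^ j * norm v) ^ M"
proof -
  let ?d = "DIM('a)"
  obtain C where C: "C > 0" "\<And>x. (1 + norm x) ^ M * norm (fourier \<phi>0 x) \<le> C"
    using rapidE[OF schwartz_rapid[OF schwartz_fourier[OF lp_generator_schwartz[OF gen]]]] by metis
  have B: "norm (fourier (cutoff \<phi>0 j) v) \<le> C * (2 ^ j) ^ ?d / (1 + 2 ^ j * norm v) ^ M" for j v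
  proof -
    have "(1 + 2 ^ j * norm v) ^ M * norm (fourier \<phi>0 (2 ^ j *\<^sub>R v)) \<le> C" using C(2)[of "2 ^ j *\<^sub>R v"] by simp
    then have "norm (fourier \<phi>0 (2 ^ j *\<^sub>R v)) \<le> C / (1 + 2 ^ j * norm v) ^ M"
      by (simp add: pos_le_divide_eq zero_less_power add_pos_nonneg mult.commute)
    then have "(2 ^ j) ^ ?d * norm (fourier \<phi>0 (2 ^ j *\<^sub>R v)) \<le> (2 ^ j) ^ ?d * (C / (1 + 2 ^ j * norm v) ^ M)"
      by (intro mult_left_mono) auto
    then show ?thesis unfolding fourier_cutoff[OF gen] by (simp add: norm_mult norm_power mult.commute)
  qed
  have B1: "norm (fourier (cutoff \<phi>0 (Suc j)) v) \<le> (2 ^ ?d * C) * (2 ^ j) ^ ?d / (1 + 2 ^ j * norm v) ^ M" for j v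
  proof -
    have "C * (2 ^ Suc j) ^ ?d / (1 + 2 ^ Suc j * norm v) ^ M \<le> C * (2 ^ Suc j) ^ ?d / (1 + 2 ^ j * norm v) ^ M"
      using C by (intro divide_left_mono mult_pos_pos zero_less_power power_mono add_mono mult_right_mono)
        (auto intro!: add_pos_nonneg)
    moreover have e: "C * (2 ^ Suc j) ^ ?d = (2 ^ ?d * C) * (2 ^ j) ^ ?d" by (simp add: power_mult_distrib)
    ultimately show ?thesis using B[of "Suc j" v] unfolding e by linarith
  qed
  have B2: "norm (fourier (dyadic \<phi>0 j) v) \<le> (2 ^ ?d * C + 2 ^ M * C) * (2 ^ j) ^ ?d / (1 + 2 ^ j * norm v) ^ M" for j v
  proof (cases j)
    case 0
    have "C * (2 ^ j) ^ ?d / (1 + 2 ^ j * norm v) ^ M \<le> (2 ^ ?d * C + 2 ^ M * C) * (2 ^ j) ^ ?d / (1 + 2 ^ j * norm v) ^ M"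
      using C by (intro divide_right_mono mult_right_mono) (auto intro!: add_increasing2 zero_le_power add_nonneg_nonneg)
    then show ?thesis using B[of 0 v] 0 by (simp add: dyadic_0)
  next
    case (Suc i)
    have 2: "norm (fourier (cutoff \<phi>0 i) v) \<le> 2 ^ M * C * (2 ^ j) ^ ?d / (1 + 2 ^ j * norm v) ^ M"
    proof -
      have "1 + 2 ^ j * norm v \<le> 2 * (1 + 2 ^ i * norm v)" by (simp add: Suc)
      then have "(1 + 2 ^ j * norm v) ^ M \<le> 2 ^ M * (1 + 2 ^ i * norm v) ^ M"
        by (metis power_mono power_mult_distrib add_nonneg_nonneg norm_ge_zero zero_le_one zero_le_mult_iff zero_le_numeral zero_le_power)
      then have "1 / (1 + 2 ^ i * norm v) ^ M \<le> 2 ^ M / (1 + 2 ^ j * norm v) ^ M"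
        by (simp add: field_simps zero_less_power add_pos_nonneg)
      then have "C * (2 ^ i) ^ ?d * (1 / (1 + 2 ^ i * norm v) ^ M) \<le> C * (2 ^ j) ^ ?d * (2 ^ M / (1 + 2 ^ j * norm v) ^ M)"
        using C by (intro mult_mono power_mono) (auto simp: Suc)
      then show ?thesis using B[of i v] by (simp add: mult_ac)
    qed
    have "fourier (dyadic \<phi>0 j) v = fourier (cutoff \<phi>0 (Suc i)) v - fourier (cutoff \<phi>0 i) v"
      unfolding Suc dyadic_Suc by (intro fourier_diff schwartz_integrable schwartz_cutoff gen)
    then have "norm (fourier (dyadic \<phi>0 j) v) \<le> norm (fourier (cutoff \<phi>0 j) v) + norm (fourier (cutoff \<phi>0 i) v)"
      by (simp add: norm_triangle_ineq4 Suc)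
    also have "norm (fourier (cutoff \<phi>0 j) v) \<le> C * (2 ^ j) ^ ?d / (1 + 2 ^ j * norm v) ^ M" by (rule B)
    also have "\<dots> \<le> 2 ^ ?d * C * (2 ^ j) ^ ?d / (1 + 2 ^ j * norm v) ^ M"
      using C by (intro divide_right_mono mult_right_mono) (auto intro!: zero_le_power add_nonneg_nonneg)
    finally show ?thesis using 2 by (simp add: distrib_right add_divide_distrib)
  qed
  show ?thesis
  proof (rule that[of "2 ^ ?d * C + 2 ^ M * C"])
    show "0 < 2 ^ ?d * C + 2 ^ M * C" using C by (intro add_pos_pos) auto
    show "norm (fourier (cutoff \<phi>0 (Suc j)) v) \<le> (2 ^ ?d * C + 2 ^ M * C) * (2 ^ j) ^ ?d / (1 + 2 ^ j * norm v) ^ M" for j v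
      by (rule order_trans[OF B1]) (use C in \<open>auto intro!: divide_right_mono mult_right_mono zero_le_power add_nonneg_nonneg\<close>)
  qed (rule B2)
qed

lemma norm_integral_le_nn_integral:
  fixes f :: "'a \<Rightarrow> complex"
  shows "ennreal (norm (LINT x|M. f x)) \<le> (\<integral>\<^sup>+x. ennreal (norm (f x)) \<partial>M)"
  by (cases "integrable M f") (auto simp: integral_norm_bound_ennreal not_integrable_integral_eq)

text \<open>Let \<open>m\<close> be the supremum of \<open>norm (g y)\<close> divided by the growth
  factor. Splitting \<open>norm (g y)\<close> into its powers \<open>u\<close> and
  \<open>1 - u\<close> and bounding the latter by \<open>m\<close> gives
  \<open>m <= m^(1-u) * C * I\<close>, where \<open>I\<close> is the integral on the right. Dividing
  by \<open>m^(1-u)\<close> is legitimate only because \<open>B\<close> makes \<open>m\<close>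
  finite; the size of \<open>B\<close> does not enter the result.\<close>

lemma peetre_maximal:
  fixes g :: "'a::euclidean_space \<Rightarrow> complex" and L :: "'a \<Rightarrow> 'a \<Rightarrow> complex"
  assumes t: "t > 0" and u: "0 < u" "u \<le> 1" and a: "a * u \<ge> 2 * real DIM('a)" and C: "C > 0"
    and [measurable]: "g \<in> borel_measurable borel"
    and rep: "\<And>w. g w = (LINT y|lborel. g y * L w y)"
    and L: "\<And>w y. norm (L w y) \<le> C * (1 + t * norm (y - w)) powr (- a)"
    and B: "\<And>y. norm (g y) \<le> B * (1 + t * norm (y - z)) powr a"
  obtains m where "m \<ge> 0" "\<And>y. norm (g y) \<le> m * (1 + t * norm (y - z)) powr a"
    "ennreal (m powr u) \<le> ennreal C * (\<integral>\<^sup>+y. ennreal (norm (g y) powr u * weight (t *\<^sub>R (y - z))) \<partial>lborel)"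
proof -
  define n where "n v = 1 + t * norm v" for v :: 'a
  have n1: "n v \<ge> 1" for v using t by (simp add: n_def)
  have n0: "n v > 0" for v using n1[of v] by simp
  define q where "q y = norm (g y) / n (y - z) powr a" for y
  define m where "m = (SUP y. q y)"
  have bdd: "bdd_above (range q)"
  proof (rule bdd_aboveI2)
    show "q y \<le> B" for y using B[of y] n0[of "y - z"] by (simp add: q_def n_def divide_le_eq)
  qed
  have qm: "q y \<le> m" for y unfolding m_def by (rule cSUP_upper[OF _ bdd]) simp
  have m0: "m \<ge> 0" using qm[of z] n0 by (auto simp: q_def intro: order_trans[rotated])
  have gm: "norm (g y) \<le> m * n (y - z) powr a" for y
    using qm[of y] n0[of "y - z"] by (simp add: q_def divide_le_eq)
  define I where "I = (\<integral>\<^sup>+y. ennreal (norm (g y) powr u * weight (t *\<^sub>R (y - z))) \<partial>lborel)"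
  have main: "ennreal (norm (g w)) \<le> ennreal (m powr (1 - u) * C * n (w - z) powr a) * I" for w
  proof -
    have "ennreal (norm (g w)) \<le> (\<integral>\<^sup>+y. ennreal (norm (g y * L w y)) \<partial>lborel)"
      by (subst rep) (rule norm_integral_le_nn_integral)
    also have "\<dots> \<le> (\<integral>\<^sup>+y. ennreal (m powr (1 - u) * C * n (w - z) powr a) * ennreal (norm (g y) powr u * weight (t *\<^sub>R (y - z))) \<partial>lborel)"
    proof (intro nn_integral_mono)
      fix y
      have 1: "norm (g y) \<le> norm (g y) powr u * (m powr (1 - u) * n (y - z) powr (a * (1 - u)))"
      proof (cases "g y = 0")
        case False
        have "norm (g y) = norm (g y) powr u * norm (g y) powr (1 - u)"
          using False by (simp flip: powr_add)
        also have "norm (g y) powr (1 - u) \<le> (m * n (y - z) powr a) powr (1 - u)"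
          using u gm by (intro powr_mono2) auto
        also have "\<dots> = m powr (1 - u) * n (y - z) powr (a * (1 - u))"
          using m0 by (simp add: powr_mult powr_powr)
        finally show ?thesis by (simp add: mult_left_mono)
      qed simp
      \<comment> \<open>Of the growth \<open>a * (1 - u)\<close> the part \<open>a\<close> is split
        between kernel decay and the point \<open>w\<close>; what remains is decay of order
        \<open>a * u >= 2 d\<close>, which becomes the weight.\<close>
      have 2: "n (y - z) powr (a * (1 - u)) \<le> n (y - w) powr a * n (w - z) powr a * weight (t *\<^sub>R (y - z))"
      proof -
        have a0: "a \<ge> 0" using a u by (smt (verit) mult_nonneg_nonneg mult_pos_pos of_nat_0_le_iff zero_le_mult_iff)
        have "n (y - z) \<le> n (y - w) * n (w - z)"
        proof -
          have "norm (y - z) \<le> norm (y - w) + norm (w - z)" using norm_triangle_ineq[of "y - w" "w - z"] by simp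
          then have "t * norm (y - z) \<le> t * norm (y - w) + t * norm (w - z)" using t by (simp flip: distrib_left)
          moreover have "0 \<le> (t * norm (y - w)) * (t * norm (w - z))" using t by simp
          ultimately show ?thesis unfolding n_def by (simp add: distrib_left distrib_right)
        qed
        then have "n (y - z) powr a \<le> (n (y - w) * n (w - z)) powr a" using n0[of "y - z"] a0 by (intro powr_mono2) auto
        also have "\<dots> = n (y - w) powr a * n (w - z) powr a" using n0 by (simp add: powr_mult less_imp_le)
        finally have A: "n (y - z) powr a \<le> n (y - w) powr a * n (w - z) powr a" .
        have "n (y - z) powr (- (a * u)) \<le> n (y - z) powr (- real (2 * DIM('a)))"
          using a n1 by (intro powr_mono) auto
        also have "\<dots> = weight (t *\<^sub>R (y - z))"
          using n0[of "y - z"] t by (simp add: weight_def n_def powr_minus powr_realpow[symmetric] divide_inverse del: powr_numeral of_nat_mult)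
        finally have "n (y - z) powr a * n (y - z) powr (- (a * u)) \<le> n (y - w) powr a * n (w - z) powr a * weight (t *\<^sub>R (y - z))"
          using A by (intro mult_mono) auto
        then show ?thesis by (simp add: powr_add[symmetric] algebra_simps)
      qed
      have "norm (g y * L w y) \<le> (norm (g y) powr u * (m powr (1 - u) * n (y - z) powr (a * (1 - u)))) * (C * n (y - w) powr (- a))"
        unfolding norm_mult using 1 L[of w y] by (intro mult_mono) (auto simp: n_def)
      also have "\<dots> \<le> (norm (g y) powr u * (m powr (1 - u) * (n (y - w) powr a * n (w - z) powr a * weight (t *\<^sub>R (y - z))))) * (C * n (y - w) powr (- a))"
        using C by (intro mult_right_mono mult_left_mono 2) auto
      also have "\<dots> = (m powr (1 - u) * C * n (w - z) powr a) * (norm (g y) powr u * weight (t *\<^sub>R (y - z)))"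
        using n0[of "y - w"] by (simp add: powr_minus field_simps)
      finally show "ennreal (norm (g y * L w y)) \<le> ennreal (m powr (1 - u) * C * n (w - z) powr a) * ennreal (norm (g y) powr u * weight (t *\<^sub>R (y - z)))"
        using C by (subst ennreal_mult[symmetric]) (auto intro!: ennreal_leI)
    qed
    also have "\<dots> = ennreal (m powr (1 - u) * C * n (w - z) powr a) * I"
      unfolding I_def by (rule nn_integral_cmult) measurable
    finally show ?thesis .
  qed
  have "ennreal (m powr u) \<le> ennreal C * I"
  proof (cases "I = \<infinity> \<or> m = 0")
    case True
    then show ?thesis using C u by (auto simp: ennreal_mult_top)
  next
    case False
    then obtain i where i: "I = ennreal i" "i \<ge> 0" by (cases I) auto
    have mp: "m > 0" using False m0 by simp
    have "q w \<le> m powr (1 - u) * C * i" for w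
    proof -
      have "ennreal (norm (g w)) \<le> ennreal (m powr (1 - u) * C * n (w - z) powr a * i)"
        using main[of w] C i by (simp add: ennreal_mult)
      then have "norm (g w) \<le> m powr (1 - u) * C * n (w - z) powr a * i"
        using C i by (subst (asm) ennreal_le_iff) auto
      then show ?thesis using n0[of "w - z"] by (simp add: q_def divide_le_eq mult_ac)
    qed
    then have "m \<le> m powr (1 - u) * C * i" unfolding m_def by (intro cSUP_least) auto
    then have "m powr u * m powr (1 - u) \<le> (C * i) * m powr (1 - u)"
      using mp by (simp add: mult_ac flip: powr_add)
    then have "m powr u \<le> C * i" using mp by simp
    then show ?thesis using i C by (simp add: ennreal_mult[symmetric] ennreal_leI)
  qed
  then show ?thesis using that[of m] m0 gm unfolding n_def I_def by blast
qed

lemma weight_le_1: "weight x \<le> 1"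
  by (simp add: weight_def divide_le_eq)

lemma nn_integral_weight_scale:
  assumes "t > 0"
  shows "(\<integral>\<^sup>+y. ennreal (t ^ DIM('a) * weight (t *\<^sub>R (y - z))) \<partial>(lborel :: 'a::euclidean_space measure)) = ennreal (LINT y|lborel. weight (y :: 'a))"
proof -
  have "ennreal (LINT y|lborel. weight (y :: 'a)) = (\<integral>\<^sup>+y. ennreal (weight (y::'a)) \<partial>lborel)"
    by (rule nn_integral_eq_integral[symmetric, OF integrable_weight]) simp
  also have "\<dots> = ennreal (t ^ DIM('a)) * (\<integral>\<^sup>+y. ennreal (weight (- (t *\<^sub>R z) + t *\<^sub>R y)) \<partial>(lborel :: 'a measure))"
    using assms by (subst nn_integral_lborel_affine[of _ t "- (t *\<^sub>R z)"]) auto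
  also have "\<dots> = (\<integral>\<^sup>+y. ennreal (t ^ DIM('a)) * ennreal (weight (- (t *\<^sub>R z) + t *\<^sub>R y)) \<partial>(lborel :: 'a measure))"
    by (rule nn_integral_cmult[symmetric]) measurable
  also have "\<dots> = (\<integral>\<^sup>+y. ennreal (t ^ DIM('a) * weight (t *\<^sub>R (y - z))) \<partial>(lborel :: 'a measure))"
    using assms by (intro nn_integral_cong) (simp add: ennreal_mult[symmetric] scaleR_diff_right)
  finally show ?thesis ..
qed

text \<open>The growth exponent must depend on \<open>u\<close> alone, whereas a block is known
  beforehand only to grow polynomially, at an order depending on \<open>T\<close>. Hence two passes:
  one with a large exponent and constants depending on \<open>T\<close> shows that the block is
  bounded, and boundedness then permits the fixed exponent and a uniform constant.\<close>

lemma block_maximal: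
  fixes \<phi>0 :: "'a::euclidean_space \<Rightarrow> complex"
  assumes gen: "lp_generator \<phi>0" and u: "0 < u" "u \<le> 1" "u \<le> p"
  obtains C where "C > 0" "\<And>T j z. T \<in> tempered_dists \<Longrightarrow>
      (\<integral>\<^sup>+y. ennreal (norm (block (dyadic \<phi>0 j) T y) powr p) \<partial>lborel) < \<infinity> \<Longrightarrow>
      \<exists>m\<ge>0. (\<forall>y. norm (block (dyadic \<phi>0 j) T y) \<le> m * (1 + 2 ^ j * norm (y - z)) powr (2 * real DIM('a) / u)) \<and>
        ennreal (m powr u) \<le> ennreal C * (\<integral>\<^sup>+y. ennreal (norm (block (dyadic \<phi>0 j) T y) powr u * ((2 ^ j) ^ DIM('a) * weight (2 ^ j *\<^sub>R (y - z)))) \<partial>lborel)"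
proof -
  let ?d = "DIM('a)"
  let ?c = "fourier_const TYPE('a)"
  have kernel: "\<exists>C>0. \<forall>j v. norm (complex_of_real ?c * fourier (cutoff \<phi>0 (Suc j)) v) \<le> C * (2 ^ j) ^ ?d * (1 + 2 ^ j * norm v) powr (- a)" for a
  proof -
    obtain M where M: "real M \<ge> a" using real_arch_simple by blast
    obtain C where C: "C > 0" "\<And>j v. norm (fourier (cutoff \<phi>0 (Suc j)) v) \<le> C * (2 ^ j) ^ ?d / (1 + 2 ^ j * norm v) ^ M"
      using kernel_bound[OF gen, of M] by metis
    have "norm (complex_of_real ?c * fourier (cutoff \<phi>0 (Suc j)) v) \<le> (?c * C) * (2 ^ j) ^ ?d * (1 + 2 ^ j * norm v) powr (- a)" for j v
    proof -
      have "1 / (1 + 2 ^ j * norm v) ^ M = (1 + 2 ^ j * norm v) powr (- real M)"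
        by (simp add: powr_minus powr_realpow add_pos_nonneg divide_inverse)
      also have "\<dots> \<le> (1 + 2 ^ j * norm v) powr (- a)" using M by (intro powr_mono) auto
      finally have "C * (2 ^ j) ^ ?d * (1 / (1 + 2 ^ j * norm v) ^ M) \<le> C * (2 ^ j) ^ ?d * (1 + 2 ^ j * norm v) powr (- a)"
        using C by (intro mult_left_mono) auto
      then have "norm (fourier (cutoff \<phi>0 (Suc j)) v) \<le> C * (2 ^ j) ^ ?d * (1 + 2 ^ j * norm v) powr (- a)" using C(2)[of j v] by simp
      then have "?c * norm (fourier (cutoff \<phi>0 (Suc j)) v) \<le> ?c * (C * (2 ^ j) ^ ?d * (1 + 2 ^ j * norm v) powr (- a))"
        using fourier_const_pos[of "TYPE('a)"] by (intro mult_left_mono) auto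
      then show ?thesis using fourier_const_pos[of "TYPE('a)"] by (simp add: norm_mult mult_ac)
    qed
    then show ?thesis using C(1) fourier_const_pos[of "TYPE('a)"] by (intro exI[of _ "?c * C"]) auto
  qed
  define a where "a = 2 * real ?d / u"
  obtain C where C: "C > 0" "\<And>j v. norm (complex_of_real ?c * fourier (cutoff \<phi>0 (Suc j)) v) \<le> C * (2 ^ j) ^ ?d * (1 + 2 ^ j * norm v) powr (- a)"
    using kernel by metis
  have au: "a * u \<ge> 2 * real ?d" using u by (simp add: a_def)
  show ?thesis
  proof (rule that[OF C(1)])
    fix T :: "('a \<Rightarrow> complex) \<Rightarrow> complex" and j and z :: 'a
    assume T: "T \<in> tempered_dists"
    define g where "g = block (dyadic \<phi>0 j) T"
    assume "(\<integral>\<^sup>+y. ennreal (norm (block (dyadic \<phi>0 j) T y) powr p) \<partial>lborel) < \<infinity>"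
    then have fin: "(\<integral>\<^sup>+y. ennreal (norm (g y) powr p) \<partial>lborel) < \<infinity>" by (simp add: g_def)
    have [measurable]: "g \<in> borel_measurable borel"
      unfolding g_def by (intro borel_measurable_continuous_onI block_continuous T schwartz_dyadic gen)
    have rep: "g w = (LINT y|lborel. g y * (complex_of_real ?c * fourier (cutoff \<phi>0 (Suc j)) (y - w)))" for w
      unfolding g_def by (rule reproducing[OF gen T])
    let ?I = "\<lambda>z. \<integral>\<^sup>+y. ennreal (norm (g y) powr u * weight (2 ^ j *\<^sub>R (y - z))) \<partial>lborel"
    obtain A N where A: "A > 0" "\<And>y. norm (g y) \<le> A * (1 + norm y) ^ N"
      using block_growth[OF T schwartz_dyadic[OF gen]] unfolding g_def by metis
    \<comment> \<open>Large enough for the unknown growth order \<open>N\<close> of this particular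
      block. The a priori bound also depends on the centre, which is harmless because only its
      finiteness counts.\<close>
    define b where "b = max a (real N)"
    obtain C' where C': "C' > 0" "\<And>j v. norm (complex_of_real ?c * fourier (cutoff \<phi>0 (Suc j)) v) \<le> C' * (2 ^ j) ^ ?d * (1 + 2 ^ j * norm v) powr (- b)"
      using kernel by metis
    have bu: "b * u \<ge> 2 * real ?d" using au u(1) unfolding b_def by (smt (verit) mult_right_mono)
    \<comment> \<open>Finite bound independent of the centre: the power \<open>u\<close> of the
      block is at most 1 where the block is small and at most its power \<open>p\<close> elsewhere,
      as \<open>u <= p\<close>.\<close>
    define Q where "Q = ennreal (C' * (2 ^ j) ^ ?d) * ((\<integral>\<^sup>+y. ennreal (weight (2 ^ j *\<^sub>R (y - z))) \<partial>lborel) + (\<integral>\<^sup>+y. ennreal (norm (g y) powr p) \<partial>lborel))"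
    have sc: "(\<integral>\<^sup>+y. ennreal (weight (2 ^ j *\<^sub>R (y - z))) \<partial>lborel) = (\<integral>\<^sup>+y. ennreal (weight (2 ^ j *\<^sub>R (y - z'))) \<partial>lborel)" for z' :: 'a
    proof -
      have s: "(\<integral>\<^sup>+y. ennreal (weight (2 ^ j *\<^sub>R (y::'a))) \<partial>lborel) = (\<integral>\<^sup>+y. ennreal (weight (2 ^ j *\<^sub>R (y - x))) \<partial>lborel)" for x :: 'a
        using nn_integral_lborel_affine[of "\<lambda>y. ennreal (weight (2 ^ j *\<^sub>R y))" 1 "- x"] by (simp add: add.commute[of "- x"])
      show ?thesis using s[of z] s[of z'] by simp
    qed
    have Qfin: "Q < \<infinity>"
    proof -
      have "(\<integral>\<^sup>+y. ennreal (weight (2 ^ j *\<^sub>R (y - z))) \<partial>lborel) \<le> (\<integral>\<^sup>+y. ennreal ((2 ^ j) ^ ?d * weight (2 ^ j *\<^sub>R (y - z))) \<partial>lborel)"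
      proof (intro nn_integral_mono ennreal_leI)
        fix y
        have "1 * weight (2 ^ j *\<^sub>R (y - z)) \<le> (2 ^ j) ^ ?d * weight (2 ^ j *\<^sub>R (y - z))"
          by (intro mult_right_mono one_le_power) auto
        then show "weight (2 ^ j *\<^sub>R (y - z)) \<le> (2 ^ j) ^ ?d * weight (2 ^ j *\<^sub>R (y - z))" by simp
      qed
      also have "\<dots> < \<infinity>" by (subst nn_integral_weight_scale) auto
      finally show ?thesis unfolding Q_def using fin by (simp add: ennreal_mult_less_top)
    qed
    have bound: "norm (g x) \<le> enn2real Q powr (1 / u)" for x
    proof -
      obtain m where m: "m \<ge> 0" "\<And>y. norm (g y) \<le> m * (1 + 2 ^ j * norm (y - x)) powr b"
         "ennreal (m powr u) \<le> ennreal (C' * (2 ^ j) ^ ?d) * ?I x"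
      proof (rule peetre_maximal[of "2 ^ j" u b "C' * (2 ^ j) ^ ?d" g "\<lambda>w y. complex_of_real ?c * fourier (cutoff \<phi>0 (Suc j)) (y - w)" "A * (1 + norm x) ^ N" x])
        show "norm (g y) \<le> A * (1 + norm x) ^ N * (1 + 2 ^ j * norm (y - x)) powr b" for y
        proof -
          have "norm (g y) \<le> A * ((1 + norm x) ^ N * (1 + norm (y - x)) ^ N)"
            using A one_plus_norm_power_le[of y N x] by (smt (verit) mult_left_mono)
          also have "(1 + norm (y - x)) ^ N \<le> (1 + 2 ^ j * norm (y - x)) ^ N"
          proof (intro power_mono add_left_mono)
            have "1 * norm (y - x) \<le> 2 ^ j * norm (y - x)" by (intro mult_right_mono one_le_power) auto
            then show "norm (y - x) \<le> 2 ^ j * norm (y - x)" by simp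
          qed auto
          also have "\<dots> = (1 + 2 ^ j * norm (y - x)) powr real N" by (simp add: powr_realpow add_pos_nonneg)
          also have "\<dots> \<le> (1 + 2 ^ j * norm (y - x)) powr b" by (intro powr_mono) (auto simp: b_def)
          finally show ?thesis using A(1) by (simp add: mult.assoc mult_left_mono)
        qed
        show "g w = (LINT y|lborel. g y * (complex_of_real ?c * fourier (cutoff \<phi>0 (Suc j)) (y - w)))" for w by (rule rep)
        show "norm (complex_of_real ?c * fourier (cutoff \<phi>0 (Suc j)) (y - w)) \<le> C' * (2 ^ j) ^ ?d * (1 + 2 ^ j * norm (y - w)) powr (- b)" for w y by (rule C'(2))
      qed (use u bu C'(1) in simp_all)
      have "?I x \<le> (\<integral>\<^sup>+y. ennreal (weight (2 ^ j *\<^sub>R (y - x))) + ennreal (norm (g y) powr p) \<partial>lborel)"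
      proof (intro nn_integral_mono)
        fix y
        have "norm (g y) powr u * weight (2 ^ j *\<^sub>R (y - x)) \<le> weight (2 ^ j *\<^sub>R (y - x)) + norm (g y) powr p"
        proof (cases "norm (g y) \<le> 1")
          case True
          then have "norm (g y) powr u \<le> 1" using u by (intro powr_le1) auto
          then have "norm (g y) powr u * weight (2 ^ j *\<^sub>R (y - x)) \<le> 1 * weight (2 ^ j *\<^sub>R (y - x))" by (intro mult_right_mono) auto
          then show ?thesis by (simp add: add_increasing2)
        next
          case False
          then have "norm (g y) powr u \<le> norm (g y) powr p" using u by (intro powr_mono) auto
          then have "norm (g y) powr u * weight (2 ^ j *\<^sub>R (y - x)) \<le> norm (g y) powr p * 1"
            using weight_le_1 by (intro mult_mono) auto
          then show ?thesis by (simp add: add_increasing)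
        qed
        then show "ennreal (norm (g y) powr u * weight (2 ^ j *\<^sub>R (y - x))) \<le> ennreal (weight (2 ^ j *\<^sub>R (y - x))) + ennreal (norm (g y) powr p)"
          by (simp add: ennreal_plus[symmetric] ennreal_leI del: ennreal_plus)
      qed
      also have "\<dots> = (\<integral>\<^sup>+y. ennreal (weight (2 ^ j *\<^sub>R (y - x))) \<partial>lborel) + (\<integral>\<^sup>+y. ennreal (norm (g y) powr p) \<partial>lborel)"
        by (intro nn_integral_add) measurable
      finally have "ennreal (m powr u) \<le> Q" unfolding Q_def sc[of x] using m(3) by (meson mult_left_mono order_trans zero_le)
      then have "m powr u \<le> enn2real Q" using Qfin by (cases Q) (auto simp: ennreal_le_iff)
      then have "(m powr u) powr (1 / u) \<le> enn2real Q powr (1 / u)" using u by (intro powr_mono2) auto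
      then show ?thesis using m(1) m(2)[of x] u by (simp add: powr_powr)
    qed
    \<comment> \<open>Second pass, now with exponent \<open>a\<close>; boundedness supplies the
      finite supremum, and the constant \<open>C\<close> was fixed before \<open>T\<close>.\<close>
    obtain m where m: "m \<ge> 0" "\<And>y. norm (g y) \<le> m * (1 + 2 ^ j * norm (y - z)) powr a"
         "ennreal (m powr u) \<le> ennreal (C * (2 ^ j) ^ ?d) * ?I z"
    proof (rule peetre_maximal[of "2 ^ j" u a "C * (2 ^ j) ^ ?d" g "\<lambda>w y. complex_of_real ?c * fourier (cutoff \<phi>0 (Suc j)) (y - w)" "enn2real Q powr (1 / u)" z])
      show "norm (g y) \<le> enn2real Q powr (1 / u) * (1 + 2 ^ j * norm (y - z)) powr a" for y
      proof -
        have "1 \<le> (1 + 2 ^ j * norm (y - z)) powr a" using u by (intro ge_one_powr_ge_zero) (auto simp: a_def)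
        then have "enn2real Q powr (1 / u) * 1 \<le> enn2real Q powr (1 / u) * (1 + 2 ^ j * norm (y - z)) powr a"
          by (intro mult_left_mono) auto
        then show ?thesis using bound[of y] by linarith
      qed
      show "g w = (LINT y|lborel. g y * (complex_of_real ?c * fourier (cutoff \<phi>0 (Suc j)) (y - w)))" for w by (rule rep)
      show "norm (complex_of_real ?c * fourier (cutoff \<phi>0 (Suc j)) (y - w)) \<le> C * (2 ^ j) ^ ?d * (1 + 2 ^ j * norm (y - w)) powr (- a)" for w y by (rule C(2))
    qed (use u au C(1) in simp_all)
    have eq: "ennreal (C * (2 ^ j) ^ ?d) * ?I z = ennreal C * (\<integral>\<^sup>+y. ennreal (norm (g y) powr u * ((2 ^ j) ^ ?d * weight (2 ^ j *\<^sub>R (y - z)))) \<partial>lborel)"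
    proof -
      have "(\<integral>\<^sup>+y. ennreal (norm (g y) powr u * ((2 ^ j) ^ ?d * weight (2 ^ j *\<^sub>R (y - z)))) \<partial>lborel)
         = (\<integral>\<^sup>+y. ennreal ((2 ^ j) ^ ?d) * ennreal (norm (g y) powr u * weight (2 ^ j *\<^sub>R (y - z))) \<partial>lborel)"
        by (intro nn_integral_cong) (simp add: ennreal_mult[symmetric] mult_ac)
      also have "\<dots> = ennreal ((2 ^ j) ^ ?d) * ?I z" by (rule nn_integral_cmult) measurable
      finally show ?thesis using C by (simp add: ennreal_mult mult.assoc)
    qed
    show "\<exists>m\<ge>0. (\<forall>y. norm (block (dyadic \<phi>0 j) T y) \<le> m * (1 + 2 ^ j * norm (y - z)) powr (2 * real DIM('a) / u)) \<and>
        ennreal (m powr u) \<le> ennreal C * (\<integral>\<^sup>+y. ennreal (norm (block (dyadic \<phi>0 j) T y) powr u * ((2 ^ j) ^ DIM('a) * weight (2 ^ j *\<^sub>R (y - z)))) \<partial>lborel)"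
      unfolding g_def[symmetric] a_def[symmetric]
      by (intro exI[of _ m] conjI allI m(1,2) m(3)[unfolded eq])
  qed
qed

subsection \<open>Rotations and points on spheres\<close>

lemma orthogonal_transformation_measurable:
  fixes h :: "'a::euclidean_space \<Rightarrow> 'a"
  assumes "orthogonal_transformation h" shows "h \<in> borel_measurable borel"
  by (intro borel_measurable_continuous_onI linear_continuous_on linear_conv_bounded_linear[THEN iffD1] orthogonal_transformation_linear assms)

text \<open>
  Lebesgue measure is compared with its image under \<open>h\<close> by integrating
  \<open>f (h x) * weight (y + h x)\<close> over both variables in both orders, as in the proof of the
  uniqueness of Haar measure; the radial \<open>weight\<close> fixes the constant. The results on linear images
  in the library require the index type of \<open>real ^ 'n\<close> to be well-ordered.
\<close>

lemma nn_integral_orthogonal: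
  fixes h :: "'a::euclidean_space \<Rightarrow> 'a" and f :: "'a \<Rightarrow> ennreal"
  assumes h: "orthogonal_transformation h" and [measurable]: "f \<in> borel_measurable borel"
  shows "(\<integral>\<^sup>+x. f (h x) \<partial>lborel) = (\<integral>\<^sup>+x. f x \<partial>lborel)"
proof -
  note [measurable] = orthogonal_transformation_measurable[OF h]
  have lin: "linear h" by (rule orthogonal_transformation_linear[OF h])
  have hw: "weight (h x) = weight x" for x by (simp add: weight_def orthogonal_transformation_norm[OF h])
  have tr: "(\<integral>\<^sup>+x. k (v + x) \<partial>lborel) = (\<integral>\<^sup>+x. k x \<partial>lborel)" if [measurable]: "k \<in> borel_measurable borel" for k :: "'a \<Rightarrow> ennreal" and v
    using nn_integral_lborel_affine[of k 1 v] by simp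
  have refl: "(\<integral>\<^sup>+x. k (v - x) \<partial>lborel) = (\<integral>\<^sup>+x. k x \<partial>lborel)" if [measurable]: "k \<in> borel_measurable borel" for k :: "'a \<Rightarrow> ennreal" and v
    using nn_integral_lborel_affine[of k "-1" v] by simp
  define g where "g x = ennreal (weight (x :: 'a))" for x
  have [measurable]: "g \<in> borel_measurable borel" unfolding g_def[abs_def] by measurable
  define G where "G = (\<integral>\<^sup>+x. g x \<partial>lborel)"
  have G: "G = ennreal (LINT x|lborel. weight (x :: 'a))"
    unfolding G_def g_def by (rule nn_integral_eq_integral[OF integrable_weight]) simp
  have "G \<noteq> 0"
  proof
    assume "G = 0"
    then have "AE x in lborel. g x = 0" unfolding G_def by (subst (asm) nn_integral_0_iff_AE) auto
    moreover have "g x \<noteq> 0" for x using weight_pos[of x] by (simp add: g_def ennreal_eq_0_iff not_le)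
    ultimately have "AE x::'a in lborel. False" by simp
    then show False by (simp add: eventually_False ae_filter_eq_bot_iff)
  qed
  have "(\<integral>\<^sup>+x. f (h x) \<partial>lborel) * G = (\<integral>\<^sup>+x. f (h x) * G \<partial>lborel)"
    by (rule nn_integral_multc[symmetric]) measurable
  also have "\<dots> = (\<integral>\<^sup>+x. \<integral>\<^sup>+y. f (h x) * g (h x + y) \<partial>lborel \<partial>lborel)"
    by (intro nn_integral_cong, subst nn_integral_cmult) (simp_all add: tr G_def)
  also have "\<dots> = (\<integral>\<^sup>+y. \<integral>\<^sup>+x. f (h x) * g (h x + y) \<partial>lborel \<partial>lborel)"
    by (rule lborel_pair.Fubini') measurable
  also have "\<dots> = (\<integral>\<^sup>+y. \<integral>\<^sup>+x. f (h x - y) * g (h x) \<partial>lborel \<partial>lborel)"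
  proof (rule nn_integral_cong)
    fix y
    have "h (inv h y) = y" using orthogonal_transformation_surj[OF h] by (simp add: surj_f_inv_f)
    then have e: "h (x - inv h y) = h x - y" for x using lin by (simp add: linear_diff)
    show "(\<integral>\<^sup>+x. f (h x) * g (h x + y) \<partial>lborel) = (\<integral>\<^sup>+x. f (h x - y) * g (h x) \<partial>lborel)"
      using tr[of "\<lambda>x. f (h x) * g (h x + y)" "- inv h y"] by (simp add: e)
  qed
  also have "\<dots> = (\<integral>\<^sup>+x. \<integral>\<^sup>+y. f (h x - y) * g (h x) \<partial>lborel \<partial>lborel)"
    by (rule lborel_pair.Fubini') measurable
  also have "\<dots> = (\<integral>\<^sup>+x. (\<integral>\<^sup>+y. f y \<partial>lborel) * g x \<partial>lborel)"
    by (intro nn_integral_cong, subst nn_integral_multc) (simp_all add: refl g_def hw)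
  also have "\<dots> = (\<integral>\<^sup>+y. f y \<partial>lborel) * G"
    unfolding G_def by (rule nn_integral_cmult) measurable
  finally have "G * (\<integral>\<^sup>+x. f (h x) \<partial>lborel) = G * (\<integral>\<^sup>+x. f x \<partial>lborel)" by (simp only: mult.commute)
  moreover have "G \<noteq> top" unfolding G by simp
  ultimately show ?thesis using \<open>G \<noteq> 0\<close> by (simp add: ennreal_mult_cancel_left)
qed

lemma distr_lborel_orthogonal:
  fixes h :: "'a::euclidean_space \<Rightarrow> 'a"
  assumes h: "orthogonal_transformation h"
  shows "distr lborel borel h = lborel"
proof (rule measure_eqI)
  note [measurable] = orthogonal_transformation_measurable[OF h]
  fix A assume "A \<in> sets (distr lborel borel h)"
  then have [measurable]: "A \<in> sets borel" by simp
  have "emeasure (distr lborel borel h) A = (\<integral>\<^sup>+x. indicator A x \<partial>distr lborel borel h)" by simp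
  also have "\<dots> = (\<integral>\<^sup>+x. indicator A (h x) \<partial>lborel)" by (rule nn_integral_distr) measurable
  also have "\<dots> = (\<integral>\<^sup>+x. indicator A x \<partial>lborel)" by (rule nn_integral_orthogonal[OF h]) measurable
  finally show "emeasure (distr lborel borel h) A = emeasure lborel A" by simp
qed simp

lemma integral_orthogonal:
  fixes h :: "'a::euclidean_space \<Rightarrow> 'a" and f :: "'a \<Rightarrow> complex"
  assumes h: "orthogonal_transformation h" and [measurable]: "f \<in> borel_measurable borel"
  shows "(LINT x|lborel. f (h x)) = (LINT x|lborel. f x)"
proof -
  note [measurable] = orthogonal_transformation_measurable[OF h]
  have "(LINT x|distr lborel borel h. f x) = (LINT x|lborel. f (h x))" by (rule integral_distr) auto
  then show ?thesis by (simp add: distr_lborel_orthogonal[OF h])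
qed

lemma schwartz_orthogonal:
  fixes h :: "'a::euclidean_space \<Rightarrow> 'a"
  assumes "orthogonal_transformation h" "f \<in> schwartz"
  shows "(\<lambda>x. f (h x)) \<in> schwartz"
  by (rule schwartz_linear_image[of h 1])
    (use assms in \<open>auto simp: orthogonal_transformation_norm intro: linear_conv_bounded_linear[THEN iffD1] orthogonal_transformation_linear\<close>)

lemma inv_fourier_orthogonal:
  fixes h :: "'a::euclidean_space \<Rightarrow> 'a"
  assumes h: "orthogonal_transformation h" and [measurable]: "f \<in> borel_measurable borel"
  shows "inv_fourier (\<lambda>x. f (h x)) \<xi> = inv_fourier f (h \<xi>)"
proof -
  have hi: "h x \<bullet> h \<xi> = x \<bullet> \<xi>" for x using h by (simp add: orthogonal_transformation_def)
  show ?thesis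
    using integral_orthogonal[OF h, of "\<lambda>x. exp (\<i> * of_real (x \<bullet> h \<xi>)) * f x"]
    unfolding inv_fourier_eq fourier_altdef by (simp add: hi)
qed

text \<open>Invariance of \<open>T\<close> lets the kernel, not the block, be rotated, so that the
  value at \<open>h z\<close> becomes a pairing centred at \<open>z\<close>. The generator need not
  be radial, hence the rotated kernel has another multiplier than \<open>dyadic \<phi>0 j\<close>.
  Its spectrum still lies in the same annulus, and the neighbouring dyadic functions resolve
  it.\<close>

lemma block_rotated:
  fixes \<phi>0 :: "real ^ 'n \<Rightarrow> complex"
  assumes gen: "lp_generator \<phi>0" and T: "T \<in> tempered_dists" and rad: "radial_dist T" and h: "orthogonal_transformation h"
  shows "block (dyadic \<phi>0 j) T (h z) = (\<Sum>i\<in>{j - 1..j + 1}. LINT y|lborel. block (dyadic \<phi>0 i) T y *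
    (of_real (fourier_const TYPE(real ^ 'n)) * fourier (dyadic \<phi>0 j) (h y - h z)))"
proof -
  let ?c = "complex_of_real (fourier_const TYPE(real ^ 'n))"
  note D = schwartz_dyadic[OF gen]
  define G where "G y = ?c * fourier (dyadic \<phi>0 j) (y - h z)" for y
  have G: "G \<in> schwartz" unfolding G_def[abs_def] by (intro schwartz_cmult schwartz_translate schwartz_fourier D)
  define \<psi> where "\<psi> = (\<lambda>y. G (h y))"
  have \<psi>: "\<psi> \<in> schwartz" unfolding \<psi>_def by (rule schwartz_orthogonal[OF h G])
  have F\<psi>: "inv_fourier \<psi> \<xi> = ?c * (exp (\<i> * of_real (h z \<bullet> h \<xi>)) * dyadic \<phi>0 j (h \<xi>))" for \<xi>
    unfolding \<psi>_def inv_fourier_orthogonal[OF h schwartz_measurable[OF G]] unfolding G_def[abs_def]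
      inv_fourier_cmult inv_fourier_translate[OF schwartz_measurable[OF schwartz_fourier[OF D]]] inv_fourier_fourier[OF D] ..
  have split: "inv_fourier \<psi> \<xi> = (\<Sum>i\<in>{j - 1..j + 1}. dyadic \<phi>0 i \<xi> * inv_fourier \<psi> \<xi>)" for \<xi>
  proof (cases "dyadic \<phi>0 j (h \<xi>) = 0")
    case False
    have "(\<Sum>i\<in>{j - 1..j + 1}. dyadic \<phi>0 i \<xi>) = 1"
      using dyadic_support[OF gen False] by (intro sum_dyadic_neighbours[OF gen]) (auto simp: orthogonal_transformation_norm[OF h])
    then show ?thesis by (simp flip: sum_distrib_right)
  qed (simp add: F\<psi>)
  have S: "(\<lambda>\<xi>. dyadic \<phi>0 i \<xi> * inv_fourier \<psi> \<xi>) \<in> schwartz" for i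
    by (intro schwartz_mult D schwartz_inv_fourier \<psi>)
  have fsum: "fourier (\<lambda>\<xi>. \<Sum>i\<in>I. dyadic \<phi>0 i \<xi> * inv_fourier \<psi> \<xi>) = (\<lambda>w. \<Sum>i\<in>I. fourier (\<lambda>\<xi>. dyadic \<phi>0 i \<xi> * inv_fourier \<psi> \<xi>) w)" for I
  proof (induction I rule: infinite_finite_induct)
    case (insert i I)
    have "(\<lambda>\<xi>. \<Sum>i\<in>I. dyadic \<phi>0 i \<xi> * inv_fourier \<psi> \<xi>) \<in> schwartz" by (intro schwartz_sum S)
    then show ?case using insert fourier_add[OF schwartz_integrable[OF S] schwartz_integrable] by (auto simp: fun_eq_iff)
  qed (auto simp: fourier_altdef fun_eq_iff)
  have "\<psi> = fourier (\<lambda>\<xi>. \<Sum>i\<in>{j - 1..j + 1}. dyadic \<phi>0 i \<xi> * inv_fourier \<psi> \<xi>)"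
    using fourier_inversion[OF \<psi>] split by (simp flip: split)
  also have "\<dots> = (\<lambda>w. \<Sum>i\<in>{j - 1..j + 1}. fourier (\<lambda>\<xi>. dyadic \<phi>0 i \<xi> * inv_fourier \<psi> \<xi>) w)"
    by (rule fsum)
  finally have "T \<psi> = T (\<lambda>w. \<Sum>i\<in>{j - 1..j + 1}. fourier (\<lambda>\<xi>. dyadic \<phi>0 i \<xi> * inv_fourier \<psi> \<xi>) w)"
    by (rule arg_cong)
  also have "\<dots> = (\<Sum>i\<in>{j - 1..j + 1}. T (fourier (\<lambda>\<xi>. dyadic \<phi>0 i \<xi> * inv_fourier \<psi> \<xi>)))"
    by (rule tempered_sum[OF T schwartz_fourier[OF S]])
  finally have T\<psi>: "T \<psi> = (\<Sum>i\<in>{j - 1..j + 1}. LINT y|lborel. block (dyadic \<phi>0 i) T y * \<psi> y)"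
    by (simp only: block_pairing(2)[OF T D \<psi>])
  have "block (dyadic \<phi>0 j) T (h z) = T G"
    unfolding block_def G_def[abs_def] by (rule tempered_cmult[OF T schwartz_translate(1)[OF schwartz_fourier[OF D]], symmetric])
  also have "\<dots> = T \<psi>" using rad h G unfolding radial_dist_def \<psi>_def by (auto simp: o_def)
  finally show ?thesis using T\<psi> unfolding \<psi>_def G_def by simp
qed

lemma powr_mult_neg: "x > 0 \<Longrightarrow> x powr a * x powr (- a) = (1 :: real)"
  by (simp flip: powr_add)

lemma inverse_le_mult_inverse: "0 < a \<Longrightarrow> 0 < b \<Longrightarrow> b \<le> c * a \<Longrightarrow> 1 / a \<le> c * (1 / b)" for a b c :: real
  by (simp add: field_simps)

lemma powr_sum_le:
  fixes m :: "'i \<Rightarrow> real"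
  assumes "finite I" "u > 0" "\<And>i. i \<in> I \<Longrightarrow> m i \<ge> 0"
  shows "(\<Sum>i\<in>I. m i) powr u \<le> real (card I) powr u * (\<Sum>i\<in>I. m i powr u)"
proof (cases "I = {}")
  case False
  define M where "M = Max (m ` I)"
  have M: "m i \<le> M" if "i \<in> I" for i unfolding M_def using assms(1) that by simp
  have "M \<in> m ` I" unfolding M_def using assms(1) False by (intro Max_in) auto
  then obtain k where k: "k \<in> I" "M = m k" by blast
  have "(\<Sum>i\<in>I. m i) powr u \<le> (real (card I) * M) powr u"
    using M assms sum_bounded_above[of I m M] by (intro powr_mono2 sum_nonneg) auto
  also have "\<dots> = real (card I) powr u * M powr u" using assms(3) k by (simp add: powr_mult)
  also have "M powr u \<le> (\<Sum>i\<in>I. m i powr u)"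
    unfolding k(2) using assms(1) k(1) by (intro member_le_sum) auto
  finally show ?thesis by (simp add: mult_left_mono)
qed simp

text \<open>Combines rotation with the maximal inequality centred at \<open>z\<close>: the value at
  \<open>x\<close> is dominated by the three maximal quantities at any point of the same sphere.
  This freedom in \<open>z\<close> is the only way in which radiality is exploited
  afterwards.\<close>

lemma block_pointwise:
  fixes \<phi>0 :: "real ^ 'n \<Rightarrow> complex"
  assumes gen: "lp_generator \<phi>0" and u: "0 < u" "u \<le> 1" "u \<le> p"
  obtains C where "C > 0" "\<And>T j x z. T \<in> tempered_dists \<Longrightarrow> radial_dist T \<Longrightarrow>
      (\<And>i. (\<integral>\<^sup>+y. ennreal (norm (block (dyadic \<phi>0 i) T y) powr p) \<partial>lborel) < \<infinity>) \<Longrightarrow> norm z = norm x \<Longrightarrow>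
      ennreal (norm (block (dyadic \<phi>0 j) T x) powr u) \<le> ennreal C * (\<Sum>i\<in>{j - 1..j + 1}. \<integral>\<^sup>+y. ennreal (norm (block (dyadic \<phi>0 i) T y) powr u * ((2 ^ j) ^ CARD('n) * weight (2 ^ j *\<^sub>R (y - z)))) \<partial>lborel)"
proof -
  let ?d = "CARD('n)"
  let ?c = "fourier_const TYPE(real ^ 'n)"
  define a where "a = 2 * real ?d / u"
  have a0: "a \<ge> 0" using u by (simp add: a_def)
  obtain C2 where C2: "C2 > 0" "\<And>T j z. T \<in> tempered_dists \<Longrightarrow>
      (\<integral>\<^sup>+y. ennreal (norm (block (dyadic \<phi>0 j) T y) powr p) \<partial>lborel) < \<infinity> \<Longrightarrow>
      \<exists>m\<ge>0. (\<forall>y. norm (block (dyadic \<phi>0 j) T y) \<le> m * (1 + 2 ^ j * norm (y - z)) powr a) \<and>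
        ennreal (m powr u) \<le> ennreal C2 * (\<integral>\<^sup>+y. ennreal (norm (block (dyadic \<phi>0 j) T y) powr u * ((2 ^ j) ^ ?d * weight (2 ^ j *\<^sub>R (y - z)))) \<partial>lborel)"
    by (rule block_maximal[OF gen u, unfolded DIM_cart DIM_real mult_1_right, folded a_def]) (rule that)
  \<comment> \<open>The kernel must decay by \<open>a\<close> to absorb the growth allowed for the
    blocks, and by a further \<open>2 d\<close> to leave an integrable weight; hence the order
    \<open>M + 2 * ?d\<close> below.\<close>
  obtain M where M: "real M \<ge> a" using real_arch_simple by blast
  obtain C1 where C1: "C1 > 0" "\<And>j v. norm (fourier (dyadic \<phi>0 j) v) \<le> C1 * (2 ^ j) ^ ?d / (1 + 2 ^ j * norm v) ^ (M + 2 * ?d)"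
    by (rule kernel_bound[OF gen, of "M + 2 * ?d", unfolded DIM_cart DIM_real mult_1_right]) (rule that)
  define W where "W = (LINT y|lborel. weight (y :: real ^ 'n))"
  have W0: "W \<ge> 0" unfolding W_def by (intro integral_nonneg_AE) auto
  define K0 where "K0 = 2 powr a * (?c * C1) * W"
  have K0: "K0 \<ge> 0" unfolding K0_def using C1 W0 fourier_const_pos[of "TYPE(real ^ 'n)"] by auto
  \<comment> \<open>The power of 3 accounts for at most three neighbours; \<open>8 ^ ?d\<close> is
    \<open>2 ^ ?d\<close> from the normalisation times \<open>4 ^ ?d\<close> from the weight when
    scale \<open>i\<close> is replaced by scale \<open>j\<close>.\<close>
  define C where "C = 3 powr u * K0 powr u * C2 * 8 ^ ?d + 1"
  show ?thesis
  proof (rule that[of C])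
    show "C > 0" unfolding C_def using C2(1) by (intro add_nonneg_pos) auto
    fix T :: "(real ^ 'n \<Rightarrow> complex) \<Rightarrow> complex" and j :: nat and x z :: "real ^ 'n"
    assume T: "T \<in> tempered_dists" and rad: "radial_dist T"
      and fin: "\<And>i. (\<integral>\<^sup>+y. ennreal (norm (block (dyadic \<phi>0 i) T y) powr p) \<partial>lborel) < \<infinity>" and xz: "norm z = norm x"
    define g where "g i = block (dyadic \<phi>0 i) T" for i
    have [measurable]: "g i \<in> borel_measurable borel" for i
      unfolding g_def by (intro borel_measurable_continuous_onI block_continuous T schwartz_dyadic gen)
    let ?J = "\<lambda>i k. \<integral>\<^sup>+y. ennreal (norm (g i y) powr u * ((2 ^ k) ^ ?d * weight (2 ^ k *\<^sub>R (y - z)))) \<partial>lborel"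
    have "\<forall>i. \<exists>m. m \<ge> 0 \<and> (\<forall>y. norm (g i y) \<le> m * (1 + 2 ^ i * norm (y - z)) powr a) \<and> ennreal (m powr u) \<le> ennreal C2 * ?J i i"
      using C2(2)[OF T fin] unfolding g_def by blast
    from choice[OF this] obtain m where m': "\<forall>i. m i \<ge> 0 \<and> (\<forall>y. norm (g i y) \<le> m i * (1 + 2 ^ i * norm (y - z)) powr a) \<and> ennreal (m i powr u) \<le> ennreal C2 * ?J i i"
      by blast
    have m: "m i \<ge> 0" "norm (g i y) \<le> m i * (1 + 2 ^ i * norm (y - z)) powr a"
      "ennreal (m i powr u) \<le> ennreal C2 * ?J i i" for i y using m' by blast+
    obtain h where h: "orthogonal_transformation h" "h z = x" using orthogonal_transformation_exists[OF xz] by blast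
    let ?I = "{j - 1..j + 1}"
    let ?k = "\<lambda>y. complex_of_real ?c * fourier (dyadic \<phi>0 j) (h y - h z)"
    have nh: "norm (h y - h z) = norm (y - z)" for y
      using orthogonal_transformation_linear[OF h(1)] orthogonal_transformation_norm[OF h(1)] by (metis linear_diff)
    have kb: "norm (?k y) \<le> (?c * C1) * (1 + 2 ^ j * norm (y - z)) powr (- a) * ((2 ^ j) ^ ?d * weight (2 ^ j *\<^sub>R (y - z)))" for y
    proof -
      let ?n = "1 + 2 ^ j * norm (y - z)"
      have n1: "?n \<ge> 1" by simp
      have "1 / ?n ^ M = ?n powr (- real M)" by (simp add: powr_minus powr_realpow divide_inverse add_pos_nonneg)
      also have "\<dots> \<le> ?n powr (- a)" using M n1 by (intro powr_mono) auto
      finally have le: "C1 * (2 ^ j) ^ ?d * (1 / ?n ^ M) * (1 / ?n ^ (2 * ?d)) \<le> C1 * (2 ^ j) ^ ?d * ?n powr (- a) * (1 / ?n ^ (2 * ?d))"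
        using C1 n1 by (intro mult_right_mono mult_left_mono) auto
      have w: "1 / ?n ^ (2 * ?d) = weight (2 ^ j *\<^sub>R (y - z))" by (simp add: weight_def)
      have "norm (fourier (dyadic \<phi>0 j) (h y - h z)) \<le> C1 * (2 ^ j) ^ ?d * (1 / ?n ^ M) * (1 / ?n ^ (2 * ?d))"
        using C1(2)[of j "h y - h z"] by (simp add: nh power_add)
      from order_trans[OF this le] have "norm (fourier (dyadic \<phi>0 j) (h y - h z)) \<le> C1 * (2 ^ j) ^ ?d * ?n powr (- a) * weight (2 ^ j *\<^sub>R (y - z))"
        unfolding w .
      then have "?c * norm (fourier (dyadic \<phi>0 j) (h y - h z)) \<le> ?c * (C1 * (2 ^ j) ^ ?d * ?n powr (- a) * weight (2 ^ j *\<^sub>R (y - z)))"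
        using fourier_const_pos[of "TYPE(real ^ 'n)"] by (intro mult_left_mono) auto
      then show ?thesis using fourier_const_pos[of "TYPE(real ^ 'n)"] by (simp add: norm_mult mult_ac)
    qed
    have trm: "norm (LINT y|lborel. g i y * ?k y) \<le> K0 * m i" if i: "i \<in> ?I" for i
    proof -
      have "ennreal (norm (LINT y|lborel. g i y * ?k y)) \<le> (\<integral>\<^sup>+y. ennreal (norm (g i y * ?k y)) \<partial>lborel)"
        by (rule norm_integral_le_nn_integral)
      also have "\<dots> \<le> (\<integral>\<^sup>+y. ennreal (m i * 2 powr a * (?c * C1)) * ennreal ((2 ^ j) ^ ?d * weight (2 ^ j *\<^sub>R (y - z))) \<partial>lborel)"
      proof (intro nn_integral_mono)
        fix y
        let ?n = "1 + 2 ^ j * norm (y - z)"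
        have n1: "?n \<ge> 1" by simp
        have "(2::real) ^ i \<le> 2 ^ (j + 1)" using i by (intro power_increasing) auto
        then have "2 ^ i * norm (y - z) \<le> 2 ^ (j + 1) * norm (y - z)" by (intro mult_right_mono) auto
        then have "1 + 2 ^ i * norm (y - z) \<le> 2 * ?n" by (simp add: algebra_simps)
        then have "(1 + 2 ^ i * norm (y - z)) powr a \<le> (2 * ?n) powr a" using a0 by (intro powr_mono2) auto
        also have "\<dots> = 2 powr a * ?n powr a" using n1 by (intro powr_mult)
        finally have "norm (g i y) \<le> m i * (2 powr a * ?n powr a)" using m(1,2)[of i] by (meson mult_left_mono order_trans)
        then have "norm (g i y * ?k y) \<le> (m i * (2 powr a * ?n powr a)) * ((?c * C1) * ?n powr (- a) * ((2 ^ j) ^ ?d * weight (2 ^ j *\<^sub>R (y - z))))"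
          unfolding norm_mult[of "g i y"] using kb[of y] m(1) by (intro mult_mono) auto
        also have "\<dots> = (m i * 2 powr a * (?c * C1)) * ((2 ^ j) ^ ?d * weight (2 ^ j *\<^sub>R (y - z))) * (?n powr a * ?n powr (- a))"
          by (simp only: mult_ac)
        also have "?n powr a * ?n powr (- a) = 1" by (rule powr_mult_neg) (simp add: add_pos_nonneg)
        finally show "ennreal (norm (g i y * ?k y)) \<le> ennreal (m i * 2 powr a * (?c * C1)) * ennreal ((2 ^ j) ^ ?d * weight (2 ^ j *\<^sub>R (y - z)))"
          using m(1)[of i] C1(1) fourier_const_pos[of "TYPE(real ^ 'n)"] by (subst ennreal_mult[symmetric]) (auto intro!: ennreal_leI)
      qed
      also have "\<dots> = ennreal (m i * 2 powr a * (?c * C1)) * ennreal W"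
        using nn_integral_weight_scale[of "2 ^ j" z] by (subst nn_integral_cmult) (auto simp: W_def)
      also have "\<dots> = ennreal (K0 * m i)"
        using m(1)[of i] C1(1) W0 fourier_const_pos[of "TYPE(real ^ 'n)"] by (subst ennreal_mult[symmetric]) (auto simp: K0_def mult_ac)
      finally show ?thesis using K0 m(1)[of i] by (subst (asm) ennreal_le_iff) auto
    qed
    have "norm (g j x) \<le> (\<Sum>i\<in>?I. K0 * m i)"
      unfolding g_def h(2)[symmetric] block_rotated[OF gen T rad h(1)]
      using trm[unfolded g_def] by (intro order_trans[OF norm_sum] sum_mono)
    then have "norm (g j x) powr u \<le> (\<Sum>i\<in>?I. K0 * m i) powr u" using u by (intro powr_mono2) auto
    also have "\<dots> \<le> real (card ?I) powr u * (\<Sum>i\<in>?I. (K0 * m i) powr u)" using u K0 m(1) by (intro powr_sum_le) auto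
    also have "\<dots> \<le> 3 powr u * (\<Sum>i\<in>?I. (K0 * m i) powr u)" using u by (intro mult_right_mono powr_mono2 sum_nonneg) auto
    also have "\<dots> = 3 powr u * K0 powr u * (\<Sum>i\<in>?I. m i powr u)" by (simp only: powr_mult sum_distrib_left mult.assoc)
    finally have 1: "norm (g j x) powr u \<le> 3 powr u * K0 powr u * (\<Sum>i\<in>?I. m i powr u)" .
    have J: "?J i i \<le> ennreal (8 ^ ?d) * ?J i j" if i: "i \<in> ?I" for i
    proof -
      have "?J i i \<le> (\<integral>\<^sup>+y. ennreal (8 ^ ?d) * ennreal (norm (g i y) powr u * ((2 ^ j) ^ ?d * weight (2 ^ j *\<^sub>R (y - z)))) \<partial>lborel)"
      proof (intro nn_integral_mono)
        fix y
        let ?s = "norm (y - z)"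
        have "(2::real) ^ i \<le> 2 ^ (j + 1)" using i by (intro power_increasing) auto
        then have "((2::real) ^ i) ^ ?d \<le> (2 * 2 ^ j) ^ ?d" by (intro power_mono) auto
        then have A: "((2::real) ^ i) ^ ?d \<le> 2 ^ ?d * (2 ^ j) ^ ?d" by (simp only: power_mult_distrib)
        have "(2::real) ^ j \<le> 2 ^ (i + 1)" using i by (intro power_increasing) auto
        then have "2 ^ j * ?s \<le> 2 ^ (i + 1) * ?s" by (intro mult_right_mono) auto
        then have "1 + 2 ^ j * ?s \<le> 2 * (1 + 2 ^ i * ?s)" by (simp add: algebra_simps)
        then have "(1 + 2 ^ j * ?s) ^ (2 * ?d) \<le> (2 * (1 + 2 ^ i * ?s)) ^ (2 * ?d)" by (intro power_mono) auto
        also have "\<dots> = 4 ^ ?d * (1 + 2 ^ i * ?s) ^ (2 * ?d)" by (simp only: power_mult_distrib) (simp add: power_mult)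
        finally have B: "weight (2 ^ i *\<^sub>R (y - z)) \<le> 4 ^ ?d * weight (2 ^ j *\<^sub>R (y - z))"
          unfolding weight_def DIM_cart DIM_real mult_1_right norm_scaleR real_norm_def power_abs[symmetric] abs_numeral
          by (intro inverse_le_mult_inverse zero_less_power add_pos_nonneg) auto
        have "(2 ^ i) ^ ?d * weight (2 ^ i *\<^sub>R (y - z)) \<le> (2 ^ ?d * (2 ^ j) ^ ?d) * (4 ^ ?d * weight (2 ^ j *\<^sub>R (y - z)))"
          by (intro mult_mono A B) auto
        also have "\<dots> = (2 * 4) ^ ?d * ((2 ^ j) ^ ?d * weight (2 ^ j *\<^sub>R (y - z)))" by (simp only: power_mult_distrib mult_ac)
        finally have "norm (g i y) powr u * ((2 ^ i) ^ ?d * weight (2 ^ i *\<^sub>R (y - z))) \<le> norm (g i y) powr u * (8 ^ ?d * ((2 ^ j) ^ ?d * weight (2 ^ j *\<^sub>R (y - z))))"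
          by (intro mult_left_mono) auto
        then show "ennreal (norm (g i y) powr u * ((2 ^ i) ^ ?d * weight (2 ^ i *\<^sub>R (y - z)))) \<le> ennreal (8 ^ ?d) * ennreal (norm (g i y) powr u * ((2 ^ j) ^ ?d * weight (2 ^ j *\<^sub>R (y - z))))"
          by (subst ennreal_mult[symmetric]) (auto intro!: ennreal_leI simp: mult_ac)
      qed
      also have "\<dots> = ennreal (8 ^ ?d) * ?J i j" by (rule nn_integral_cmult) measurable
      finally show ?thesis .
    qed
    have "ennreal (norm (g j x) powr u) \<le> ennreal (3 powr u * K0 powr u) * (\<Sum>i\<in>?I. ennreal (m i powr u))"
      using ennreal_leI[OF 1] by (simp add: ennreal_mult sum_nonneg sum_ennreal[symmetric] del: sum.cl_ivl_Suc sum_ennreal)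
    also have "\<dots> \<le> ennreal (3 powr u * K0 powr u) * (\<Sum>i\<in>?I. ennreal C2 * (ennreal (8 ^ ?d) * ?J i j))"
      by (intro mult_left_mono sum_mono order_trans[OF m(3)] J) auto
    also have "\<dots> = ennreal (3 powr u * K0 powr u * C2 * 8 ^ ?d) * (\<Sum>i\<in>?I. ?J i j)"
      using C2(1) by (simp add: ennreal_mult sum_distrib_left mult.assoc del: sum.cl_ivl_Suc)
    also have "\<dots> \<le> ennreal C * (\<Sum>i\<in>?I. ?J i j)"
      by (intro mult_right_mono ennreal_leI) (auto simp: C_def)
    finally show "ennreal (norm (block (dyadic \<phi>0 j) T x) powr u) \<le> ennreal C * (\<Sum>i\<in>{j - 1..j + 1}. \<integral>\<^sup>+y. ennreal (norm (block (dyadic \<phi>0 i) T y) powr u * ((2 ^ j) ^ CARD('n) * weight (2 ^ j *\<^sub>R (y - z)))) \<partial>lborel)"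
      unfolding g_def .
  qed
qed

text \<open>A grid of spacing \<open>1 / t\<close> is placed in all coordinates but one, and the
  last coordinate is solved from the equation of the sphere. Distinct grid points already differ by
  \<open>1 / t\<close> in some free coordinate, so lifting keeps them separated.\<close>

lemma sphere_separated_points:
  fixes r t :: real
  assumes r: "r > 0" and t: "t > 0"
  obtains Z :: "(real ^ 'n) set" where "finite Z" "Z \<noteq> {}" "\<And>z. z \<in> Z \<Longrightarrow> norm z = r"
    "\<And>z w. z \<in> Z \<Longrightarrow> w \<in> Z \<Longrightarrow> z \<noteq> w \<Longrightarrow> t * norm (z - w) \<ge> 1"
    "real (card Z) \<ge> (t * r / sqrt (real CARD('n))) ^ (CARD('n) - 1)"
proof -
  obtain k0 :: 'n where True by simp
  \<comment> \<open>Keeping each free coordinate below \<open>r / sqrt d\<close> makes the sum of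
    their squares at most \<open>r^2\<close>, so the square root in \<open>pt\<close> is real. The
    grid index 0 is included, which gives \<open>K + 1\<close> values per coordinate.\<close>
  define K where "K = nat \<lfloor>t * r / sqrt (real CARD('n))\<rfloor>"
  have K: "real K \<le> t * r / sqrt (real CARD('n))" "t * r / sqrt (real CARD('n)) \<le> real K + 1"
    unfolding K_def using r t by (auto simp: of_nat_nat intro: real_of_int_floor_add_one_ge)
  define P where "P = PiE (UNIV - {k0}) (\<lambda>_. {0..K})"
  define S where "S m = (\<Sum>i\<in>UNIV - {k0}. (real (m i) / t)\<^sup>2)" for m :: "'n \<Rightarrow> nat"
  define pt :: "('n \<Rightarrow> nat) \<Rightarrow> real ^ 'n" where "pt m = (\<chi> i. if i = k0 then sqrt (r\<^sup>2 - S m) else real (m i) / t)" for m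
  have finP: "finite P" unfolding P_def by (intro finite_PiE) auto
  have cardP: "card P = (K + 1) ^ (CARD('n) - 1)"
    unfolding P_def by (subst card_PiE) (auto simp: card_Diff_singleton)
  have S_le: "S m \<le> r\<^sup>2" if m: "m \<in> P" for m
  proof -
    have "S m \<le> (\<Sum>i\<in>UNIV - {k0}. (r / sqrt (real CARD('n)))\<^sup>2)"
      unfolding S_def
    proof (intro sum_mono power_mono)
      fix i assume i: "i \<in> UNIV - {k0}"
      have "m i \<le> K" using m i unfolding P_def by (auto simp: PiE_def Pi_def)
      then have "real (m i) \<le> t * r / sqrt (real CARD('n))" using K(1) by linarith
      then show "real (m i) / t \<le> r / sqrt (real CARD('n))" using t by (simp add: field_simps)
    qed (use t in auto)
    also have "\<dots> \<le> (\<Sum>i\<in>(UNIV::'n set). (r / sqrt (real CARD('n)))\<^sup>2)"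
      by (intro sum_mono2) auto
    also have "\<dots> = r\<^sup>2" by (simp add: power_divide)
    finally show ?thesis .
  qed
  have npt: "norm (pt m) = r" if m: "m \<in> P" for m
  proof -
    have "(norm (pt m))\<^sup>2 = (\<Sum>i\<in>UNIV. (pt m $ i)\<^sup>2)"
      unfolding power2_norm_eq_inner inner_vec_def by (simp add: power2_eq_square)
    also have "\<dots> = (pt m $ k0)\<^sup>2 + (\<Sum>i\<in>UNIV - {k0}. (pt m $ i)\<^sup>2)" by (subst sum.remove[of _ k0]) auto
    also have "(\<Sum>i\<in>UNIV - {k0}. (pt m $ i)\<^sup>2) = S m" unfolding S_def by (intro sum.cong) (auto simp: pt_def)
    also have "(pt m $ k0)\<^sup>2 + S m = r\<^sup>2" using S_le[OF m] by (simp add: pt_def)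
    finally show ?thesis using r by (simp add: power2_eq_iff_nonneg)
  qed
  have sep: "t * norm (pt m - pt m') \<ge> 1" if m: "m \<in> P" "m' \<in> P" "m \<noteq> m'" for m m'
  proof -
    obtain i where i: "i \<noteq> k0" "m i \<noteq> m' i"
      using m unfolding P_def by (metis PiE_ext DiffI UNIV_I singletonD Diff_iff insertCI)
    have "\<bar>real (m i) - real (m' i)\<bar> \<ge> 1" using i(2) by linarith
    then have "1 \<le> t * \<bar>(pt m - pt m') $ i\<bar>" using i(1) t by (simp add: pt_def abs_mult[symmetric] diff_divide_distrib[symmetric])
    also have "\<dots> \<le> t * norm (pt m - pt m')" using t component_le_norm_cart[of "pt m - pt m'" i] by (intro mult_left_mono) auto
    finally show ?thesis .
  qed
  have inj: "inj_on pt P"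
  proof (rule inj_onI)
    fix m m' assume m: "m \<in> P" "m' \<in> P" "pt m = pt m'"
    show "m = m'" using sep[of m m'] m by force
  qed
  show ?thesis
  proof (rule that[of "pt ` P"])
    show "finite (pt ` P)" using finP by simp
    show "pt ` P \<noteq> {}" using cardP finP by (metis card.empty image_is_empty power_eq_0_iff add_is_0 one_neq_zero)
    have "(t * r / sqrt (real CARD('n))) ^ (CARD('n) - 1) \<le> (real K + 1) ^ (CARD('n) - 1)"
      using K(2) r t by (intro power_mono) auto
    also have "\<dots> = real (card (pt ` P))" by (simp add: card_image[OF inj] cardP add.commute)
    finally show "real (card (pt ` P)) \<ge> (t * r / sqrt (real CARD('n))) ^ (CARD('n) - 1)" .
    show "t * norm (z - w) \<ge> 1" if "z \<in> pt ` P" "w \<in> pt ` P" "z \<noteq> w" for z w using that sep by auto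
  qed (use npt in auto)
qed

text \<open>Balls of radius 1/2 around the points \<open>t *\<^sub>R z\<close> are disjoint, and the
  weight changes by a bounded factor across each of them. The sum is thus comparable to an integral
  of the weight, however many points there are.\<close>

lemma sum_weight_separated:
  obtains C where "C > 0" "\<And>(Z :: 'a::euclidean_space set) t y. finite Z \<Longrightarrow> t > 0 \<Longrightarrow>
    (\<And>z w. z \<in> Z \<Longrightarrow> w \<in> Z \<Longrightarrow> z \<noteq> w \<Longrightarrow> t * norm (z - w) \<ge> 1) \<Longrightarrow> (\<Sum>z\<in>Z. weight (t *\<^sub>R (y - z))) \<le> C"
proof -
  let ?d = "DIM('a)"
  define V where "V = measure lborel (ball (0::'a) (1/2))"
  have V: "V > 0" unfolding V_def using content_ball_pos[of "1/2" "0::'a"] by simp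
  define W where "W = (LINT y|lborel. weight (y :: 'a))"
  have W0: "W \<ge> 0" unfolding W_def by (intro integral_nonneg_AE) auto
  \<comment> \<open>The factor \<open>(3/2) ^ (2 * ?d)\<close> is the variation of the weight over
    distance 1/2, and \<open>V\<close> is the volume of one ball.\<close>
  define C where "C = (3/2) ^ (2 * ?d) * W / V + 1"
  show ?thesis
  proof (rule that[of C])
    show "C > 0" unfolding C_def using V W0 by (intro add_nonneg_pos) auto
    fix Z :: "'a set" and t :: real and y :: 'a
    assume Z: "finite Z" and t: "t > 0" and sep: "\<And>z w. z \<in> Z \<Longrightarrow> w \<in> Z \<Longrightarrow> z \<noteq> w \<Longrightarrow> t * norm (z - w) \<ge> 1"
    have Vz: "measure lborel (ball (x::'a) (1/2)) = V" for x unfolding V_def by (simp add: content_ball_conv_unit_ball[of "1/2" x] content_ball_conv_unit_ball[of "1/2" 0])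
    have fm: "emeasure lborel (ball (x::'a) (1/2)) < \<infinity>" for x using emeasure_bounded_finite[OF bounded_ball] by auto
    have ind: "integrable lborel (\<lambda>w. indicator (ball (t *\<^sub>R z) (1/2)) w * weight (t *\<^sub>R y - w))" for z
      using integrable_mult_indicator[OF _ integrable_lborel_affine[OF integrable_weight, of "-1" "t *\<^sub>R y"], of "ball (t *\<^sub>R z) (1/2)"] by simp
    have one: "weight (t *\<^sub>R (y - z)) * V \<le> (3/2) ^ (2 * ?d) * (LINT w|lborel. indicator (ball (t *\<^sub>R z) (1/2)) w * weight (t *\<^sub>R y - w))" for z
    proof -
      have "weight (t *\<^sub>R (y - z)) * V = (LINT w|lborel. weight (t *\<^sub>R (y - z)) * indicator (ball (t *\<^sub>R z) (1/2)) w)"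
        by (simp add: Vz)
      also have "\<dots> \<le> (LINT w|lborel. (3/2) ^ (2 * ?d) * (indicator (ball (t *\<^sub>R z) (1/2)) w * weight (t *\<^sub>R y - w)))"
      proof (intro integral_mono integrable_mult_right ind integrable_real_indicator fm)
        fix w
        show "weight (t *\<^sub>R (y - z)) * indicator (ball (t *\<^sub>R z) (1/2)) w \<le> (3/2) ^ (2 * ?d) * (indicator (ball (t *\<^sub>R z) (1/2)) w * weight (t *\<^sub>R y - w))"
        proof (cases "w \<in> ball (t *\<^sub>R z) (1/2)")
          case True
          let ?v = "t *\<^sub>R (y - z)"
          have "norm ((t *\<^sub>R y - w) - ?v) \<le> 1/2" using True by (simp add: dist_norm scaleR_diff_right)
          then have "(1 + norm ((t *\<^sub>R y - w) - ?v)) ^ (2 * ?d) \<le> (3/2) ^ (2 * ?d)" by (intro power_mono) auto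
          then have "(1 + norm (t *\<^sub>R y - w)) ^ (2 * ?d) \<le> (1 + norm ?v) ^ (2 * ?d) * (3/2) ^ (2 * ?d)"
            using one_plus_norm_power_le[of "t *\<^sub>R y - w" "2 * ?d" ?v] by (smt (verit) mult_left_mono norm_ge_zero zero_le_power)
          then have "weight ?v \<le> (3/2) ^ (2 * ?d) * weight (t *\<^sub>R y - w)"
            unfolding weight_def by (simp add: pos_divide_le_eq pos_le_divide_eq zero_less_power add_pos_nonneg mult.commute)
          then show ?thesis using True by simp
        qed simp
      qed auto
      finally show ?thesis by simp
    qed
    have "(\<Sum>z\<in>Z. weight (t *\<^sub>R (y - z))) * V \<le> (3/2) ^ (2 * ?d) * (\<Sum>z\<in>Z. (LINT w|lborel. indicator (ball (t *\<^sub>R z) (1/2)) w * weight (t *\<^sub>R y - w)))"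
      unfolding sum_distrib_left sum_distrib_right by (intro sum_mono one)
    also have "(\<Sum>z\<in>Z. (LINT w|lborel. indicator (ball (t *\<^sub>R z) (1/2)) w * weight (t *\<^sub>R y - w))) = (LINT w|lborel. (\<Sum>z\<in>Z. indicator (ball (t *\<^sub>R z) (1/2)) w * weight (t *\<^sub>R y - w)))"
      by (rule Bochner_Integration.integral_sum[symmetric, OF ind])
    also have "\<dots> \<le> (LINT w|lborel. weight (t *\<^sub>R y - w))"
    proof (intro integral_mono Bochner_Integration.integrable_sum ind)
      show "integrable lborel (\<lambda>w. weight (t *\<^sub>R y - w))"
        using integrable_lborel_affine[OF integrable_weight, of "-1" "t *\<^sub>R y"] by simp
      fix w
      have "(\<Sum>z\<in>Z. indicator (ball (t *\<^sub>R z) (1/2)) w :: real) \<le> 1"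
      proof (cases "\<exists>z0\<in>Z. w \<in> ball (t *\<^sub>R z0) (1/2)")
        case True
        then obtain z0 where z0: "z0 \<in> Z" "w \<in> ball (t *\<^sub>R z0) (1/2)" by blast
        have "indicator (ball (t *\<^sub>R z) (1/2)) w = (if z = z0 then 1 else 0 :: real)" if z: "z \<in> Z" for z
        proof (cases "z = z0")
          case False
          have "w \<notin> ball (t *\<^sub>R z) (1/2)"
          proof
            assume "w \<in> ball (t *\<^sub>R z) (1/2)"
            then have "dist (t *\<^sub>R z) (t *\<^sub>R z0) < 1" using z0(2) dist_triangle_half_r[of w "t *\<^sub>R z" 1 "t *\<^sub>R z0"]
              by (metis dist_commute mem_ball dist_triangle_half_l)
            then show False using sep[OF z z0(1) False] t by (simp add: dist_norm flip: scaleR_diff_right)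
          qed
          then show ?thesis using False by simp
        qed (use z0 in simp)
        then have "(\<Sum>z\<in>Z. indicator (ball (t *\<^sub>R z) (1/2)) w :: real) = (\<Sum>z\<in>Z. if z = z0 then 1 else 0)" by (intro sum.cong) auto
        then show ?thesis using Z z0 by simp
      next
        case False
        then have "(\<Sum>z\<in>Z. indicator (ball (t *\<^sub>R z) (1/2)) w :: real) = 0" by (intro sum.neutral) auto
        then show ?thesis by simp
      qed
      then have "(\<Sum>z\<in>Z. indicator (ball (t *\<^sub>R z) (1/2)) w) * weight (t *\<^sub>R y - w) \<le> 1 * weight (t *\<^sub>R y - w)"
        by (intro mult_right_mono) auto
      then show "(\<Sum>z\<in>Z. indicator (ball (t *\<^sub>R z) (1/2)) w * weight (t *\<^sub>R y - w)) \<le> weight (t *\<^sub>R y - w)"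
        by (simp add: sum_distrib_right)
    qed
    also have "(LINT w|lborel. weight (t *\<^sub>R y - w)) = W"
    proof -
      have "complex_of_real (LINT w|lborel. weight (t *\<^sub>R y - w)) = complex_of_real W"
        using integral_lborel_affine[of "\<lambda>w. complex_of_real (weight w)" "-1" "t *\<^sub>R y"]
        by (simp add: W_def)
      then show ?thesis by simp
    qed
    finally have "(\<Sum>z\<in>Z. weight (t *\<^sub>R (y - z))) * V \<le> (3/2) ^ (2 * ?d) * W" by (simp add: mult_left_mono)
    then have "(\<Sum>z\<in>Z. weight (t *\<^sub>R (y - z))) \<le> (3/2) ^ (2 * ?d) * W / V" using V by (simp add: pos_le_divide_eq)
    then show "(\<Sum>z\<in>Z. weight (t *\<^sub>R (y - z))) \<le> C" by (simp add: C_def)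
  qed
qed

subsection \<open>Averaged kernels\<close>

text \<open>For \<open>1 \<le> 2\<^bsup>j\<^esup> r\<close>: the reciprocal of the volume of the shell of radius \<open>r\<close> and width \<open>2\<^bsup>-j\<^esup>\<close>, up to constants.\<close>

definition shell_density :: "nat \<Rightarrow> nat \<Rightarrow> real \<Rightarrow> real" where
  "shell_density d j r = (2 ^ j) ^ d * min 1 ((2 ^ j * r) powr - (real d - 1))"

text \<open>The estimate at a single centre is averaged over the separated points. Averaging leaves
  the total mass of the kernel unchanged, but its supremum drops by the number of points, since at
  each place only boundedly many bumps are felt. The kernel depends on \<open>j\<close> and
  \<open>r\<close> alone.\<close>

lemma averaged_kernel:
  fixes \<phi>0 :: "real ^ 'n \<Rightarrow> complex"
  assumes gen: "lp_generator \<phi>0" and u: "0 < u" "u \<le> 1" "u \<le> p"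
  obtains C where "C > 0" "\<And>j r. r > 0 \<Longrightarrow> \<exists>\<kappa> :: real ^ 'n \<Rightarrow> real. \<kappa> \<in> borel_measurable borel \<and>
      (\<forall>y. 0 \<le> \<kappa> y \<and> \<kappa> y \<le> C * shell_density CARD('n) j r) \<and> (\<integral>\<^sup>+y. ennreal (\<kappa> y) \<partial>lborel) \<le> ennreal C \<and>
      (\<forall>T x. T \<in> tempered_dists \<longrightarrow> radial_dist T \<longrightarrow>
        (\<forall>i. (\<integral>\<^sup>+y. ennreal (norm (block (dyadic \<phi>0 i) T y) powr p) \<partial>lborel) < \<infinity>) \<longrightarrow> norm x = r \<longrightarrow>
        ennreal (norm (block (dyadic \<phi>0 j) T x) powr u) \<le> ennreal C * (\<Sum>i\<in>{j - 1..j + 1}. \<integral>\<^sup>+y. ennreal (norm (block (dyadic \<phi>0 i) T y) powr u * \<kappa> y) \<partial>lborel))"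
proof -
  let ?d = "CARD('n)"
  obtain C1 where C1: "C1 > 0" "\<And>T j x z. T \<in> tempered_dists \<Longrightarrow> radial_dist T \<Longrightarrow>
      (\<And>i. (\<integral>\<^sup>+y. ennreal (norm (block (dyadic \<phi>0 i) T y) powr p) \<partial>lborel) < \<infinity>) \<Longrightarrow> norm z = norm x \<Longrightarrow>
      ennreal (norm (block (dyadic \<phi>0 j) T x) powr u) \<le> ennreal C1 * (\<Sum>i\<in>{j - 1..j + 1}. \<integral>\<^sup>+y. ennreal (norm (block (dyadic \<phi>0 i) T y) powr u * ((2 ^ j) ^ ?d * weight (2 ^ j *\<^sub>R (y - z)))) \<partial>lborel)"
    by (rule block_pointwise[OF gen u]) (rule that, assumption, blast)
  obtain C2 where C2: "C2 > 0" "\<And>(Z :: (real ^ 'n) set) t y. finite Z \<Longrightarrow> t > 0 \<Longrightarrow>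
    (\<And>z w. z \<in> Z \<Longrightarrow> w \<in> Z \<Longrightarrow> z \<noteq> w \<Longrightarrow> t * norm (z - w) \<ge> 1) \<Longrightarrow> (\<Sum>z\<in>Z. weight (t *\<^sub>R (y - z))) \<le> C2"
    by (rule sum_weight_separated) (rule that, assumption, blast)
  define W where "W = (LINT y|lborel. weight (y :: real ^ 'n))"
  have W0: "W \<ge> 0" unfolding W_def by (intro integral_nonneg_AE) auto
  define S where "S = sqrt (real ?d) ^ (?d - 1)"
  have S1: "S \<ge> 1" unfolding S_def by (intro one_le_power) simp
  define C where "C = C1 + C2 * S + W"
  have C: "C \<ge> C1" "C \<ge> C2 * S" "C \<ge> W" "C > 0" using C1(1) C2(1) S1 W0 by (auto simp: C_def intro!: add_pos_nonneg)
  show ?thesis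
  proof (rule that[OF C(4)])
    fix j :: nat and r :: real assume r: "r > 0"
    let ?t = "(2::real) ^ j"
    obtain Z :: "(real ^ 'n) set" where Z: "finite Z" "Z \<noteq> {}" "\<And>z. z \<in> Z \<Longrightarrow> norm z = r"
      "\<And>z w. z \<in> Z \<Longrightarrow> w \<in> Z \<Longrightarrow> z \<noteq> w \<Longrightarrow> ?t * norm (z - w) \<ge> 1"
      "real (card Z) \<ge> (?t * r / sqrt (real ?d)) ^ (?d - 1)"
      by (rule sphere_separated_points[OF r, of ?t]) (simp, rule that)
    define n where "n = real (card Z)"
    have n: "n \<ge> 1" using Z(1,2) by (simp add: n_def Suc_le_eq card_gt_0_iff)
    define \<kappa> where "\<kappa> y = ?t ^ ?d / n * (\<Sum>z\<in>Z. weight (?t *\<^sub>R (y - z)))" for y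
    have [measurable]: "\<kappa> \<in> borel_measurable borel" unfolding \<kappa>_def[abs_def] by measurable
    have k0: "\<kappa> y \<ge> 0" for y unfolding \<kappa>_def using n by (intro mult_nonneg_nonneg sum_nonneg) auto
    \<comment> \<open>The cap 1 comes from having at least one point, the other branch from the
      count on the sphere; \<open>S\<close> absorbs the power of \<open>sqrt d\<close> in that
      count.\<close>
    have ninv: "1 / n \<le> S * min 1 ((?t * r) powr - (real ?d - 1))"
    proof -
      have p0: "?t * r > 0" using r by simp
      have "(?t * r) powr - (real ?d - 1) = 1 / (?t * r) ^ (?d - 1)"
        unfolding powr_minus using powr_realpow[OF p0, of "?d - 1"] by (simp add: divide_inverse of_nat_diff Suc_leI)
      moreover have "1 / n \<le> S * (1 / (?t * r) ^ (?d - 1))"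
      proof -
        have "(?t * r) ^ (?d - 1) / S \<le> n" using Z(5) by (simp add: n_def S_def power_divide)
        then have "(?t * r) ^ (?d - 1) \<le> S * n" using S1 by (simp add: pos_divide_le_eq mult.commute)
        then show ?thesis using n p0 by (intro inverse_le_mult_inverse) auto
      qed
      moreover have "1 / n \<le> S"
      proof -
        have "1 * 1 \<le> S * n" using n S1 by (intro mult_mono) auto
        then show ?thesis using n by (simp add: pos_divide_le_eq)
      qed
      ultimately show ?thesis by (simp add: min_def)
    qed
    have kb: "\<kappa> y \<le> C * shell_density ?d j r" for y
    proof -
      have "\<kappa> y \<le> ?t ^ ?d / n * C2"
        unfolding \<kappa>_def using n by (intro mult_left_mono C2(2) Z) auto
      also have "\<dots> = ?t ^ ?d * C2 * (1 / n)" by simp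
      also have "\<dots> \<le> ?t ^ ?d * C2 * (S * min 1 ((?t * r) powr - (real ?d - 1)))"
        using C2(1) by (intro mult_left_mono ninv) auto
      also have "\<dots> = (C2 * S) * shell_density ?d j r" unfolding shell_density_def by (simp only: mult_ac)
      also have "\<dots> \<le> C * shell_density ?d j r" by (intro mult_right_mono C) (auto simp: shell_density_def)
      finally show ?thesis .
    qed
    have wi: "(\<integral>\<^sup>+y. ennreal (?t ^ ?d * weight (?t *\<^sub>R (y - z))) \<partial>lborel) = ennreal W" for z :: "real ^ 'n"
      using nn_integral_weight_scale[of ?t z] by (simp add: W_def)
    have ke: "ennreal (c * \<kappa> y) = (\<Sum>z\<in>Z. ennreal (1 / n) * ennreal (c * (?t ^ ?d * weight (?t *\<^sub>R (y - z)))))" if "c \<ge> 0" for c y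
      unfolding \<kappa>_def using that n
      by (subst (1) ennreal_mult[symmetric]) (auto simp: sum_distrib_left sum_ennreal mult_ac)
    have "(\<integral>\<^sup>+y. ennreal (\<kappa> y) \<partial>lborel) = (\<integral>\<^sup>+y. (\<Sum>z\<in>Z. ennreal (1 / n) * ennreal (?t ^ ?d * weight (?t *\<^sub>R (y - z)))) \<partial>lborel)"
      using ke[of 1] by simp
    also have "\<dots> = (\<Sum>z\<in>Z. ennreal (1 / n) * (\<integral>\<^sup>+y. ennreal (?t ^ ?d * weight (?t *\<^sub>R (y - z))) \<partial>lborel))"
      by (subst nn_integral_sum) (auto simp: nn_integral_cmult)
    also have "\<dots> = of_nat (card Z) * (ennreal (1 / n) * ennreal W)" unfolding wi by simp
    also have "\<dots> = ennreal W"
      using n W0 by (simp add: n_def ennreal_of_nat_eq_real_of_nat ennreal_mult[symmetric])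
    finally have kint: "(\<integral>\<^sup>+y. ennreal (\<kappa> y) \<partial>lborel) \<le> ennreal C" using C(3) by (simp add: ennreal_leI)
    have main: "ennreal (norm (block (dyadic \<phi>0 j) T x) powr u) \<le> ennreal C * (\<Sum>i\<in>{j - 1..j + 1}. \<integral>\<^sup>+y. ennreal (norm (block (dyadic \<phi>0 i) T y) powr u * \<kappa> y) \<partial>lborel)"
      if T: "T \<in> tempered_dists" and rad: "radial_dist T" and fin: "\<forall>i. (\<integral>\<^sup>+y. ennreal (norm (block (dyadic \<phi>0 i) T y) powr p) \<partial>lborel) < \<infinity>" and x: "norm x = r"
      for T x
    proof -
      define g where "g i = block (dyadic \<phi>0 i) T" for i
      have [measurable]: "g i \<in> borel_measurable borel" for i
        unfolding g_def by (intro borel_measurable_continuous_onI block_continuous T schwartz_dyadic gen)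
      let ?X = "ennreal (norm (g j x) powr u)"
      define I where "I = {j - 1..j + 1}"
      define J where "J i z = (\<integral>\<^sup>+y. ennreal (norm (g i y) powr u * (?t ^ ?d * weight (?t *\<^sub>R (y - z)))) \<partial>lborel)" for i z
      have X: "?X \<le> ennreal C1 * (\<Sum>i\<in>I. J i z)" if "z \<in> Z" for z
        unfolding g_def J_def I_def using C1(2)[OF T rad] fin Z(3)[OF that] x by simp
      \<comment> \<open>The left side is written as the mean of \<open>n\<close> copies of itself,
        one for each centre, so that every copy can be estimated with its own centre.\<close>
      have "?X = (\<Sum>z\<in>Z. ennreal (1 / n) * ?X)"
      proof -
        have "(\<Sum>z\<in>Z. ennreal (1 / n) * ?X) = of_nat (card Z) * (ennreal (1 / n) * ?X)" by simp
        also have "\<dots> = ?X" using n by (simp add: n_def ennreal_of_nat_eq_real_of_nat ennreal_mult[symmetric])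
        finally show ?thesis ..
      qed
      also have "\<dots> \<le> (\<Sum>z\<in>Z. ennreal (1 / n) * (ennreal C1 * (\<Sum>i\<in>I. J i z)))"
        by (intro sum_mono mult_left_mono X) auto
      also have "\<dots> = ennreal C1 * (\<Sum>z\<in>Z. \<Sum>i\<in>I. ennreal (1 / n) * J i z)"
        by (simp only: sum_distrib_left mult_ac)
      also have "(\<Sum>z\<in>Z. \<Sum>i\<in>I. ennreal (1 / n) * J i z) = (\<Sum>i\<in>I. \<Sum>z\<in>Z. ennreal (1 / n) * J i z)" by (rule sum.swap)
      also have "\<dots> = (\<Sum>i\<in>I. \<integral>\<^sup>+y. ennreal (norm (g i y) powr u * \<kappa> y) \<partial>lborel)"
      proof (rule sum.cong[OF refl])
        fix i
        have "(\<integral>\<^sup>+y. ennreal (norm (g i y) powr u * \<kappa> y) \<partial>lborel) = (\<integral>\<^sup>+y. (\<Sum>z\<in>Z. ennreal (1 / n) * ennreal (norm (g i y) powr u * (?t ^ ?d * weight (?t *\<^sub>R (y - z))))) \<partial>lborel)"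
          by (intro nn_integral_cong ke) simp
        also have "\<dots> = (\<Sum>z\<in>Z. ennreal (1 / n) * J i z)"
          unfolding J_def by (subst nn_integral_sum) (auto simp: nn_integral_cmult)
        finally show "(\<Sum>z\<in>Z. ennreal (1 / n) * J i z) = (\<integral>\<^sup>+y. ennreal (norm (g i y) powr u * \<kappa> y) \<partial>lborel)" ..
      qed
      finally have "?X \<le> ennreal C1 * (\<Sum>i\<in>I. \<integral>\<^sup>+y. ennreal (norm (g i y) powr u * \<kappa> y) \<partial>lborel)" .
      also have "\<dots> \<le> ennreal C * (\<Sum>i\<in>I. \<integral>\<^sup>+y. ennreal (norm (g i y) powr u * \<kappa> y) \<partial>lborel)"
        by (intro mult_right_mono ennreal_leI C) auto
      finally show ?thesis unfolding g_def I_def .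
    qed
    show "\<exists>\<kappa> :: real ^ 'n \<Rightarrow> real. \<kappa> \<in> borel_measurable borel \<and>
      (\<forall>y. 0 \<le> \<kappa> y \<and> \<kappa> y \<le> C * shell_density ?d j r) \<and> (\<integral>\<^sup>+y. ennreal (\<kappa> y) \<partial>lborel) \<le> ennreal C \<and>
      (\<forall>T x. T \<in> tempered_dists \<longrightarrow> radial_dist T \<longrightarrow>
        (\<forall>i. (\<integral>\<^sup>+y. ennreal (norm (block (dyadic \<phi>0 i) T y) powr p) \<partial>lborel) < \<infinity>) \<longrightarrow> norm x = r \<longrightarrow>
        ennreal (norm (block (dyadic \<phi>0 j) T x) powr u) \<le> ennreal C * (\<Sum>i\<in>{j - 1..j + 1}. \<integral>\<^sup>+y. ennreal (norm (block (dyadic \<phi>0 i) T y) powr u * \<kappa> y) \<partial>lborel))"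
      by (intro exI[of _ \<kappa>] conjI allI impI k0 kb kint main) auto
  qed
qed

text \<open>
  Hoelder's inequality up to a constant: integrate
  \<open>h \<le> \<lambda> + \<lambda>\<^bsup>1-b\<^esup> h\<^bsup>b\<^esup>\<close> and optimise in \<open>\<lambda>\<close>.
\<close>

lemma nn_integral_kernel_powr:
  fixes h \<kappa> :: "'a::euclidean_space \<Rightarrow> real"
  assumes [measurable]: "h \<in> borel_measurable borel" "\<kappa> \<in> borel_measurable borel"
    and h0: "\<And>y. h y \<ge> 0" and k: "\<And>y. 0 \<le> \<kappa> y" "\<And>y. \<kappa> y \<le> K" and C: "C \<ge> 0" "(\<integral>\<^sup>+y. ennreal (\<kappa> y) \<partial>lborel) \<le> ennreal C"
    and b: "b \<ge> 1" and N: "N \<ge> 0" "(\<integral>\<^sup>+y. ennreal (h y powr b) \<partial>lborel) \<le> ennreal N"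
  shows "(\<integral>\<^sup>+y. ennreal (h y * \<kappa> y) \<partial>lborel) \<le> ennreal ((C + 1) * (K * N) powr (1 / b))"
proof -
  have K0: "K \<ge> 0" using k order_trans by blast
  have le: "(\<integral>\<^sup>+y. ennreal (h y * \<kappa> y) \<partial>lborel) \<le> ennreal (l * C + l powr (1 - b) * (K * N))" if l: "l > 0" for l
  proof -
    have "(\<integral>\<^sup>+y. ennreal (h y * \<kappa> y) \<partial>lborel) \<le> (\<integral>\<^sup>+y. ennreal l * ennreal (\<kappa> y) + ennreal (l powr (1 - b) * K) * ennreal (h y powr b) \<partial>lborel)"
    proof (rule nn_integral_mono)
      fix y
      have "h y \<le> l + l powr (1 - b) * h y powr b"
      proof (cases "h y \<le> l")
        case False
        then have hp: "h y > 0" using l by simp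
        have "h y = h y powr (1 - b) * h y powr b" using hp by (simp flip: powr_add)
        also have "\<dots> \<le> l powr (1 - b) * h y powr b" using False l b by (intro mult_right_mono powr_mono2') auto
        finally show ?thesis using l by simp
      qed (simp add: add_increasing2)
      then have "h y * \<kappa> y \<le> (l + l powr (1 - b) * h y powr b) * \<kappa> y" using k by (intro mult_right_mono)
      also have "\<dots> = l * \<kappa> y + l powr (1 - b) * h y powr b * \<kappa> y" by (simp add: distrib_right)
      also have "\<dots> \<le> l * \<kappa> y + l powr (1 - b) * h y powr b * K" using k by (intro add_left_mono mult_left_mono) auto
      also have "\<dots> = l * \<kappa> y + (l powr (1 - b) * K) * h y powr b" by (simp only: mult_ac)
      finally have "ennreal (h y * \<kappa> y) \<le> ennreal (l * \<kappa> y + (l powr (1 - b) * K) * h y powr b)" by (rule ennreal_leI)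
      then show "ennreal (h y * \<kappa> y) \<le> ennreal l * ennreal (\<kappa> y) + ennreal (l powr (1 - b) * K) * ennreal (h y powr b)"
        using l k K0 by (simp add: ennreal_mult)
    qed
    also have "\<dots> = ennreal l * (\<integral>\<^sup>+y. ennreal (\<kappa> y) \<partial>lborel) + ennreal (l powr (1 - b) * K) * (\<integral>\<^sup>+y. ennreal (h y powr b) \<partial>lborel)"
      by (simp add: nn_integral_add nn_integral_cmult)
    also have "\<dots> \<le> ennreal l * ennreal C + ennreal (l powr (1 - b) * K) * ennreal N"
      by (intro add_mono mult_left_mono C N) auto
    also have "\<dots> = ennreal (l * C + l powr (1 - b) * (K * N))"
      using l C N K0 by (simp add: ennreal_mult mult.assoc)
    finally show ?thesis .
  qed
  show ?thesis
  proof (cases "K * N = 0")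
    \<comment> \<open>Here the balancing parameter degenerates to 0; arbitrarily small positive
      parameters show that the integral vanishes.\<close>
    case True
    have "(\<integral>\<^sup>+y. ennreal (h y * \<kappa> y) \<partial>lborel) \<le> ennreal 0 + ennreal e" if e: "e > 0" for e
    proof -
      have "(\<integral>\<^sup>+y. ennreal (h y * \<kappa> y) \<partial>lborel) \<le> ennreal (e / (C + 1) * C + (e / (C + 1)) powr (1 - b) * (K * N))"
        using e C by (intro le) auto
      also have "\<dots> \<le> ennreal e" unfolding True using e C by (intro ennreal_leI) (simp add: field_simps)
      finally show ?thesis by simp
    qed
    then have "(\<integral>\<^sup>+y. ennreal (h y * \<kappa> y) \<partial>lborel) \<le> ennreal 0" by (rule ennreal_le_epsilon)
    then show ?thesis by simp
  next
    case False
    then have p: "K * N > 0" using K0 N by (simp add: less_le)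
    define l where "l = (K * N) powr (1 / b)"
    have l: "l > 0" unfolding l_def powr_gt_zero using False .
    have e: "1 / b * b = 1" using b by simp
    have "K * N = l powr b" unfolding l_def powr_powr e by (rule powr_one[symmetric]) (use p in linarith)
    then have "l powr (1 - b) * (K * N) = l" using l by (simp flip: powr_add)
    then show ?thesis using le[OF l] by (simp add: l_def[symmetric] algebra_simps)
  qed
qed

lemma sum_neighbours_le:
  fixes j :: nat
  assumes "\<And>i. i \<in> {j - 1..j + 1} \<Longrightarrow> m i \<le> (c::real)" "c \<ge> 0"
  shows "(\<Sum>i\<in>{j - 1..j + 1}. m i) \<le> 3 * c"
proof -
  have "(\<Sum>i\<in>{j - 1..j + 1}. m i) \<le> real (card {j - 1..j + 1}) * c"
    by (rule sum_bounded_above) (rule assms)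
  also have "\<dots> \<le> 3 * c"
  proof (rule mult_right_mono[OF _ assms(2)])
    have "card {j - 1..j + 1} \<le> 3" unfolding card_atLeastAtMost by arith
    then show "real (card {j - 1..j + 1}) \<le> 3" by (simp del: card_atLeastAtMost)
  qed
  finally show ?thesis .
qed

text \<open>With mass at most \<open>C\<close> and supremum at most \<open>C\<close> times the shell
  density, the averaged kernel yields the power \<open>1 / p\<close> of that density in Hoelder's
  inequality. This factor carries the entire radial gain.\<close>

lemma pointwise_Lp:
  fixes \<phi>0 :: "real ^ 'n \<Rightarrow> complex"
  assumes gen: "lp_generator \<phi>0" and p: "p > 0"
  obtains C where "C > 0" "\<And>T j x N. T \<in> tempered_dists \<Longrightarrow> radial_dist T \<Longrightarrow> (\<And>i. N i \<ge> 0) \<Longrightarrow>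
      (\<And>i. (\<integral>\<^sup>+y. ennreal (norm (block (dyadic \<phi>0 i) T y) powr p) \<partial>lborel) \<le> ennreal (N i powr p)) \<Longrightarrow> x \<noteq> 0 \<Longrightarrow>
      norm (block (dyadic \<phi>0 j) T x) \<le> C * shell_density CARD('n) j (norm x) powr (1 / p) * (\<Sum>i\<in>{j - 1..j + 1}. N i)"
proof -
  let ?d = "CARD('n)"
  \<comment> \<open>The maximal inequality needs \<open>u <= 1\<close>, and the exponent
    \<open>p / u\<close> in Hoelder's inequality has to be at least 1.\<close>
  define u where "u = min 1 p"
  have u: "0 < u" "u \<le> 1" "u \<le> p" using p by (auto simp: u_def)
  obtain C where C: "C > 0" "\<And>j r. r > 0 \<Longrightarrow> \<exists>\<kappa> :: real ^ 'n \<Rightarrow> real. \<kappa> \<in> borel_measurable borel \<and>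
      (\<forall>y. 0 \<le> \<kappa> y \<and> \<kappa> y \<le> C * shell_density ?d j r) \<and> (\<integral>\<^sup>+y. ennreal (\<kappa> y) \<partial>lborel) \<le> ennreal C \<and>
      (\<forall>T x. T \<in> tempered_dists \<longrightarrow> radial_dist T \<longrightarrow>
        (\<forall>i. (\<integral>\<^sup>+y. ennreal (norm (block (dyadic \<phi>0 i) T y) powr p) \<partial>lborel) < \<infinity>) \<longrightarrow> norm x = r \<longrightarrow>
        ennreal (norm (block (dyadic \<phi>0 j) T x) powr u) \<le> ennreal C * (\<Sum>i\<in>{j - 1..j + 1}. \<integral>\<^sup>+y. ennreal (norm (block (dyadic \<phi>0 i) T y) powr u * \<kappa> y) \<partial>lborel))"
    by (rule averaged_kernel[OF gen u]) (rule that)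
  define b where "b = p / u"
  have b: "b \<ge> 1" using u by (simp add: b_def)
  have ub: "u * b = p" using u by (simp add: b_def)
  define E where "E = 3 powr (1 / u) * (C * (C + 1)) powr (1 / u) * C powr (1 / p)"
  show ?thesis
  proof (rule that[of E])
    show "E > 0" unfolding E_def using C(1) by (intro mult_pos_pos) auto
    fix T :: "(real ^ 'n \<Rightarrow> complex) \<Rightarrow> complex" and j :: nat and x :: "real ^ 'n" and N :: "nat \<Rightarrow> real"
    assume T: "T \<in> tempered_dists" and rad: "radial_dist T" and N0: "\<And>i. N i \<ge> 0"
      and N: "\<And>i. (\<integral>\<^sup>+y. ennreal (norm (block (dyadic \<phi>0 i) T y) powr p) \<partial>lborel) \<le> ennreal (N i powr p)" and x: "x \<noteq> 0"
    define g where "g i = block (dyadic \<phi>0 i) T" for i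
    have [measurable]: "g i \<in> borel_measurable borel" for i
      unfolding g_def by (intro borel_measurable_continuous_onI block_continuous T schwartz_dyadic gen)
    have fin: "\<forall>i. (\<integral>\<^sup>+y. ennreal (norm (block (dyadic \<phi>0 i) T y) powr p) \<partial>lborel) < \<infinity>"
    proof
      show "(\<integral>\<^sup>+y. ennreal (norm (block (dyadic \<phi>0 i) T y) powr p) \<partial>lborel) < \<infinity>" for i
        using N[of i] by (rule order_le_less_trans) simp
    qed
    let ?D = "shell_density ?d j (norm x)"
    have D0: "?D \<ge> 0" by (simp add: shell_density_def)
    define I where "I = {j - 1..j + 1}"
    have I: "finite I" "card I \<le> 3" unfolding I_def card_atLeastAtMost by (simp, arith)
    have "norm x > 0" using x by simp
    from C(2)[OF this, of j] obtain \<kappa> :: "real ^ 'n \<Rightarrow> real" where [measurable]: "\<kappa> \<in> borel_measurable borel"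
      and k': "\<forall>y. 0 \<le> \<kappa> y \<and> \<kappa> y \<le> C * ?D" "(\<integral>\<^sup>+y. ennreal (\<kappa> y) \<partial>lborel) \<le> ennreal C"
      and main': "\<forall>T x'. T \<in> tempered_dists \<longrightarrow> radial_dist T \<longrightarrow>
        (\<forall>i. (\<integral>\<^sup>+y. ennreal (norm (block (dyadic \<phi>0 i) T y) powr p) \<partial>lborel) < \<infinity>) \<longrightarrow> norm x' = norm x \<longrightarrow>
        ennreal (norm (block (dyadic \<phi>0 j) T x') powr u) \<le> ennreal C * (\<Sum>i\<in>{j - 1..j + 1}. \<integral>\<^sup>+y. ennreal (norm (block (dyadic \<phi>0 i) T y) powr u * \<kappa> y) \<partial>lborel)"
      by (elim exE conjE)
    have k: "0 \<le> \<kappa> y" "\<kappa> y \<le> C * ?D" "(\<integral>\<^sup>+y. ennreal (\<kappa> y) \<partial>lborel) \<le> ennreal C" for y using k' by auto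
    have main: "ennreal (norm (g j x) powr u) \<le> ennreal C * (\<Sum>i\<in>I. \<integral>\<^sup>+y. ennreal (norm (g i y) powr u * \<kappa> y) \<partial>lborel)"
      unfolding g_def I_def by (rule main'[rule_format, OF T rad fin[rule_format] refl])
    have hold: "(\<integral>\<^sup>+y. ennreal (norm (g i y) powr u * \<kappa> y) \<partial>lborel) \<le> ennreal ((C + 1) * (C * ?D * N i powr p) powr (1 / b))" for i
    proof (rule nn_integral_kernel_powr[where b = b])
      show "(\<integral>\<^sup>+y. ennreal ((norm (g i y) powr u) powr b) \<partial>lborel) \<le> ennreal (N i powr p)"
        using N[of i] by (simp add: powr_powr ub g_def)
    qed (use k b C(1) in auto)
    have "(C * ?D * N i powr p) powr (1 / b) = ((C * ?D) powr (1 / p) * N i) powr u" for i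
    proof -
      have "1 / b = (1 / p) * u" using u p by (simp add: b_def)
      then have "(C * ?D * N i powr p) powr (1 / b) = ((C * ?D * N i powr p) powr (1 / p)) powr u" by (simp only: powr_powr)
      also have "(C * ?D * N i powr p) powr (1 / p) = (C * ?D) powr (1 / p) * N i"
        using C(1) D0 N0[of i] p by (simp add: powr_mult powr_powr)
      finally show ?thesis .
    qed
    note e = this
    define a where "a i = (C * ?D) powr (1 / p) * N i" for i
    have a0: "a i \<ge> 0" for i using N0 by (simp add: a_def)
    have "ennreal (norm (g j x) powr u) \<le> ennreal C * (\<Sum>i\<in>I. ennreal ((C + 1) * a i powr u))"
      using hold unfolding e a_def[symmetric] by (intro order_trans[OF main] mult_left_mono sum_mono) auto
    also have "\<dots> = ennreal ((C * (C + 1)) * (\<Sum>i\<in>I. a i powr u))"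
      using C(1) by (simp add: ennreal_mult[symmetric] sum_ennreal sum_nonneg sum_distrib_left mult.assoc)
    finally have "norm (g j x) powr u \<le> (C * (C + 1)) * (\<Sum>i\<in>I. a i powr u)"
      using C(1) by (subst (asm) ennreal_le_iff) (auto intro!: mult_nonneg_nonneg sum_nonneg)
    then have "(norm (g j x) powr u) powr (1 / u) \<le> ((C * (C + 1)) * (\<Sum>i\<in>I. a i powr u)) powr (1 / u)"
      using u by (intro powr_mono2) auto
    also have "\<dots> = (C * (C + 1)) powr (1 / u) * (\<Sum>i\<in>I. a i powr u) powr (1 / u)"
      by (rule powr_mult)
    also have "\<dots> \<le> (C * (C + 1)) powr (1 / u) * (real (card I) powr (1 / u) * (\<Sum>i\<in>I. (a i powr u) powr (1 / u)))"
      using u I by (intro mult_left_mono powr_sum_le) auto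
    also have "\<dots> \<le> (C * (C + 1)) powr (1 / u) * (3 powr (1 / u) * (\<Sum>i\<in>I. (a i powr u) powr (1 / u)))"
      using u I by (intro mult_left_mono mult_right_mono powr_mono2 sum_nonneg) auto
    also have "(\<Sum>i\<in>I. (a i powr u) powr (1 / u)) = (\<Sum>i\<in>I. a i)"
      using u a0 by (intro sum.cong) (auto simp: powr_powr)
    also have "(\<Sum>i\<in>I. a i) = C powr (1 / p) * ?D powr (1 / p) * (\<Sum>i\<in>I. N i)"
      using C(1) D0 by (simp add: a_def powr_mult sum_distrib_left)
    finally have "norm (g j x) \<le> (C * (C + 1)) powr (1 / u) * (3 powr (1 / u) * (C powr (1 / p) * ?D powr (1 / p) * (\<Sum>i\<in>I. N i)))"
      using u by (simp add: powr_powr)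
    then show "norm (block (dyadic \<phi>0 j) T x) \<le> E * ?D powr (1 / p) * (\<Sum>i\<in>{j - 1..j + 1}. N i)"
      unfolding g_def I_def E_def by (simp only: mult_ac)
  qed
qed

text \<open>In \<open>nat\<close> one of the differences \<open>i - j\<close> and
  \<open>j - i\<close> is 0, so the exponent is the distance of the indices. Each side contributes
  at most \<open>4 = 1 / (1 - 3/4)\<close>.\<close>

lemma sum_geometric_distance:
  fixes r :: real
  assumes r: "0 \<le> r" "r \<le> 3/4" and J: "finite J"
  shows "(\<Sum>j\<in>J. r ^ ((i - j) + (j - i))) \<le> 8"
proof -
  have up: "(\<Sum>j\<in>{i..<n}. r ^ (j - i)) \<le> 4 * (1 - r ^ (n - i))" if "n \<ge> i" for n
    using that
  proof (induction n rule: dec_induct)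
    case (step n)
    have "r * r ^ (n - i) \<le> 3/4 * r ^ (n - i)" using r by (intro mult_right_mono) auto
    then show ?case using step by (simp add: Suc_diff_le)
  qed simp
  have down: "(\<Sum>j\<in>{..<i}. r ^ (i - j)) \<le> 4" for i
  proof (induction i)
    case (Suc i)
    have "(\<Sum>j\<in>{..<Suc i}. r ^ (Suc i - j)) = r * (\<Sum>j\<in>{..<i}. r ^ (i - j)) + r"
      by (simp add: sum_distrib_left Suc_diff_le)
    also have "\<dots> \<le> r * 4 + r" using Suc r by (intro add_mono mult_left_mono) auto
    also have "\<dots> \<le> 4" using r by simp
    finally show ?case .
  qed simp
  obtain n where n: "J \<subseteq> {..<n}" "i \<le> n"
  proof
    show "J \<subseteq> {..<max (Suc (Max (insert 0 J))) i}" using J by (auto simp: less_max_iff_disj less_Suc_eq_le)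
  qed simp
  have "(\<Sum>j\<in>J. r ^ ((i - j) + (j - i))) \<le> (\<Sum>j\<in>{..<n}. r ^ ((i - j) + (j - i)))"
    using n r by (intro sum_mono2) auto
  also have "{..<n} = {..<i} \<union> {i..<n}" using n by auto
  also have "(\<Sum>j\<in>{..<i} \<union> {i..<n}. r ^ ((i - j) + (j - i))) = (\<Sum>j\<in>{..<i}. r ^ (i - j)) + (\<Sum>j\<in>{i..<n}. r ^ (j - i))"
    by (subst sum.union_disjoint) (auto intro!: arg_cong2[of _ _ _ _ plus] sum.cong)
  also have "\<dots> \<le> 4 + 4 * (1 - r ^ (n - i))" using up[OF n(2)] down by (intro add_mono) auto
  also have "\<dots> \<le> 8" using r by simp
  finally show ?thesis .
qed

text \<open>
  Almost orthogonality: \<open>\<integral>\<kappa>\<^sub>i \<kappa>\<^sub>j \<le> C B 2\<^bsup>min i j\<^esup>\<close>, so after normalisation by \<open>2\<^bsup>-j/2\<^esup>\<close> the Gram matrix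
  of the kernels decays geometrically off the diagonal. This replaces a maximal inequality.
\<close>

lemma almost_orthogonal:
  fixes \<kappa> :: "nat \<Rightarrow> 'a::euclidean_space \<Rightarrow> real" and H :: "'a \<Rightarrow> ennreal"
  assumes [measurable]: "\<And>j. \<kappa> j \<in> borel_measurable borel" "H \<in> borel_measurable borel"
    and k0: "\<And>j y. 0 \<le> \<kappa> j y" and kB: "\<And>j y. \<kappa> j y \<le> B * 2 ^ j"
    and kC: "\<And>j. (\<integral>\<^sup>+y. ennreal (\<kappa> j y) \<partial>lborel) \<le> ennreal C" and BC: "B > 0" "C > 0" and J: "finite J"
  shows "(\<Sum>j\<in>J. ennreal (1 / 2 ^ j) * (\<integral>\<^sup>+y. H y * ennreal (\<kappa> j y) \<partial>lborel)\<^sup>2) \<le> ennreal (8 * C * B) * (\<integral>\<^sup>+y. (H y)\<^sup>2 \<partial>lborel)"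
proof (cases "(\<integral>\<^sup>+y. (H y)\<^sup>2 \<partial>lborel) = \<infinity>")
  case True
  then show ?thesis using BC by (simp add: ennreal_mult_top)
next
  case False
  then obtain h where h: "(\<integral>\<^sup>+y. (H y)\<^sup>2 \<partial>lborel) = ennreal h" "h \<ge> 0"
    by (cases "(\<integral>\<^sup>+y. (H y)\<^sup>2 \<partial>lborel)") auto
  have kk: "(\<integral>\<^sup>+y. ennreal (\<kappa> i y) * ennreal (\<kappa> j y) \<partial>lborel) \<le> ennreal (C * B * 2 ^ min i j)" for i j
  proof -
    have 1: "(\<integral>\<^sup>+y. ennreal (\<kappa> i y) * ennreal (\<kappa> j y) \<partial>lborel) \<le> ennreal (C * B * 2 ^ i)" for i j
    proof -
      have "(\<integral>\<^sup>+y. ennreal (\<kappa> i y) * ennreal (\<kappa> j y) \<partial>lborel) \<le> (\<integral>\<^sup>+y. ennreal (B * 2 ^ i) * ennreal (\<kappa> j y) \<partial>lborel)"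
        by (intro nn_integral_mono mult_right_mono ennreal_leI kB) auto
      also have "\<dots> = ennreal (B * 2 ^ i) * (\<integral>\<^sup>+y. ennreal (\<kappa> j y) \<partial>lborel)" by (rule nn_integral_cmult) measurable
      also have "\<dots> \<le> ennreal (B * 2 ^ i) * ennreal C" by (intro mult_left_mono kC) auto
      also have "\<dots> = ennreal (C * B * 2 ^ i)" using BC by (simp add: ennreal_mult[symmetric] mult_ac)
      finally show ?thesis .
    qed
    show ?thesis using 1[of i j] 1[of j i] by (cases "i \<le> j") (auto simp: min_def mult.commute)
  qed
  define A where "A j = enn2real (\<integral>\<^sup>+y. H y * ennreal (\<kappa> j y) \<partial>lborel)" for j
  have A: "(\<integral>\<^sup>+y. H y * ennreal (\<kappa> j y) \<partial>lborel) = ennreal (A j)" for j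
  proof -
    have "(\<integral>\<^sup>+y. H y * ennreal (\<kappa> j y) \<partial>lborel)\<^sup>2 \<le> (\<integral>\<^sup>+y. (H y)\<^sup>2 \<partial>lborel) * (\<integral>\<^sup>+y. (ennreal (\<kappa> j y))\<^sup>2 \<partial>lborel)"
      by (rule Cauchy_Schwarz_nn_integral) measurable
    also have "\<dots> \<le> ennreal h * ennreal (C * B * 2 ^ j)"
      using kk[of j j] unfolding h(1) by (intro mult_left_mono) (auto simp: power2_eq_square)
    also have "\<dots> < \<infinity>" by (simp add: ennreal_mult_less_top)
    finally have "(\<integral>\<^sup>+y. H y * ennreal (\<kappa> j y) \<partial>lborel) < \<infinity>" by (simp add: power_less_top_ennreal)
    then show ?thesis unfolding A_def by (simp add: less_top)
  qed
  have A0: "A j \<ge> 0" for j by (simp add: A_def)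
  define S where "S = (\<Sum>j\<in>J. 1 / 2 ^ j * (A j)\<^sup>2)"
  have S0: "S \<ge> 0" unfolding S_def by (intro sum_nonneg) auto
  have lhs: "(\<Sum>j\<in>J. ennreal (1 / 2 ^ j) * (\<integral>\<^sup>+y. H y * ennreal (\<kappa> j y) \<partial>lborel)\<^sup>2) = ennreal S"
  proof -
    have "(\<Sum>j\<in>J. ennreal (1 / 2 ^ j) * (ennreal (A j))\<^sup>2) = (\<Sum>j\<in>J. ennreal (1 / 2 ^ j * (A j)\<^sup>2))"
      using A0 by (intro sum.cong refl) (simp add: ennreal_power ennreal_mult'[symmetric])
    then show ?thesis unfolding A S_def by (simp add: sum_ennreal)
  qed
  \<comment> \<open>Duality: with these coefficients the combination \<open>G\<close> of the kernels
    satisfies that the pairing of \<open>H\<close> with \<open>G\<close> is \<open>S\<close> itself,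
    while the squared norm of \<open>G\<close> is at most a multiple of \<open>S\<close>.
    Cauchy-Schwarz then bounds \<open>S^2\<close> by a multiple of \<open>S\<close>.\<close>
  define w where "w j = 1 / 2 ^ j * A j" for j
  have w0: "w j \<ge> 0" for j using A0 by (simp add: w_def)
  define G where "G y = (\<Sum>j\<in>J. ennreal (w j) * ennreal (\<kappa> j y))" for y
  have [measurable]: "G \<in> borel_measurable borel" unfolding G_def[abs_def] by measurable
  have HG: "(\<integral>\<^sup>+y. H y * G y \<partial>lborel) = ennreal S"
  proof -
    have "(\<integral>\<^sup>+y. H y * G y \<partial>lborel) = (\<integral>\<^sup>+y. (\<Sum>j\<in>J. ennreal (w j) * (H y * ennreal (\<kappa> j y))) \<partial>lborel)"
      unfolding G_def by (simp only: sum_distrib_left mult_ac)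
    also have "\<dots> = (\<Sum>j\<in>J. ennreal (w j) * (\<integral>\<^sup>+y. H y * ennreal (\<kappa> j y) \<partial>lborel))"
      by (subst nn_integral_sum) (auto simp: nn_integral_cmult)
    also have "\<dots> = ennreal S"
      unfolding A S_def using A0 w0 by (simp add: ennreal_mult[symmetric] sum_ennreal w_def power2_eq_square mult.assoc)
    finally show ?thesis .
  qed
  \<comment> \<open>Chosen because \<open>2^(-i-j) * 2^(min i j) = 2^(- max i j)\<close> factors as
    \<open>r^|i-j| * r^i * r^j\<close>. The last two factors turn \<open>A i\<close> and
    \<open>A j\<close> into \<open>\<alpha> i\<close> and \<open>\<alpha> j\<close>, and the first
    gives the off-diagonal decay.\<close>
  define r :: real where "r = sqrt (1/2)"
  have r: "0 \<le> r" "r \<le> 3/4" "r\<^sup>2 = 1/2"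
  proof -
    show "r \<le> 3/4" unfolding r_def by (rule real_le_lsqrt) (simp_all add: power2_eq_square)
  qed (simp_all add: r_def)
  define \<alpha> where "\<alpha> j = r ^ j * A j" for j
  have a2: "(\<alpha> j)\<^sup>2 = 1 / 2 ^ j * (A j)\<^sup>2" for j
  proof -
    have "(r ^ j)\<^sup>2 = (r\<^sup>2) ^ j" by (simp add: power_mult[symmetric] mult.commute)
    then show ?thesis by (simp add: \<alpha>_def power_mult_distrib r(3) power_divide)
  qed
  have wk: "w i * w j * 2 ^ min i j = r ^ ((i - j) + (j - i)) * \<alpha> i * \<alpha> j" for i j
  proof -
    have "1 / 2 ^ i * (1 / 2 ^ j) * 2 ^ min i j = (1/2::real) ^ max i j"
      by (cases "i \<le> j") (auto simp: min_def max_def power_divide)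
    also have "\<dots> = r ^ (2 * max i j)" by (simp add: power_mult r(3))
    also have "2 * max i j = ((i - j) + (j - i)) + i + j" by (simp add: max_def)
    also have "r ^ \<dots> = r ^ ((i - j) + (j - i)) * r ^ i * r ^ j" by (simp only: power_add mult.assoc)
    finally have "(1 / 2 ^ i * (1 / 2 ^ j) * 2 ^ min i j) * (A i * A j) = (r ^ ((i - j) + (j - i)) * r ^ i * r ^ j) * (A i * A j)"
      by (rule arg_cong)
    then show ?thesis unfolding w_def \<alpha>_def by (simp only: mult_ac)
  qed
  have GG: "(\<integral>\<^sup>+y. (G y)\<^sup>2 \<partial>lborel) \<le> ennreal (C * B * (8 * S))"
  proof -
    have "(\<integral>\<^sup>+y. (G y)\<^sup>2 \<partial>lborel) = (\<integral>\<^sup>+y. (\<Sum>i\<in>J. \<Sum>j\<in>J. ennreal (w i * w j) * (ennreal (\<kappa> i y) * ennreal (\<kappa> j y))) \<partial>lborel)"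
      unfolding G_def power2_eq_square sum_product using w0 by (simp add: ennreal_mult mult_ac)
    also have "\<dots> = (\<Sum>i\<in>J. \<Sum>j\<in>J. ennreal (w i * w j) * (\<integral>\<^sup>+y. ennreal (\<kappa> i y) * ennreal (\<kappa> j y) \<partial>lborel))"
      by (subst nn_integral_sum, measurable) (intro sum.cong refl, subst nn_integral_sum, measurable,
        intro sum.cong refl nn_integral_cmult, measurable)
    also have "\<dots> \<le> (\<Sum>i\<in>J. \<Sum>j\<in>J. ennreal (w i * w j) * ennreal (C * B * 2 ^ min i j))"
      by (intro sum_mono mult_left_mono kk) auto
    also have "\<dots> = ennreal (\<Sum>i\<in>J. \<Sum>j\<in>J. (w i * w j) * (C * B * 2 ^ min i j))"
      using w0 BC by (simp add: ennreal_mult[symmetric] sum_ennreal sum_nonneg)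
    also have "(\<Sum>i\<in>J. \<Sum>j\<in>J. (w i * w j) * (C * B * 2 ^ min i j)) = C * B * (\<Sum>i\<in>J. \<Sum>j\<in>J. r ^ ((i - j) + (j - i)) * \<alpha> i * \<alpha> j)"
      unfolding wk[symmetric] sum_distrib_left by (simp only: mult_ac)
    also have "\<dots> \<le> C * B * (8 * S)"
    proof (intro mult_left_mono)
      \<comment> \<open>Schur test for a symmetric matrix: the product is replaced by the mean of
        the squares, after which only row sums are left.\<close>
      have "(\<Sum>i\<in>J. \<Sum>j\<in>J. r ^ ((i - j) + (j - i)) * \<alpha> i * \<alpha> j)
        \<le> (\<Sum>i\<in>J. \<Sum>j\<in>J. (r ^ ((i - j) + (j - i)) * (\<alpha> i)\<^sup>2 + r ^ ((j - i) + (i - j)) * (\<alpha> j)\<^sup>2) / 2)"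
      proof (intro sum_mono)
        fix i j
        have "\<alpha> i * \<alpha> j \<le> ((\<alpha> i)\<^sup>2 + (\<alpha> j)\<^sup>2) / 2"
          using sum_squares_bound[of "\<alpha> i" "\<alpha> j"] by simp
        then have "r ^ ((i - j) + (j - i)) * (\<alpha> i * \<alpha> j) \<le> r ^ ((i - j) + (j - i)) * (((\<alpha> i)\<^sup>2 + (\<alpha> j)\<^sup>2) / 2)"
          using r by (intro mult_left_mono) auto
        then show "r ^ ((i - j) + (j - i)) * \<alpha> i * \<alpha> j \<le> (r ^ ((i - j) + (j - i)) * (\<alpha> i)\<^sup>2 + r ^ ((j - i) + (i - j)) * (\<alpha> j)\<^sup>2) / 2"
          by (simp add: add.commute distrib_left mult.assoc)
      qed
      also have "\<dots> = (\<Sum>i\<in>J. \<Sum>j\<in>J. r ^ ((i - j) + (j - i)) * (\<alpha> i)\<^sup>2)"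
      proof -
        have "(\<Sum>i\<in>J. \<Sum>j\<in>J. r ^ ((j - i) + (i - j)) * (\<alpha> j)\<^sup>2) = (\<Sum>i\<in>J. \<Sum>j\<in>J. r ^ ((i - j) + (j - i)) * (\<alpha> i)\<^sup>2)"
          by (rule sum.swap)
        then show ?thesis by (simp add: sum.distrib flip: sum_divide_distrib)
      qed
      also have "\<dots> = (\<Sum>i\<in>J. (\<alpha> i)\<^sup>2 * (\<Sum>j\<in>J. r ^ ((i - j) + (j - i))))" by (simp only: sum_distrib_left mult_ac)
      also have "\<dots> \<le> (\<Sum>i\<in>J. (\<alpha> i)\<^sup>2 * 8)"
        by (intro sum_mono mult_left_mono sum_geometric_distance r J) auto
      also have "\<dots> = 8 * S" unfolding a2 S_def by (simp add: sum_distrib_left mult_ac)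
      finally show "(\<Sum>i\<in>J. \<Sum>j\<in>J. r ^ ((i - j) + (j - i)) * \<alpha> i * \<alpha> j) \<le> 8 * S" .
    qed (use BC in auto)
    finally show ?thesis by (simp add: ennreal_leI)
  qed
  have "(ennreal S)\<^sup>2 \<le> ennreal h * ennreal (C * B * (8 * S))"
    using Cauchy_Schwarz_nn_integral[of H lborel G] GG unfolding HG h(1) by (auto intro: order_trans[OF _ mult_left_mono])
  then have "ennreal (S\<^sup>2) \<le> ennreal (h * (C * B * (8 * S)))"
    using S0 h BC by (simp add: ennreal_mult ennreal_power)
  then have "S * S \<le> (8 * C * B * h) * S"
    using S0 h BC by (subst (asm) ennreal_le_iff) (auto simp: power2_eq_square mult_ac)
  then have "S \<le> 8 * C * B * h" using S0 BC h by (cases "S = 0") auto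
  then show ?thesis unfolding lhs h(1) using BC h by (simp add: ennreal_mult[symmetric] ennreal_leI)
qed

text \<open>The sequence \<open>2^j r\<close> crosses 1 at one index, and on either side of it the
  terms decay geometrically with the distance. The bound is thus independent of \<open>r\<close>,
  which only shifts the crossing.\<close>

lemma dyadic_geometric_sum:
  fixes \<alpha> \<beta> :: real
  assumes a: "\<alpha> > 0" and b: "\<beta> > 0"
  obtains C :: real where "C > 0" "\<And>r n. r > 0 \<Longrightarrow> (\<Sum>j<n. min ((2 ^ j * r) powr \<alpha>) ((2 ^ j * r) powr - \<beta>)) \<le> C"
proof -
  define \<gamma> where "\<gamma> = min \<alpha> \<beta>"
  have g: "\<gamma> > 0" "\<gamma> \<le> \<alpha>" "\<gamma> \<le> \<beta>" using a b by (auto simp: \<gamma>_def)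
  define q :: real where "q = 2 powr - \<gamma>"
  have q: "0 < q" "q < 1" using g by (auto simp: q_def powr_less_one)
  have qk: "q ^ k = (2 ^ k) powr - \<gamma>" for k
    by (simp add: q_def powr_realpow[symmetric] powr_powr mult.commute)
  have geo: "(\<Sum>k<m. q ^ k) \<le> 1 / (1 - q)" for m
    using q sum_le_suminf[OF summable_geometric, of q "{..<m}"] by (simp add: suminf_geometric)
  show ?thesis
  proof (rule that[of "2 / (1 - q)"])
    show "2 / (1 - q) > 0" using q by simp
    fix r :: real and n assume r: "r > 0"
    define f where "f j = min ((2 ^ j * r) powr \<alpha>) ((2 ^ j * r) powr - \<beta>)" for j
    have f0: "f j \<ge> 0" for j by (simp add: f_def)
    obtain m where "1 / r < 2 ^ m" using real_arch_pow[of 2 "1 / r"] by auto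
    then have ex: "\<exists>j. 2 ^ j * r \<ge> 1" using r by (intro exI[of _ m]) (simp add: field_simps)
    \<comment> \<open>The crossing index; from it on the second power is small, and before it the
      first.\<close>
    define k where "k = (LEAST j. 2 ^ j * r \<ge> 1)"
    have k1: "2 ^ k * r \<ge> 1" unfolding k_def by (rule LeastI_ex[OF ex])
    have k2: "2 ^ j * r < 1" if "j < k" for j using not_less_Least[of j] that unfolding k_def by force
    have up: "f (k + i) \<le> q ^ i" for i
    proof -
      have "f (k + i) \<le> (2 ^ (k + i) * r) powr - \<beta>" by (simp add: f_def)
      also have "\<dots> \<le> (2 ^ i) powr - \<beta>"
      proof (rule powr_mono2')
        show "2 ^ i \<le> 2 ^ (k + i) * r" using mult_right_mono[OF k1, of "2 ^ i"] by (simp add: power_add mult_ac)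
      qed (use b in auto)
      also have "\<dots> \<le> (2 ^ i) powr - \<gamma>" using g by (intro powr_mono) auto
      finally show ?thesis by (simp add: qk)
    qed
    have down: "f j \<le> q ^ (k - Suc j)" if j: "j < k" for j
    proof -
      have lt: "2 ^ (k - Suc j) * (2 ^ j * r) < 1"
        using k2[of "k - 1"] j by (simp add: mult.assoc[symmetric] flip: power_add)
      have pos: "2 ^ j * r > 0" using r by simp
      have "f j \<le> (2 ^ j * r) powr \<alpha>" by (simp add: f_def)
      also have "\<dots> \<le> (2 ^ j * r) powr \<gamma>" using g k2[OF j] pos by (intro powr_mono') auto
      also have "\<dots> \<le> (1 / 2 ^ (k - Suc j)) powr \<gamma>"
        using g pos lt by (intro powr_mono2) (auto simp: pos_le_divide_eq mult.commute)
      also have "\<dots> = q ^ (k - Suc j)" unfolding qk by (simp add: powr_divide powr_minus_divide)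
      finally show ?thesis .
    qed
    have "(\<Sum>j<n. f j) \<le> (\<Sum>j<k + n. f j)" using f0 by (intro sum_mono2) auto
    also have "\<dots> = (\<Sum>j<k. f j) + (\<Sum>i<n. f (k + i))"
      by (induction n) auto
    also have "\<dots> \<le> (\<Sum>j<k. q ^ (k - Suc j)) + (\<Sum>i<n. q ^ i)"
      by (intro add_mono sum_mono up down) auto
    also have "(\<Sum>j<k. q ^ (k - Suc j)) = (\<Sum>i<k. q ^ i)" by (rule sum.nat_diff_reindex)
    also have "(\<Sum>i<k. q ^ i) + (\<Sum>i<n. q ^ i) \<le> 2 / (1 - q)" using geo[of k] geo[of n] by simp
    finally show "(\<Sum>j<n. min ((2 ^ j * r) powr \<alpha>) ((2 ^ j * r) powr - \<beta>)) \<le> 2 / (1 - q)" unfolding f_def .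
  qed
qed

subsection \<open>Pointwise bounds from the blocks\<close>

lemma powr_sum_le_sum_powr:
  fixes a :: "'i \<Rightarrow> real"
  assumes J: "finite J" and p: "0 < p" "p \<le> 1" and a: "\<And>j. j \<in> J \<Longrightarrow> a j \<ge> 0"
  shows "(\<Sum>j\<in>J. a j) powr p \<le> (\<Sum>j\<in>J. a j powr p)"
proof (cases "(\<Sum>j\<in>J. a j) = 0")
  case False
  define S where "S = (\<Sum>j\<in>J. a j)"
  have S: "S > 0" using False sum_nonneg[of J a] a unfolding S_def by force
  have "1 = (\<Sum>j\<in>J. a j / S)" using S by (simp add: S_def flip: sum_divide_distrib)
  also have "\<dots> \<le> (\<Sum>j\<in>J. (a j / S) powr p)"
  proof (rule sum_mono)
    fix j assume j: "j \<in> J"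
    have "a j \<le> S" unfolding S_def using j a J by (intro member_le_sum) auto
    then have "a j / S \<le> 1" "a j / S \<ge> 0" using S a[OF j] by auto
    then have "(a j / S) powr 1 \<le> (a j / S) powr p" using p by (intro powr_mono') auto
    moreover have "(a j / S) powr 1 = a j / S" using \<open>a j / S \<ge> 0\<close> by (rule powr_one)
    ultimately show "a j / S \<le> (a j / S) powr p" by linarith
  qed
  also have "\<dots> = (\<Sum>j\<in>J. a j powr p / S powr p)" using S a by (intro sum.cong) (auto simp: powr_divide)
  also have "\<dots> = (\<Sum>j\<in>J. a j powr p) / S powr p" by (simp add: sum_divide_distrib)
  finally show ?thesis using S by (simp add: S_def[symmetric] pos_le_divide_eq)
qed (simp add: sum_nonneg)

section \<open>Quasi-norms with values in the extended reals\<close>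

lemma ennpow_ennreal: "x \<ge> 0 \<Longrightarrow> ennpow (ennreal x) r = ennreal (x powr r)"
  by (simp add: ennpow_def)

lemma ennpow_top [simp]: "ennpow \<infinity> r = \<infinity>" "ennpow top r = top"
  by (simp_all add: ennpow_def)

lemma ennpow_mono:
  assumes "x \<le> y" "r > 0" shows "ennpow x r \<le> ennpow y r"
proof (cases y)
  case (real b)
  then obtain a where a: "x = ennreal a" "a \<ge> 0" using assms(1) by (cases x) (auto simp: top_unique)
  then have "a \<le> b" using assms(1) real by simp
  then show ?thesis using a real assms(2) by (auto simp: ennpow_ennreal intro!: ennreal_leI powr_mono2)
qed simp

lemma ennpow_ennpow:
  assumes "r > 0" "t > 0" shows "ennpow (ennpow x r) t = ennpow x (r * t)"
  by (cases x) (auto simp: ennpow_ennreal powr_powr)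

lemma ennpow_1 [simp]: "ennpow x 1 = x"
  by (cases x) (auto simp: ennpow_ennreal)

lemma ennpow_measurable [measurable]: "(\<lambda>t. ennpow t r) \<in> borel_measurable borel"
  unfolding ennpow_def[abs_def] by measurable

lemma ennpow_half_square: "r > 0 \<Longrightarrow> (ennpow x (r / 2))\<^sup>2 = ennpow x r"
  by (cases x) (auto simp: ennpow_ennreal ennreal_power power2_eq_square ennreal_mult[symmetric] simp flip: powr_add)

lemma Lp_norm_finiteD:
  assumes p: "p > 0" and n: "Lp_norm p u \<le> ennreal \<nu>" "\<nu> \<ge> 0"
  shows "(\<integral>\<^sup>+x. ennpow (u x) p \<partial>lborel) \<le> ennreal (\<nu> powr p)"
proof -
  have "ennpow (ennpow (\<integral>\<^sup>+x. ennpow (u x) p \<partial>lborel) (1 / p)) p \<le> ennpow (ennreal \<nu>) p"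
    using n p unfolding Lp_norm_def by (intro ennpow_mono) auto
  then show ?thesis using p n by (simp add: ennpow_ennpow ennpow_ennreal)
qed

lemma lq_norm_ge:
  assumes "q > 0" shows "a j \<le> lq_norm q a"
proof (cases "q = \<infinity>")
  case False
  define t where "t = enn2real q"
  have t: "t > 0" using assms False by (simp add: t_def enn2real_positive_iff less_top)
  have "ennpow (a j) t \<le> (\<Sum>j. ennpow (a j) t)"
    using sum_le_suminf[of "\<lambda>j. ennpow (a j) t" "{j}"] by simp
  then have "ennpow (ennpow (a j) t) (1 / t) \<le> ennpow (\<Sum>j. ennpow (a j) t) (1 / t)" using t by (intro ennpow_mono) auto
  then show ?thesis using False t by (simp add: lq_norm_def ennpow_ennpow t_def[symmetric])
qed (simp add: lq_norm_def SUP_upper)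

lemma sum_le_lq_norm:
  fixes \<alpha> :: "nat \<Rightarrow> real"
  assumes q: "0 < q" "q \<le> 1" and a: "\<And>j. \<alpha> j \<ge> 0" and n: "lq_norm q (\<lambda>j. ennreal (\<alpha> j)) \<le> ennreal \<nu>" "\<nu> \<ge> 0"
  shows "(\<Sum>j<n. \<alpha> j) \<le> \<nu>"
proof -
  define t where "t = enn2real q"
  have qt: "q \<noteq> \<infinity>" using q by (auto simp: top_unique)
  have t: "t > 0" using q qt by (simp add: t_def enn2real_positive_iff less_top)
  have t1: "t \<le> 1" using q qt unfolding t_def by (metis enn2real_1 enn2real_mono ennreal_one_less_top)
  have "ennpow (ennpow (\<Sum>j. ennpow (ennreal (\<alpha> j)) t) (1 / t)) t \<le> ennpow (ennreal \<nu>) t"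
    using n t qt unfolding lq_norm_def t_def[symmetric] by (intro ennpow_mono) auto
  then have "(\<Sum>j. ennpow (ennreal (\<alpha> j)) t) \<le> ennreal (\<nu> powr t)"
    using t n by (simp add: ennpow_ennpow ennpow_ennreal)
  then have "(\<Sum>j. ennreal (\<alpha> j powr t)) \<le> ennreal (\<nu> powr t)" using a by (simp add: ennpow_ennreal)
  moreover have "(\<Sum>j<n. ennreal (\<alpha> j powr t)) \<le> (\<Sum>j. ennreal (\<alpha> j powr t))" by (rule sum_le_suminf) auto
  ultimately have "(\<Sum>j<n. ennreal (\<alpha> j powr t)) \<le> ennreal (\<nu> powr t)" by (rule order_trans[rotated])
  then have "(\<Sum>j<n. \<alpha> j powr t) \<le> \<nu> powr t" by (simp add: sum_ennreal ennreal_le_iff)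
  then have "(\<Sum>j<n. \<alpha> j) powr t \<le> \<nu> powr t"
    using powr_sum_le_sum_powr[of "{..<n}" t \<alpha>] t t1 a by simp
  then show ?thesis using powr_less_mono2[OF t n(2), of "\<Sum>j<n. \<alpha> j"] by linarith
qed

text \<open>The hypothesis \<open>tail\<close> is a uniform Cauchy condition away from the origin.
  It makes the limit of the block series continuous there and permits termwise pairing with test
  functions supported off the origin. Convergence of the dyadic expansion identifies the limit with
  \<open>T\<close>, and uniqueness of continuous representatives concludes.\<close>

lemma cont_rep_block_series:
  fixes \<phi>0 :: "'a::euclidean_space \<Rightarrow> complex"
  assumes gen: "lp_generator \<phi>0" and T: "T \<in> tempered_dists"
    and tail: "\<And>r \<epsilon>. r > 0 \<Longrightarrow> \<epsilon> > 0 \<Longrightarrow> \<exists>m0. \<forall>m\<ge>m0. \<forall>n. \<forall>x. r \<le> norm x \<longrightarrow> (\<Sum>j\<in>{m..<n}. norm (block (dyadic \<phi>0 j) T x)) \<le> \<epsilon>"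
    and x: "x \<noteq> 0"
  shows "(\<lambda>n. \<Sum>j<n. block (dyadic \<phi>0 j) T x) \<longlonglongrightarrow> cont_rep (- {0}) T x"
proof -
  define g where "g j = block (dyadic \<phi>0 j) T" for j
  define S where "S n x = (\<Sum>j<n. g j x)" for n x
  have gc: "continuous_on A (g j)" for A j unfolding g_def by (intro block_continuous T schwartz_dyadic gen)
  have Sc: "continuous_on A (S n)" for A n unfolding S_def by (intro continuous_intros gc)
  have [measurable]: "S n \<in> borel_measurable borel" for n by (intro borel_measurable_continuous_onI Sc)
  define G where "G x = lim (\<lambda>n. S n x)" for x
  have Sd: "norm (S n y - S m y) \<le> \<epsilon>" if "m \<le> n" "(\<Sum>j\<in>{m..<n}. norm (g j y)) \<le> \<epsilon>" for m n y \<epsilon>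
  proof -
    have "S n y = S m y + (\<Sum>j\<in>{m..<n}. g j y)"
      unfolding S_def using that(1) by (simp add: lessThan_atLeast0 sum.atLeastLessThan_concat)
    then have "norm (S n y - S m y) \<le> (\<Sum>j\<in>{m..<n}. norm (g j y))" using norm_sum[of "\<lambda>j. g j y" "{m..<n}"] by simp
    then show ?thesis using that(2) by simp
  qed
  have ul: "uniform_limit {y. r \<le> norm y} S G sequentially" if r: "r > 0" for r
  proof -
    have "uniformly_Cauchy_on {y. r \<le> norm y} S"
    proof (rule uniformly_Cauchy_onI)
      fix e :: real assume "e > 0"
      then obtain m0 where m0: "\<forall>m\<ge>m0. \<forall>n. \<forall>x. r \<le> norm x \<longrightarrow> (\<Sum>j\<in>{m..<n}. norm (g j x)) \<le> e / 2"
        using tail[OF r, of "e / 2"] unfolding g_def by auto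
      have "dist (S m y) (S n y) < e" if "y \<in> {y. r \<le> norm y}" "m \<ge> m0" "n \<ge> m0" for y m n
      proof (cases "m \<le> n")
        case True
        then show ?thesis using Sd[OF True, of y "e/2"] m0 that \<open>e > 0\<close> by (auto simp: dist_norm norm_minus_commute)
      next
        case False
        then show ?thesis using Sd[of n m y "e/2"] m0 that \<open>e > 0\<close> by (auto simp: dist_norm)
      qed
      then show "\<exists>M. \<forall>x\<in>{y. r \<le> norm y}. \<forall>m\<ge>M. \<forall>n\<ge>M. dist (S m x) (S n x) < e" by blast
    qed
    then show ?thesis unfolding G_def
      by (simp add: uniformly_convergent_eq_Cauchy[symmetric] uniformly_convergent_uniform_limit_iff)
  qed
  have pl: "(\<lambda>n. S n y) \<longlonglongrightarrow> G y" if "y \<noteq> 0" for y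
    using tendsto_uniform_limitI[OF ul[of "norm y"], of y] that by simp
  have Gc: "continuous_on (- {0}) G"
  proof -
    have "isCont G y" if y: "y \<noteq> 0" for y
    proof -
      have "continuous_on {z. norm y / 2 \<le> norm z} G"
        using y by (intro uniform_limit_theorem[OF _ ul]) (auto intro!: always_eventually Sc)
      then have c: "continuous_on {z. norm y / 2 < norm z} G" by (rule continuous_on_subset) auto
      have "open {z::'a. norm y / 2 < norm z}" by (intro open_Collect_less continuous_intros)
      with c have "\<forall>z\<in>{z. norm y / 2 < norm z}. isCont G z" by (simp add: continuous_on_eq_continuous_at)
      moreover have "y \<in> {z. norm y / 2 < norm z}" using y by simp
      ultimately show ?thesis by blast
    qed
    then show ?thesis by (intro continuous_at_imp_continuous_on) auto
  qed
  have "agrees_on (- {0}) T G"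
    unfolding agrees_on_def
  proof
    fix \<psi> :: "'a \<Rightarrow> complex" assume \<psi>t: "\<psi> \<in> test_funs (- {0})"
    then have \<psi>: "\<psi> \<in> schwartz" using test_funs_subset_schwartz by blast
    have [measurable]: "\<psi> \<in> borel_measurable borel" by (rule schwartz_measurable[OF \<psi>])
    obtain K where K: "compact K" "K \<subseteq> - {0}" "\<And>y. y \<notin> K \<Longrightarrow> \<psi> y = 0"
      using \<psi>t unfolding test_funs_def by blast
    \<comment> \<open>The distance of the support from the origin, where uniform convergence is
      available; an empty support gets the arbitrary value 1.\<close>
    obtain r where r: "r > 0" "\<And>y. y \<in> K \<Longrightarrow> r \<le> norm y"
    proof (cases "K = {}")
      case False
      from distance_attains_inf[OF compact_imp_closed[OF K(1)] False, of 0]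
      obtain k where k: "k \<in> K" "\<And>y. y \<in> K \<Longrightarrow> dist 0 k \<le> dist 0 y" by blast
      then show ?thesis using that[of "norm k"] K(2) by auto
    qed (use that[of 1] in auto)
    obtain m0 where m0: "\<forall>m\<ge>m0. \<forall>n. \<forall>x. r \<le> norm x \<longrightarrow> (\<Sum>j\<in>{m..<n}. norm (g j x)) \<le> 1"
      using tail[OF r(1), of 1] unfolding g_def by auto
    have Si: "integrable lborel (\<lambda>y. S n y * \<psi> y)"
      and SL: "(LINT y|lborel. S n y * \<psi> y) = (\<Sum>j<n. LINT y|lborel. g j y * \<psi> y)" for n
      unfolding S_def sum_distrib_right g_def
      using block_pairing(1)[OF T schwartz_dyadic[OF gen] \<psi>]
      by (auto intro!: Bochner_Integration.integrable_sum Bochner_Integration.integral_sum)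
    \<comment> \<open>Only the sums beyond \<open>m0\<close> are known to differ by at most 1 on the
      support, so the partial sum \<open>S m0\<close> itself enters the majorant.\<close>
    have dom: "norm (S (n + m0) y * \<psi> y) \<le> norm (S m0 y * \<psi> y) + norm (\<psi> y)" for n y
    proof (cases "y \<in> K")
      case True
      have "norm (S (n + m0) y - S m0 y) \<le> 1" using m0 r(2)[OF True] by (intro Sd) auto
      then have "norm (S (n + m0) y) \<le> norm (S m0 y) + 1" using norm_triangle_sub[of "S (n + m0) y" "S m0 y"] by linarith
      then have "norm (S (n + m0) y) * norm (\<psi> y) \<le> (norm (S m0 y) + 1) * norm (\<psi> y)" by (intro mult_right_mono) auto
      then show ?thesis by (simp add: norm_mult distrib_right)
    qed (simp add: K(3))
    have lim: "(\<lambda>n. S (n + m0) y * \<psi> y) \<longlonglongrightarrow> G y * \<psi> y" for y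
    proof (cases "y \<in> K")
      case True
      then have "y \<noteq> 0" using K(2) by auto
      then show ?thesis by (intro tendsto_intros LIMSEQ_ignore_initial_segment pl)
    qed (simp add: K(3))
    have [measurable]: "(\<lambda>y. G y * \<psi> y) \<in> borel_measurable borel"
      by (rule borel_measurable_LIMSEQ_metric[of "\<lambda>n y. S (n + m0) y * \<psi> y"]) (use lim in auto)
    have w: "integrable lborel (\<lambda>y. norm (S m0 y * \<psi> y) + norm (\<psi> y))"
      using Si schwartz_integrable[OF \<psi>] by (intro Bochner_Integration.integrable_add integrable_norm)
    have 1: "(\<lambda>n. LINT y|lborel. S (n + m0) y * \<psi> y) \<longlonglongrightarrow> (LINT y|lborel. G y * \<psi> y)"
      by (rule integral_dominated_convergence[OF _ _ w]) (use lim dom in auto)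
    have 2: "integrable lborel (\<lambda>y. G y * \<psi> y)"
      by (rule integrable_dominated_convergence[OF _ _ w, of _ "\<lambda>n y. S (n + m0) y * \<psi> y"]) (use lim dom in auto)
    have "(\<lambda>J. \<Sum>j\<le>J. LINT y|lborel. g j y * \<psi> y) \<longlonglongrightarrow> T \<psi>"
      unfolding g_def by (rule block_sum_tendsto[OF gen T \<psi>])
    then have "(\<lambda>n. \<Sum>j<n. LINT y|lborel. g j y * \<psi> y) \<longlonglongrightarrow> T \<psi>"
      unfolding lessThan_Suc_atMost[symmetric] by (rule LIMSEQ_imp_Suc)
    then have "(\<lambda>n. LINT y|lborel. S (n + m0) y * \<psi> y) \<longlonglongrightarrow> T \<psi>"
      unfolding SL by (rule LIMSEQ_ignore_initial_segment)
    with 1 have "T \<psi> = (LINT y|lborel. G y * \<psi> y)" using LIMSEQ_unique by blast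
    with 2 show "integrable lborel (\<lambda>x. G x * \<psi> x) \<and> T \<psi> = (LINT x|lborel. G x * \<psi> x)" by blast
  qed
  then have "cont_rep (- {0}) T x = G x" using x by (intro cont_rep_eq[OF gen _ Gc]) auto
  then show ?thesis using pl[OF x] unfolding S_def g_def by simp
qed

lemma cont_rep_bound:
  fixes \<phi>0 :: "'a::euclidean_space \<Rightarrow> complex"
  assumes gen: "lp_generator \<phi>0" and T: "T \<in> tempered_dists"
    and tail: "\<And>r \<epsilon>. r > 0 \<Longrightarrow> \<epsilon> > 0 \<Longrightarrow> \<exists>m0. \<forall>m\<ge>m0. \<forall>n. \<forall>x. r \<le> norm x \<longrightarrow> (\<Sum>j\<in>{m..<n}. norm (block (dyadic \<phi>0 j) T x)) \<le> \<epsilon>"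
    and x: "x \<noteq> 0" and B: "\<And>n. (\<Sum>j<n. norm (block (dyadic \<phi>0 j) T x)) \<le> B"
  shows "norm (cont_rep (- {0}) T x) \<le> B"
proof (rule tendsto_upperbound)
  show "(\<lambda>n. norm (\<Sum>j<n. block (dyadic \<phi>0 j) T x)) \<longlonglongrightarrow> norm (cont_rep (- {0}) T x)"
    by (intro tendsto_norm cont_rep_block_series[OF gen T _ x] tail)
  show "\<forall>\<^sub>F n in sequentially. norm (\<Sum>j<n. block (dyadic \<phi>0 j) T x) \<le> B"
    using B by (intro always_eventually allI order_trans[OF norm_sum])
qed simp

lemma tail_from_majorant:
  fixes g :: "nat \<Rightarrow> 'a::real_normed_vector \<Rightarrow> complex" and M :: "nat \<Rightarrow> real"
  assumes M0: "\<And>j. M j \<ge> 0" and MB: "\<And>n. (\<Sum>j<n. M j) \<le> B" and g: "\<And>j x. r \<le> norm x \<Longrightarrow> norm (g j x) \<le> M j" and e: "\<epsilon> > 0"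
  shows "\<exists>m0. \<forall>m\<ge>m0. \<forall>n. \<forall>x. r \<le> norm x \<longrightarrow> (\<Sum>j\<in>{m..<n}. norm (g j x)) \<le> \<epsilon>"
proof -
  have "summable M" using M0 MB by (intro summableI_nonneg_bounded) auto
  then obtain m0 where m0: "\<And>m n. m \<ge> m0 \<Longrightarrow> norm (sum M {m..<n}) < \<epsilon>"
    using e unfolding summable_Cauchy by blast
  have "(\<Sum>j\<in>{m..<n}. norm (g j x)) \<le> \<epsilon>" if "m \<ge> m0" "r \<le> norm x" for m n x
  proof -
    have "(\<Sum>j\<in>{m..<n}. norm (g j x)) \<le> sum M {m..<n}" using g[OF that(2)] by (intro sum_mono)
    also have "\<dots> \<le> \<epsilon>" using m0[OF that(1), of n] by simp
    finally show ?thesis .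
  qed
  then show ?thesis by blast
qed

section \<open>Summation of the block bounds\<close>

lemma shell_density_pos: "shell_density d j r \<ge> 0"
  by (simp add: shell_density_def)

lemma shell_density_antimono:
  assumes "0 < r" "r \<le> r'" "d \<ge> 1" shows "shell_density d j r' \<le> shell_density d j r"
  unfolding shell_density_def using assms
  by (intro mult_left_mono min.mono order_refl powr_mono2') auto

lemma shell_density_le: 
  assumes "r > 0" "d \<ge> 1" shows "shell_density d j r \<le> 2 ^ j * r powr - (real d - 1)"
proof -
  have "shell_density d j r \<le> (2 ^ j) ^ d * (2 ^ j * r) powr - (real d - 1)"
    unfolding shell_density_def by (intro mult_left_mono) auto
  also have "\<dots> = (2 ^ j) powr (real d + - (real d - 1)) * r powr - (real d - 1)"
  proof -
    have e: "((2::real) ^ j) ^ d = (2 ^ j) powr real d" by (simp add: powr_realpow)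
    show ?thesis unfolding e by (simp only: powr_mult powr_add mult.assoc)
  qed
  finally show ?thesis by simp
qed

text \<open>Only the embedding into \<open>B\<^bsup>s\<^esup>\<^bsub>p,\<infinity>\<^esub>\<close> is used.\<close>

lemma radial_bound_supercritical:
  fixes \<phi>0 :: "real ^ 'n \<Rightarrow> complex"
  assumes gen: "lp_generator \<phi>0" and p: "p > 0" and s: "1 / p < s" "s < real CARD('n) / p"
  obtains C where "C > 0" "\<And>T \<nu> x. T \<in> tempered_dists \<Longrightarrow> radial_dist T \<Longrightarrow> \<nu> \<ge> 0 \<Longrightarrow>
      (\<And>i. (\<integral>\<^sup>+y. ennreal (norm (block (dyadic \<phi>0 i) T y) powr p) \<partial>lborel) \<le> ennreal ((2 powr - (real i * s) * \<nu>) powr p)) \<Longrightarrow> x \<noteq> 0 \<Longrightarrow>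
      norm (cont_rep (- {0}) T x) \<le> C * norm x powr (s - real CARD('n) / p) * \<nu>"
proof -
  let ?d = "real CARD('n)"
  have d1: "CARD('n) \<ge> 1" by (simp add: Suc_leI)
  have s0: "s > 0" using s(1) p by (meson less_trans zero_less_divide_1_iff)
  obtain C1 where C1: "C1 > 0" "\<And>T j x N. T \<in> tempered_dists \<Longrightarrow> radial_dist T \<Longrightarrow> (\<And>i. N i \<ge> 0) \<Longrightarrow>
      (\<And>i. (\<integral>\<^sup>+y. ennreal (norm (block (dyadic \<phi>0 i) T y) powr p) \<partial>lborel) \<le> ennreal (N i powr p)) \<Longrightarrow> x \<noteq> 0 \<Longrightarrow>
      norm (block (dyadic \<phi>0 j) T x) \<le> C1 * shell_density CARD('n) j (norm x) powr (1 / p) * (\<Sum>i\<in>{j - 1..j + 1}. N i)"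
    by (rule pointwise_Lp[OF gen p]) (rule that, assumption, blast)
  \<comment> \<open>For \<open>2^j r < 1\<close> the block bound grows like
    \<open>2^(j(d/p - s))\<close>, for \<open>2^j r > 1\<close> it decays like
    \<open>2^(j(1/p - s))\<close>. Once \<open>r^(s - d/p)\<close> is factored out, both depend on
    \<open>2^j r\<close> alone.\<close>
  define \<alpha> where "\<alpha> = ?d / p - s"
  define \<beta> where "\<beta> = s - 1 / p"
  have ab: "\<alpha> > 0" "\<beta> > 0" using s by (auto simp: \<alpha>_def \<beta>_def)
  obtain C2 where C2: "C2 > 0" "\<And>r n. r > 0 \<Longrightarrow> (\<Sum>j<n. min ((2 ^ j * r) powr \<alpha>) ((2 ^ j * r) powr - \<beta>)) \<le> C2"
    by (rule dyadic_geometric_sum[OF ab]) (rule that, assumption, blast)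
  define K where "K = C1 * (3 * 2 powr s)"
  have K: "K > 0" using C1(1) by (simp add: K_def)
  define m where "m j r = K * r powr (s - ?d / p) * min ((2 ^ j * r) powr \<alpha>) ((2 ^ j * r) powr - \<beta>)" for j r
  have m0: "m j r \<ge> 0" for j r using K by (simp add: m_def)
  have mB: "(\<Sum>j<n. m j r) \<le> K * r powr (s - ?d / p) * C2" if "r > 0" for n r
    unfolding m_def sum_distrib_left[symmetric] using C2(2)[OF that] K by (intro mult_left_mono) auto
  have dens: "shell_density CARD('n) j r powr (1 / p) * 2 powr - (real j * s) = r powr (s - ?d / p) * min ((2 ^ j * r) powr \<alpha>) ((2 ^ j * r) powr - \<beta>)" if r: "r > 0" for j r
  proof -
    let ?t = "2 ^ j * r"
    have t: "?t > 0" using r by simp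
    have mp: "(min 1 (?t powr - (?d - 1))) powr (1 / p) = min 1 (?t powr (- (?d - 1) / p))"
    proof -
      have Y: "?t powr (- (?d - 1) / p) = (?t powr - (?d - 1)) powr (1 / p)" unfolding powr_powr by simp
      show ?thesis
      proof (cases "1 \<le> ?t powr - (?d - 1)")
        case True
        then have "1 \<le> (?t powr - (?d - 1)) powr (1 / p)" by (rule ge_one_powr_ge_zero) (use p in simp)
        then show ?thesis unfolding Y min_absorb1[OF True] by (simp only: min_absorb1 powr_one_eq_one)
      next
        case False
        then have F: "?t powr - (?d - 1) \<le> 1" by linarith
        then have "(?t powr - (?d - 1)) powr (1 / p) \<le> 1" using p by (intro powr_le1) auto
        then show ?thesis unfolding Y min_absorb2[OF F] by (simp only: min_absorb2)
      qed
    qed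
    have e1: "((2::real) ^ j) ^ CARD('n) = (2 ^ j) powr ?d" by (simp add: powr_realpow)
    have A: "shell_density CARD('n) j r powr (1 / p) = (2 ^ j) powr (?d / p) * min 1 (?t powr (- (?d - 1) / p))"
      unfolding shell_density_def e1 powr_mult[of "(2 ^ j) powr ?d"] mp by (simp add: powr_powr)
    have B: "2 powr - (real j * s) = (2 ^ j) powr - s" by (simp add: powr_realpow[symmetric] powr_powr)
    have "shell_density CARD('n) j r powr (1 / p) * 2 powr - (real j * s) = (2 ^ j) powr (?d / p) * min 1 (?t powr (- (?d - 1) / p)) * (2 ^ j) powr - s"
      unfolding A B ..
    also have "(2 ^ j) powr (?d / p) * min 1 (?t powr (- (?d - 1) / p)) * (2 ^ j) powr - s = (2 ^ j) powr \<alpha> * min 1 (?t powr (- (?d - 1) / p))"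
      unfolding \<alpha>_def by (simp add: powr_diff powr_minus divide_inverse mult_ac)
    also have "(2 ^ j) powr \<alpha> = r powr - \<alpha> * ?t powr \<alpha>" using r by (simp add: powr_mult powr_minus field_simps)
    also have "r powr - \<alpha> * ?t powr \<alpha> * min 1 (?t powr (- (?d - 1) / p)) = r powr - \<alpha> * min (?t powr \<alpha>) (?t powr \<alpha> * ?t powr (- (?d - 1) / p))"
      by (simp add: mult.assoc min_mult_distrib_left)
    also have "?t powr \<alpha> * ?t powr (- (?d - 1) / p) = ?t powr - \<beta>"
      unfolding powr_add[symmetric] by (rule arg_cong[of _ _ "(powr) ?t"]) (simp add: \<alpha>_def \<beta>_def diff_divide_distrib)
    finally show ?thesis by (simp add: \<alpha>_def)
  qed
  show ?thesis
  proof (rule that[of "K * C2"])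
    show "K * C2 > 0" using K C2(1) by simp
    fix T :: "(real ^ 'n \<Rightarrow> complex) \<Rightarrow> complex" and \<nu> :: real and x :: "real ^ 'n"
    assume T: "T \<in> tempered_dists" and rad: "radial_dist T" and v: "\<nu> \<ge> 0"
      and N: "\<And>i. (\<integral>\<^sup>+y. ennreal (norm (block (dyadic \<phi>0 i) T y) powr p) \<partial>lborel) \<le> ennreal ((2 powr - (real i * s) * \<nu>) powr p)" and x: "x \<noteq> 0"
    have pt: "norm (block (dyadic \<phi>0 j) T y) \<le> m j (norm y) * \<nu>" if y: "y \<noteq> 0" for j y
    proof -
      \<comment> \<open>A neighbour has index at least \<open>j - 1\<close>, so replacing
        \<open>i\<close> by \<open>j\<close> costs \<open>2 powr s\<close>; this uses
        \<open>s > 0\<close>.\<close>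
      have "(\<Sum>i\<in>{j - 1..j + 1}. 2 powr - (real i * s) * \<nu>) \<le> 3 * (2 powr s * 2 powr - (real j * s) * \<nu>)"
      proof (rule sum_neighbours_le)
        fix i assume "i \<in> {j - 1..j + 1}"
        then have "real j - 1 \<le> real i" by auto
        then have "(real j - 1) * s \<le> real i * s" using s0 by (intro mult_right_mono) auto
        then have "2 powr - (real i * s) \<le> 2 powr (s + - (real j * s))" by (intro powr_mono) (auto simp: left_diff_distrib)
        then show "2 powr - (real i * s) * \<nu> \<le> 2 powr s * 2 powr - (real j * s) * \<nu>"
          unfolding powr_add by (rule mult_right_mono) (rule v)
      qed (use v in auto)
      then have "C1 * shell_density CARD('n) j (norm y) powr (1 / p) * (\<Sum>i\<in>{j - 1..j + 1}. 2 powr - (real i * s) * \<nu>) \<le> C1 * shell_density CARD('n) j (norm y) powr (1 / p) * (3 * (2 powr s * 2 powr - (real j * s) * \<nu>))"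
        using C1(1) by (intro mult_left_mono) auto
      also have "\<dots> = K * (shell_density CARD('n) j (norm y) powr (1 / p) * 2 powr - (real j * s)) * \<nu>" unfolding K_def by (simp only: mult_ac)
      also have "\<dots> = m j (norm y) * \<nu>" using y by (subst dens) (auto simp: m_def mult.assoc)
      finally show ?thesis using C1(2)[OF T rad _ N y, of j] v by simp
    qed
    \<comment> \<open>The density decreases in the radius, which gives a numerical majorant valid at
      once for all points with norm at least \<open>r\<close>.\<close>
    have pt': "norm (block (dyadic \<phi>0 j) T y) \<le> m j r * \<nu>" if y: "r \<le> norm y" "r > 0" for j y r
    proof -
      have "m j (norm y) = K * (shell_density CARD('n) j (norm y) powr (1 / p) * 2 powr - (real j * s))" 
        using y by (subst dens) (auto simp: m_def mult.assoc)
      also have "\<dots> \<le> K * (shell_density CARD('n) j r powr (1 / p) * 2 powr - (real j * s))"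
        using K p y d1 shell_density_pos by (intro mult_left_mono mult_right_mono powr_mono2 shell_density_antimono) auto
      also have "\<dots> = m j r" using y by (subst dens) (auto simp: m_def mult.assoc)
      finally have "m j (norm y) * \<nu> \<le> m j r * \<nu>" using v by (intro mult_right_mono)
      moreover have "y \<noteq> 0" using y by auto
      ultimately show ?thesis using pt[of y j] by linarith
    qed
    show "norm (cont_rep (- {0}) T x) \<le> K * C2 * norm x powr (s - ?d / p) * \<nu>"
    proof (rule cont_rep_bound[OF gen T _ x])
      fix r \<epsilon> :: real assume r: "r > 0" "\<epsilon> > 0"
      show "\<exists>m0. \<forall>m\<ge>m0. \<forall>n. \<forall>x. r \<le> norm x \<longrightarrow> (\<Sum>j\<in>{m..<n}. norm (block (dyadic \<phi>0 j) T x)) \<le> \<epsilon>"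
      proof (rule tail_from_majorant)
        show "(\<Sum>j<n. m j r * \<nu>) \<le> K * r powr (s - ?d / p) * C2 * \<nu>" for n
          unfolding sum_distrib_right[symmetric] using mB[OF r(1)] v by (intro mult_right_mono)
        show "0 \<le> m j r * \<nu>" for j using m0 v by simp
        show "norm (block (dyadic \<phi>0 j) T x) \<le> m j r * \<nu>" if "r \<le> norm x" for j x using pt'[OF that r(1)] .
      qed (rule r(2))
    next
      fix n
      have "(\<Sum>j<n. norm (block (dyadic \<phi>0 j) T x)) \<le> (\<Sum>j<n. m j (norm x)) * \<nu>"
        unfolding sum_distrib_right by (intro sum_mono pt x)
      also have "\<dots> \<le> K * norm x powr (s - ?d / p) * C2 * \<nu>" using mB x v by (intro mult_right_mono) auto
      finally show "(\<Sum>j<n. norm (block (dyadic \<phi>0 j) T x)) \<le> K * C2 * norm x powr (s - ?d / p) * \<nu>" by (simp only: mult_ac)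
    qed
  qed
qed

text \<open>The factor \<open>2^(j/p)\<close> of the density exactly cancels the weight
  \<open>2^(-j/p)\<close>, so no geometric decay is left. The summable sequence \<open>b\<close>
  itself becomes the majorant, and dropping the cap 1 in the density loses nothing.\<close>

lemma radial_bound_besov_endpoint:
  fixes \<phi>0 :: "real ^ 'n \<Rightarrow> complex"
  assumes gen: "lp_generator \<phi>0" and p: "p > 0"
  obtains C where "C > 0" "\<And>T \<nu> b x. T \<in> tempered_dists \<Longrightarrow> radial_dist T \<Longrightarrow> (\<And>j. b j \<ge> 0) \<Longrightarrow> (\<And>n. (\<Sum>j<n. b j) \<le> \<nu>) \<Longrightarrow>
      (\<And>i. (\<integral>\<^sup>+y. ennreal (norm (block (dyadic \<phi>0 i) T y) powr p) \<partial>lborel) \<le> ennreal ((2 powr - (real i / p) * b i) powr p)) \<Longrightarrow> x \<noteq> 0 \<Longrightarrow>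
      norm (cont_rep (- {0}) T x) \<le> C * norm x powr (1 / p - real CARD('n) / p) * \<nu>"
proof -
  let ?d = "real CARD('n)"
  have d1: "CARD('n) \<ge> 1" by (simp add: Suc_leI)
  obtain C1 where C1: "C1 > 0" "\<And>T j x N. T \<in> tempered_dists \<Longrightarrow> radial_dist T \<Longrightarrow> (\<And>i. N i \<ge> 0) \<Longrightarrow>
      (\<And>i. (\<integral>\<^sup>+y. ennreal (norm (block (dyadic \<phi>0 i) T y) powr p) \<partial>lborel) \<le> ennreal (N i powr p)) \<Longrightarrow> x \<noteq> 0 \<Longrightarrow>
      norm (block (dyadic \<phi>0 j) T x) \<le> C1 * shell_density CARD('n) j (norm x) powr (1 / p) * (\<Sum>i\<in>{j - 1..j + 1}. N i)"
    by (rule pointwise_Lp[OF gen p]) (rule that, assumption, blast)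
  define K where "K = C1 * 2 powr (1 / p)"
  have K: "K > 0" using C1(1) by (simp add: K_def)
  show ?thesis
  proof (rule that[of "K * 4"])
    show "K * 4 > 0" using K by simp
    fix T :: "(real ^ 'n \<Rightarrow> complex) \<Rightarrow> complex" and \<nu> :: real and x :: "real ^ 'n" and b :: "nat \<Rightarrow> real"
    assume T: "T \<in> tempered_dists" and rad: "radial_dist T" and b0: "\<And>j. b j \<ge> 0" and bs: "\<And>n. (\<Sum>j<n. b j) \<le> \<nu>"
      and N: "\<And>i. (\<integral>\<^sup>+y. ennreal (norm (block (dyadic \<phi>0 i) T y) powr p) \<partial>lborel) \<le> ennreal ((2 powr - (real i / p) * b i) powr p)" and x: "x \<noteq> 0"
    define B where "B j = (\<Sum>i\<in>{j - 1..j + 1}. b i)" for j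
    have B0: "B j \<ge> 0" for j unfolding B_def by (intro sum_nonneg b0)
    \<comment> \<open>The constant 4 comes from three shifted sums, of which the one over
      \<open>b (j - 1)\<close> contains \<open>b 0\<close> twice because of truncated subtraction
      and so costs 2.\<close>
    have Bs: "(\<Sum>j<n. B j) \<le> 4 * \<nu>" for n
    proof -
      have B3: "B j \<le> b (j - 1) + b j + b (j + 1)" for j
      proof (cases j)
        case 0
        have "{0..Suc 0} = {0, Suc 0}" by auto
        then show ?thesis using b0[of 0] by (simp add: B_def 0)
      next
        case (Suc k)
        have "{k..Suc (Suc k)} = {k, Suc k, Suc (Suc k)}" by auto
        then show ?thesis by (simp add: B_def Suc)
      qed
      have s1: "(\<Sum>j<n. b (j + 1)) \<le> \<nu>" 
        using bs[of "Suc n"] b0[of 0] unfolding sum.lessThan_Suc_shift by simp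
      have s2: "(\<Sum>j<n. b (j - 1)) \<le> 2 * \<nu>"
      proof (cases n)
        case 0
        then show ?thesis using bs[of 0] by simp
      next
        case (Suc k)
        have "(\<Sum>j<n. b (j - 1)) = b 0 + (\<Sum>j<k. b j)" unfolding Suc by (subst sum.lessThan_Suc_shift) simp
        then show ?thesis using bs[of 1] bs[of k] by simp
      qed
      have "(\<Sum>j<n. B j) \<le> (\<Sum>j<n. b (j - 1) + b j + b (j + 1))" by (intro sum_mono B3)
      then show ?thesis using s1 s2 bs[of n] by (simp add: sum.distrib)
    qed
    have pt: "norm (block (dyadic \<phi>0 j) T y) \<le> K * r powr (1 / p - ?d / p) * B j" if y: "r \<le> norm y" "r > 0" for j y r
    proof -
      have "(\<Sum>i\<in>{j - 1..j + 1}. 2 powr - (real i / p) * b i) \<le> (\<Sum>i\<in>{j - 1..j + 1}. 2 powr (1 / p) * 2 powr - (real j / p) * b i)"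
      proof (rule sum_mono)
        fix i assume "i \<in> {j - 1..j + 1}"
        then have "real j - 1 \<le> real i" by auto
        then have "(real j - 1) / p \<le> real i / p" using p by (intro divide_right_mono) auto
        then have "2 powr - (real i / p) \<le> 2 powr (1 / p + - (real j / p))" by (intro powr_mono) (auto simp: diff_divide_distrib)
        then show "2 powr - (real i / p) * b i \<le> 2 powr (1 / p) * 2 powr - (real j / p) * b i"
          unfolding powr_add by (rule mult_right_mono) (rule b0)
      qed
      also have "\<dots> = 2 powr (1 / p) * 2 powr - (real j / p) * B j" unfolding B_def by (simp only: sum_distrib_left)
      finally have 1: "(\<Sum>i\<in>{j - 1..j + 1}. 2 powr - (real i / p) * b i) \<le> 2 powr (1 / p) * 2 powr - (real j / p) * B j" .
      have "shell_density CARD('n) j (norm y) \<le> 2 ^ j * r powr - (?d - 1)"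
        using shell_density_antimono[OF y(2,1) d1] shell_density_le[OF y(2) d1] by (rule order_trans)
      then have "shell_density CARD('n) j (norm y) powr (1 / p) \<le> (2 ^ j * r powr - (?d - 1)) powr (1 / p)"
        using p shell_density_pos by (intro powr_mono2) auto
      also have "\<dots> = 2 powr (real j / p) * r powr (1 / p - ?d / p)"
        by (simp add: powr_mult powr_powr powr_realpow[symmetric] diff_divide_distrib)
      finally have 2: "shell_density CARD('n) j (norm y) powr (1 / p) \<le> 2 powr (real j / p) * r powr (1 / p - ?d / p)" .
      have "norm (block (dyadic \<phi>0 j) T y) \<le> C1 * shell_density CARD('n) j (norm y) powr (1 / p) * (\<Sum>i\<in>{j - 1..j + 1}. 2 powr - (real i / p) * b i)"
        using y b0 by (intro C1(2)[OF T rad _ N]) auto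
      also have "\<dots> \<le> C1 * (2 powr (real j / p) * r powr (1 / p - ?d / p)) * (2 powr (1 / p) * 2 powr - (real j / p) * B j)"
        using C1(1) 1 2 b0 by (intro mult_mono mult_left_mono sum_nonneg mult_nonneg_nonneg) auto
      also have "\<dots> = K * r powr (1 / p - ?d / p) * B j * (2 powr (real j / p) * 2 powr - (real j / p))" unfolding K_def by (simp only: mult_ac)
      also have "2 powr (real j / p) * 2 powr - (real j / p) = 1" by (rule powr_mult_neg) simp
      finally show ?thesis by simp
    qed
    show "norm (cont_rep (- {0}) T x) \<le> K * 4 * norm x powr (1 / p - ?d / p) * \<nu>"
    proof (rule cont_rep_bound[OF gen T _ x])
      fix r \<epsilon> :: real assume r: "r > 0" "\<epsilon> > 0"
      show "\<exists>m0. \<forall>m\<ge>m0. \<forall>n. \<forall>x. r \<le> norm x \<longrightarrow> (\<Sum>j\<in>{m..<n}. norm (block (dyadic \<phi>0 j) T x)) \<le> \<epsilon>"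
      proof (rule tail_from_majorant)
        show "(\<Sum>j<n. K * r powr (1 / p - ?d / p) * B j) \<le> K * r powr (1 / p - ?d / p) * (4 * \<nu>)" for n
          unfolding sum_distrib_left[symmetric] using Bs K by (intro mult_left_mono) auto
        show "0 \<le> K * r powr (1 / p - ?d / p) * B j" for j using B0 K by simp
        show "norm (block (dyadic \<phi>0 j) T x) \<le> K * r powr (1 / p - ?d / p) * B j" if "r \<le> norm x" for j x using pt[OF that r(1)] .
      qed (rule r(2))
    next
      fix n
      have "(\<Sum>j<n. norm (block (dyadic \<phi>0 j) T x)) \<le> K * norm x powr (1 / p - ?d / p) * (\<Sum>j<n. B j)"
        unfolding sum_distrib_left using x by (intro sum_mono pt) auto
      also have "\<dots> \<le> K * norm x powr (1 / p - ?d / p) * (4 * \<nu>)" using Bs K by (intro mult_left_mono) auto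
      finally show "(\<Sum>j<n. norm (block (dyadic \<phi>0 j) T x)) \<le> K * 4 * norm x powr (1 / p - ?d / p) * \<nu>" by (simp only: mult_ac)
    qed
  qed
qed

subsection \<open>The Triebel endpoint\<close>

lemma ennreal_sum_square_le: "(a + b)\<^sup>2 \<le> 2 * a\<^sup>2 + 2 * (b::ennreal)\<^sup>2"
proof (cases "a = top \<or> b = top")
  case False
  then obtain x y where xy: "a = ennreal x" "x \<ge> 0" "b = ennreal y" "y \<ge> 0" by (cases a; cases b) auto
  have "(x + y)\<^sup>2 \<le> 2 * x\<^sup>2 + 2 * y\<^sup>2"
    using sum_squares_bound[of x y] by (simp add: power2_sum)
  then have "ennreal ((x + y)\<^sup>2) \<le> ennreal (2 * x\<^sup>2 + 2 * y\<^sup>2)" by (rule ennreal_leI)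
  moreover have "(a + b)\<^sup>2 = ennreal ((x + y)\<^sup>2)"
    using xy by (simp add: ennreal_power flip: ennreal_plus)
  moreover have "ennreal (2 * x\<^sup>2 + 2 * y\<^sup>2) = 2 * a\<^sup>2 + 2 * b\<^sup>2"
    using xy by (simp add: ennreal_power ennreal_mult)
  ultimately show ?thesis by simp
qed (auto simp: power2_eq_square ennreal_mult_top)

lemma ennreal_powr_half_square: "(ennreal (t powr (p / 2)))\<^sup>2 = ennreal (t powr p)"
proof -
  have "(t powr (p / 2))\<^sup>2 = t powr p" unfolding power2_eq_square powr_add[symmetric] by simp
  then show ?thesis by (simp add: ennreal_power)
qed

text \<open>Subtraction in \<open>ennreal\<close> stops at 0, so \<open>H y - of_nat N\<close> is
  the excess of \<open>H\<close> over the level \<open>N\<close>. Splitting \<open>H\<close> into a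
  bounded part and an excess that is small in the square norm yields the uniform tails at the
  Triebel endpoint.\<close>

lemma truncation_tendsto_0:
  fixes H :: "'a::euclidean_space \<Rightarrow> ennreal"
  assumes [measurable]: "H \<in> borel_measurable borel" and fin: "(\<integral>\<^sup>+y. (H y)\<^sup>2 \<partial>lborel) < \<infinity>"
  shows "(\<lambda>N. \<integral>\<^sup>+y. (H y - of_nat N)\<^sup>2 \<partial>lborel) \<longlonglongrightarrow> 0"
proof -
  have "(\<lambda>N. \<integral>\<^sup>+y. (H y - of_nat N)\<^sup>2 \<partial>lborel) \<longlonglongrightarrow> (\<integral>\<^sup>+y. 0 \<partial>(lborel :: 'a measure))"
  proof (rule nn_integral_dominated_convergence[where w = "\<lambda>y. (H y)\<^sup>2"])
    show "AE y in lborel. (H y - of_nat N)\<^sup>2 \<le> (H y)\<^sup>2" for N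
      by (intro always_eventually allI power_mono diff_le_self_ennreal) auto
    have "AE y in lborel. (H y)\<^sup>2 \<noteq> \<infinity>" using fin by (intro nn_integral_PInf_AE) auto
    then show "AE y in lborel. (\<lambda>N. (H y - of_nat N)\<^sup>2) \<longlonglongrightarrow> 0"
    proof eventually_elim
      case (elim y)
      then have "H y \<noteq> \<infinity>" by (auto simp: power2_eq_square ennreal_mult_top)
      then obtain h where h: "H y = ennreal h" "h \<ge> 0" by (cases "H y") auto
      obtain N0 where N0: "h \<le> real N0" using real_arch_simple by blast
      have "(H y - of_nat N)\<^sup>2 = 0" if "N \<ge> N0" for N
      proof -
        have "H y \<le> of_nat N" using h N0 that by (simp add: ennreal_of_nat_eq_real_of_nat ennreal_leI)
        then show ?thesis by (simp add: diff_eq_0_ennreal h)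
      qed
      then show ?case by (intro tendsto_eventually) (auto simp: eventually_sequentially)
    qed
  qed (use fin in auto)
  then show ?thesis by simp
qed

lemma sum_half_powers: "(\<Sum>j\<in>{m..<n}. 1 / 2 ^ j) \<le> 2 / (2::real) ^ m"
proof (cases "m \<le> n")
  case True
  then have "(\<Sum>j\<in>{m..<n}. 1 / 2 ^ j) = 2 / 2 ^ m - 2 / (2::real) ^ n"
    by (induction n rule: dec_induct) auto
  then show ?thesis by simp
qed simp

text \<open>Using \<open>u = p / 2\<close>, the power \<open>p\<close> of a block at
  \<open>x\<close> is at most \<open>2^(-j)\<close> times the square of the pairing of
  \<open>H\<close> with a kernel, the form in which almost orthogonality sums over \<open>j\<close>.
  As \<open>p <= 1\<close>, the sum of the blocks is controlled by the sum of their powers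
  \<open>p\<close>. The kernels change with the radius and admit no common numerical majorant, so
  uniform convergence away from 0 is derived from a truncation of \<open>H\<close>.\<close>

lemma radial_bound_triebel_endpoint:
  fixes \<phi>0 :: "real ^ 'n \<Rightarrow> complex"
  assumes gen: "lp_generator \<phi>0" and p: "0 < p" "p \<le> 1"
  obtains C where "C > 0" "\<And>T H \<nu> x. T \<in> tempered_dists \<Longrightarrow> radial_dist T \<Longrightarrow> H \<in> borel_measurable borel \<Longrightarrow>
      (\<And>i y. ennreal (2 powr (real i / 2) * norm (block (dyadic \<phi>0 i) T y) powr (p / 2)) \<le> H y) \<Longrightarrow>
      (\<integral>\<^sup>+y. (H y)\<^sup>2 \<partial>lborel) \<le> ennreal (\<nu> powr p) \<Longrightarrow> \<nu> \<ge> 0 \<Longrightarrow> x \<noteq> 0 \<Longrightarrow>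
      norm (cont_rep (- {0}) T x) \<le> C * norm x powr (1 / p - real CARD('n) / p) * \<nu>"
proof -
  let ?d = "real CARD('n)"
  have d1: "CARD('n) \<ge> 1" by (simp add: Suc_leI)
  define u where "u = p / 2"
  have u: "0 < u" "u \<le> 1" "u \<le> p" using p by (auto simp: u_def)
  obtain C where C: "C > 0" "\<And>j r. r > 0 \<Longrightarrow> \<exists>\<kappa> :: real ^ 'n \<Rightarrow> real. \<kappa> \<in> borel_measurable borel \<and>
      (\<forall>y. 0 \<le> \<kappa> y \<and> \<kappa> y \<le> C * shell_density CARD('n) j r) \<and> (\<integral>\<^sup>+y. ennreal (\<kappa> y) \<partial>lborel) \<le> ennreal C \<and>
      (\<forall>T x. T \<in> tempered_dists \<longrightarrow> radial_dist T \<longrightarrow>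
        (\<forall>i. (\<integral>\<^sup>+y. ennreal (norm (block (dyadic \<phi>0 i) T y) powr p) \<partial>lborel) < \<infinity>) \<longrightarrow> norm x = r \<longrightarrow>
        ennreal (norm (block (dyadic \<phi>0 j) T x) powr u) \<le> ennreal C * (\<Sum>i\<in>{j - 1..j + 1}. \<integral>\<^sup>+y. ennreal (norm (block (dyadic \<phi>0 i) T y) powr u * \<kappa> y) \<partial>lborel))"
    by (rule averaged_kernel[OF gen u]) (rule that)
  \<comment> \<open>The square of \<open>6 C\<close>: at most three neighbours, each at a loss of 2
    when \<open>2^(-i/2)\<close> is replaced by \<open>2^(-j/2)\<close>.\<close>
  define D where "D = 36 * C\<^sup>2"
  have D: "D > 0" using C(1) by (simp add: D_def)
  define E where "E = (D * (8 * C * C)) powr (1 / p)"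
  have E: "E > 0" using C(1) D by (simp add: E_def)
  show ?thesis
  proof (rule that[OF E])
    fix T :: "(real ^ 'n \<Rightarrow> complex) \<Rightarrow> complex" and H :: "real ^ 'n \<Rightarrow> ennreal" and \<nu> :: real and x :: "real ^ 'n"
    assume T: "T \<in> tempered_dists" and rad: "radial_dist T" and H[measurable]: "H \<in> borel_measurable borel"
      and Hb: "\<And>i y. ennreal (2 powr (real i / 2) * norm (block (dyadic \<phi>0 i) T y) powr (p / 2)) \<le> H y"
      and HI: "(\<integral>\<^sup>+y. (H y)\<^sup>2 \<partial>lborel) \<le> ennreal (\<nu> powr p)" and v: "\<nu> \<ge> 0" and x: "x \<noteq> 0"
    define g where "g i = block (dyadic \<phi>0 i) T" for i
    have [measurable]: "g i \<in> borel_measurable borel" for i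
      unfolding g_def by (intro borel_measurable_continuous_onI block_continuous T schwartz_dyadic gen)
    have gH: "ennreal (norm (g i y) powr u) \<le> ennreal (2 powr - (real i / 2)) * H y" for i y
    proof -
      have "ennreal (norm (g i y) powr u) = ennreal (2 powr - (real i / 2)) * ennreal (2 powr (real i / 2) * norm (g i y) powr u)"
        by (subst ennreal_mult[symmetric]) (auto simp: powr_minus)
      also have "\<dots> \<le> ennreal (2 powr - (real i / 2)) * H y"
        using Hb[of i y] unfolding g_def u_def by (intro mult_left_mono) auto
      finally show ?thesis .
    qed
    have fin: "\<forall>i. (\<integral>\<^sup>+y. ennreal (norm (block (dyadic \<phi>0 i) T y) powr p) \<partial>lborel) < \<infinity>"
    proof
      fix i
      have "(\<integral>\<^sup>+y. ennreal (norm (g i y) powr p) \<partial>lborel) \<le> (\<integral>\<^sup>+y. (H y)\<^sup>2 \<partial>lborel)"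
      proof (rule nn_integral_mono)
        fix y
        have "norm (g i y) powr u \<le> 2 powr (real i / 2) * norm (g i y) powr u"
          using mult_right_mono[of 1 "2 powr (real i / 2)" "norm (g i y) powr u"] by (simp add: ge_one_powr_ge_zero)
        then have "ennreal (norm (g i y) powr u) \<le> H y"
          using Hb[of i y] unfolding g_def u_def by (auto intro: order_trans ennreal_leI)
        then have "(ennreal (norm (g i y) powr u))\<^sup>2 \<le> (H y)\<^sup>2" by (intro power_mono) auto
        moreover have "(ennreal (norm (g i y) powr u))\<^sup>2 = ennreal (norm (g i y) powr p)"
          unfolding u_def by (rule ennreal_powr_half_square)
        ultimately show "ennreal (norm (g i y) powr p) \<le> (H y)\<^sup>2" by simp
      qed
      also have "\<dots> < \<infinity>" using HI by (rule order_le_less_trans) simp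
      finally show "(\<integral>\<^sup>+y. ennreal (norm (block (dyadic \<phi>0 i) T y) powr p) \<partial>lborel) < \<infinity>" by (simp add: g_def)
    qed
    \<comment> \<open>For a fixed radius one kernel per frequency is selected; bounding the density
      by \<open>2 ^ j * r powr - (?d - 1)\<close> gives the growth in \<open>j\<close> that almost
      orthogonality expects.\<close>
    have shell: "\<exists>\<kappa> :: nat \<Rightarrow> real ^ 'n \<Rightarrow> real. (\<forall>j. \<kappa> j \<in> borel_measurable borel) \<and> (\<forall>j y. 0 \<le> \<kappa> j y) \<and>
        (\<forall>j y. \<kappa> j y \<le> (C * r powr - (?d - 1)) * 2 ^ j) \<and> (\<forall>j. (\<integral>\<^sup>+y. ennreal (\<kappa> j y) \<partial>lborel) \<le> ennreal C) \<and>
        (\<forall>j x. norm x = r \<longrightarrow> ennreal (norm (g j x) powr p) \<le> ennreal (D * (1 / 2 ^ j)) * (\<integral>\<^sup>+y. H y * ennreal (\<kappa> j y) \<partial>lborel)\<^sup>2)"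
      if r: "r > 0" for r
    proof -
      have "\<forall>j. \<exists>\<kappa> :: real ^ 'n \<Rightarrow> real. \<kappa> \<in> borel_measurable borel \<and>
        (\<forall>y. 0 \<le> \<kappa> y \<and> \<kappa> y \<le> C * shell_density CARD('n) j r) \<and> (\<integral>\<^sup>+y. ennreal (\<kappa> y) \<partial>lborel) \<le> ennreal C \<and>
        (\<forall>x. norm x = r \<longrightarrow>
        ennreal (norm (g j x) powr u) \<le> ennreal C * (\<Sum>i\<in>{j - 1..j + 1}. \<integral>\<^sup>+y. ennreal (norm (g i y) powr u * \<kappa> y) \<partial>lborel))"
        unfolding g_def using C(2)[OF r] T rad fin by blast
      from choice[OF this] obtain \<kappa> :: "nat \<Rightarrow> real ^ 'n \<Rightarrow> real" where
        k[measurable]: "\<And>j. \<kappa> j \<in> borel_measurable borel" and k0: "\<And>j y. 0 \<le> \<kappa> j y"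
        and kb: "\<And>j y. \<kappa> j y \<le> C * shell_density CARD('n) j r" and kC: "\<And>j. (\<integral>\<^sup>+y. ennreal (\<kappa> j y) \<partial>lborel) \<le> ennreal C"
        and main: "\<And>j x. norm x = r \<Longrightarrow> ennreal (norm (g j x) powr u) \<le> ennreal C * (\<Sum>i\<in>{j - 1..j + 1}. \<integral>\<^sup>+y. ennreal (norm (g i y) powr u * \<kappa> j y) \<partial>lborel)"
        by blast
      have "\<kappa> j y \<le> (C * r powr - (?d - 1)) * 2 ^ j" for j y
      proof -
        have "\<kappa> j y \<le> C * shell_density CARD('n) j r" by (rule kb)
        also have "\<dots> \<le> C * (2 ^ j * r powr - (?d - 1))" by (intro mult_left_mono shell_density_le r d1) (use C(1) in simp)
        also have "\<dots> = (C * r powr - (?d - 1)) * 2 ^ j" by (simp only: mult_ac)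
        finally show ?thesis .
      qed
      moreover have "ennreal (norm (g j x) powr p) \<le> ennreal (D * (1 / 2 ^ j)) * (\<integral>\<^sup>+y. H y * ennreal (\<kappa> j y) \<partial>lborel)\<^sup>2" if xr: "norm x = r" for j x
      proof -
        let ?A = "\<integral>\<^sup>+y. H y * ennreal (\<kappa> j y) \<partial>lborel"
        let ?h = "2 powr - (real j / 2)"
        have "(\<Sum>i\<in>{j - 1..j + 1}. \<integral>\<^sup>+y. ennreal (norm (g i y) powr u * \<kappa> j y) \<partial>lborel) \<le> (\<Sum>i\<in>{j - 1..j + 1}. ennreal (2 * ?h) * ?A)"
        proof (rule sum_mono)
          fix i assume "i \<in> {j - 1..j + 1}"
          then have "real j - 1 \<le> real i" by auto
          then have "2 powr - (real i / 2) \<le> 2 powr (1 + - (real j / 2))" by (intro powr_mono) auto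
          also have "\<dots> = 2 * ?h" unfolding powr_add by simp
          finally have le: "2 powr - (real i / 2) \<le> 2 * ?h" .
          have "(\<integral>\<^sup>+y. ennreal (norm (g i y) powr u * \<kappa> j y) \<partial>lborel) \<le> (\<integral>\<^sup>+y. ennreal (2 * ?h) * (H y * ennreal (\<kappa> j y)) \<partial>lborel)"
          proof (rule nn_integral_mono)
            fix y
            have "ennreal (norm (g i y) powr u * \<kappa> j y) = ennreal (norm (g i y) powr u) * ennreal (\<kappa> j y)" using k0 by (simp add: ennreal_mult)
            also have "\<dots> \<le> (ennreal (2 powr - (real i / 2)) * H y) * ennreal (\<kappa> j y)" by (intro mult_right_mono gH) auto
            also have "\<dots> \<le> (ennreal (2 * ?h) * H y) * ennreal (\<kappa> j y)" using le by (intro mult_right_mono ennreal_leI) auto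
            finally show "ennreal (norm (g i y) powr u * \<kappa> j y) \<le> ennreal (2 * ?h) * (H y * ennreal (\<kappa> j y))" by (simp only: mult.assoc)
          qed
          also have "\<dots> = ennreal (2 * ?h) * ?A" by (rule nn_integral_cmult) measurable
          finally show "(\<integral>\<^sup>+y. ennreal (norm (g i y) powr u * \<kappa> j y) \<partial>lborel) \<le> ennreal (2 * ?h) * ?A" .
        qed
        also have "\<dots> = of_nat (card {j - 1..j + 1}) * (ennreal (2 * ?h) * ?A)" by (rule sum_constant)
        also have "\<dots> \<le> ennreal 3 * (ennreal (2 * ?h) * ?A)"
        proof (rule mult_right_mono)
          have "card {j - 1..j + 1} \<le> 3" unfolding card_atLeastAtMost by arith
          then have "real (card {j - 1..j + 1}) \<le> 3" by (simp del: card_atLeastAtMost)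
          then show "of_nat (card {j - 1..j + 1}) \<le> ennreal 3" unfolding ennreal_of_nat_eq_real_of_nat by (rule ennreal_leI)
        qed simp
        finally have "ennreal (norm (g j x) powr u) \<le> ennreal C * (ennreal 3 * (ennreal (2 * ?h) * ?A))"
          by (intro order_trans[OF main[OF xr]] mult_left_mono) auto
        also have "\<dots> = ennreal (6 * C * ?h) * ?A"
        proof -
          have "6 * C * ?h = C * (3 * (2 * ?h))" by simp
          then have "ennreal (6 * C * ?h) = ennreal C * (ennreal 3 * ennreal (2 * ?h))"
            using C(1) by (simp only: ennreal_mult less_imp_le zero_le_numeral mult_nonneg_nonneg powr_ge_zero)
          then show ?thesis by (simp only: mult.assoc)
        qed
        finally have "(ennreal (norm (g j x) powr u))\<^sup>2 \<le> (ennreal (6 * C * ?h) * ?A)\<^sup>2" by (intro power_mono) auto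
        moreover have "(ennreal (norm (g j x) powr u))\<^sup>2 = ennreal (norm (g j x) powr p)"
          unfolding u_def by (rule ennreal_powr_half_square)
        moreover have "(ennreal (6 * C * ?h) * ?A)\<^sup>2 = ennreal (D * (1 / 2 ^ j)) * ?A\<^sup>2"
        proof -
          have "?h\<^sup>2 = 1 / 2 ^ j"
          proof -
            have "?h\<^sup>2 = ?h * ?h" by (rule power2_eq_square)
            also have "\<dots> = 2 powr (- real j)" unfolding powr_add[symmetric] by simp
            also have "\<dots> = 1 / 2 ^ j" by (simp add: powr_minus powr_realpow divide_inverse)
            finally show ?thesis .
          qed
          then have sq: "(6 * C * ?h)\<^sup>2 = D * (1 / 2 ^ j)" unfolding D_def power_mult_distrib by simp
          have "(ennreal (6 * C * ?h))\<^sup>2 = ennreal ((6 * C * ?h)\<^sup>2)" by (intro ennreal_power) (use C(1) in auto)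
          then show ?thesis unfolding power_mult_distrib[of "ennreal (6 * C * ?h)"] sq by (rule arg_cong)
        qed
        ultimately show ?thesis by simp
      qed
      ultimately show ?thesis using k k0 kC by blast
    qed
    have Hfin: "(\<integral>\<^sup>+y. (H y)\<^sup>2 \<partial>lborel) < \<infinity>" using HI by (rule order_le_less_trans) simp
    have powle: "(\<Sum>j\<in>J. norm (g j y)) \<le> b powr (1 / p)" if "finite J" "(\<Sum>j\<in>J. ennreal (norm (g j y) powr p)) \<le> ennreal b" "b \<ge> 0" for J y b
    proof -
      have "(\<Sum>j\<in>J. norm (g j y) powr p) \<le> b" using that(2,3) by (simp add: sum_ennreal)
      then have "(\<Sum>j\<in>J. norm (g j y)) powr p \<le> b"
        using powr_sum_le_sum_powr[OF that(1) p, of "\<lambda>j. norm (g j y)"] by simp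
      then have "((\<Sum>j\<in>J. norm (g j y)) powr p) powr (1 / p) \<le> b powr (1 / p)" using p by (intro powr_mono2) auto
      then show ?thesis using p by (simp add: powr_powr sum_nonneg)
    qed
    show "norm (cont_rep (- {0}) T x) \<le> E * norm x powr (1 / p - ?d / p) * \<nu>"
    proof (rule cont_rep_bound[OF gen T _ x])
      fix r \<epsilon> :: real assume r: "r > 0" and e: "\<epsilon> > 0"
      define Br where "Br = C * r powr - (?d - 1)"
      have Br: "Br > 0" using C(1) r by (simp add: Br_def)
      \<comment> \<open>Collects the constants of the excess part: 2 from squaring a sum and
        \<open>8 * C * Br\<close> from almost orthogonality. Then \<open>\<delta>\<close> is chosen
        to make this part exactly half of the permitted \<open>\<epsilon> powr p\<close>.\<close>
      define c1 where "c1 = D * 2 * (8 * C * Br)"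
      have c1: "c1 > 0" using D C(1) Br by (simp add: c1_def)
      define \<delta> where "\<delta> = \<epsilon> powr p / 2 / c1"
      have dp: "\<delta> > 0" using e c1 by (simp add: \<delta>_def)
      have "\<forall>\<^sub>F N in sequentially. (\<integral>\<^sup>+y. (H y - of_nat N)\<^sup>2 \<partial>lborel) < ennreal \<delta>"
        using truncation_tendsto_0[OF H Hfin] dp by (intro order_tendstoD(2)[of _ 0]) auto
      then obtain N where N: "(\<integral>\<^sup>+y. (H y - of_nat N)\<^sup>2 \<partial>lborel) < ennreal \<delta>" by (auto simp: eventually_sequentially)
      \<comment> \<open>Constants of the bounded part, whose pairings are at most
        \<open>N C\<close>; the last factor 2 is from the geometric tail. The index
        \<open>m0\<close> makes this part the other half of
        \<open>\<epsilon> powr p\<close>.\<close>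
      define c2 where "c2 = D * 2 * (real N * C)\<^sup>2 * 2"
      have c2: "c2 \<ge> 0" using D by (simp add: c2_def)
      obtain m0 where m0: "2 * (c2 + 1) / \<epsilon> powr p < 2 ^ m0" using real_arch_pow[of 2 "2 * (c2 + 1) / \<epsilon> powr p"] by auto
      have "(\<Sum>j\<in>{m..<n}. norm (block (dyadic \<phi>0 j) T y)) \<le> \<epsilon>" if m: "m \<ge> m0" and y: "r \<le> norm y" for m n y
      proof -
        have ny: "norm y > 0" using r y by linarith
        obtain \<kappa> :: "nat \<Rightarrow> real ^ 'n \<Rightarrow> real" where k[measurable]: "\<And>j. \<kappa> j \<in> borel_measurable borel" and k0: "\<And>j y. 0 \<le> \<kappa> j y"
          and kb: "\<And>j z. \<kappa> j z \<le> (C * norm y powr - (?d - 1)) * 2 ^ j" and kC: "\<And>j. (\<integral>\<^sup>+y. ennreal (\<kappa> j y) \<partial>lborel) \<le> ennreal C"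
          and main: "\<And>j. ennreal (norm (g j y) powr p) \<le> ennreal (D * (1 / 2 ^ j)) * (\<integral>\<^sup>+y. H y * ennreal (\<kappa> j y) \<partial>lborel)\<^sup>2"
          using shell[OF ny] by blast
        \<comment> \<open>The kernels depend on \<open>norm y\<close>, but their bound can be taken
          at the smallest radius \<open>r\<close>. This keeps \<open>N\<close> and \<open>m0\<close>
          independent of \<open>y\<close>.\<close>
        have kB: "\<kappa> j z \<le> Br * 2 ^ j" for j z
        proof -
          have "C * norm y powr - (?d - 1) \<le> Br"
            unfolding Br_def using C(1) r y d1 by (intro mult_left_mono powr_mono2') auto
          then have "(C * norm y powr - (?d - 1)) * 2 ^ j \<le> Br * 2 ^ j" by (intro mult_right_mono) auto
          then show ?thesis using kb[of j z] by linarith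
        qed
        let ?A2 = "\<lambda>j. \<integral>\<^sup>+z. (H z - of_nat N) * ennreal (\<kappa> j z) \<partial>lborel"
        have split: "(\<integral>\<^sup>+z. H z * ennreal (\<kappa> j z) \<partial>lborel) \<le> ennreal (real N * C) + ?A2 j" for j
        proof -
          have "(\<integral>\<^sup>+z. H z * ennreal (\<kappa> j z) \<partial>lborel) \<le> (\<integral>\<^sup>+z. of_nat N * ennreal (\<kappa> j z) + (H z - of_nat N) * ennreal (\<kappa> j z) \<partial>lborel)"
          proof (rule nn_integral_mono)
            fix z
            have "H z \<le> of_nat N + (H z - of_nat N)"
              by (cases "of_nat N \<le> H z") (auto simp: add_diff_inverse_ennreal add_increasing2)
            then have "H z * ennreal (\<kappa> j z) \<le> (of_nat N + (H z - of_nat N)) * ennreal (\<kappa> j z)" by (intro mult_right_mono) auto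
            then show "H z * ennreal (\<kappa> j z) \<le> of_nat N * ennreal (\<kappa> j z) + (H z - of_nat N) * ennreal (\<kappa> j z)" by (simp only: distrib_right)
          qed
          also have "\<dots> = of_nat N * (\<integral>\<^sup>+z. ennreal (\<kappa> j z) \<partial>lborel) + ?A2 j"
            by (subst nn_integral_add) (auto simp: nn_integral_cmult)
          also have "\<dots> \<le> of_nat N * ennreal C + ?A2 j" by (intro add_right_mono mult_left_mono kC) auto
          finally show ?thesis using C(1) by (simp add: ennreal_mult ennreal_of_nat_eq_real_of_nat)
        qed
        have "(\<Sum>j\<in>{m..<n}. ennreal (norm (g j y) powr p)) \<le> (\<Sum>j\<in>{m..<n}. ennreal (D * (1 / 2 ^ j)) * (2 * (ennreal (real N * C))\<^sup>2 + 2 * (?A2 j)\<^sup>2))"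
        proof (rule sum_mono)
          fix j
          have "(\<integral>\<^sup>+z. H z * ennreal (\<kappa> j z) \<partial>lborel)\<^sup>2 \<le> (ennreal (real N * C) + ?A2 j)\<^sup>2" by (intro power_mono split) auto
          also have "\<dots> \<le> 2 * (ennreal (real N * C))\<^sup>2 + 2 * (?A2 j)\<^sup>2" by (rule ennreal_sum_square_le)
          finally show "ennreal (norm (g j y) powr p) \<le> ennreal (D * (1 / 2 ^ j)) * (2 * (ennreal (real N * C))\<^sup>2 + 2 * (?A2 j)\<^sup>2)"
            by (intro order_trans[OF main] mult_left_mono) auto
        qed
        also have "\<dots> = ennreal (D * 2 * (real N * C)\<^sup>2) * (\<Sum>j\<in>{m..<n}. ennreal (1 / 2 ^ j)) + ennreal (D * 2) * (\<Sum>j\<in>{m..<n}. ennreal (1 / 2 ^ j) * (?A2 j)\<^sup>2)"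
        proof -
          have two: "(2::ennreal) = ennreal 2" by simp
          have "ennreal (D * (1 / 2 ^ j)) * (2 * (ennreal (real N * C))\<^sup>2 + 2 * (?A2 j)\<^sup>2) = ennreal (D * 2 * (real N * C)\<^sup>2) * ennreal (1 / 2 ^ j) + ennreal (D * 2) * (ennreal (1 / 2 ^ j) * (?A2 j)\<^sup>2)" for j
          proof -
            have 1: "ennreal (D * (1 / 2 ^ j)) = ennreal D * ennreal (1 / 2 ^ j)" using D by (intro ennreal_mult) auto
            have 2: "ennreal (D * 2 * (real N * C)\<^sup>2) = ennreal D * ennreal 2 * (ennreal (real N * C))\<^sup>2"
            proof -
              have "(ennreal (real N * C))\<^sup>2 = ennreal ((real N * C)\<^sup>2)" by (intro ennreal_power) (use C(1) in auto)
              moreover have "ennreal (D * 2 * (real N * C)\<^sup>2) = ennreal D * ennreal 2 * ennreal ((real N * C)\<^sup>2)"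
                using D by (simp only: ennreal_mult mult_nonneg_nonneg less_imp_le zero_le_power2 zero_le_numeral)
              ultimately show ?thesis by simp
            qed
            have 3: "ennreal (D * 2) = ennreal D * ennreal 2" using D by (intro ennreal_mult) auto
            show ?thesis unfolding 1 2 3 two distrib_left by (simp only: mult_ac)
          qed
          then show ?thesis by (simp only: sum.distrib sum_distrib_left)
        qed
        also have "\<dots> \<le> ennreal (D * 2 * (real N * C)\<^sup>2) * ennreal (2 / 2 ^ m) + ennreal (D * 2) * (ennreal (8 * C * Br) * ennreal \<delta>)"
        proof (intro add_mono mult_left_mono)
          show "(\<Sum>j\<in>{m..<n}. ennreal (1 / 2 ^ j)) \<le> ennreal (2 / 2 ^ m)"
            using sum_half_powers[of m n] by (simp only: sum_ennreal zero_le_divide_1_iff zero_le_power zero_le_numeral ennreal_leI)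
          have "(\<Sum>j\<in>{m..<n}. ennreal (1 / 2 ^ j) * (?A2 j)\<^sup>2) \<le> ennreal (8 * C * Br) * (\<integral>\<^sup>+z. (H z - of_nat N)\<^sup>2 \<partial>lborel)"
            by (rule almost_orthogonal[OF _ _ k0 kB kC Br C(1)]) auto
          also have "\<dots> \<le> ennreal (8 * C * Br) * ennreal \<delta>" using N by (intro mult_left_mono) auto
          finally show "(\<Sum>j\<in>{m..<n}. ennreal (1 / 2 ^ j) * (?A2 j)\<^sup>2) \<le> ennreal (8 * C * Br) * ennreal \<delta>" .
        qed auto
        also have "\<dots> = ennreal (c2 / 2 ^ m + c1 * \<delta>)"
        proof -
          have "ennreal (D * 2 * (real N * C)\<^sup>2) * ennreal (2 / 2 ^ m) = ennreal (c2 / 2 ^ m)"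
            using D by (subst ennreal_mult[symmetric]) (auto simp: c2_def)
          moreover have "ennreal (D * 2) * (ennreal (8 * C * Br) * ennreal \<delta>) = ennreal (c1 * \<delta>)"
            using D C(1) Br dp by (simp add: ennreal_mult[symmetric] c1_def mult.assoc)
          ultimately show ?thesis using c1 c2 dp by simp
        qed
        also have "\<dots> \<le> ennreal (\<epsilon> powr p)"
        proof (rule ennreal_leI)
          have ep: "\<epsilon> powr p > 0" using e by simp
          have "(2::real) ^ m0 \<le> 2 ^ m" using m by (intro power_increasing) auto
          then have "2 * (c2 + 1) / \<epsilon> powr p < 2 ^ m" using m0 by linarith
          then have "2 * (c2 + 1) < 2 ^ m * \<epsilon> powr p" using ep by (simp add: pos_divide_less_eq)
          then have "c2 \<le> 2 ^ m * (\<epsilon> powr p / 2)" by simp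
          then have "c2 / 2 ^ m \<le> \<epsilon> powr p / 2" by (simp add: pos_divide_le_eq mult.commute)
          moreover have "c1 * \<delta> = \<epsilon> powr p / 2" using c1 by (simp add: \<delta>_def)
          ultimately show "c2 / 2 ^ m + c1 * \<delta> \<le> \<epsilon> powr p" by linarith
        qed
        finally have "(\<Sum>j\<in>{m..<n}. norm (g j y)) \<le> (\<epsilon> powr p) powr (1 / p)" by (intro powle) auto
        then show ?thesis using e p by (simp add: powr_powr g_def)
      qed
      then show "\<exists>m0. \<forall>m\<ge>m0. \<forall>n. \<forall>x. r \<le> norm x \<longrightarrow> (\<Sum>j\<in>{m..<n}. norm (block (dyadic \<phi>0 j) T x)) \<le> \<epsilon>" by blast
    next
      fix n
      have nx: "norm x > 0" using x by simp
      obtain \<kappa> :: "nat \<Rightarrow> real ^ 'n \<Rightarrow> real" where k[measurable]: "\<And>j. \<kappa> j \<in> borel_measurable borel" and k0: "\<And>j y. 0 \<le> \<kappa> j y"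
        and kb: "\<And>j z. \<kappa> j z \<le> (C * norm x powr - (?d - 1)) * 2 ^ j" and kC: "\<And>j. (\<integral>\<^sup>+y. ennreal (\<kappa> j y) \<partial>lborel) \<le> ennreal C"
        and main: "\<And>j. ennreal (norm (g j x) powr p) \<le> ennreal (D * (1 / 2 ^ j)) * (\<integral>\<^sup>+y. H y * ennreal (\<kappa> j y) \<partial>lborel)\<^sup>2"
        using shell[OF nx] by blast
      let ?B = "C * norm x powr - (?d - 1)"
      have B: "?B > 0" using C(1) nx by simp
      have "(\<Sum>j<n. ennreal (norm (g j x) powr p)) \<le> (\<Sum>j<n. ennreal D * (ennreal (1 / 2 ^ j) * (\<integral>\<^sup>+y. H y * ennreal (\<kappa> j y) \<partial>lborel)\<^sup>2))"
        using main D by (intro sum_mono) (simp only: ennreal_mult less_imp_le zero_le_divide_1_iff zero_le_power zero_le_numeral mult.assoc)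
      also have "\<dots> = ennreal D * (\<Sum>j<n. ennreal (1 / 2 ^ j) * (\<integral>\<^sup>+y. H y * ennreal (\<kappa> j y) \<partial>lborel)\<^sup>2)" by (simp only: sum_distrib_left)
      also have "\<dots> \<le> ennreal D * (ennreal (8 * C * ?B) * (\<integral>\<^sup>+z. (H z)\<^sup>2 \<partial>lborel))"
        by (intro mult_left_mono almost_orthogonal k0 kb kC B C(1)) auto
      also have "\<dots> \<le> ennreal D * (ennreal (8 * C * ?B) * ennreal (\<nu> powr p))" by (intro mult_left_mono HI) auto
      also have "\<dots> = ennreal (D * (8 * C * ?B * \<nu> powr p))"
        using D C(1) B by (simp add: ennreal_mult[symmetric])
      finally have "(\<Sum>j<n. norm (g j x)) \<le> (D * (8 * C * ?B * \<nu> powr p)) powr (1 / p)"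
        using D C(1) by (intro powle) auto
      also have "D * (8 * C * ?B * \<nu> powr p) = (D * (8 * C * C)) * (norm x powr - (?d - 1) * \<nu> powr p)" by (simp only: mult_ac)
      also have "\<dots> powr (1 / p) = E * (norm x powr (- (?d - 1) * (1 / p)) * \<nu> powr (p * (1 / p)))"
        unfolding E_def by (simp only: powr_mult powr_powr)
      also have "\<nu> powr (p * (1 / p)) = \<nu>" using p v by simp
      also have "- (?d - 1) * (1 / p) = 1 / p - ?d / p" by (simp add: diff_divide_distrib)
      finally show "(\<Sum>j<n. norm (block (dyadic \<phi>0 j) T x)) \<le> E * norm x powr (1 / p - ?d / p) * \<nu>"
        by (simp only: g_def mult.assoc)
    qed
  qed
qed

section \<open>From the quasi-norm to bounds for single blocks\<close>

lemma besov_block_Lp: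
  assumes q: "q > 0" and n: "A_enorm \<phi>0 Besov s p q f \<le> ennreal \<nu>"
  shows "Lp_norm p (\<lambda>x. ennreal (norm (freq_block \<phi>0 j f x))) \<le> ennreal (2 powr - (real j * s) * \<nu>)"
proof -
  let ?L = "Lp_norm p (\<lambda>x. ennreal (norm (freq_block \<phi>0 j f x)))"
  have "ennreal (2 powr (real j * s)) * ?L \<le> ennreal \<nu>"
    using lq_norm_ge[OF q, of "\<lambda>j. ennreal (2 powr (real j * s)) * Lp_norm p (\<lambda>x. ennreal (norm (freq_block \<phi>0 j f x)))" j] n
    by simp
  then have "ennreal (2 powr - (real j * s)) * (ennreal (2 powr (real j * s)) * ?L) \<le> ennreal (2 powr - (real j * s)) * ennreal \<nu>"
    by (intro mult_left_mono) auto
  moreover have "ennreal (2 powr - (real j * s)) * (ennreal (2 powr (real j * s)) * ?L) = ?L"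
    by (simp add: ennreal_mult[symmetric] mult.assoc[symmetric] flip: powr_add)
  ultimately show ?thesis by (simp add: ennreal_mult')
qed

lemma triebel_block_Lp:
  assumes p: "p > 0" and q: "q > 0" and n: "A_enorm \<phi>0 Triebel s p q f \<le> ennreal \<nu>" "\<nu> \<ge> 0"
    and [measurable]: "freq_block \<phi>0 j f \<in> borel_measurable borel"
  shows "(\<integral>\<^sup>+x. ennreal (norm (freq_block \<phi>0 j f x) powr p) \<partial>lborel) \<le> ennreal ((2 powr - (real j * s) * \<nu>) powr p)"
proof -
  let ?q = "\<lambda>x. lq_norm q (\<lambda>j. ennreal (2 powr (real j * s)) * ennreal (norm (freq_block \<phi>0 j f x)))"
  let ?I = "\<integral>\<^sup>+x. ennreal (norm (freq_block \<phi>0 j f x) powr p) \<partial>lborel"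
  let ?c = "2 powr (real j * s)"
  have "ennreal (?c powr p) * ?I = (\<integral>\<^sup>+x. ennreal (?c powr p) * ennreal (norm (freq_block \<phi>0 j f x) powr p) \<partial>lborel)"
    by (rule nn_integral_cmult[symmetric]) measurable
  also have "\<dots> \<le> (\<integral>\<^sup>+x. ennpow (?q x) p \<partial>lborel)"
  proof (rule nn_integral_mono)
    fix x
    have "ennreal (?c * norm (freq_block \<phi>0 j f x)) \<le> ?q x"
      using lq_norm_ge[OF q, of "\<lambda>j. ennreal (2 powr (real j * s)) * ennreal (norm (freq_block \<phi>0 j f x))" j]
      by (simp add: ennreal_mult)
    then have "ennpow (ennreal (?c * norm (freq_block \<phi>0 j f x))) p \<le> ennpow (?q x) p" using p by (rule ennpow_mono)
    then show "ennreal (?c powr p) * ennreal (norm (freq_block \<phi>0 j f x) powr p) \<le> ennpow (?q x) p"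
      by (subst (asm) ennpow_ennreal) (auto simp: powr_mult ennreal_mult)
  qed
  also have "\<dots> \<le> ennreal (\<nu> powr p)" using n by (intro Lp_norm_finiteD[OF p]) auto
  finally have "ennreal ((2 powr - (real j * s)) powr p) * (ennreal (?c powr p) * ?I) \<le> ennreal ((2 powr - (real j * s)) powr p) * ennreal (\<nu> powr p)"
    by (intro mult_left_mono) auto
  moreover have "ennreal ((2 powr - (real j * s)) powr p) * (ennreal (?c powr p) * ?I) = ?I"
  proof -
    have "(2 powr - (real j * s)) powr p * ?c powr p = 1" by (simp add: powr_powr flip: powr_add)
    then have "ennreal ((2 powr - (real j * s)) powr p) * ennreal (?c powr p) = 1" by (simp only: ennreal_mult[symmetric] powr_ge_zero ennreal_1)
    then show ?thesis by (simp only: mult.assoc[symmetric] mult_1)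
  qed
  ultimately show ?thesis by (simp add: powr_mult ennreal_mult)
qed

lemma radial_upper_bound:
  fixes \<phi>0 :: "real ^ 'n \<Rightarrow> complex"
  assumes p: "0 < p" and q: "0 < q" and gen: "lp_generator \<phi>0" and U: "U_cond A s p q" and s: "s < real CARD('n) / p"
  shows "\<exists>c::real. \<forall>f \<in> RA_space \<phi>0 A s p q. \<forall>x. x \<noteq> 0 \<longrightarrow>
          norm x powr (real CARD('n) / p - s) * norm (cont_rep (- {0}) f x) \<le> c * A_norm \<phi>0 A s p q f"
proof -
  let ?d = "real CARD('n)"
  have space: "f \<in> tempered_dists" "radial_dist f" "A_enorm \<phi>0 A s p q f = ennreal (A_norm \<phi>0 A s p q f)" "A_norm \<phi>0 A s p q f \<ge> 0"
    if "f \<in> RA_space \<phi>0 A s p q" for f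
    using that by (auto simp: RA_space_def A_space_def A_norm_def less_top)
  have conclude: ?thesis if c: "\<And>f x. f \<in> RA_space \<phi>0 A s p q \<Longrightarrow> x \<noteq> 0 \<Longrightarrow> norm (cont_rep (- {0}) f x) \<le> C * norm x powr (s - ?d / p) * A_norm \<phi>0 A s p q f" for C
  proof (intro exI ballI allI impI)
    fix f and x :: "real ^ 'n" assume f: "f \<in> RA_space \<phi>0 A s p q" and x: "x \<noteq> 0"
    have "norm x powr (?d / p - s) * norm (cont_rep (- {0}) f x) \<le> norm x powr (?d / p - s) * (C * norm x powr (s - ?d / p) * A_norm \<phi>0 A s p q f)"
      by (intro mult_left_mono c f x) auto
    also have "\<dots> = (norm x powr (?d / p - s) * norm x powr - (?d / p - s)) * (C * A_norm \<phi>0 A s p q f)" by (simp add: mult_ac)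
    also have "norm x powr (?d / p - s) * norm x powr - (?d / p - s) = 1" using x by (intro powr_mult_neg) simp
    finally show "norm x powr (?d / p - s) * norm (cont_rep (- {0}) f x) \<le> C * A_norm \<phi>0 A s p q f" by simp
  qed
  have meas: "block (dyadic \<phi>0 i) f \<in> borel_measurable borel" if "f \<in> tempered_dists" for f i
    by (intro borel_measurable_continuous_onI block_continuous that schwartz_dyadic gen)
  have Nb: "(\<integral>\<^sup>+y. ennreal (norm (block (dyadic \<phi>0 i) f y) powr p) \<partial>lborel) \<le> ennreal ((2 powr - (real i * s) * A_norm \<phi>0 A s p q f) powr p)"
    if f: "f \<in> RA_space \<phi>0 A s p q" for f i
  proof (cases A)
    case Besov
    then have "Lp_norm p (\<lambda>x. ennreal (norm (freq_block \<phi>0 i f x))) \<le> ennreal (2 powr - (real i * s) * A_norm \<phi>0 A s p q f)"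
      using space(3)[OF f] by (intro besov_block_Lp[OF q]) simp
    from Lp_norm_finiteD[OF p this] show ?thesis
      using space(4)[OF f] by (simp add: ennpow_ennreal freq_block_eq[OF gen space(1)[OF f]])
  next
    case Triebel
    then show ?thesis
      using triebel_block_Lp[OF p q, of \<phi>0 s f "A_norm \<phi>0 A s p q f" i] space[OF f] meas[OF space(1)[OF f]]
      by (simp add: freq_block_eq[OF gen space(1)[OF f]])
  qed
  show ?thesis
  proof (cases "s > 1 / p")
    case True
    obtain C where C: "C > 0" "\<And>T \<nu> x. T \<in> tempered_dists \<Longrightarrow> radial_dist T \<Longrightarrow> \<nu> \<ge> 0 \<Longrightarrow>
      (\<And>i. (\<integral>\<^sup>+y. ennreal (norm (block (dyadic \<phi>0 i) T y) powr p) \<partial>lborel) \<le> ennreal ((2 powr - (real i * s) * \<nu>) powr p)) \<Longrightarrow> x \<noteq> 0 \<Longrightarrow>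
      norm (cont_rep (- {0}) T x) \<le> C * norm x powr (s - ?d / p) * \<nu>"
      by (rule radial_bound_supercritical[OF gen p True s]) (rule that, assumption, blast)
    show ?thesis by (rule conclude[of C]) (rule C(2)[OF space(1,2,4) Nb])
  next
    case False
    then have se: "s = 1 / p" using U by (cases A) auto
    show ?thesis
    proof (cases A)
      case Besov
      then have q1: "q \<le> 1" using U False by simp
      obtain C where C: "C > 0" "\<And>T \<nu> b x. T \<in> tempered_dists \<Longrightarrow> radial_dist T \<Longrightarrow> (\<And>j. b j \<ge> 0) \<Longrightarrow> (\<And>n. (\<Sum>j<n. b j) \<le> \<nu>) \<Longrightarrow>
        (\<And>i. (\<integral>\<^sup>+y. ennreal (norm (block (dyadic \<phi>0 i) T y) powr p) \<partial>lborel) \<le> ennreal ((2 powr - (real i / p) * b i) powr p)) \<Longrightarrow> x \<noteq> 0 \<Longrightarrow>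
        norm (cont_rep (- {0}) T x) \<le> C * norm x powr (1 / p - ?d / p) * \<nu>"
        by (rule radial_bound_besov_endpoint[OF gen p]) (rule that, assumption, blast)
      show ?thesis
      proof (rule conclude[of C])
        fix f and x :: "real ^ 'n" assume f: "f \<in> RA_space \<phi>0 A s p q" and x: "x \<noteq> 0"
        define L where "L j = Lp_norm p (\<lambda>x. ennreal (norm (freq_block \<phi>0 j f x)))" for j
        have Lle: "L j \<le> ennreal (2 powr - (real j * s) * A_norm \<phi>0 A s p q f)" for j
          unfolding L_def using space(3)[OF f] Besov by (intro besov_block_Lp[OF q]) simp
        define N where "N j = enn2real (L j)" for j
        have N: "L j = ennreal (N j)" "N j \<ge> 0" for j
        proof -
          have "L j < top" using Lle[of j] ennreal_less_top by (rule order_le_less_trans)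
          then show "L j = ennreal (N j)" "N j \<ge> 0" by (simp_all add: N_def)
        qed
        \<comment> \<open>The weighted block norms whose \<open>lq_norm\<close> is the Besov
          quasi-norm; they are summable because \<open>q <= 1\<close>.\<close>
        define b where "b j = 2 powr (real j * s) * N j" for j
        have "lq_norm q (\<lambda>j. ennreal (b j)) = A_enorm \<phi>0 A s p q f"
        proof -
          have "ennreal (b j) = ennreal (2 powr (real j * s)) * L j" for j
            unfolding N(1) b_def using N(2) by (intro ennreal_mult) auto
          then show ?thesis by (simp add: Besov L_def)
        qed
        then have bs: "(\<Sum>j<n. b j) \<le> A_norm \<phi>0 A s p q f" for n
          using space[OF f] N by (intro sum_le_lq_norm[OF q q1]) (auto simp: b_def)
        have Nb: "(\<integral>\<^sup>+y. ennreal (norm (block (dyadic \<phi>0 i) f y) powr p) \<partial>lborel) \<le> ennreal ((2 powr - (real i / p) * b i) powr p)" for i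
        proof -
          have "2 powr - (real i / p) * b i = N i" by (simp add: b_def se mult.assoc[symmetric] flip: powr_add)
          moreover have "L i \<le> ennreal (N i)" using N by simp
          note Lp_norm_finiteD[OF p this[unfolded L_def] N(2)]
          ultimately show ?thesis by (simp add: ennpow_ennreal freq_block_eq[OF gen space(1)[OF f]])
        qed
        show "norm (cont_rep (- {0}) f x) \<le> C * norm x powr (s - ?d / p) * A_norm \<phi>0 A s p q f"
          unfolding se by (rule C(2)[OF space(1,2)[OF f, unfolded se] _ bs[unfolded se] Nb x]) (use N in \<open>simp add: b_def\<close>)
      qed
    next
      case Triebel
      then have p1: "p \<le> 1" using U False by simp
      obtain C where C: "C > 0" "\<And>T H \<nu> x. T \<in> tempered_dists \<Longrightarrow> radial_dist T \<Longrightarrow> H \<in> borel_measurable borel \<Longrightarrow>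
        (\<And>i y. ennreal (2 powr (real i / 2) * norm (block (dyadic \<phi>0 i) T y) powr (p / 2)) \<le> H y) \<Longrightarrow>
        (\<integral>\<^sup>+y. (H y)\<^sup>2 \<partial>lborel) \<le> ennreal (\<nu> powr p) \<Longrightarrow> \<nu> \<ge> 0 \<Longrightarrow> x \<noteq> 0 \<Longrightarrow>
        norm (cont_rep (- {0}) T x) \<le> C * norm x powr (1 / p - ?d / p) * \<nu>"
        by (rule radial_bound_triebel_endpoint[OF gen p p1]) (rule that, assumption, blast)
      show ?thesis
      proof (rule conclude[of C])
        fix f and x :: "real ^ 'n" assume f: "f \<in> RA_space \<phi>0 A s p q" and x: "x \<noteq> 0"
        note T = space(1)[OF f]
        note [measurable] = meas[OF T]
        \<comment> \<open>Every \<open>lq_norm\<close> dominates the supremum, so any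
          \<open>q\<close> is covered. With \<open>s = 1 / p\<close>, raising to the power
          \<open>p / 2\<close> turns the weight \<open>2^(i s)\<close> into the
          \<open>2^(i/2)\<close> of the endpoint estimate.\<close>
        define L where "L y = (SUP j. ennreal (2 powr (real j * s)) * ennreal (norm (block (dyadic \<phi>0 j) f y)))" for y
        have [measurable]: "L \<in> borel_measurable borel" unfolding L_def[abs_def] by measurable
        define H where "H y = ennpow (L y) (p / 2)" for y
        have Hm: "H \<in> borel_measurable borel" unfolding H_def[abs_def] by measurable
        have Hb: "ennreal (2 powr (real i / 2) * norm (block (dyadic \<phi>0 i) f y) powr (p / 2)) \<le> H y" for i y
        proof -
          have "ennreal (2 powr (real i * s) * norm (block (dyadic \<phi>0 i) f y)) \<le> L y"
            unfolding L_def by (rule SUP_upper2[of i]) (auto simp: ennreal_mult)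
          then have "ennpow (ennreal (2 powr (real i * s) * norm (block (dyadic \<phi>0 i) f y))) (p / 2) \<le> H y"
            unfolding H_def using p by (intro ennpow_mono) auto
          moreover have "(2 powr (real i * s) * norm (block (dyadic \<phi>0 i) f y)) powr (p / 2) = 2 powr (real i / 2) * norm (block (dyadic \<phi>0 i) f y) powr (p / 2)"
            unfolding powr_mult powr_powr using p by (simp add: se)
          ultimately show ?thesis by (simp add: ennpow_ennreal)
        qed
        have HI: "(\<integral>\<^sup>+y. (H y)\<^sup>2 \<partial>lborel) \<le> ennreal (A_norm \<phi>0 A s p q f powr p)"
        proof -
          have "(\<integral>\<^sup>+y. (H y)\<^sup>2 \<partial>lborel) \<le> (\<integral>\<^sup>+y. ennpow (lq_norm q (\<lambda>j. ennreal (2 powr (real j * s)) * ennreal (norm (freq_block \<phi>0 j f y)))) p \<partial>lborel)"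
            unfolding H_def ennpow_half_square[OF p] L_def freq_block_eq[OF gen T]
            by (intro nn_integral_mono ennpow_mono SUP_least lq_norm_ge[OF q] p)
          also have "\<dots> \<le> ennreal (A_norm \<phi>0 A s p q f powr p)"
            using space[OF f] Triebel by (intro Lp_norm_finiteD[OF p]) auto
          finally show ?thesis .
        qed
        show "norm (cont_rep (- {0}) f x) \<le> C * norm x powr (s - ?d / p) * A_norm \<phi>0 A s p q f"
          using C(2)[OF T space(2)[OF f] Hm Hb HI space(4)[OF f] x] by (simp add: se)
      qed
    qed
  qed
qed

subsection \<open>Dilated Gaussians\<close>

definition fun_dist :: "('a::euclidean_space \<Rightarrow> complex) \<Rightarrow> (('a \<Rightarrow> complex) \<Rightarrow> complex)" where
  "fun_dist g = (\<lambda>\<phi>\<in>schwartz. LINT y|lborel. g y * \<phi> y)"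

lemma integrable_schwartz_mult:
  assumes "g \<in> schwartz" "\<phi> \<in> schwartz" shows "integrable lborel (\<lambda>y. g y * \<phi> y)"
  by (rule schwartz_integrable[OF schwartz_mult[OF assms]])

lemma fun_dist_tempered:
  fixes g :: "'a::euclidean_space \<Rightarrow> complex"
  assumes g: "g \<in> schwartz"
  shows "fun_dist g \<in> tempered_dists"
  unfolding tempered_dists_def mem_Collect_eq
proof (intro conjI ballI allI)
  show "fun_dist g \<in> extensional schwartz" by (simp add: fun_dist_def)
  show "fun_dist g (\<lambda>x. \<phi> x + \<psi> x) = fun_dist g \<phi> + fun_dist g \<psi>" if "\<phi> \<in> schwartz" "\<psi> \<in> schwartz" for \<phi> \<psi>
    using that schwartz_add(1)[OF that] integrable_schwartz_mult[OF g] by (simp add: fun_dist_def distrib_left)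
  show "fun_dist g (\<lambda>x. c * \<phi> x) = c * fun_dist g \<phi>" if "\<phi> \<in> schwartz" for c \<phi>
    using that schwartz_cmult(1)[OF that] by (simp add: fun_dist_def mult.left_commute[of _ c])
  show "\<exists>C N. \<forall>\<phi>\<in>schwartz. norm (fun_dist g \<phi>) \<le> C * (\<Sum>bs | bs \<in> multi_indices \<and> length bs \<le> N. schwartz_seminorm N bs \<phi>)"
  proof (intro exI ballI)
    fix \<phi> :: "'a \<Rightarrow> complex" assume \<phi>: "\<phi> \<in> schwartz"
    have bdd: "bdd_above (range (\<lambda>x. (1 + norm x) ^ 0 * norm (iter_deriv [] \<phi> x)))"
      using \<phi> unfolding schwartz_def by (auto dest!: spec[of _ 0] bspec[of _ _ "[]"])
    have sup: "norm (\<phi> y) \<le> schwartz_seminorm 0 [] \<phi>" for y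
      using cSUP_upper[OF UNIV_I bdd, of y] unfolding schwartz_seminorm_def by simp
    have "norm (fun_dist g \<phi>) \<le> (LINT y|lborel. norm (g y * \<phi> y))"
      using \<phi> by (simp add: fun_dist_def integral_norm_bound)
    also have "\<dots> \<le> (LINT y|lborel. norm (g y) * schwartz_seminorm 0 [] \<phi>)"
      using integrable_schwartz_mult[OF g \<phi>] schwartz_integrable[OF g] sup
      by (intro integral_mono integrable_norm integrable_mult_left) (auto simp: norm_mult intro!: mult_left_mono)
    also have "\<dots> = (LINT y|lborel. norm (g y)) * schwartz_seminorm 0 [] \<phi>" by simp
    also have "schwartz_seminorm 0 [] \<phi> = (\<Sum>bs | bs \<in> multi_indices \<and> length bs \<le> 0. schwartz_seminorm 0 bs \<phi>)"
    proof -
      have "{bs. bs \<in> (multi_indices :: 'a list set) \<and> length bs \<le> 0} = {[]}" by auto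
      then show ?thesis by simp
    qed
    finally show "norm (fun_dist g \<phi>) \<le> (LINT y|lborel. norm (g y)) * (\<Sum>bs | bs \<in> multi_indices \<and> length bs \<le> 0. schwartz_seminorm 0 bs \<phi>)" .
  qed
qed

lemma fun_dist_agrees:
  assumes "g \<in> schwartz" shows "agrees_on UNIV (fun_dist g) g"
  unfolding agrees_on_def fun_dist_def
  using integrable_schwartz_mult[OF assms] subsetD[OF test_funs_subset_schwartz] by (auto simp: restrict_def)

lemma fun_dist_radial:
  fixes g :: "'a::euclidean_space \<Rightarrow> complex"
  assumes g: "g \<in> schwartz" and rad: "radial_fun g"
  shows "radial_dist (fun_dist g)"
  unfolding radial_dist_def
proof (intro allI impI ballI)
  fix h :: "'a \<Rightarrow> 'a" and \<phi> :: "'a \<Rightarrow> complex" assume h: "orthogonal_transformation h" and \<phi>: "\<phi> \<in> schwartz"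
  have [measurable]: "g \<in> borel_measurable borel" "\<phi> \<in> borel_measurable borel" using g \<phi> schwartz_measurable by auto
  have gh: "g (h y) = g y" for y using rad h unfolding radial_fun_def by (metis o_apply)
  have "(LINT y|lborel. g y * \<phi> (h y)) = (LINT y|lborel. g y * \<phi> y)"
    using integral_orthogonal[OF h, of "\<lambda>y. g y * \<phi> y"] by (simp add: gh)
  then show "fun_dist g (\<phi> \<circ> h) = fun_dist g \<phi>"
    using \<phi> schwartz_orthogonal[OF h \<phi>] by (simp add: fun_dist_def o_def)
qed

lemma freq_block_fun_dist:
  fixes g :: "'a::euclidean_space \<Rightarrow> complex"
  assumes gen: "lp_generator \<phi>0" and g: "g \<in> schwartz"
  shows "freq_block \<phi>0 j (fun_dist g) = inv_fourier (\<lambda>\<xi>. dyadic \<phi>0 j \<xi> * fourier g \<xi>)"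
proof (rule freq_block_eqI[OF gen])
  let ?u = "\<lambda>\<xi>. dyadic \<phi>0 j \<xi> * fourier g \<xi>"
  have u: "?u \<in> schwartz" by (intro schwartz_mult schwartz_dyadic gen schwartz_fourier g)
  note Fu = schwartz_inv_fourier[OF u]
  show "continuous_on UNIV (inv_fourier ?u)" by (rule schwartz_continuous[OF Fu])
  fix \<psi> :: "'a \<Rightarrow> complex" assume \<psi>: "\<psi> \<in> schwartz"
  show "integrable lborel (\<lambda>y. inv_fourier ?u y * \<psi> y)" by (rule integrable_schwartz_mult[OF Fu \<psi>])
  let ?v = "\<lambda>\<xi>. dyadic \<phi>0 j \<xi> * inv_fourier \<psi> \<xi>"
  have v: "?v \<in> schwartz" by (intro schwartz_mult schwartz_dyadic gen schwartz_inv_fourier \<psi>)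
  have "fun_dist g (fourier ?v) = (LINT y|lborel. g y * fourier ?v y)"
    using schwartz_fourier[OF v] by (simp add: fun_dist_def)
  also have "\<dots> = (LINT y|lborel. fourier g y * ?v y)"
    by (rule fourier_multiplication[OF schwartz_integrable[OF g] schwartz_integrable[OF v]])
  also have "\<dots> = (LINT y|lborel. ?u y * inv_fourier \<psi> y)" by (simp only: mult_ac)
  also have "\<dots> = (LINT y|lborel. inv_fourier ?u y * \<psi> y)"
    by (rule inv_fourier_multiplication[OF schwartz_integrable[OF u] schwartz_integrable[OF \<psi>]])
  finally show "fun_dist g (fourier ?v) = (LINT y|lborel. inv_fourier ?u y * \<psi> y)" .
qed

section \<open>Decay of Gaussian blocks, uniformly in the width\<close>

lemma gauss_dilate_partial:
  fixes \<mu> :: real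
  assumes "b \<in> Basis"
  shows "(\<lambda>\<xi>. gauss (\<mu> *\<^sub>R \<xi>)) differentiable at \<xi>"
    and "partial_deriv b (\<lambda>\<xi>::'a::euclidean_space. gauss (\<mu> *\<^sub>R \<xi>)) \<xi> = - of_real (\<mu>\<^sup>2) * of_real (\<xi> \<bullet> b) * gauss (\<mu> *\<^sub>R \<xi>)"
proof -
  have s: "((\<lambda>\<xi>::'a. \<mu> *\<^sub>R \<xi>) has_derivative (\<lambda>h. \<mu> *\<^sub>R h)) (at \<xi>)" by (auto intro!: derivative_eq_intros)
  note D = has_derivative_compose[OF s schwartz_has_derivative[OF schwartz_gauss]]
  show "(\<lambda>\<xi>. gauss (\<mu> *\<^sub>R \<xi>)) differentiable at \<xi>" using D unfolding differentiable_def by blast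
  have "partial_deriv b (\<lambda>\<xi>::'a. gauss (\<mu> *\<^sub>R \<xi>)) \<xi> = (\<Sum>b'\<in>Basis. (\<mu> *\<^sub>R b \<bullet> b') *\<^sub>R partial_deriv b' gauss (\<mu> *\<^sub>R \<xi>))"
    by (rule partial_derivI[OF D])
  also have "\<dots> = (\<Sum>b'\<in>Basis. if b = b' then \<mu> *\<^sub>R partial_deriv b' gauss (\<mu> *\<^sub>R \<xi>) else 0)"
    using assms by (intro sum.cong) (auto simp: inner_Basis)
  also have "\<dots> = \<mu> *\<^sub>R partial_deriv b gauss (\<mu> *\<^sub>R \<xi>)" using assms by simp
  finally show "partial_deriv b (\<lambda>\<xi>::'a. gauss (\<mu> *\<^sub>R \<xi>)) \<xi> = - of_real (\<mu>\<^sup>2) * of_real (\<xi> \<bullet> b) * gauss (\<mu> *\<^sub>R \<xi>)"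
    by (simp add: gauss_partial_deriv scaleR_conv_of_real power2_eq_square)
qed

text \<open>One power of a coordinate is exchanged for one derivative, which falls on
  \<open>\<psi>\<close> or on the Gaussian. The second case produces \<open>\<mu>^2\<close> and a
  coordinate factor; the loss is recovered by using the induction hypothesis with
  \<open>N + 2\<close>. Hence the induction has to generalise over both \<open>\<psi>\<close> and
  \<open>N\<close>.\<close>

lemma gauss_family_decay_coord:
  fixes \<psi> :: "'a::euclidean_space \<Rightarrow> complex" and M :: "real set"
  assumes M: "\<And>\<mu>. \<mu> \<in> M \<Longrightarrow> \<mu> > 0"
    and bound: "\<And>N. \<exists>C. \<forall>\<mu>\<in>M. \<forall>\<xi>::'a. \<rho> \<le> norm \<xi> \<longrightarrow> (1 + \<mu>) ^ N * norm (gauss (\<mu> *\<^sub>R \<xi>)) \<le> C"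
    and b: "b \<in> Basis" and \<psi>: "\<psi> \<in> schwartz" "\<And>\<xi>. norm \<xi> < \<rho> \<Longrightarrow> \<psi> \<xi> = 0"
  shows "\<exists>C. \<forall>\<mu>\<in>M. \<forall>x. (1 + \<mu>) ^ N * (\<bar>x \<bullet> b\<bar> ^ k * norm (inv_fourier (\<lambda>\<xi>. \<psi> \<xi> * gauss (\<mu> *\<^sub>R \<xi>)) x)) \<le> C"
  using \<psi>
proof (induction k arbitrary: \<psi> N)
  case 0
  obtain C where C: "\<And>\<mu> \<xi>. \<mu> \<in> M \<Longrightarrow> \<rho> \<le> norm (\<xi>::'a) \<Longrightarrow> (1 + \<mu>) ^ N * norm (gauss (\<mu> *\<^sub>R \<xi>)) \<le> C"
    using bound by blast
  let ?c = "fourier_const TYPE('a)"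
  have "(1 + \<mu>) ^ N * norm (inv_fourier (\<lambda>\<xi>. \<psi> \<xi> * gauss (\<mu> *\<^sub>R \<xi>)) x) \<le> ?c * (LINT \<xi>|lborel. C * norm (\<psi> \<xi>))" if \<mu>: "\<mu> \<in> M" for \<mu> x
  proof -
    have S: "(\<lambda>\<xi>. \<psi> \<xi> * gauss (\<mu> *\<^sub>R \<xi>)) \<in> schwartz" by (intro schwartz_mult 0 schwartz_dilate schwartz_gauss M \<mu>)
    have "(1 + \<mu>) ^ N * norm (inv_fourier (\<lambda>\<xi>. \<psi> \<xi> * gauss (\<mu> *\<^sub>R \<xi>)) x) \<le> (1 + \<mu>) ^ N * (?c * (LINT \<xi>|lborel. norm (\<psi> \<xi> * gauss (\<mu> *\<^sub>R \<xi>))))"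
      using M[OF \<mu>] unfolding inv_fourier_eq by (intro mult_left_mono norm_fourier_le) auto
    also have "\<dots> = ?c * (LINT \<xi>|lborel. (1 + \<mu>) ^ N * norm (\<psi> \<xi> * gauss (\<mu> *\<^sub>R \<xi>)))" by simp
    also have "\<dots> \<le> ?c * (LINT \<xi>|lborel. C * norm (\<psi> \<xi>))"
    proof (intro mult_left_mono integral_mono)
      show "integrable lborel (\<lambda>\<xi>. (1 + \<mu>) ^ N * norm (\<psi> \<xi> * gauss (\<mu> *\<^sub>R \<xi>)))"
        by (intro integrable_mult_right integrable_norm schwartz_integrable[OF S])
      show "integrable lborel (\<lambda>\<xi>. C * norm (\<psi> \<xi>))" by (intro integrable_mult_right integrable_norm schwartz_integrable 0)
      fix \<xi>
      show "(1 + \<mu>) ^ N * norm (\<psi> \<xi> * gauss (\<mu> *\<^sub>R \<xi>)) \<le> C * norm (\<psi> \<xi>)"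
      proof (cases "norm \<xi> < \<rho>")
        case False
        then have "norm (\<psi> \<xi>) * ((1 + \<mu>) ^ N * norm (gauss (\<mu> *\<^sub>R \<xi>))) \<le> norm (\<psi> \<xi>) * C" by (intro mult_left_mono C \<mu>) auto
        then show ?thesis by (simp only: norm_mult mult_ac)
      qed (simp add: 0)
    qed (use fourier_const_pos[of "TYPE('a)"] in auto)
    finally show ?thesis .
  qed
  then show ?case by auto
next
  case (Suc k)
  \<comment> \<open>The two multipliers left by the product rule; both are Schwartz functions and
    vanish for norms below \<open>\<rho>\<close>, so the induction hypothesis covers them.\<close>
  let ?\<psi>1 = "partial_deriv b \<psi>"
  let ?\<psi>2 = "\<lambda>\<xi>. complex_of_real (\<xi> \<bullet> b) * \<psi> \<xi>"
  have S1: "?\<psi>1 \<in> schwartz" by (rule schwartz_partial_deriv[OF Suc.prems(1) b])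
  have S2: "?\<psi>2 \<in> schwartz" by (rule schwartz_coord_mult[OF Suc.prems(1)])
  have Z1: "?\<psi>1 \<xi> = 0" if "norm \<xi> < \<rho>" for \<xi>
  proof -
    have "(\<psi> has_derivative (\<lambda>h. 0)) (at \<xi>)"
      by (rule has_derivative_transform_within_open[where s = "ball 0 \<rho>" and f = "\<lambda>_. 0"]) (use that Suc.prems(2) in auto)
    from partial_derivI[OF this] show ?thesis .
  qed
  have Z2: "?\<psi>2 \<xi> = 0" if "norm \<xi> < \<rho>" for \<xi> using Suc.prems(2)[OF that] by simp
  obtain C1 where C1: "\<And>\<mu> x. \<mu> \<in> M \<Longrightarrow> (1 + \<mu>) ^ N * (\<bar>x \<bullet> b\<bar> ^ k * norm (inv_fourier (\<lambda>\<xi>. ?\<psi>1 \<xi> * gauss (\<mu> *\<^sub>R \<xi>)) x)) \<le> C1"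
    using Suc.IH[OF S1 Z1, of N] by blast
  obtain C2 where C2: "\<And>\<mu> x. \<mu> \<in> M \<Longrightarrow> (1 + \<mu>) ^ (N + 2) * (\<bar>x \<bullet> b\<bar> ^ k * norm (inv_fourier (\<lambda>\<xi>. ?\<psi>2 \<xi> * gauss (\<mu> *\<^sub>R \<xi>)) x)) \<le> C2"
    using Suc.IH[OF S2 Z2, of "N + 2"] by blast
  have "(1 + \<mu>) ^ N * (\<bar>x \<bullet> b\<bar> ^ Suc k * norm (inv_fourier (\<lambda>\<xi>. \<psi> \<xi> * gauss (\<mu> *\<^sub>R \<xi>)) x)) \<le> C1 + C2" if \<mu>: "\<mu> \<in> M" for \<mu> x
  proof -
    let ?e = "\<lambda>\<xi>::'a. gauss (\<mu> *\<^sub>R \<xi>)"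
    have eS: "?e \<in> schwartz" by (intro schwartz_dilate schwartz_gauss M \<mu>)
    have S: "(\<lambda>\<xi>. \<psi> \<xi> * ?e \<xi>) \<in> schwartz" by (intro schwartz_mult Suc.prems(1) eS)
    let ?I1 = "inv_fourier (\<lambda>\<xi>. ?\<psi>1 \<xi> * ?e \<xi>) x" and ?I2 = "inv_fourier (\<lambda>\<xi>. ?\<psi>2 \<xi> * ?e \<xi>) x"
    have pd: "partial_deriv b (\<lambda>\<xi>. \<psi> \<xi> * ?e \<xi>) = (\<lambda>\<xi>. - of_real (\<mu>\<^sup>2) * (?\<psi>2 \<xi> * ?e \<xi>) + ?\<psi>1 \<xi> * ?e \<xi>)"
    proof
      fix \<xi>
      show "partial_deriv b (\<lambda>\<xi>. \<psi> \<xi> * ?e \<xi>) \<xi> = - of_real (\<mu>\<^sup>2) * (?\<psi>2 \<xi> * ?e \<xi>) + ?\<psi>1 \<xi> * ?e \<xi>"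
        unfolding schwartz_mult_partial[OF schwartz_differentiable[OF Suc.prems(1)] gauss_dilate_partial(1)[OF b] b]
          gauss_dilate_partial(2)[OF b] by (simp add: mult_ac)
    qed
    have i: "integrable lborel (\<lambda>\<xi>. - of_real (\<mu>\<^sup>2) * (?\<psi>2 \<xi> * ?e \<xi>))" "integrable lborel (\<lambda>\<xi>. ?\<psi>1 \<xi> * ?e \<xi>)"
      using integrable_schwartz_mult[OF S2 eS] integrable_schwartz_mult[OF S1 eS] by auto
    have "\<i> * of_real (b \<bullet> (- x)) * fourier (\<lambda>\<xi>. \<psi> \<xi> * ?e \<xi>) (- x) = - of_real (\<mu>\<^sup>2) * ?I2 + ?I1"
      unfolding fourier_of_partial_deriv[OF S b, symmetric] pd fourier_add[OF i] fourier_cmult inv_fourier_eq ..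
    then have "norm (\<i> * of_real (b \<bullet> (- x)) * fourier (\<lambda>\<xi>. \<psi> \<xi> * ?e \<xi>) (- x)) \<le> \<mu>\<^sup>2 * norm ?I2 + norm ?I1"
      using norm_triangle_ineq[of "- of_real (\<mu>\<^sup>2) * ?I2" ?I1] by (simp add: norm_mult norm_power)
    then have le: "\<bar>x \<bullet> b\<bar> * norm (inv_fourier (\<lambda>\<xi>. \<psi> \<xi> * ?e \<xi>) x) \<le> \<mu>\<^sup>2 * norm ?I2 + norm ?I1"
      by (simp add: norm_mult inv_fourier_eq inner_commute)
    have m0: "\<mu> > 0" by (rule M[OF \<mu>])
    have "(1 + \<mu>) ^ N * (\<bar>x \<bullet> b\<bar> ^ Suc k * norm (inv_fourier (\<lambda>\<xi>. \<psi> \<xi> * ?e \<xi>) x)) = (1 + \<mu>) ^ N * \<bar>x \<bullet> b\<bar> ^ k * (\<bar>x \<bullet> b\<bar> * norm (inv_fourier (\<lambda>\<xi>. \<psi> \<xi> * ?e \<xi>) x))"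
      by simp
    also have "\<dots> \<le> (1 + \<mu>) ^ N * \<bar>x \<bullet> b\<bar> ^ k * (\<mu>\<^sup>2 * norm ?I2 + norm ?I1)"
      using m0 by (intro mult_left_mono le) auto
    also have "\<dots> = ((1 + \<mu>) ^ N * \<mu>\<^sup>2) * (\<bar>x \<bullet> b\<bar> ^ k * norm ?I2) + (1 + \<mu>) ^ N * (\<bar>x \<bullet> b\<bar> ^ k * norm ?I1)"
      by (simp only: distrib_left mult_ac)
    also have "\<dots> \<le> (1 + \<mu>) ^ (N + 2) * (\<bar>x \<bullet> b\<bar> ^ k * norm ?I2) + (1 + \<mu>) ^ N * (\<bar>x \<bullet> b\<bar> ^ k * norm ?I1)"
    proof (intro add_right_mono mult_right_mono)
      show "(1 + \<mu>) ^ N * \<mu>\<^sup>2 \<le> (1 + \<mu>) ^ (N + 2)" unfolding power_add using m0 by (intro mult_left_mono power_mono) auto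
    qed auto
    also have "\<dots> \<le> C2 + C1" by (intro add_mono C1 C2 \<mu>)
    finally show ?thesis by simp
  qed
  then show ?case by blast
qed

lemma gauss_family_decay:
  fixes \<psi> :: "'a::euclidean_space \<Rightarrow> complex" and M :: "real set"
  assumes M: "\<And>\<mu>. \<mu> \<in> M \<Longrightarrow> \<mu> > 0"
    and bound: "\<And>N. \<exists>C. \<forall>\<mu>\<in>M. \<forall>\<xi>::'a. \<rho> \<le> norm \<xi> \<longrightarrow> (1 + \<mu>) ^ N * norm (gauss (\<mu> *\<^sub>R \<xi>)) \<le> C"
    and \<psi>: "\<psi> \<in> schwartz" "\<And>\<xi>. norm \<xi> < \<rho> \<Longrightarrow> \<psi> \<xi> = 0"
  shows "\<exists>C. \<forall>\<mu>\<in>M. \<forall>x. (1 + \<mu>) ^ N * ((1 + norm x) ^ k * norm (inv_fourier (\<lambda>\<xi>. \<psi> \<xi> * gauss (\<mu> *\<^sub>R \<xi>)) x)) \<le> C"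
proof -
  have "\<exists>C. \<forall>b\<in>Basis. \<forall>\<mu>\<in>M. \<forall>x. (1 + \<mu>) ^ N * (\<bar>x \<bullet> b\<bar> ^ l * norm (inv_fourier (\<lambda>\<xi>. \<psi> \<xi> * gauss (\<mu> *\<^sub>R \<xi>)) x)) \<le> C b" for l
    by (rule bchoice) (use gauss_family_decay_coord[OF M bound _ \<psi>] in blast)
  then obtain C where C: "\<And>l b \<mu> x. b \<in> Basis \<Longrightarrow> \<mu> \<in> M \<Longrightarrow> (1 + \<mu>) ^ N * (\<bar>x \<bullet> b\<bar> ^ l * norm (inv_fourier (\<lambda>\<xi>. \<psi> \<xi> * gauss (\<mu> *\<^sub>R \<xi>)) x)) \<le> C l b"
    by metis
  obtain b0 :: 'a where b0: "b0 \<in> Basis" using nonempty_Basis by blast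
  let ?D = "(1 + real DIM('a)) ^ k"
  have "(1 + \<mu>) ^ N * ((1 + norm x) ^ k * norm (inv_fourier (\<lambda>\<xi>. \<psi> \<xi> * gauss (\<mu> *\<^sub>R \<xi>)) x)) \<le> ?D * (C 0 b0 + (\<Sum>b\<in>Basis. C k b))" if \<mu>: "\<mu> \<in> M" for \<mu> x
  proof -
    let ?n = "norm (inv_fourier (\<lambda>\<xi>. \<psi> \<xi> * gauss (\<mu> *\<^sub>R \<xi>)) x)"
    have "(1 + \<mu>) ^ N * ((1 + norm x) ^ k * ?n) \<le> (1 + \<mu>) ^ N * ((?D * (1 + (\<Sum>b\<in>Basis. \<bar>x \<bullet> b\<bar> ^ k))) * ?n)"
      using M[OF \<mu>] by (intro mult_left_mono mult_right_mono one_plus_norm_power_le_sum) auto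
    also have "\<dots> = ?D * ((1 + \<mu>) ^ N * (\<bar>x \<bullet> b0\<bar> ^ 0 * ?n) + (\<Sum>b\<in>Basis. (1 + \<mu>) ^ N * (\<bar>x \<bullet> b\<bar> ^ k * ?n)))"
      by (simp add: algebra_simps sum_distrib_left sum_distrib_right)
    also have "\<dots> \<le> ?D * (C 0 b0 + (\<Sum>b\<in>Basis. C k b))"
      by (intro mult_left_mono add_mono sum_mono C b0 \<mu>) auto
    finally show ?thesis .
  qed
  then show ?thesis by blast
qed

text \<open>Scaling reduces all blocks to two model multipliers, the generator for
  \<open>j = 0\<close> and \<open>dyadic \<phi>0 1\<close> otherwise, with the single parameter
  \<open>\<mu> = 2^(j-1) / r\<close>. For large \<open>\<mu>\<close> the decay comes from the
  Gaussian on the annulus, for \<open>j = 0\<close> one has \<open>\<mu> <= 1\<close>.\<close>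

lemma gauss_blocks_pointwise:
  fixes \<phi>0 :: "'a::euclidean_space \<Rightarrow> complex"
  assumes gen: "lp_generator \<phi>0"
  obtains C where "C > 0" "\<And>r j x. r \<ge> 1 \<Longrightarrow>
    norm (freq_block \<phi>0 j (fun_dist (\<lambda>y. gauss (r *\<^sub>R y))) x)
      \<le> C * r powr - real DIM('a) * (2 ^ (j - 1)) ^ DIM('a) / ((1 + 2 ^ (j - 1) / r) ^ N * (1 + 2 ^ (j - 1) * norm x) ^ k)"
proof -
  let ?d = "DIM('a)"
  have g1: "norm (gauss y) \<le> 1" for y :: 'a by (simp add: gauss_def)
  have "\<exists>C. \<forall>\<mu>\<in>{0<..1}. \<forall>x. (1 + \<mu>) ^ N * ((1 + norm x) ^ k * norm (inv_fourier (\<lambda>\<xi>. \<phi>0 \<xi> * gauss (\<mu> *\<^sub>R \<xi>)) x)) \<le> C"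
  \<comment> \<open>The generator does not vanish near the origin, but here
    \<open>\<mu> <= 1\<close>, so powers of \<open>1 + \<mu>\<close> are bounded.\<close>
  proof (rule gauss_family_decay[where \<rho> = 0])
    show "\<exists>C. \<forall>\<mu>\<in>{0<..1}. \<forall>\<xi>::'a. 0 \<le> norm \<xi> \<longrightarrow> (1 + \<mu>) ^ N * norm (gauss (\<mu> *\<^sub>R \<xi>)) \<le> C" for N
    proof (intro exI[of _ "2 ^ N * 1"] ballI allI impI)
      fix \<mu> :: real and \<xi> :: 'a assume "\<mu> \<in> {0<..1}"
      then show "(1 + \<mu>) ^ N * norm (gauss (\<mu> *\<^sub>R \<xi>)) \<le> 2 ^ N * 1" by (intro mult_mono power_mono g1) auto
    qed
  qed (use lp_generator_schwartz[OF gen] in auto)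
  then obtain C0 where C0: "\<And>\<mu> x. 0 < \<mu> \<Longrightarrow> \<mu> \<le> 1 \<Longrightarrow> (1 + \<mu>) ^ N * ((1 + norm x) ^ k * norm (inv_fourier (\<lambda>\<xi>. \<phi>0 \<xi> * gauss (\<mu> *\<^sub>R \<xi>)) x)) \<le> C0"
    by (metis greaterThanAtMost_iff)
  have "\<exists>C. \<forall>\<mu>\<in>{0<..}. \<forall>x. (1 + \<mu>) ^ N * ((1 + norm x) ^ k * norm (inv_fourier (\<lambda>\<xi>. dyadic \<phi>0 1 \<xi> * gauss (\<mu> *\<^sub>R \<xi>)) x)) \<le> C"
  \<comment> \<open>Where the annular multiplier lives, \<open>norm \<xi> >= 1\<close>, so
    \<open>1 + \<mu>\<close> is at most \<open>1 + norm (\<mu> *\<^sub>R \<xi>)\<close> and the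
    rapid decay of the Gaussian applies for all positive \<open>\<mu>\<close>.\<close>
  proof (rule gauss_family_decay[where \<rho> = 1])
    show "\<exists>C. \<forall>\<mu>\<in>{0<..}. \<forall>\<xi>::'a. 1 \<le> norm \<xi> \<longrightarrow> (1 + \<mu>) ^ N * norm (gauss (\<mu> *\<^sub>R \<xi>)) \<le> C" for N
    proof -
      obtain C where C: "C > 0" "\<And>x::'a. (1 + norm x) ^ N * norm (gauss x) \<le> C" using rapidE[OF rapid_gauss] by metis
      have "(1 + \<mu>) ^ N * norm (gauss (\<mu> *\<^sub>R \<xi>)) \<le> C" if "\<mu> > 0" "1 \<le> norm \<xi>" for \<mu> and \<xi> :: 'a
      proof -
        have "\<mu> * 1 \<le> \<mu> * norm \<xi>" using that by (intro mult_left_mono) auto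
        then have "(1 + \<mu>) ^ N * norm (gauss (\<mu> *\<^sub>R \<xi>)) \<le> (1 + norm (\<mu> *\<^sub>R \<xi>)) ^ N * norm (gauss (\<mu> *\<^sub>R \<xi>))"
          using that by (intro mult_right_mono power_mono) auto
        then show ?thesis using C(2)[of "\<mu> *\<^sub>R \<xi>"] by linarith
      qed
      then show ?thesis by auto
    qed
    show "dyadic \<phi>0 1 \<xi> = 0" if "norm \<xi> < 1" for \<xi>
      using dyadic_support(2)[OF gen, of 1 \<xi>] that by force
  qed (use schwartz_dyadic[OF gen] in auto)
  then obtain C1 where C1: "\<And>\<mu> x. 0 < \<mu> \<Longrightarrow> (1 + \<mu>) ^ N * ((1 + norm x) ^ k * norm (inv_fourier (\<lambda>\<xi>. dyadic \<phi>0 1 \<xi> * gauss (\<mu> *\<^sub>R \<xi>)) x)) \<le> C1"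
    by (metis greaterThan_iff)
  define C where "C = max 1 (max C0 C1)"
  have C: "C > 0" "C0 \<le> C" "C1 \<le> C" by (auto simp: C_def)
  show ?thesis
  proof (rule that[OF C(1)])
    fix r :: real and j :: nat and x :: 'a assume l: "r \<ge> 1"
    \<comment> \<open>For \<open>j = 0\<close> truncated subtraction gives \<open>t = 1\<close>,
      matching the unscaled generator; for \<open>j > 0\<close> the scale is that of
      \<open>dyadic \<phi>0 1\<close>.\<close>
    define t :: real where "t = 2 ^ (j - 1)"
    have t: "t > 0" by (simp add: t_def)
    define \<psi> where "\<psi> = (if j = 0 then \<phi>0 else dyadic \<phi>0 1)"
    have \<psi>: "\<psi> \<in> schwartz" unfolding \<psi>_def using lp_generator_schwartz[OF gen] schwartz_dyadic[OF gen] by auto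
    define \<mu> where "\<mu> = t / r"
    have m: "\<mu> > 0" using t l by (simp add: \<mu>_def)
    have dj: "dyadic \<phi>0 j (t *\<^sub>R \<xi>) = \<psi> \<xi>" for \<xi>
    proof (cases j)
      case 0
      then show ?thesis by (simp add: \<psi>_def t_def dyadic_def)
    next
      case (Suc i)
      have 1: "2 powr - real (Suc i) * 2 ^ (Suc i - 1) = (2::real) powr - 1" by (simp add: powr_realpow[symmetric] flip: powr_add)
      have 2: "2 powr (- real (Suc i) + 1) * 2 ^ (Suc i - 1) = (2::real) powr 0" by (simp add: powr_realpow[symmetric] flip: powr_add)
      show ?thesis unfolding Suc \<psi>_def t_def dyadic_def scaleR_scaleR 1 2 by simp
    qed
    have gS: "(\<lambda>y. gauss (r *\<^sub>R y)) \<in> (schwartz :: ('a \<Rightarrow> complex) set)" using l by (intro schwartz_dilate schwartz_gauss) auto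
    have Fg: "fourier (\<lambda>y::'a. gauss (r *\<^sub>R y)) \<xi> = of_real (inverse r ^ ?d) * gauss (inverse r *\<^sub>R \<xi>)" for \<xi>
      using fourier_scale[OF schwartz_measurable[OF gS], of "inverse r" \<xi>] l by (simp add: fourier_gauss)
    let ?w = "\<lambda>\<xi>. dyadic \<phi>0 j \<xi> * gauss (inverse r *\<^sub>R \<xi>)"
    have gl: "(\<lambda>y. gauss (inverse r *\<^sub>R y)) \<in> (schwartz :: ('a \<Rightarrow> complex) set)" using l by (intro schwartz_dilate schwartz_gauss) auto
    have wS: "?w \<in> schwartz" by (intro schwartz_mult schwartz_dyadic gen gl)
    have "(\<lambda>\<xi>. dyadic \<phi>0 j \<xi> * fourier (\<lambda>y::'a. gauss (r *\<^sub>R y)) \<xi>) = (\<lambda>\<xi>. of_real (inverse r ^ ?d) * ?w \<xi>)"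
      unfolding Fg by (simp add: mult_ac)
    then have "freq_block \<phi>0 j (fun_dist (\<lambda>y. gauss (r *\<^sub>R y))) x = of_real (inverse r ^ ?d) * inv_fourier ?w x"
      unfolding freq_block_fun_dist[OF gen gS] by (simp only: inv_fourier_cmult)
    also have "inv_fourier ?w x = of_real (t ^ ?d) * inv_fourier (\<lambda>\<xi>. ?w (t *\<^sub>R \<xi>)) (t *\<^sub>R x)"
      unfolding inv_fourier_eq using fourier_scale[OF schwartz_measurable[OF wS] t, of "- x"] by simp
    also have "(\<lambda>\<xi>. ?w (t *\<^sub>R \<xi>)) = (\<lambda>\<xi>. \<psi> \<xi> * gauss (\<mu> *\<^sub>R \<xi>))"
      unfolding dj by (simp add: \<mu>_def divide_inverse mult.commute)
    finally have eq: "norm (freq_block \<phi>0 j (fun_dist (\<lambda>y. gauss (r *\<^sub>R y))) x) = inverse r ^ ?d * t ^ ?d * norm (inv_fourier (\<lambda>\<xi>. \<psi> \<xi> * gauss (\<mu> *\<^sub>R \<xi>)) (t *\<^sub>R x))"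
      using t l by (simp add: norm_mult norm_power norm_inverse)
    have "(1 + \<mu>) ^ N * ((1 + norm (t *\<^sub>R x)) ^ k * norm (inv_fourier (\<lambda>\<xi>. \<psi> \<xi> * gauss (\<mu> *\<^sub>R \<xi>)) (t *\<^sub>R x))) \<le> C"
    proof (cases "j = 0")
      case True
      then have "\<mu> \<le> 1" using l by (simp add: \<mu>_def t_def)
      then show ?thesis using C0[OF m, of "t *\<^sub>R x"] C True by (simp add: \<psi>_def)
    next
      case False
      then show ?thesis using C1[OF m, of "t *\<^sub>R x"] C by (simp add: \<psi>_def)
    qed
    then have "norm (inv_fourier (\<lambda>\<xi>. \<psi> \<xi> * gauss (\<mu> *\<^sub>R \<xi>)) (t *\<^sub>R x)) \<le> C / ((1 + \<mu>) ^ N * (1 + t * norm x) ^ k)"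
      using m t by (simp add: pos_le_divide_eq zero_less_power add_pos_nonneg add_pos_pos mult_ac)
    then have "inverse r ^ ?d * t ^ ?d * norm (inv_fourier (\<lambda>\<xi>. \<psi> \<xi> * gauss (\<mu> *\<^sub>R \<xi>)) (t *\<^sub>R x)) \<le> inverse r ^ ?d * t ^ ?d * (C / ((1 + \<mu>) ^ N * (1 + t * norm x) ^ k))"
      using t l by (intro mult_left_mono) auto
    moreover have "inverse r ^ ?d = r powr - real ?d" using l by (simp add: powr_minus powr_realpow power_inverse)
    ultimately show "norm (freq_block \<phi>0 j (fun_dist (\<lambda>y. gauss (r *\<^sub>R y))) x)
      \<le> C * r powr - real ?d * (2 ^ (j - 1)) ^ ?d / ((1 + 2 ^ (j - 1) / r) ^ N * (1 + 2 ^ (j - 1) * norm x) ^ k)"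
      unfolding eq t_def[symmetric] \<mu>_def[symmetric] by (simp add: mult_ac)
  qed
qed

subsection \<open>Quasi-norms of dilated Gaussians\<close>

lemma ennreal_le_suminf: "f j \<le> (\<Sum>i. f i)" for f :: "nat \<Rightarrow> ennreal"
  using sum_le_suminf[of f "{j}"] by simp

lemma ennpow_cmult:
  assumes "\<alpha> > 0" shows "ennpow (ennreal \<alpha> * x) r = ennreal (\<alpha> powr r) * ennpow x r"
proof (cases x)
  case (real y)
  then have "ennreal \<alpha> * x = ennreal (\<alpha> * y)" using assms by (simp add: ennreal_mult)
  then have "ennpow (ennreal \<alpha> * x) r = ennreal (\<alpha> powr r * y powr r)" using real assms by (simp only: ennpow_ennreal powr_mult mult_nonneg_nonneg less_imp_le)
  also have "\<dots> = ennreal (\<alpha> powr r) * ennreal (y powr r)" by (rule ennreal_mult) auto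
  finally show ?thesis using real by (simp add: ennpow_ennreal)
next
  case top
  then show ?thesis using assms by (simp add: ennreal_mult_top)
qed

lemma lq_norm_cmult:
  assumes "\<alpha> > 0" "q > 0" shows "lq_norm q (\<lambda>j. ennreal \<alpha> * a j) = ennreal \<alpha> * lq_norm q a"
proof (cases "q = \<infinity>")
  case True
  then show ?thesis by (simp add: lq_norm_def SUP_mult_left_ennreal)
next
  case False
  then have t: "enn2real q > 0" using assms by (simp add: enn2real_positive_iff less_top)
  then show ?thesis using False assms
    by (simp add: lq_norm_def ennpow_cmult powr_powr)
qed

lemma Lp_norm_cmult:
  assumes "\<alpha> > 0" "p > 0" and [measurable]: "u \<in> borel_measurable borel"
  shows "Lp_norm p (\<lambda>x. ennreal \<alpha> * u x) = ennreal \<alpha> * Lp_norm p u"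
proof -
  have "(\<integral>\<^sup>+x. ennreal (\<alpha> powr p) * ennpow (u x) p \<partial>lborel) = ennreal (\<alpha> powr p) * (\<integral>\<^sup>+x. ennpow (u x) p \<partial>lborel)"
    by (rule nn_integral_cmult) measurable
  then show ?thesis using assms by (simp add: Lp_norm_def ennpow_cmult powr_powr)
qed

lemma lq_norm_measurable [measurable (raw)]:
  assumes [measurable]: "\<And>j. u j \<in> borel_measurable M"
  shows "(\<lambda>x. lq_norm q (\<lambda>j. u j x)) \<in> borel_measurable M"
  unfolding lq_norm_def by (cases "q = \<infinity>") simp_all

lemma A_enorm_cmult:
  assumes q: "q > 0" and p: "p > 0" and a: "\<alpha> > 0"
    and [measurable]: "\<And>j. freq_block \<phi>0 j f \<in> borel_measurable borel"
    and h: "\<And>j x. norm (freq_block \<phi>0 j h x) = \<alpha> * norm (freq_block \<phi>0 j f x)"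
  shows "A_enorm \<phi>0 A s p q h = ennreal \<alpha> * A_enorm \<phi>0 A s p q f"
proof -
  have eq: "ennreal (norm (freq_block \<phi>0 j h x)) = ennreal \<alpha> * ennreal (norm (freq_block \<phi>0 j f x))" for j x
    using a by (simp add: h ennreal_mult)
  show ?thesis
  proof (cases A)
    case Besov
    have "Lp_norm p (\<lambda>x. ennreal (norm (freq_block \<phi>0 j h x))) = ennreal \<alpha> * Lp_norm p (\<lambda>x. ennreal (norm (freq_block \<phi>0 j f x)))" for j
      unfolding eq by (rule Lp_norm_cmult[OF a p]) measurable
    then show ?thesis using lq_norm_cmult[OF a q] by (simp add: Besov mult.left_commute)
  next
    case Triebel
    have "Lp_norm p (\<lambda>x. ennreal \<alpha> * lq_norm q (\<lambda>j. ennreal (2 powr (real j * s)) * ennreal (norm (freq_block \<phi>0 j f x))))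
      = ennreal \<alpha> * Lp_norm p (\<lambda>x. lq_norm q (\<lambda>j. ennreal (2 powr (real j * s)) * ennreal (norm (freq_block \<phi>0 j f x))))"
      by (rule Lp_norm_cmult[OF a p]) measurable
    then show ?thesis unfolding Triebel A_enorm.simps eq by (simp only: mult.left_commute[of _ "ennreal \<alpha>"] lq_norm_cmult[OF a q])
  qed
qed

text \<open>The maximum with 1 covers \<open>q = \<infinity>\<close>, where the weights enter only
  through their bound by 1 and \<open>enn2real q\<close> takes the value 0.\<close>

lemma lq_norm_le_weights:
  assumes q: "q > 0" and a: "\<And>j. a j \<le> ennreal (w j) * V" and w: "\<And>j. 0 < w j" "\<And>j. w j \<le> 1"
    and S: "S > 0" "\<And>n. q \<noteq> \<infinity> \<Longrightarrow> (\<Sum>j<n. w j powr enn2real q) \<le> S"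
  shows "lq_norm q a \<le> ennreal (max 1 (S powr (1 / enn2real q))) * V"
proof (cases "q = \<infinity>")
  case True
  have "a j \<le> ennreal (max 1 (S powr (1 / enn2real q))) * V" for j
    by (rule order_trans[OF a]) (intro mult_right_mono ennreal_leI, use w(2)[of j] in auto)
  then show ?thesis using True by (simp add: lq_norm_def SUP_le_iff)
next
  case False
  define t where "t = enn2real q"
  have t: "t > 0" using q False by (simp add: t_def enn2real_positive_iff less_top)
  have "(\<Sum>j. ennpow (a j) t) \<le> ennreal S * ennpow V t"
    unfolding suminf_eq_SUP
  proof (rule SUP_least)
    fix n
    have "(\<Sum>j<n. ennpow (a j) t) \<le> (\<Sum>j<n. ennreal (w j powr t) * ennpow V t)"
      unfolding ennpow_cmult[OF w(1), symmetric] using t by (intro sum_mono ennpow_mono a)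
    also have "\<dots> = ennreal (\<Sum>j<n. w j powr t) * ennpow V t" by (simp add: sum_distrib_right[symmetric] sum_ennreal)
    also have "\<dots> \<le> ennreal S * ennpow V t"
      using S(2)[OF False, of n] by (intro mult_right_mono ennreal_leI) (simp_all add: t_def)
    finally show "(\<Sum>j<n. ennpow (a j) t) \<le> ennreal S * ennpow V t" .
  qed
  then have "lq_norm q a \<le> ennpow (ennreal S * ennpow V t) (1 / t)"
    unfolding lq_norm_def t_def[symmetric] using False t by (auto intro!: ennpow_mono)
  also have "\<dots> = ennreal (S powr (1 / t)) * V" using t by (simp add: ennpow_cmult[OF S(1)] ennpow_ennpow)
  also have "\<dots> \<le> ennreal (max 1 (S powr (1 / t))) * V" by (intro mult_right_mono ennreal_leI) auto
  finally show ?thesis unfolding t_def .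
qed

text \<open>The weight enters squared so that it can be spent twice in the Triebel case: one factor
  makes the inner sequence norm in \<open>j\<close> finite, the other makes the sum of the integrals
  over \<open>j\<close> finite. No vector-valued inequality is involved, and all \<open>q\<close>
  are treated alike.\<close>

lemma A_enorm_le_weights:
  fixes \<phi>0 :: "'a::euclidean_space \<Rightarrow> complex"
  assumes q: "q > 0" and p: "p > 0" and K: "K > 0"
    and meas[measurable]: "\<And>j. freq_block \<phi>0 j f \<in> borel_measurable borel"
    and int: "\<And>j. (\<integral>\<^sup>+x. ennreal ((2 powr (real j * s) * norm (freq_block \<phi>0 j f x)) powr p) \<partial>lborel) \<le> ennreal ((K * (w j)\<^sup>2) powr p)"
    and w: "\<And>j. 0 < w j" "\<And>j. w j \<le> 1"
    and S: "S > 0" "\<And>n. q \<noteq> \<infinity> \<Longrightarrow> (\<Sum>j<n. w j powr enn2real q) \<le> S"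
    and R: "\<And>n. (\<Sum>j<n. w j powr p) \<le> R"
  shows "A_enorm \<phi>0 A s p q f \<le> ennreal (max 1 (S powr (1 / enn2real q)) * max 1 (R powr (1 / p)) * K)"
proof -
  let ?S = "max 1 (S powr (1 / enn2real q))"
  define u where "u j x = 2 powr (real j * s) * norm (freq_block \<phi>0 j f x)" for j x
  have um[measurable]: "u j \<in> borel_measurable borel" for j unfolding u_def[abs_def] by measurable
  have u0: "u j x \<ge> 0" for j x by (simp add: u_def)
  have ue: "ennreal (2 powr (real j * s)) * ennreal (norm (freq_block \<phi>0 j f x)) = ennreal (u j x)" for j x
    by (simp add: u_def ennreal_mult)
  note int = int[folded u_def]
  have S1: "?S \<ge> 1" by simp
  have R0: "R \<ge> 0" using R[of 0] by simp
  show ?thesis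
  proof (cases A)
    case Besov
    have "ennreal (2 powr (real j * s)) * Lp_norm p (\<lambda>x. ennreal (norm (freq_block \<phi>0 j f x))) \<le> ennreal (w j) * ennreal K" for j
    proof -
      have "ennreal (2 powr (real j * s)) * Lp_norm p (\<lambda>x. ennreal (norm (freq_block \<phi>0 j f x))) = Lp_norm p (\<lambda>x. ennreal (u j x))"
        unfolding ue[symmetric] by (rule Lp_norm_cmult[symmetric]) (use p in auto)
      also have "\<dots> \<le> ennpow (ennreal ((K * (w j)\<^sup>2) powr p)) (1 / p)"
        unfolding Lp_norm_def using int[of j] p by (intro ennpow_mono) (auto simp: ennpow_ennreal u0)
      also have "\<dots> = ennreal (K * (w j)\<^sup>2)" using p K by (simp add: ennpow_ennreal powr_powr)
      also have "\<dots> \<le> ennreal (w j * K)"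
      proof (rule ennreal_leI)
        have "w j * w j \<le> w j * 1" using w[of j] less_imp_le by (intro mult_left_mono) auto
        then show "K * (w j)\<^sup>2 \<le> w j * K" using K by (simp add: power2_eq_square mult.commute)
      qed
      also have "\<dots> = ennreal (w j) * ennreal K" using w(1)[of j] K by (simp add: ennreal_mult)
      finally show ?thesis .
    qed
    from lq_norm_le_weights[OF q this w S]
    have "A_enorm \<phi>0 A s p q f \<le> ennreal ?S * ennreal K" by (simp add: Besov)
    also have "\<dots> = ennreal (?S * K)" using S1 K by (simp add: ennreal_mult)
    also have "\<dots> \<le> ennreal (?S * max 1 (R powr (1 / p)) * K)"
      using K by (intro ennreal_leI mult_right_mono) (auto simp: mult_le_cancel_left1)
    finally show ?thesis .
  next
    case Triebel
    \<comment> \<open>A pointwise common bound: each weighted block is at most \<open>w j\<close>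
      times the power \<open>1 / p\<close> of \<open>V\<close>, and the integral of \<open>V\<close>
      is a sum over single blocks.\<close>
    define V where "V x = (\<Sum>j. ennreal ((u j x / w j) powr p))" for x
    have [measurable]: "V \<in> borel_measurable borel" unfolding V_def[abs_def] by measurable
    have "ennreal (u j x) \<le> ennreal (w j) * ennpow (V x) (1 / p)" for j x
    proof -
      have "ennreal (u j x / w j) = ennpow (ennreal ((u j x / w j) powr p)) (1 / p)"
        using p u0[of j x] w(1)[of j] by (simp add: ennpow_ennreal powr_powr)
      also have "\<dots> \<le> ennpow (V x) (1 / p)"
      proof (rule ennpow_mono)
        show "ennreal ((u j x / w j) powr p) \<le> V x"
          unfolding V_def by (rule ennreal_le_suminf)
      qed (use p in simp)
      finally have "ennreal (w j) * ennreal (u j x / w j) \<le> ennreal (w j) * ennpow (V x) (1 / p)" by (intro mult_left_mono) auto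
      moreover have "ennreal (w j) * ennreal (u j x / w j) = ennreal (u j x)"
        using u0[of j x] w(1)[of j] by (simp add: ennreal_mult[symmetric])
      ultimately show ?thesis by simp
    qed
    from lq_norm_le_weights[OF q this w S]
    have "lq_norm q (\<lambda>j. ennreal (u j x)) \<le> ennreal ?S * ennpow (V x) (1 / p)" for x by simp
    then have "(\<integral>\<^sup>+x. ennpow (lq_norm q (\<lambda>j. ennreal (u j x))) p \<partial>lborel) \<le> (\<integral>\<^sup>+x. ennreal (?S powr p) * V x \<partial>lborel)"
    proof (intro nn_integral_mono)
      fix x
      assume "\<And>x. lq_norm q (\<lambda>j. ennreal (u j x)) \<le> ennreal ?S * ennpow (V x) (1 / p)"
      then have "ennpow (lq_norm q (\<lambda>j. ennreal (u j x))) p \<le> ennpow (ennreal ?S * ennpow (V x) (1 / p)) p" by (intro ennpow_mono p)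
      also have "\<dots> = ennreal (?S powr p) * V x" using p S1 by (subst ennpow_cmult) (simp_all add: ennpow_ennpow)
      finally show "ennpow (lq_norm q (\<lambda>j. ennreal (u j x))) p \<le> ennreal (?S powr p) * V x" .
    qed
    also have "\<dots> = ennreal (?S powr p) * (\<integral>\<^sup>+x. V x \<partial>lborel)" by (rule nn_integral_cmult) measurable
    also have "(\<integral>\<^sup>+x. V x \<partial>lborel) = (\<Sum>j. \<integral>\<^sup>+x. ennreal ((u j x / w j) powr p) \<partial>lborel)"
      unfolding V_def by (rule nn_integral_suminf) measurable
    also have "\<dots> \<le> ennreal (K powr p * R)"
      unfolding suminf_eq_SUP
    proof (rule SUP_least)
      fix n
      have "(\<integral>\<^sup>+x. ennreal ((u j x / w j) powr p) \<partial>lborel) \<le> ennreal (K powr p * w j powr p)" for j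
      proof -
        have "(\<integral>\<^sup>+x. ennreal ((u j x / w j) powr p) \<partial>lborel) = (\<integral>\<^sup>+x. ennreal (inverse (w j) powr p) * ennreal (u j x powr p) \<partial>lborel)"
          using u0 w(1)[of j] by (intro nn_integral_cong) (simp add: ennreal_mult[symmetric] powr_mult[symmetric] divide_inverse mult.commute)
        also have "\<dots> = ennreal (inverse (w j) powr p) * (\<integral>\<^sup>+x. ennreal (u j x powr p) \<partial>lborel)"
          by (rule nn_integral_cmult) measurable
        also have "\<dots> \<le> ennreal (inverse (w j) powr p) * ennreal ((K * (w j)\<^sup>2) powr p)" by (intro mult_left_mono int) auto
        also have "\<dots> = ennreal ((inverse (w j) * (K * (w j)\<^sup>2)) powr p)"
          using w(1)[of j] K by (simp add: ennreal_mult[symmetric] powr_mult)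
        also have "inverse (w j) * (K * (w j)\<^sup>2) = K * w j" using w(1)[of j] by (simp add: power2_eq_square)
        also have "(K * w j) powr p = K powr p * w j powr p" using K w(1)[of j] by (simp add: powr_mult)
        finally show ?thesis .
      qed
      then have "(\<Sum>j<n. \<integral>\<^sup>+x. ennreal ((u j x / w j) powr p) \<partial>lborel) \<le> (\<Sum>j<n. ennreal (K powr p * w j powr p))" by (rule sum_mono)
      also have "\<dots> = ennreal (K powr p * (\<Sum>j<n. w j powr p))" by (simp add: sum_ennreal sum_distrib_left)
      also have "\<dots> \<le> ennreal (K powr p * R)" by (intro ennreal_leI mult_left_mono R) auto
      finally show "(\<Sum>j<n. \<integral>\<^sup>+x. ennreal ((u j x / w j) powr p) \<partial>lborel) \<le> ennreal (K powr p * R)" .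
    qed
    finally have "(\<integral>\<^sup>+x. ennpow (lq_norm q (\<lambda>j. ennreal (u j x))) p \<partial>lborel) \<le> ennreal (?S powr p) * ennreal (K powr p * R)"
      by (simp add: mult_left_mono)
    also have "\<dots> = ennreal (?S powr p * (K powr p * R))" using R0 by (simp add: ennreal_mult)
    finally have "A_enorm \<phi>0 A s p q f \<le> ennpow (ennreal (?S powr p * (K powr p * R))) (1 / p)"
      unfolding Triebel A_enorm.simps ue Lp_norm_def using p by (intro ennpow_mono) auto
    also have "\<dots> = ennreal (?S * R powr (1 / p) * K)"
      using p R0 S1 K by (simp add: ennpow_ennreal powr_mult powr_powr mult_ac)
    also have "\<dots> \<le> ennreal (?S * max 1 (R powr (1 / p)) * K)"
      using K S1 by (intro ennreal_leI mult_right_mono mult_left_mono) auto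
    finally show ?thesis .
  qed
qed

text \<open>For small \<open>\<mu>\<close> the numerator alone suffices; for large
  \<open>\<mu>\<close> the denominator leaves at most the power \<open>- 1\<close>. Every exponent
  in between therefore works on both ranges.\<close>

lemma powr_div_power_le:
  fixes \<mu> :: real
  assumes m: "\<mu> > 0" and N: "\<tau> + 1 \<le> real N" and e: "e \<le> \<tau>" "- 1 \<le> e"
  shows "\<mu> powr \<tau> / (1 + \<mu>) ^ N \<le> \<mu> powr e"
proof (cases "\<mu> \<le> 1")
  case True
  have "\<mu> powr \<tau> / (1 + \<mu>) ^ N \<le> \<mu> powr \<tau> / 1"
    using m by (intro divide_left_mono one_le_power mult_pos_pos zero_less_power) auto
  also have "\<dots> \<le> \<mu> powr e" using True m e by (simp add: powr_mono')
  finally show ?thesis .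
next
  case False
  have "\<mu> powr \<tau> / (1 + \<mu>) ^ N \<le> \<mu> powr \<tau> / \<mu> ^ N"
    using m by (intro divide_left_mono power_mono mult_pos_pos zero_less_power) auto
  also have "\<dots> = \<mu> powr (\<tau> - real N)" using m by (simp add: powr_diff powr_realpow)
  also have "\<dots> \<le> \<mu> powr e" using False N e by (intro powr_mono) auto
  finally show ?thesis .
qed

text \<open>Because of truncated subtraction, the terms for \<open>j = 0\<close> and \<open>j = 1\<close> coincide.\<close>

definition dyadic_bump :: "real \<Rightarrow> real \<Rightarrow> nat \<Rightarrow> real" where
  "dyadic_bump \<epsilon> r j = min ((2 ^ (j - 1) / r) powr \<epsilon>) ((2 ^ (j - 1) / r) powr - \<epsilon>)"

lemma dyadic_bump_bounds:
  assumes "r > 0" "\<epsilon> > 0"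
  shows "dyadic_bump \<epsilon> r j > 0" "dyadic_bump \<epsilon> r j \<le> 1"
proof -
  let ?m = "2 ^ (j - 1) / r"
  have m: "?m > 0" using assms by simp
  then show "dyadic_bump \<epsilon> r j > 0" using assms by (simp add: dyadic_bump_def)
  show "dyadic_bump \<epsilon> r j \<le> 1"
  proof (cases "?m \<le> 1")
    case True
    then have "?m powr \<epsilon> \<le> 1 powr \<epsilon>" using m assms by (intro powr_mono2) auto
    then show ?thesis unfolding dyadic_bump_def by (intro min.coboundedI1) simp
  next
    case False
    then have "?m powr - \<epsilon> \<le> ?m powr 0" using assms by (intro powr_mono) auto
    then show ?thesis unfolding dyadic_bump_def using m assms by (intro min.coboundedI2) simp
  qed
qed

lemma dyadic_bump_sum:
  assumes e: "\<epsilon> > 0" and a: "a > 0"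
  obtains C where "C > 0" "\<And>r n. r > 0 \<Longrightarrow> (\<Sum>j<n. dyadic_bump \<epsilon> r j powr a) \<le> C"
proof -
  obtain C :: real where C: "C > 0" "\<And>r n. r > 0 \<Longrightarrow> (\<Sum>j<n. min ((2 ^ j * r) powr (\<epsilon> * a)) ((2 ^ j * r) powr - (\<epsilon> * a))) \<le> C"
    using dyadic_geometric_sum[of "\<epsilon> * a" "\<epsilon> * a"] e a by auto
  show ?thesis
  proof (rule that[of "2 * C"])
    fix r :: real and n assume r: "r > 0"
    have mp: "min x y powr a = min (x powr a) (y powr a)" if "x > 0" "y > 0" for x y :: real
      using that a powr_mono2[of a x y] powr_mono2[of a y x] by (auto simp: min_def)
    have eq: "dyadic_bump \<epsilon> r j powr a = min ((2 ^ (j - 1) * (1 / r)) powr (\<epsilon> * a)) ((2 ^ (j - 1) * (1 / r)) powr - (\<epsilon> * a))" for j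
      unfolding dyadic_bump_def using r by (subst mp) (simp_all add: powr_powr)
    show "(\<Sum>j<n. dyadic_bump \<epsilon> r j powr a) \<le> 2 * C"
    proof (cases n)
      case (Suc m)
      have "(\<Sum>j<n. dyadic_bump \<epsilon> r j powr a) = dyadic_bump \<epsilon> r 0 powr a + (\<Sum>j<m. dyadic_bump \<epsilon> r (Suc j) powr a)"
        unfolding Suc by (rule sum.lessThan_Suc_shift)
      also have "\<dots> \<le> C + C"
      proof (rule add_mono)
        show "dyadic_bump \<epsilon> r 0 powr a \<le> C" unfolding eq using C(2)[of "1 / r" 1] r by simp
        show "(\<Sum>j<m. dyadic_bump \<epsilon> r (Suc j) powr a) \<le> C" unfolding eq using C(2)[of "1 / r" m] r by simp
      qed
      finally show ?thesis by simp
    qed (use C in simp)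
  qed (use C in simp)
qed

text \<open>Integrating the pointwise decay at scale \<open>1 / t\<close>, with
  \<open>t = 2^(j-1)\<close>, costs \<open>t^(-d/p)\<close>. Altogether
  \<open>t^s * r^(-d) * t^d * t^(-d/p)\<close> equals \<open>r^(s-d/p) * \<mu>^\<tau>\<close> with
  \<open>\<mu> = t / r\<close>, and positivity of \<open>\<tau>\<close> gives decay towards low
  frequencies.\<close>

lemma gauss_blocks_Lp:
  fixes \<phi>0 :: "'a::euclidean_space \<Rightarrow> complex"
  assumes gen: "lp_generator \<phi>0" and p: "p > 0" and s: "s > 0" and \<tau>: "s + real DIM('a) - real DIM('a) / p > 0"
  obtains \<epsilon> K where "\<epsilon> > 0" "K > 0" "\<And>r j. r \<ge> 1 \<Longrightarrow>
    (\<integral>\<^sup>+x. ennreal ((2 powr (real j * s) * norm (freq_block \<phi>0 j (fun_dist (\<lambda>y. gauss (r *\<^sub>R y))) x)) powr p) \<partial>lborel)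
      \<le> ennreal ((K * r powr (s - real DIM('a) / p) * (dyadic_bump \<epsilon> r j)\<^sup>2) powr p)"
proof -
  let ?d = "real DIM('a)"
  define \<tau> where "\<tau> = s + ?d - ?d / p"
  have t0: "\<tau> > 0" using \<tau> by (simp add: \<tau>_def)
  \<comment> \<open>Both \<open>2 * \<epsilon>\<close> and \<open>- 2 * \<epsilon>\<close> then lie
    between \<open>- 1\<close> and \<open>\<tau>\<close>, as required for comparison with the square
    of the bump.\<close>
  define \<epsilon> where "\<epsilon> = min \<tau> 1 / 2"
  have e: "\<epsilon> > 0" "2 * \<epsilon> \<le> \<tau>" "2 * \<epsilon> \<le> 1" using t0 by (auto simp: \<epsilon>_def)
  obtain N where N: "\<tau> + 1 \<le> real N" using real_arch_simple by blast
  \<comment> \<open>This order of spatial decay leaves at least the exponent \<open>2 d\<close>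
    after raising to the power \<open>p\<close>, which is the integrable weight.\<close>
  obtain k where k: "2 * ?d / p \<le> real k" using real_arch_simple by blast
  then have kp: "2 * ?d \<le> real k * p" using p by (simp add: pos_divide_le_eq)
  obtain C where C: "C > 0" "\<And>r j x. r \<ge> 1 \<Longrightarrow>
    norm (freq_block \<phi>0 j (fun_dist (\<lambda>y. gauss (r *\<^sub>R y))) x)
      \<le> C * r powr - ?d * (2 ^ (j - 1)) ^ DIM('a) / ((1 + 2 ^ (j - 1) / r) ^ N * (1 + 2 ^ (j - 1) * norm (x::'a)) ^ k)"
    using gauss_blocks_pointwise[OF gen, of N k] by blast
  define W where "W = 1 + (LINT y|lborel. weight (y :: 'a))"
  have "(LINT y|lborel. weight (y :: 'a)) \<ge> 0" by (rule integral_nonneg_AE) simp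
  then have W: "W \<ge> 1" "(LINT y|lborel. weight (y :: 'a)) \<le> W" by (auto simp: W_def)
  define K where "K = 2 powr s * C * W powr (1 / p)"
  have K: "K > 0" using C(1) W by (simp add: K_def)
  show ?thesis
  proof (rule that[OF e(1) K])
    fix r :: real and j :: nat assume r: "r \<ge> 1"
    define t :: real where "t = 2 ^ (j - 1)"
    have t: "t > 0" by (simp add: t_def)
    define \<mu> where "\<mu> = t / r"
    have m: "\<mu> > 0" using t r by (simp add: \<mu>_def)
    define B where "B = 2 powr (real j * s) * (C * r powr - ?d * t ^ DIM('a) / (1 + \<mu>) ^ N)"
    have B: "B \<ge> 0" using C(1) t m by (simp add: B_def)
    have pt: "(2 powr (real j * s) * norm (freq_block \<phi>0 j (fun_dist (\<lambda>y. gauss (r *\<^sub>R y))) x)) powr p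
      \<le> (B powr p * t powr - ?d) * (t ^ DIM('a) * weight (t *\<^sub>R x))" for x :: 'a
    proof -
      have p1: "1 + t * norm x \<ge> 1" using t by simp
      have "2 powr (real j * s) * norm (freq_block \<phi>0 j (fun_dist (\<lambda>y. gauss (r *\<^sub>R y))) x) \<le> B * (1 + t * norm x) powr - real k"
      proof -
        have "2 powr (real j * s) * norm (freq_block \<phi>0 j (fun_dist (\<lambda>y. gauss (r *\<^sub>R y))) x)
          \<le> 2 powr (real j * s) * (C * r powr - ?d * t ^ DIM('a) / ((1 + \<mu>) ^ N * (1 + t * norm x) ^ k))"
          unfolding t_def \<mu>_def by (intro mult_left_mono C(2) r) auto
        also have "\<dots> = B * (1 + t * norm x) powr - real k"
        proof -
          have "(1 + t * norm x) powr - real k = 1 / (1 + t * norm x) ^ k" using p1 by (simp add: powr_minus powr_realpow divide_inverse)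
          then show ?thesis by (simp add: B_def)
        qed
        finally show ?thesis .
      qed
      then have "(2 powr (real j * s) * norm (freq_block \<phi>0 j (fun_dist (\<lambda>y. gauss (r *\<^sub>R y))) x)) powr p \<le> (B * (1 + t * norm x) powr - real k) powr p"
        using p by (intro powr_mono2) auto
      also have "\<dots> = B powr p * (1 + t * norm x) powr (- (real k * p))" using B by (simp add: powr_mult powr_powr)
      also have "\<dots> \<le> B powr p * (1 + t * norm x) powr (- (2 * ?d))"
        using kp p1 by (intro mult_left_mono powr_mono) auto
      also have "(1 + t * norm x) powr (- (2 * ?d)) = weight (t *\<^sub>R x)"
      proof -
        have "(1 + t * norm x) powr (2 * ?d) = (1 + t * norm x) powr real (2 * DIM('a))" by simp
        also have "\<dots> = (1 + t * norm x) ^ (2 * DIM('a))" using p1 by (intro powr_realpow) auto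
        finally show ?thesis using t by (simp add: weight_def powr_minus divide_inverse)
      qed
      also have "B powr p * weight (t *\<^sub>R x) = (B powr p * t powr - ?d) * (t ^ DIM('a) * weight (t *\<^sub>R x))"
        using t by (simp add: powr_minus powr_realpow)
      finally show ?thesis .
    qed
    have "(\<integral>\<^sup>+x. ennreal ((2 powr (real j * s) * norm (freq_block \<phi>0 j (fun_dist (\<lambda>y. gauss (r *\<^sub>R y))) x)) powr p) \<partial>lborel)
      \<le> (\<integral>\<^sup>+x. ennreal (B powr p * t powr - ?d) * ennreal (t ^ DIM('a) * weight (t *\<^sub>R (x - (0::'a)))) \<partial>lborel)"
      using pt t by (intro nn_integral_mono) (simp add: ennreal_mult[symmetric])
    also have "\<dots> = ennreal (B powr p * t powr - ?d) * (\<integral>\<^sup>+x. ennreal (t ^ DIM('a) * weight (t *\<^sub>R (x - (0::'a)))) \<partial>lborel)"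
      by (rule nn_integral_cmult) measurable
    also have "\<dots> = ennreal (B powr p * t powr - ?d) * ennreal (LINT y|lborel. weight (y :: 'a))"
      unfolding nn_integral_weight_scale[OF t] ..
    also have "\<dots> \<le> ennreal (B powr p * t powr - ?d) * ennreal W" using W by (intro mult_left_mono ennreal_leI) auto
    also have "\<dots> = ennreal ((B * t powr - (?d / p) * W powr (1 / p)) powr p)"
      using p W B t by (simp add: ennreal_mult[symmetric] powr_mult powr_powr)
    also have "\<dots> \<le> ennreal ((K * r powr (s - ?d / p) * (dyadic_bump \<epsilon> r j)\<^sup>2) powr p)"
    proof (intro ennreal_leI powr_mono2)
      \<comment> \<open>The shift between \<open>2^j\<close> and \<open>t = 2^(j-1)\<close> costs
        \<open>2 powr s\<close>; for \<open>j = 0\<close> both are 1 and the bound uses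
        \<open>s > 0\<close>.\<close>
      have js: "2 powr (real j * s) \<le> 2 powr s * t powr s"
      proof (cases j)
        case 0
        then show ?thesis using s by (simp add: t_def ge_one_powr_ge_zero)
      next
        case (Suc i)
        have "t powr s = 2 powr (real i * s)" by (simp add: t_def Suc powr_realpow[symmetric] powr_powr)
        then show ?thesis by (simp add: Suc powr_add[symmetric] algebra_simps)
      qed
      have bump: "\<mu> powr \<tau> / (1 + \<mu>) ^ N \<le> (dyadic_bump \<epsilon> r j)\<^sup>2"
      proof -
        have sq: "(\<mu> powr a)\<^sup>2 = \<mu> powr (2 * a)" for a by (simp add: power2_eq_square powr_add[symmetric])
        have "\<mu> powr \<tau> / (1 + \<mu>) ^ N \<le> (\<mu> powr \<epsilon>)\<^sup>2" "\<mu> powr \<tau> / (1 + \<mu>) ^ N \<le> (\<mu> powr - \<epsilon>)\<^sup>2"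
          unfolding sq using e t0 by (auto intro!: powr_div_power_le[OF m N])
        then show ?thesis by (simp add: dyadic_bump_def \<mu>_def t_def min_def)
      qed
      have "B * t powr - (?d / p) * W powr (1 / p) \<le> (2 powr s * t powr s) * (C * r powr - ?d * t ^ DIM('a) / (1 + \<mu>) ^ N) * t powr - (?d / p) * W powr (1 / p)"
        unfolding B_def using C(1) t m by (intro mult_right_mono js) auto
      also have "\<dots> = K * (r powr - ?d * (t powr s * t powr ?d * t powr - (?d / p)) / (1 + \<mu>) ^ N)"
        using t by (simp add: K_def powr_realpow mult_ac)
      also have "t powr s * t powr ?d * t powr - (?d / p) = t powr \<tau>"
        by (simp add: powr_add[symmetric] \<tau>_def)
      also have "r powr - ?d * t powr \<tau> / (1 + \<mu>) ^ N = r powr (s - ?d / p) * (\<mu> powr \<tau> / (1 + \<mu>) ^ N)"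
      proof -
        have "t powr \<tau> = r powr \<tau> * \<mu> powr \<tau>" using t r by (simp add: \<mu>_def powr_mult[symmetric])
        moreover have "r powr - ?d * r powr \<tau> = r powr (s - ?d / p)" by (simp add: powr_add[symmetric] \<tau>_def)
        ultimately show ?thesis by (simp add: mult.assoc[symmetric])
      qed
      also have "K * (r powr (s - ?d / p) * (\<mu> powr \<tau> / (1 + \<mu>) ^ N)) \<le> K * (r powr (s - ?d / p) * (dyadic_bump \<epsilon> r j)\<^sup>2)"
        using K by (intro mult_left_mono bump) auto
      finally show "B * t powr - (?d / p) * W powr (1 / p) \<le> K * r powr (s - ?d / p) * (dyadic_bump \<epsilon> r j)\<^sup>2"
        by (simp only: mult.assoc)
    qed (use p B in auto)
    finally show "(\<integral>\<^sup>+x. ennreal ((2 powr (real j * s) * norm (freq_block \<phi>0 j (fun_dist (\<lambda>y. gauss (r *\<^sub>R y))) x)) powr p) \<partial>lborel)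
      \<le> ennreal ((K * r powr (s - ?d / p) * (dyadic_bump \<epsilon> r j)\<^sup>2) powr p)" .
  qed
qed

lemma freq_block_fun_dist_measurable:
  assumes "lp_generator \<phi>0" "g \<in> schwartz"
  shows "freq_block \<phi>0 j (fun_dist g) \<in> borel_measurable borel"
  unfolding freq_block_fun_dist[OF assms]
  by (intro schwartz_measurable schwartz_inv_fourier schwartz_mult schwartz_dyadic schwartz_fourier assms)

lemma gauss_dilate_schwartz: "r > 0 \<Longrightarrow> (\<lambda>y. gauss (r *\<^sub>R y)) \<in> schwartz"
  by (rule schwartz_dilate[OF schwartz_gauss])

lemma A_enorm_gauss_dilate:
  fixes \<phi>0 :: "'a::euclidean_space \<Rightarrow> complex"
  assumes gen: "lp_generator \<phi>0" and p: "p > 0" and q: "q > 0" and s: "sigma_p p DIM('a) < s"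
  obtains K where "K > 0" "\<And>r. r \<ge> 1 \<Longrightarrow>
    A_enorm \<phi>0 A s p q (fun_dist (\<lambda>y. gauss (r *\<^sub>R y))) \<le> ennreal (K * r powr (s - real DIM('a) / p))"
proof -
  let ?d = "real DIM('a)"
  \<comment> \<open>The two arguments of the maximum in \<open>sigma_p\<close> yield the two
    conditions of the block estimate, \<open>s > 0\<close> and a positive exponent
    \<open>s + d - d/p\<close>.\<close>
  have "?d * (1 / p - 1) \<le> ?d * max 0 (1 / p - 1)" "?d * 0 \<le> ?d * max 0 (1 / p - 1)" by (intro mult_left_mono; simp)+
  then have "s > 0" "s > ?d * (1 / p - 1)" using s unfolding sigma_p_def by linarith+
  then have "s > 0" "s + ?d - ?d / p > 0" by (simp_all add: algebra_simps)
  from gauss_blocks_Lp[OF gen p this] obtain \<epsilon> K where e: "\<epsilon> > 0" and K: "K > 0" and int: "\<And>r j. r \<ge> 1 \<Longrightarrow>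
    (\<integral>\<^sup>+x. ennreal ((2 powr (real j * s) * norm (freq_block \<phi>0 j (fun_dist (\<lambda>y. gauss (r *\<^sub>R y))) x)) powr p) \<partial>lborel)
      \<le> ennreal ((K * r powr (s - ?d / p) * (dyadic_bump \<epsilon> r j)\<^sup>2) powr p)" by blast
  obtain R where R: "\<And>r n. r > 0 \<Longrightarrow> (\<Sum>j<n. dyadic_bump \<epsilon> r j powr p) \<le> R" 
    by (rule dyadic_bump_sum[OF e p]) blast
  obtain S where S: "S > 0" "\<And>r n. r > 0 \<Longrightarrow> q \<noteq> \<infinity> \<Longrightarrow> (\<Sum>j<n. dyadic_bump \<epsilon> r j powr enn2real q) \<le> S"
  proof (cases "q = \<infinity>")
    case False
    then have "enn2real q > 0" using q by (simp add: enn2real_positive_iff less_top)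
    from dyadic_bump_sum[OF e this] obtain C where "C > 0" "\<And>r n. r > 0 \<Longrightarrow> (\<Sum>j<n. dyadic_bump \<epsilon> r j powr enn2real q) \<le> C" by blast
    then show ?thesis by (rule that)
  qed (use that[of 1] in auto)
  let ?M = "max 1 (S powr (1 / enn2real q)) * max 1 (R powr (1 / p))"
  show ?thesis
  proof (rule that[of "?M * K"])
    have "?M > 0" by (intro mult_pos_pos) auto
    then show "?M * K > 0" using K by simp
    fix r :: real assume r: "r \<ge> 1"
    have "A_enorm \<phi>0 A s p q (fun_dist (\<lambda>y. gauss (r *\<^sub>R y))) \<le> ennreal (?M * (K * r powr (s - ?d / p)))"
      using r K e by (intro A_enorm_le_weights[where w = "dyadic_bump \<epsilon> r"] q p int S R freq_block_fun_dist_measurable gen gauss_dilate_schwartz dyadic_bump_bounds) auto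
    then show "A_enorm \<phi>0 A s p q (fun_dist (\<lambda>y. gauss (r *\<^sub>R y))) \<le> ennreal (?M * K * r powr (s - ?d / p))" by (simp only: mult.assoc)
  qed
qed

text \<open>A vanishing quasi-norm annihilates the block of index 0 almost everywhere. But the
  Fourier transform of that block at the origin is \<open>\<phi>0 0 * fourier g 0\<close>, and
  \<open>\<phi>0 0 = 1\<close>. This permits the normalisation to quasi-norm 1.\<close>

lemma A_enorm_fun_dist_nonzero:
  fixes g :: "'a::euclidean_space \<Rightarrow> complex"
  assumes gen: "lp_generator \<phi>0" and p: "p > 0" and q: "q > 0" and g: "g \<in> schwartz" and nz: "fourier g 0 \<noteq> 0"
  shows "A_enorm \<phi>0 A s p q (fun_dist g) \<noteq> 0"
proof
  assume z: "A_enorm \<phi>0 A s p q (fun_dist g) = 0"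
  let ?f = "freq_block \<phi>0 0 (fun_dist g)"
  note [measurable] = freq_block_fun_dist_measurable[OF gen g]
  have "(\<integral>\<^sup>+x. ennreal (norm (?f x) powr p) \<partial>lborel) \<le> ennreal 0"
  proof (cases A)
    case Besov
    then have "Lp_norm p (\<lambda>x. ennreal (norm (?f x))) \<le> ennreal 0"
      using besov_block_Lp[OF q, of \<phi>0 s p "fun_dist g" 0 0] z by simp
    from Lp_norm_finiteD[OF p this] show ?thesis using p by (simp add: ennpow_ennreal)
  next
    case Triebel
    then show ?thesis using triebel_block_Lp[OF p q, of \<phi>0 s "fun_dist g" 0 0] z p by simp
  qed
  then have "(\<integral>\<^sup>+x. ennreal (norm (?f x) powr p) \<partial>lborel) = 0" by simp
  then have "AE x in lborel. ennreal (norm (?f x) powr p) = 0" by (subst (asm) nn_integral_0_iff_AE) auto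
  then have ae: "AE x in lborel. ?f x = 0" by eventually_elim simp
  let ?u = "\<lambda>\<xi>. dyadic \<phi>0 0 \<xi> * fourier g \<xi>"
  have u: "?u \<in> schwartz" by (intro schwartz_mult schwartz_dyadic gen schwartz_fourier g)
  have "?u 0 = fourier ?f 0" unfolding freq_block_fun_dist[OF gen g] fourier_inversion[OF u] ..
  also have "\<dots> = 0"
  proof -
    have "(LINT x|lborel. exp (- \<i> * of_real (x \<bullet> 0)) * ?f x) = 0"
    proof (rule integral_eq_zero_AE)
      show "AE x in lborel. exp (- \<i> * of_real (x \<bullet> 0)) * ?f x = 0" using ae by eventually_elim simp
    qed
    then show ?thesis unfolding fourier_altdef by simp
  qed
  finally show False using nz gen by (simp add: dyadic_def lp_generator_def)
qed

lemma radial_lower_bound: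
  fixes \<phi>0 :: "'a::euclidean_space \<Rightarrow> complex"
  assumes gen: "lp_generator \<phi>0" and p: "p > 0" and q: "q > 0" and s: "sigma_p p DIM('a) < s"
  shows "\<exists>c>0. \<forall>x. 0 < norm x \<and> norm x < 1 \<longrightarrow> (\<exists>f \<in> RA_space \<phi>0 A s p q. \<exists>g.
    smooth_fun g \<and> radial_fun g \<and> agrees_on UNIV f g \<and> A_norm \<phi>0 A s p q f = 1 \<and>
    norm x powr (real DIM('a) / p - s) * norm (g x) \<ge> c)"
proof -
  let ?d = "real DIM('a)"
  obtain K where K: "K > 0" "\<And>r. r \<ge> 1 \<Longrightarrow>
    A_enorm \<phi>0 A s p q (fun_dist (\<lambda>y. gauss (r *\<^sub>R y))) \<le> ennreal (K * r powr (s - real DIM('a) / p))"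
    using A_enorm_gauss_dilate[OF gen p q s] by blast
  show ?thesis
  \<comment> \<open>The numerator is the value of the dilated Gaussian at \<open>x\<close>, where
    its argument has norm 1; \<open>K\<close> bounds its quasi-norm up to the power of the
    radius.\<close>
  proof (intro exI[of _ "exp (- 1 / 2) / K"] conjI allI impI)
    show "exp (- 1 / 2) / K > 0" using K by simp
    fix x :: 'a assume x: "0 < norm x \<and> norm x < 1"
    \<comment> \<open>The width of the Gaussian is \<open>norm x\<close>; the assumption
      \<open>norm x < 1\<close> gives the dilation factor at least 1 for which the quasi-norm
      estimate holds.\<close>
    define r where "r = 1 / norm x"
    have r: "r \<ge> 1" using x by (simp add: r_def)
    define G :: "'a \<Rightarrow> complex" where "G y = gauss (r *\<^sub>R y)" for y
    have GS: "G \<in> schwartz" unfolding G_def[abs_def] using r by (intro gauss_dilate_schwartz) simp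
    have "fourier G 0 = of_real (inverse r ^ DIM('a)) * gauss (0::'a)"
      using fourier_scale[OF schwartz_measurable[OF GS], of "inverse r" 0] r by (simp add: fourier_gauss G_def)
    then have "fourier G 0 \<noteq> 0" using r by (auto simp: gauss_def)
    then have nz: "A_enorm \<phi>0 A s p q (fun_dist G) \<noteq> 0" by (rule A_enorm_fun_dist_nonzero[OF gen p q GS])
    have le: "A_enorm \<phi>0 A s p q (fun_dist G) \<le> ennreal (K * r powr (s - ?d / p))"
      unfolding G_def[abs_def] by (rule K(2)[OF r])
    define \<nu> where "\<nu> = enn2real (A_enorm \<phi>0 A s p q (fun_dist G))"
    have fin: "A_enorm \<phi>0 A s p q (fun_dist G) < \<infinity>" using le by (rule order_le_less_trans) simp
    have \<nu>: "A_enorm \<phi>0 A s p q (fun_dist G) = ennreal \<nu>" using fin by (simp add: \<nu>_def less_top)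
    have \<nu>0: "\<nu> > 0" using nz fin by (simp add: \<nu>_def enn2real_positive_iff zero_less_iff_neq_zero less_top)
    have \<nu>K: "\<nu> \<le> K * r powr (s - ?d / p)" using le K(1) by (simp add: \<nu>)
    define g where "g y = of_real (1 / \<nu>) * G y" for y
    have gS: "g \<in> schwartz" unfolding g_def[abs_def] by (rule schwartz_cmult(1)[OF GS])
    have "norm (freq_block \<phi>0 j (fun_dist g) y) = 1 / \<nu> * norm (freq_block \<phi>0 j (fun_dist G) y)" for j y
    proof -
      have "fourier g \<xi> = of_real (1 / \<nu>) * fourier G \<xi>" for \<xi> unfolding g_def[abs_def] by (rule fourier_cmult)
      then have "(\<lambda>\<xi>. dyadic \<phi>0 j \<xi> * fourier g \<xi>) = (\<lambda>\<xi>. of_real (1 / \<nu>) * (dyadic \<phi>0 j \<xi> * fourier G \<xi>))"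
        by (simp only: mult.left_commute)
      then show ?thesis unfolding freq_block_fun_dist[OF gen gS] freq_block_fun_dist[OF gen GS]
        using \<nu>0 by (simp only: inv_fourier_cmult norm_mult norm_of_real) simp
    qed
    then have "A_enorm \<phi>0 A s p q (fun_dist g) = ennreal (1 / \<nu>) * ennreal \<nu>"
      using A_enorm_cmult[OF q p, of "1 / \<nu>" \<phi>0 "fun_dist G"] freq_block_fun_dist_measurable[OF gen GS] \<nu>0 \<nu> by simp
    then have one: "A_enorm \<phi>0 A s p q (fun_dist g) = 1" using \<nu>0 by (simp add: ennreal_mult[symmetric])
    have rad: "radial_fun g"
      unfolding radial_fun_def by (auto simp: fun_eq_iff g_def G_def gauss_def orthogonal_transformation_norm)
    show "\<exists>f \<in> RA_space \<phi>0 A s p q. \<exists>g. smooth_fun g \<and> radial_fun g \<and> agrees_on UNIV f g \<and> A_norm \<phi>0 A s p q f = 1 \<and>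
      norm x powr (?d / p - s) * norm (g x) \<ge> exp (- 1 / 2) / K"
    proof (intro bexI[of _ "fun_dist g"] exI[of _ g] conjI rad fun_dist_agrees gS)
      show "smooth_fun g" using gS by (simp add: schwartz_def)
      show "A_norm \<phi>0 A s p q (fun_dist g) = 1" by (simp add: A_norm_def one)
      show "fun_dist g \<in> RA_space \<phi>0 A s p q"
        using fun_dist_tempered[OF gS] fun_dist_radial[OF gS rad] one by (simp add: RA_space_def A_space_def)
      have "norm (r *\<^sub>R x) = 1" using x by (simp add: r_def)
      then have "norm (g x) = exp (- 1 / 2) / \<nu>" using \<nu>0 by (simp add: g_def G_def gauss_def norm_mult norm_divide)
      moreover have "norm x powr (?d / p - s) = r powr (s - ?d / p)"
        using x by (simp add: r_def powr_divide powr_minus_divide[symmetric])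
      moreover have "exp (- 1 / 2) / K \<le> r powr (s - ?d / p) * (exp (- 1 / 2) / \<nu>)"
        using \<nu>K \<nu>0 K(1) by (simp add: field_simps)
      ultimately show "norm x powr (?d / p - s) * norm (g x) \<ge> exp (- 1 / 2) / K" by simp
    qed
  qed
qed

theorem theorem13:
  fixes \<phi>0 :: "real ^ 'n \<Rightarrow> complex" and A :: space_scale and s p :: real and q :: ennreal
  assumes "CARD('n) \<ge> 2" and "0 < p" and "0 < q" and "lp_generator \<phi>0"
  shows
    "(U_cond A s p q \<and> s < real CARD('n) / p \<longrightarrow>
       (\<exists>c::real. \<forall>f \<in> RA_space \<phi>0 A s p q. \<forall>x. 0 < norm x \<and> norm x \<le> 1 \<longrightarrow>
          norm x powr (real CARD('n) / p - s) * norm (cont_rep (- {0}) f x) \<le> c * A_norm \<phi>0 A s p q f))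
     \<and>
     (sigma_p p CARD('n) < s \<and> s < real CARD('n) / p \<longrightarrow>
       (\<exists>c::real. c > 0 \<and> (\<forall>x :: real ^ 'n. 0 < norm x \<and> norm x < 1 \<longrightarrow>
          (\<exists>f \<in> RA_space \<phi>0 A s p q. \<exists>g.
             smooth_fun g \<and> radial_fun g \<and> agrees_on UNIV f g \<and>
             A_norm \<phi>0 A s p q f = 1 \<and>
             norm x powr (real CARD('n) / p - s) * norm (g x) \<ge> c))))"
proof (intro conjI impI)
  assume "U_cond A s p q \<and> s < real CARD('n) / p"
  then show "\<exists>c::real. \<forall>f \<in> RA_space \<phi>0 A s p q. \<forall>x. 0 < norm x \<and> norm x \<le> 1 \<longrightarrow>
    norm x powr (real CARD('n) / p - s) * norm (cont_rep (- {0}) f x) \<le> c * A_norm \<phi>0 A s p q f"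
    using radial_upper_bound[OF assms(2-4)] by (metis zero_less_norm_iff)
next
  assume "sigma_p p CARD('n) < s \<and> s < real CARD('n) / p"
  then show "\<exists>c::real. c > 0 \<and> (\<forall>x :: real ^ 'n. 0 < norm x \<and> norm x < 1 \<longrightarrow>
    (\<exists>f \<in> RA_space \<phi>0 A s p q. \<exists>g. smooth_fun g \<and> radial_fun g \<and> agrees_on UNIV f g \<and>
      A_norm \<phi>0 A s p q f = 1 \<and> norm x powr (real CARD('n) / p - s) * norm (g x) \<ge> c))"
    using radial_lower_bound[OF assms(4,2,3), of s A] by simp
qed

end
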